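(* Let $G$ be a connected, locally finite, transitive graph with infinitely many ends. Fix a vertex $o$ of $G$, let $c_n$ be the number of self-avoiding walks of length $n$ on $G$ started at $o$, let $\mu_w=\lim_{n\to\infty}c_n^{1/n}$, and let $\mathbb{P}_n$ be the uniform measure on the self-avoiding walks $w=(w_0,\dots,w_n)$ of length $n$ with $w_0=o$. Then there exists a constant $C>0$ such that $$\mu_w^n\le c_n\le C\mu_w^n\qquad\text{for every } n\ge 1.$$ Moreover, there exist constants $c,t>0$ such that $$\mathbb{P}_n\bigl(d_G(w_0,w_n)\ge cn\bigr)\ge 1-e^{-tn}\qquad\text{for every } n\ge 1.$$
   Context: Graphs have no loops; parallel edges are allowed (only finitely many at each vertex, by local finiteness). Automorphisms are permutations of the vertices and edges preserving incidence. $G$ is transitive if its automorphism group has exactly one orbit on the vertex set. A self-avoiding walk of length $n$ is a walk with $n$ edges whose vertices are pairwise different. $d_G$ is the graph distance. An end of $G$ is an equivalence class of rays (one-way infinite paths), where two rays are equivalent if for every finite vertex set $K$ all but finitely many of their vertices lie in the same component of $G-K$. The limit defining $\mu_w$ exists by subadditivity. *)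

theory Defs
  imports "HOL-Probability.Probability"
begin

text \<open>Loopless undirected multigraphs: an edge is an abstract object with exactly two distinct
  endpoints, and different edges may have the same endpoints.\<close>

record ('v, 'e) multigraph =
  verts :: "'v set"
  edges :: "'e set"
  endpoints :: "'e \<Rightarrow> 'v set"

definition wf_multigraph :: "('v, 'e) multigraph \<Rightarrow> bool" where
  "wf_multigraph G \<longleftrightarrow>
     (\<forall>e\<in>edges G. endpoints G e \<subseteq> verts G \<and> card (endpoints G e) = 2)"

definition locally_finite_graph :: "('v, 'e) multigraph \<Rightarrow> bool" where
  "locally_finite_graph G \<longleftrightarrow> (\<forall>v\<in>verts G. finite {e \<in> edges G. v \<in> endpoints G e})"

text \<open>A walk is a pair consisting of its list of vertices and its list of edges, so walks that
  use different parallel edges are different walks.\<close>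

definition is_walk :: "('v, 'e) multigraph \<Rightarrow> 'v list \<times> 'e list \<Rightarrow> bool" where
  "is_walk G w \<longleftrightarrow> (case w of (vs, es) \<Rightarrow>
     length vs = length es + 1 \<and> set vs \<subseteq> verts G \<and> set es \<subseteq> edges G \<and>
     (\<forall>i<length es. endpoints G (es ! i) = {vs ! i, vs ! Suc i}))"

definition walks_between :: "('v, 'e) multigraph \<Rightarrow> 'v \<Rightarrow> 'v \<Rightarrow> ('v list \<times> 'e list) set" where
  "walks_between G u v = {w. is_walk G w \<and> hd (fst w) = u \<and> last (fst w) = v}"

definition connected_graph :: "('v, 'e) multigraph \<Rightarrow> bool" where
  "connected_graph G \<longleftrightarrow> (\<forall>u\<in>verts G. \<forall>v\<in>verts G. walks_between G u v \<noteq> {})"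

text \<open>Only meaningful when \<open>u\<close> and \<open>v\<close> are joined by a walk.\<close>

definition graph_dist :: "('v, 'e) multigraph \<Rightarrow> 'v \<Rightarrow> 'v \<Rightarrow> nat" where
  "graph_dist G u v = (LEAST n. \<exists>w\<in>walks_between G u v. length (snd w) = n)"

definition is_automorphism ::
  "('v, 'e) multigraph \<Rightarrow> ('v \<Rightarrow> 'v) \<Rightarrow> ('e \<Rightarrow> 'e) \<Rightarrow> bool" where
  "is_automorphism G f g \<longleftrightarrow>
     bij_betw f (verts G) (verts G) \<and> bij_betw g (edges G) (edges G) \<and>
     (\<forall>e\<in>edges G. endpoints G (g e) = f ` endpoints G e)"

definition vertex_orbit :: "('v, 'e) multigraph \<Rightarrow> 'v \<Rightarrow> 'v set" where
  "vertex_orbit G v = {f v | f g. is_automorphism G f g}"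

definition transitive_graph :: "('v, 'e) multigraph \<Rightarrow> bool" where
  "transitive_graph G \<longleftrightarrow> card (vertex_orbit G ` verts G) = 1"

definition delete_verts :: "('v, 'e) multigraph \<Rightarrow> 'v set \<Rightarrow> ('v, 'e) multigraph" where
  "delete_verts G K = \<lparr>verts = verts G - K,
     edges = {e \<in> edges G. endpoints G e \<inter> K = {}}, endpoints = endpoints G\<rparr>"

definition graph_components :: "('v, 'e) multigraph \<Rightarrow> 'v set set" where
  "graph_components G = {{v. walks_between G u v \<noteq> {}} | u. u \<in> verts G}"

definition rays :: "('v, 'e) multigraph \<Rightarrow> ((nat \<Rightarrow> 'v) \<times> (nat \<Rightarrow> 'e)) set" where
  "rays G = {(x, y). inj x \<and> range x \<subseteq> verts G \<and> range y \<subseteq> edges G \<and>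
     (\<forall>i. endpoints G (y i) = {x i, x (Suc i)})}"

definition ray_equiv ::
  "('v, 'e) multigraph \<Rightarrow> ((nat \<Rightarrow> 'v) \<times> (nat \<Rightarrow> 'e)) rel" where
  "ray_equiv G = {(r, s). r \<in> rays G \<and> s \<in> rays G \<and>
     (\<forall>K\<subseteq>verts G. finite K \<longrightarrow> (\<exists>C\<in>graph_components (delete_verts G K).
        finite (range (fst r) - C) \<and> finite (range (fst s) - C)))}"

definition graph_ends :: "('v, 'e) multigraph \<Rightarrow> ((nat \<Rightarrow> 'v) \<times> (nat \<Rightarrow> 'e)) set set" where
  "graph_ends G = rays G // ray_equiv G"

definition saws :: "('v, 'e) multigraph \<Rightarrow> 'v \<Rightarrow> nat \<Rightarrow> ('v list \<times> 'e list) set" where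
  "saws G v n = {w. is_walk G w \<and> length (snd w) = n \<and> hd (fst w) = v \<and> distinct (fst w)}"

definition saw_count :: "('v, 'e) multigraph \<Rightarrow> 'v \<Rightarrow> nat \<Rightarrow> nat" where
  "saw_count G v n = card (saws G v n)"

definition connective_constant :: "('v, 'e) multigraph \<Rightarrow> 'v \<Rightarrow> real" where
  "connective_constant G v = lim (\<lambda>n. root n (real (saw_count G v n)))"

definition saw_pmf :: "('v, 'e) multigraph \<Rightarrow> 'v \<Rightarrow> nat \<Rightarrow> ('v list \<times> 'e list) pmf" where
  "saw_pmf G v n = pmf_of_set (saws G v n)"

end

theory Submission
  imports Defs
begin

text \<open>Ballisticity follows once the weight of the walks of length \<open>n\<close> from \<open>o\<close> to \<open>x\<close> is bounded by
  \<open>K A\<^sup>d \<nu>\<^sup>n\<close> with \<open>\<nu> < \<mu>\<^sub>w\<close> and \<open>d\<close> the distance from \<open>o\<close> to \<open>x\<close>. How this bound is obtained depends on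
  the modular function \<open>\<Delta>\<close> of the automorphism group.

  If \<open>\<Delta>\<close> is not trivial, its logarithm is a height function, and by the mass transport principle the
  walks weighted by the square root of \<open>\<Delta>\<close> are reversible. Pieces descending through a slab can be
  concatenated, so their generating function is at most \<open>1\<close> below the critical point, and the tilt makes
  it decay exponentially in the height of the slab. A Hammersley-Welsh decomposition therefore bounds
  the tilted generating function up to the critical point, which forces the tilted counts to grow
  at a rate smaller than \<open>\<mu>\<^sub>w\<close>. Cutting a walk at its lowest vertex, and the part before it at its highest one,
  leaves two ascending parts, which are dominated by the tilt, and a bridge; this gives \<open>c\<^sub>n \<le> C \<mu>\<^sub>w\<^sup>n\<close>.

  If \<open>\<Delta>\<close> is trivial, some ball separates three infinite components (half-spaces). A separated subset of
  a walk has more half-spaces disjoint from it than elements, so linearly many vertices of the walk, the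
  marks, lie next to a half-space that the walk avoids. Any subset of the marks may be chosen, and at each
  chosen mark the remainder of the walk is moved into a half-space. The only ambiguity in undoing this is the
  location of the marks among the cuts of the new walk. It is paid for by a factor for every cut that survives, and
  walks with many cuts are compensated by also turning the remainder at cuts away from a fixed
  target, since turns can be located up to a bounded distance. For every pair of end points either the
  walk or its reversal admits enough turns, and thus the generating function with fixed end points gains
  a factor exponential in the length. Finally, the part after the last visit to a ball can be
  reversed and glued to another such part, so the normalised counts \<open>a\<^sub>n\<close> satisfy \<open>a\<^sub>n\<^sup>2 \<le> D a\<^sub>2\<^sub>n\<close> up to
  maxima, and since they grow subexponentially they are bounded.\<close>

section \<open>Weighted self-avoiding walks\<close>

text \<open>Parallel edges survive only as a multiplicity \<open>m\<close>: walks become lists of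
  vertices weighted by the product \<open>wt\<close>, and the vertex set is a whole type, with
  \<open>undefined\<close> as an arbitrary base vertex. A nontrivial height makes the tilted walks
  subcritical. A trivial modular function is used to exclude that all translates of a half-space
  point towards a common end, so that the remainder of a walk can be moved with its half-space
  turned away from what precedes it. The obstacle in the second case is entropy. The new walk has a
  cut at every chosen mark, but it may have many other cuts, so the marks cannot be read off at
  bounded cost. Charging \<open>s\<close> per cut turns the sum over the candidates into a geometric
  series, but it also damps original walks that already have many cuts. The optional turns, each
  worth a factor \<open>1 + cb\<close>, repay this. A turn can be located when the target lies on
  the far side of its cut; up to a term linear in the number of marks this holds for a fixed
  proportion of the cuts of the walk or of its reversal. Since reversal exchanges the end points,
  both have to be fixed.\<close>

locale tgraph =
  fixes m :: "'a \<Rightarrow> 'a \<Rightarrow> nat"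
  assumes m_sym: "m x y = m y x"
    and m_irrefl: "m x x = 0"
    and m_fin: "finite {y. m x y > 0}"
    and m_conn: "(\<lambda>x y. m x y > 0)\<^sup>*\<^sup>* x y"
    and m_trans: "\<exists>g. bij g \<and> (\<forall>x y. m (g x) (g y) = m x y) \<and> g u = v"
begin

definition adj :: "'a \<Rightarrow> 'a \<Rightarrow> bool" where "adj x y \<longleftrightarrow> m x y > 0"

lemma adj_sym: "adj x y \<longleftrightarrow> adj y x" by (simp add: adj_def m_sym)
lemma adj_irrefl [simp]: "\<not> adj x x" by (simp add: adj_def m_irrefl)
lemma finite_nb: "finite {y. adj x y}" using m_fin by (simp add: adj_def)
lemma adj_conn: "adj\<^sup>*\<^sup>* x y" using m_conn[of x y] by (simp add: adj_def[abs_def])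

text \<open>Automorphisms enter only through their action on vertices; invariance of the
  multiplicities is all that sums over weighted walks can see.\<close>

definition Gam :: "('a \<Rightarrow> 'a) set" where
  "Gam = {g. bij g \<and> (\<forall>x y. m (g x) (g y) = m x y)}"

lemma Gam_bij: "g \<in> Gam \<Longrightarrow> bij g" by (simp add: Gam_def)
lemma Gam_m: "g \<in> Gam \<Longrightarrow> m (g x) (g y) = m x y" by (simp add: Gam_def)
lemma Gam_adj: "g \<in> Gam \<Longrightarrow> adj (g x) (g y) \<longleftrightarrow> adj x y" by (simp add: adj_def Gam_m[of g])
lemma Gam_trans: "\<exists>g\<in>Gam. g u = v" using m_trans[of u v] by (auto simp: Gam_def)
lemma Gam_id: "id \<in> Gam" by (simp add: Gam_def)
lemma Gam_comp: "g \<in> Gam \<Longrightarrow> k \<in> Gam \<Longrightarrow> g \<circ> k \<in> Gam" by (auto simp: Gam_def bij_comp)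
lemma Gam_inv: assumes "g \<in> Gam" shows "inv g \<in> Gam"
proof -
  have b: "bij g" using assms by (rule Gam_bij)
  have "m (inv g x) (inv g y) = m x y" for x y
    using Gam_m[OF assms, of "inv g x" "inv g y"] b by (simp add: bij_is_surj surj_f_inv_f)
  then show ?thesis using b by (simp add: Gam_def bij_imp_bij_inv)
qed
lemma Gam_inj: "g \<in> Gam \<Longrightarrow> inj g" by (simp add: Gam_bij bij_is_inj)
lemma Gam_eq: "g \<in> Gam \<Longrightarrow> g x = g y \<longleftrightarrow> x = y" using Gam_inj by (auto dest: injD)
lemma Gam_inv_f [simp]: "g \<in> Gam \<Longrightarrow> inv g (g x) = x" by (simp add: Gam_inj)
lemma Gam_f_inv [simp]: "g \<in> Gam \<Longrightarrow> g (inv g x) = x" by (simp add: Gam_bij bij_is_surj surj_f_inv_f)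

section \<open>Graph distance and balls\<close>

definition d :: "'a \<Rightarrow> 'a \<Rightarrow> nat" where "d x y = (LEAST n. (adj ^^ n) x y)"

lemma relpow_ex: "\<exists>n. (adj ^^ n) x y" using adj_conn[of x y] by (simp add: rtranclp_power)
lemma d_pow: "(adj ^^ d x y) x y" unfolding d_def by (rule LeastI_ex[OF relpow_ex])
lemma d_le: "(adj ^^ n) x y \<Longrightarrow> d x y \<le> n" unfolding d_def by (rule Least_le)
lemma d_refl [simp]: "d x x = 0" using d_le[of 0 x x] by simp
lemma d_eq0 [simp]: "d x y = 0 \<longleftrightarrow> x = y"
  using d_pow[of x y] by (auto simp: d_refl)
lemma relpow_sym: "(adj ^^ n) x y \<Longrightarrow> (adj ^^ n) y x"
proof (induction n arbitrary: x y)
  case (Suc n)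
  then obtain w where "(adj ^^ n) x w" "adj w y" by auto
  then have "adj y w" "(adj ^^ n) w x" using Suc.IH adj_sym by auto
  then show ?case by (metis relpowp_Suc_I2)
qed simp
lemma d_sym: "d x y = d y x" using d_le d_pow relpow_sym by (metis le_antisym)
lemma d_tri: "d x z \<le> d x y + d y z"
  using d_le[of "d x y + d y z" x z] d_pow[of x y] d_pow[of y z] by (auto simp: relpowp_add)
lemma d_adj_le: "adj x y \<Longrightarrow> d x y \<le> 1" using d_le[of 1 x y] by (simp add: OO_def)
lemma d_adj: "adj x y \<Longrightarrow> d x y = 1"
  using d_adj_le[of x y] d_eq0[of x y] by (cases "x = y"; cases "d x y") auto
lemma d_1: "d x y = 1 \<Longrightarrow> adj x y" using d_pow[of x y] by (simp add: OO_def)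
lemma relpow_Gam: "g \<in> Gam \<Longrightarrow> (adj ^^ n) x y \<Longrightarrow> (adj ^^ n) (g x) (g y)"
proof (induction n arbitrary: y)
  case (Suc n)
  then obtain w where w: "(adj ^^ n) x w" "adj w y" by auto
  then have "(adj ^^ n) (g x) (g w)" "adj (g w) (g y)" using Suc Gam_adj[of g w y] by auto
  then show ?case by auto
qed simp
lemma d_Gam: assumes "g \<in> Gam" shows "d (g x) (g y) = d x y"
proof (rule le_antisym)
  show "d (g x) (g y) \<le> d x y" using relpow_Gam[OF assms d_pow] d_le by blast
  have "(adj ^^ d (g x) (g y)) (inv g (g x)) (inv g (g y))"
    by (rule relpow_Gam[OF Gam_inv[OF assms] d_pow])
  then show "d x y \<le> d (g x) (g y)" using d_le assms by auto
qed
lemma d_split: assumes "k \<le> d x y" shows "\<exists>w. d x w = k \<and> d w y = d x y - k"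
proof -
  have "(adj ^^ (k + (d x y - k))) x y" using d_pow[of x y] assms by simp
  then obtain w where w: "(adj ^^ k) x w" "(adj ^^ (d x y - k)) w y"
    by (auto simp: relpowp_add)
  have "d x w \<le> k" "d w y \<le> d x y - k" using w d_le by auto
  with d_tri[of x y w] assms show ?thesis by (intro exI[of _ w]) auto
qed

definition B :: "'a \<Rightarrow> nat \<Rightarrow> 'a set" where "B v r = {y. d v y \<le> r}"
lemma in_B [simp]: "y \<in> B v r \<longleftrightarrow> d v y \<le> r" by (simp add: B_def)
lemma finite_B: "finite (B v r)"
proof (induction r)
  case 0 then show ?case by (simp add: B_def)
next
  case (Suc r)
  have "B v (Suc r) \<subseteq> B v r \<union> (\<Union>x\<in>B v r. {y. adj x y})"
  proof
    fix y assume y: "y \<in> B v (Suc r)"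
    show "y \<in> B v r \<union> (\<Union>x\<in>B v r. {y. adj x y})"
    proof (cases "d v y \<le> r")
      case False
      then have "d v y = Suc r" using y by simp
      then obtain w where "d v w = r" "d w y = 1" using d_split[of r v y] by auto
      then show ?thesis using d_1[of w y] by auto
    qed simp
  qed
  then show ?case using Suc finite_nb by (auto intro: finite_subset)
qed
lemma B_Gam: "g \<in> Gam \<Longrightarrow> B (g v) r = g ` B v r"
proof
  assume g: "g \<in> Gam"
  show "B (g v) r \<subseteq> g ` B v r"
  proof
    fix y assume "y \<in> B (g v) r"
    then have "d v (inv g y) \<le> r" using d_Gam[OF Gam_inv[OF g], of "g v" y] Gam_inv_f[OF g] by simp
    then show "y \<in> g ` B v r" using g by (intro image_eqI[of _ _ "inv g y"]) auto
  qed
  show "g ` B v r \<subseteq> B (g v) r" using d_Gam[OF g] by auto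
qed
definition NB :: "nat \<Rightarrow> nat" where "NB r = card (B undefined r)"
lemma card_B: "card (B v r) = NB r"
proof -
  obtain g where g: "g \<in> Gam" "g undefined = v" using Gam_trans by blast
  have "card (g ` B undefined r) = card (B undefined r)"
    by (rule card_image) (use g Gam_inj in \<open>auto intro: inj_on_subset\<close>)
  then show ?thesis using B_Gam[OF g(1), of undefined r] g by (simp add: NB_def)
qed
lemma NB_pos: "NB r > 0"
proof -
  have "undefined \<in> B undefined r" by simp
  then show ?thesis unfolding NB_def using finite_B[of undefined r] card_gt_0_iff by blast
qed
lemma card_le_NB: "A \<subseteq> B v r \<Longrightarrow> card A \<le> NB r"
  using card_mono[OF finite_B, of A v r] card_B by simp

section \<open>Self-avoiding vertex lists and their weights\<close>

abbreviation "apath \<equiv> successively adj"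
definition saw :: "'a list \<Rightarrow> bool" where "saw xs \<longleftrightarrow> xs \<noteq> [] \<and> distinct xs \<and> apath xs"

lemma path_map: "g \<in> Gam \<Longrightarrow> apath (map g xs) \<longleftrightarrow> apath xs"
  using Gam_adj[of g] by (simp add: successively_map)
lemma saw_map: "g \<in> Gam \<Longrightarrow> saw (map g xs) \<longleftrightarrow> saw xs"
  using Gam_inj[of g] by (auto simp: saw_def path_map distinct_map intro: inj_on_subset)
lemma path_rev: "apath (rev xs) \<longleftrightarrow> apath xs"
proof -
  have "(\<lambda>x y. adj y x) = adj" using adj_sym by blast
  then show ?thesis by (metis successively_rev)
qed
lemma saw_rev [simp]: "saw (rev xs) \<longleftrightarrow> saw xs" by (auto simp: saw_def path_rev simp del: successively_rev)

text \<open>The number of ways to lift a list of vertices to a walk with edges; see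
  \<open>edge_lists\<close>.\<close>

fun wt :: "'a list \<Rightarrow> real" where
  "wt (x # y # zs) = real (m x y) * wt (y # zs)"
| "wt _ = 1"

lemma wt_append: "xs \<noteq> [] \<Longrightarrow> ys \<noteq> [] \<Longrightarrow> wt (xs @ ys) = wt xs * m (last xs) (hd ys) * wt ys"
proof (induction xs rule: wt.induct)
  case (1 x y zs) then show ?case by auto
next
  case ("2_2" v) then show ?case by (cases ys) auto
qed auto
lemma wt_map [simp]: "g \<in> Gam \<Longrightarrow> wt (map g xs) = wt xs"
  by (induction xs rule: wt.induct) (auto simp: Gam_m[of g])
lemma wt_rev [simp]: "wt (rev xs) = wt xs"
proof (induction xs rule: wt.induct)
  case (1 x y zs)
  have "wt (rev (x # y # zs)) = wt (rev (y # zs) @ [x])" by simp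
  also have "\<dots> = wt (rev (y # zs)) * m y x * wt [x]"
    by (subst wt_append) (auto simp: last_rev)
  finally show ?case using 1 m_sym[of x y] by simp
qed auto
lemma wt_nonneg [simp]: "wt xs \<ge> 0" by (induction xs rule: wt.induct) auto
lemma wt_ge1: "apath xs \<Longrightarrow> wt xs \<ge> 1"
proof (induction xs rule: wt.induct)
  case (1 x y zs)
  then have "real (m x y) \<ge> 1" "wt (y # zs) \<ge> 1" by (auto simp: adj_def)
  then show ?case using mult_mono[of 1 "real (m x y)" 1 "wt (y # zs)"] by simp
qed auto

definition SW :: "'a \<Rightarrow> nat \<Rightarrow> 'a list set" where
  "SW v n = {xs. saw xs \<and> hd xs = v \<and> length xs = Suc n}"

lemma path_dist: "apath xs \<Longrightarrow> xs \<noteq> [] \<Longrightarrow> y \<in> set xs \<Longrightarrow> d (hd xs) y < length xs"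
proof (induction xs arbitrary: y rule: induct_list012)
  case (3 a b xs)
  show ?case
  proof (cases "y = a")
    case False
    then have "d b y < length (b # xs)" using 3 by auto
    moreover have "d a b = 1" using 3 d_adj by auto
    ultimately show ?thesis using d_tri[of a y b] by auto
  qed simp
qed auto
lemma SW_sub: "SW v n \<subseteq> {xs. set xs \<subseteq> B v n \<and> length xs = Suc n}"
proof
  fix xs assume x: "xs \<in> SW v n"
  have "y \<in> B v n" if "y \<in> set xs" for y
    using path_dist[of xs y] x that by (auto simp: SW_def saw_def)
  then show "xs \<in> {xs. set xs \<subseteq> B v n \<and> length xs = Suc n}" using x by (auto simp: SW_def)
qed
lemma finite_SW: "finite (SW v n)"
  using SW_sub finite_lists_length_eq[OF finite_B] by (rule finite_subset)

lemma SW_map: assumes "g \<in> Gam" shows "map g ` SW v n = SW (g v) n"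
proof
  show "map g ` SW v n \<subseteq> SW (g v) n"
    using assms by (auto simp: SW_def saw_map hd_map) (auto simp: saw_def hd_map)
  show "SW (g v) n \<subseteq> map g ` SW v n"
  proof
    fix xs assume xs: "xs \<in> SW (g v) n"
    have i: "inv g \<in> Gam" using assms by (rule Gam_inv)
    have "xs = map g (map (inv g) xs)" using assms by (simp add: map_idI)
    moreover have "map (inv g) xs \<in> SW v n"
      using xs i assms by (auto simp: SW_def saw_map) (auto simp: saw_def hd_map)
    ultimately show "xs \<in> map g ` SW v n" by blast
  qed
qed
lemma inj_map_Gam: "g \<in> Gam \<Longrightarrow> inj_on (map g) A"
  using Gam_inj by (meson inj_mapI inj_on_subset top_greatest)

lemma sum_SW_map: assumes "g \<in> Gam"
  shows "(\<Sum>xs\<in>SW (g v) n. f xs) = (\<Sum>xs\<in>SW v n. f (map g xs))"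
  by (subst SW_map[OF assms, symmetric], subst sum.reindex[OF inj_map_Gam[OF assms]]) simp

definition c :: "nat \<Rightarrow> real" where "c n = (\<Sum>xs\<in>SW undefined n. wt xs)"
lemma c_eq: "(\<Sum>xs\<in>SW v n. wt xs) = c n"
proof -
  obtain g where g: "g \<in> Gam" "g undefined = v" using Gam_trans by blast
  then show ?thesis using sum_SW_map[OF g(1), of wt undefined n] by (simp add: c_def)
qed

lemma saw_append: "saw (xs @ ys) \<longleftrightarrow> (if xs = [] then saw ys else if ys = [] then saw xs
    else saw xs \<and> saw ys \<and> set xs \<inter> set ys = {} \<and> adj (last xs) (hd ys))"
  by (auto simp: saw_def successively_append_iff)

lemma c_nonneg: "c n \<ge> 0" by (simp add: c_def sum_nonneg)

text \<open>The common form of most counting arguments below: an injective modification of walks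
  that does not decrease the weight compares two generating functions.\<close>

lemma sum_le_inj: fixes f :: "'b \<Rightarrow> real"
  assumes "finite T" "inj_on h A" "h ` A \<subseteq> T" "\<And>x. x \<in> A \<Longrightarrow> f x \<le> g (h x)" "\<And>y. y \<in> T \<Longrightarrow> g y \<ge> 0"
  shows "sum f A \<le> sum g T"
proof -
  have "sum f A \<le> (\<Sum>x\<in>A. g (h x))" using assms by (intro sum_mono) auto
  also have "\<dots> = sum g (h ` A)" using assms by (simp add: sum.reindex)
  also have "\<dots> \<le> sum g T" using assms by (intro sum_mono2) auto
  finally show ?thesis .
qed

text \<open>Both halves keep the vertex at index \<open>k\<close>, so the walk is
  \<open>xs @ tl ys\<close> and no linking edge has to be accounted for. Forgetting that the halves
  are disjoint leaves an inequality.\<close>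

lemma sum_SW_split:
  fixes f f1 f2 :: "'a list \<Rightarrow> real" and K :: real
  assumes f: "\<And>xs ys. saw xs \<Longrightarrow> saw ys \<Longrightarrow> hd ys = last xs \<Longrightarrow> hd xs = v \<Longrightarrow> length xs = Suc k \<Longrightarrow>
        length ys = Suc l \<Longrightarrow> f (xs @ tl ys) \<le> f1 xs * f2 ys"
    and f1: "\<And>xs. f1 xs \<ge> 0" and f2: "\<And>xs. f2 xs \<ge> 0"
    and K: "\<And>w. (\<Sum>ys\<in>SW w l. f2 ys) \<le> K"
  shows "(\<Sum>xs\<in>SW v (k + l). f xs) \<le> (\<Sum>xs\<in>SW v k. f1 xs) * K"
proof -
  let ?h = "\<lambda>xs. (take (Suc k) xs, drop k xs)"
  let ?S = "SIGMA xs:SW v k. SW (last xs) l"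
  have mem: "?h xs \<in> ?S" and eq: "xs = take (Suc k) xs @ tl (drop k xs)"
    and hl: "last (take (Suc k) xs) = hd (drop k xs)" if x: "xs \<in> SW v (k + l)" for xs
  proof -
    have len: "length xs = Suc (k + l)" and s: "saw xs" "hd xs = v" using x by (auto simp: SW_def)
    show eq: "xs = take (Suc k) xs @ tl (drop k xs)" 
      by (metis append_take_drop_id drop_Suc tl_drop)
    have t: "last (take (Suc k) xs) = xs ! k" using len by (simp add: take_Suc_conv_app_nth)
    have h: "hd (drop k xs) = xs ! k" using len by (simp add: hd_drop_conv_nth)
    show "last (take (Suc k) xs) = hd (drop k xs)" using t h by simp
    have "saw (take (Suc k) xs)" "saw (drop k xs)"
      using s len saw_append[of "take (Suc k) xs" "drop (Suc k) xs"] saw_append[of "take k xs" "drop k xs"]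
      by (auto split: if_splits simp: saw_def)
    then show "?h xs \<in> ?S" using len s t h by (auto simp: SW_def hd_take)
  qed
  have "(\<Sum>xs\<in>SW v (k + l). f xs) \<le> (\<Sum>p\<in>?S. f1 (fst p) * f2 (snd p))"
  proof (rule sum_le_inj[where h = ?h])
    show "finite ?S" using finite_SW by auto
    show "inj_on ?h (SW v (k + l))" by (rule inj_onI) (metis eq fst_conv snd_conv)
    show "?h ` SW v (k + l) \<subseteq> ?S" using mem by blast
    fix xs assume x: "xs \<in> SW v (k + l)"
    have "f (take (Suc k) xs @ tl (drop k xs)) \<le> f1 (take (Suc k) xs) * f2 (drop k xs)"
      by (rule f) (use mem[OF x] hl[OF x] in \<open>auto simp: SW_def\<close>)
    then show "f xs \<le> f1 (fst (?h xs)) * f2 (snd (?h xs))" using eq[OF x] by simp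
  qed (use f1 f2 in auto)
  also have "\<dots> = (\<Sum>xs\<in>SW v k. f1 xs * (\<Sum>ys\<in>SW (last xs) l. f2 ys))"
    using sum.Sigma[of "SW v k" "\<lambda>xs. SW (last xs) l" "\<lambda>xs ys. f1 xs * f2 ys"]
    by (simp add: finite_SW sum_distrib_left case_prod_unfold)
  also have "\<dots> \<le> (\<Sum>xs\<in>SW v k. f1 xs * K)"
    using K f1 by (intro sum_mono mult_left_mono) auto
  finally show ?thesis by (simp add: sum_distrib_right)
qed

lemma wt_glue: "xs \<noteq> [] \<Longrightarrow> ys \<noteq> [] \<Longrightarrow> hd ys = last xs \<Longrightarrow> wt (xs @ tl ys) = wt xs * wt ys"
proof -
  assume a: "xs \<noteq> []" "ys \<noteq> []" "hd ys = last xs"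
  then obtain y zs where ys: "ys = y # zs" by (cases ys) auto
  show ?thesis
  proof (cases zs)
    case (Cons b bs) then show ?thesis using a ys wt_append[of xs zs] by simp
  qed (use ys in simp)
qed

lemma c_submult: "c (k + l) \<le> c k * c l"
  using sum_SW_split[where f = wt and ?f1.0 = wt and ?f2.0 = wt and v = undefined and k = k and l = l and K = "c l"]
  by (auto simp: c_eq wt_glue saw_def)

end

section \<open>Submultiplicativity and ballisticity\<close>

text \<open>Fekete's lemma. That the limit is the infimum is kept in the conclusion, because it
  yields the lower bound \<open>mu ^ n \<le> c n\<close>.\<close>

lemma subadditive_limit:
  fixes f :: "nat \<Rightarrow> real"
  assumes nn: "\<And>n. f n \<ge> 0" and sub: "\<And>k l. f (k + l) \<le> f k + f l"
  shows "\<exists>L\<ge>0. (\<lambda>n. f n / real n) \<longlonglongrightarrow> L \<and> (\<forall>n\<ge>1. L * real n \<le> f n)"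
proof -
  define L where "L = (INF n\<in>{1..}. f n / real n)"
  have bdd: "bdd_below ((\<lambda>n. f n / real n) ` {1..})"
    using nn by (intro bdd_belowI[of _ 0]) auto
  have Ln: "L \<le> f n / real n" if "n \<ge> 1" for n
    unfolding L_def by (rule cINF_lower[OF bdd]) (use that in auto)
  have L0: "L \<ge> 0" unfolding L_def by (rule cINF_greatest) (use nn in auto)
  have mul: "f (q * k) \<le> real q * f k" if "q \<ge> 1" for q k
    using that
  proof (induction q rule: dec_induct)
    case (step q) then show ?case using sub[of k "q * k"] by (simp add: algebra_simps)
  qed simp
  have "(\<lambda>n. f n / real n) \<longlonglongrightarrow> L"
  proof (rule LIMSEQ_I)
    fix r :: real assume r: "r > 0"
    have "\<exists>n\<in>{1..}. f n / real n < L + r / 2"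
      using cINF_less_iff[OF _ bdd, of "L + r / 2"] r unfolding L_def by auto
    then obtain k where k: "k \<ge> 1" "f k / real k < L + r / 2" by auto
    define M where "M = (\<Sum>i<k. f i)"
    have M: "f i \<le> M" if "i < k" for i
      unfolding M_def using that nn by (intro member_le_sum) auto
    have M0: "M \<ge> 0" unfolding M_def using nn by (simp add: sum_nonneg)
    have up: "f n \<le> real n * (f k / real k) + (M + f k)" for n
    proof -
      have "f n \<le> real (n div k) * f k + M"
      proof (cases "n div k \<ge> 1")
        case True
        have "f n \<le> f (n div k * k) + f (n mod k)" using sub[of "n div k * k" "n mod k"] by simp
        then show ?thesis using mul[OF True, of k] M[of "n mod k"] k by simp
      next
        case False
        then have "n < k" using k by (simp add: not_le div_eq_0_iff)
        then show ?thesis using M[of n] nn[of k] by simp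
      qed
      moreover have "real (n div k) \<le> real n / real k" by (rule of_nat_div_le_of_nat)
      then have "real (n div k) * f k \<le> real n / real k * f k" using nn by (intro mult_right_mono)
      ultimately show ?thesis using nn[of k] by simp
    qed
    obtain N where N: "real N > 2 * (M + f k + 1) / r" using reals_Archimedean2 by blast
    show "\<exists>N. \<forall>n\<ge>N. norm (f n / real n - L) < r"
    proof (intro exI[of _ "Suc N"] allI impI)
      fix n assume n: "n \<ge> Suc N"
      have "real n > 2 * (M + f k + 1) / r" using N n by linarith
      then have "(M + f k) / real n < r / 2" using r n nn[of k] M0 by (simp add: field_simps)
      moreover have "f n / real n \<le> f k / real k + (M + f k) / real n"
        using up[of n] n by (simp add: field_simps)
      ultimately have "f n / real n < L + r" using k by linarith
      then show "norm (f n / real n - L) < r" using Ln[of n] n by simp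
    qed
  qed
  then show ?thesis using L0 Ln by (intro exI[of _ L]) (auto simp: field_simps)
qed

lemma submultiplicative_limit:
  fixes a :: "nat \<Rightarrow> real"
  assumes ge1: "\<And>n. a n \<ge> 1" and sub: "\<And>k l. a (k + l) \<le> a k * a l"
  shows "\<exists>L\<ge>1. (\<lambda>n. root n (a n)) \<longlonglongrightarrow> L \<and> (\<forall>n. L ^ n \<le> a n)"
proof -
  have pos: "a n > 0" for n using ge1[of n] by linarith
  have p1: "0 \<le> ln (a n)" for n using ge1[of n] by simp
  have p2: "ln (a (k + l)) \<le> ln (a k) + ln (a l)" for k l
  proof -
    have "ln (a (k + l)) \<le> ln (a k * a l)" using sub[of k l] pos[of "k + l"] pos[of k] pos[of l] by simp
    then show ?thesis using pos[of k] pos[of l] by (simp add: ln_mult)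
  qed
  obtain L where L: "L \<ge> 0" "(\<lambda>n. ln (a n) / real n) \<longlonglongrightarrow> L" "\<forall>n\<ge>1. L * real n \<le> ln (a n)"
    using subadditive_limit[of "\<lambda>n. ln (a n)", OF p1 p2] by auto
  have "(\<lambda>n. exp (ln (a n) / real n)) \<longlonglongrightarrow> exp L" using L(2) by (rule tendsto_exp)
  moreover have "\<forall>\<^sub>F n in sequentially. exp (ln (a n) / real n) = root n (a n)"
    using eventually_ge_at_top[of 1]
  proof eventually_elim
    case (elim n)
    then show ?case using pos[of n] by (simp add: root_powr_inverse powr_def divide_inverse mult.commute)
  qed
  ultimately have "(\<lambda>n. root n (a n)) \<longlonglongrightarrow> exp L" by (rule Lim_transform_eventually)
  moreover have "exp L ^ n \<le> a n" for n
  proof (cases "n = 0")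
    case False
    then have "exp (L * real n) \<le> exp (ln (a n))" using L(3) by simp
    then show ?thesis using pos[of n] by (simp add: exp_of_nat_mult[symmetric] mult.commute)
  qed (use ge1 in simp)
  ultimately show ?thesis using L(1) by (intro exI[of _ "exp L"]) auto
qed

text \<open>A single value below \<open>\<mu> ^ N\<close> forces a strictly smaller rate:
  \<open>\<nu>\<close> is the \<open>N\<close>-th root of the midpoint of \<open>a N\<close> and
  \<open>\<mu> ^ N\<close>, and \<open>K\<close> absorbs the residues modulo
  \<open>N\<close>.\<close>

lemma submultiplicative_growth:
  fixes a :: "nat \<Rightarrow> real"
  assumes nn: "\<And>n. a n \<ge> 0" and sub: "\<And>k l. a (k + l) \<le> a k * a l"
    and N: "a N < \<mu> ^ N" "N \<ge> 1" and mu: "\<mu> > 0"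
  shows "\<exists>\<nu> K. 0 < \<nu> \<and> \<nu> < \<mu> \<and> K > 0 \<and> (\<forall>n. a n \<le> K * \<nu> ^ n)"
proof -
  define s where "s = (a N + \<mu> ^ N) / 2"
  have s: "a N \<le> s" "s < \<mu> ^ N" "s > 0" using N nn[of N] mu by (auto simp: s_def add_nonneg_pos)
  define \<nu> where "\<nu> = root N s"
  have nu: "\<nu> > 0" "\<nu> ^ N = s" using s N(2) by (auto simp: \<nu>_def)
  have lt: "\<nu> < \<mu>" using s(2) nu mu power_less_imp_less_base[of \<nu> N \<mu>] by simp
  define K where "K = 1 + (\<Sum>i<N. a i / \<nu> ^ i)"
  have K0: "K > 0" unfolding K_def using nn nu by (intro add_pos_nonneg sum_nonneg) auto
  have Ki: "a i \<le> K * \<nu> ^ i" if "i < N" for i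
  proof -
    have "a i / \<nu> ^ i \<le> (\<Sum>i<N. a i / \<nu> ^ i)"
      using that nn nu by (intro member_le_sum) auto
    then have "a i / \<nu> ^ i \<le> K" by (simp add: K_def)
    then show ?thesis using nu by (simp add: field_simps)
  qed
  have "a n \<le> K * \<nu> ^ n" for n
  proof (induction n rule: less_induct)
    case (less n)
    show ?case
    proof (cases "n < N")
      case False
      then have "a n \<le> a N * a (n - N)" using sub[of N "n - N"] by simp
      also have "\<dots> \<le> s * (K * \<nu> ^ (n - N))"
        using less[of "n - N"] False N s nn K0 nu by (intro mult_mono) auto
      also have "\<dots> = K * \<nu> ^ (N + (n - N))" using nu(2) by (simp add: power_add)
      finally show ?thesis using False by simp
    qed (use Ki in simp)
  qed
  then show ?thesis using nu lt K0 by blast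
qed

lemma exp_decay_bound:
  fixes K \<rho> :: real
  assumes "0 < \<rho>" "\<rho> < 1" "K > 0"
  shows "\<exists>t N. t > 0 \<and> (\<forall>n\<ge>N. K * \<rho> ^ n \<le> exp (- t * real n))"
proof -
  define t where "t = - ln \<rho> / 2"
  have t: "t > 0" using assms by (simp add: t_def)
  have rho: "\<rho> = exp (- 2 * t)" using assms by (simp add: t_def)
  obtain N where N: "real N > ln K / t" using reals_Archimedean2 by blast
  have "K * \<rho> ^ n \<le> exp (- t * real n)" if "n \<ge> N" for n
  proof -
    have "real n > ln K / t" using N that by linarith
    then have "ln K \<le> t * real n" using t by (simp add: field_simps)
    then have "K \<le> exp (t * real n)" using assms(3) by (metis exp_le_cancel_iff exp_ln)
    then have "K * \<rho> ^ n \<le> exp (t * real n) * \<rho> ^ n" using assms by (intro mult_right_mono) auto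
    also have "\<dots> = exp (t * real n) * exp (real n * (- 2 * t))"
      unfolding rho by (simp only: exp_of_nat_mult)
    also have "\<dots> = exp (- t * real n)" by (simp add: exp_add[symmetric] algebra_simps)
    finally show ?thesis .
  qed
  then show ?thesis using t by blast
qed

context tgraph begin

lemma geodesic:
  "\<exists>xs. saw xs \<and> hd xs = x \<and> last xs = y \<and> length xs = Suc (d x y) \<and> (\<forall>v\<in>set xs. d x v + d v y = d x y)"
proof (induction "d x y" arbitrary: x)
  case 0
  then have "x = y" using d_eq0 by metis
  then show ?case by (intro exI[of _ "[x]"]) (auto simp: saw_def)
next
  case (Suc n)
  then obtain w where w: "d x w = 1" "d w y = n" using d_split[of 1 x y] by auto
  obtain xs where xs: "saw xs" "hd xs = w" "last xs = y" "length xs = Suc n" "\<forall>v\<in>set xs. d w v + d v y = n"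
    using Suc(1)[of w] w by auto
  have sum: "d x v + d v y = Suc n" if "v \<in> set xs" for v
  proof -
    have "d w v + d v y = n" using xs(5) that by blast
    then show ?thesis using d_tri[of x v w] d_tri[of x y v] w Suc(2) by linarith
  qed
  have "x \<notin> set xs"
  proof
    assume "x \<in> set xs"
    then have "d w x + d x y = n" using xs(5) by blast
    then show False using Suc(2) by simp
  qed
  then have "saw (x # xs)" using xs w d_1[of x w] by (cases xs) (auto simp: saw_def)
  then show ?case using xs Suc(2) sum
    by (intro exI[of _ "x # xs"]) (auto simp: saw_def)
qed

lemma NB_Suc: "NB (Suc r) \<le> NB r * NB 1"
proof -
  have "B undefined (Suc r) \<subseteq> (\<Union>x\<in>B undefined r. B x 1)"
  proof
    fix y assume y: "y \<in> B undefined (Suc r)"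
    show "y \<in> (\<Union>x\<in>B undefined r. B x 1)"
    proof (cases "d undefined y \<le> r")
      case True then show ?thesis by (intro UN_I[of y]) auto
    next
      case False
      then have "d undefined y = Suc r" using y by simp
      then obtain w where "d undefined w = r" "d w y = 1" using d_split[of r undefined y] by auto
      then show ?thesis by (intro UN_I[of w]) auto
    qed
  qed
  then have "card (B undefined (Suc r)) \<le> card (\<Union>x\<in>B undefined r. B x 1)"
    by (intro card_mono) (auto simp: finite_B)
  also have "\<dots> \<le> (\<Sum>x\<in>B undefined r. card (B x 1))" by (rule card_UN_le[OF finite_B])
  also have "\<dots> = NB r * NB 1" by (simp add: card_B)
  finally show ?thesis by (simp add: card_B)
qed
lemma NB_pow: "NB r \<le> NB 1 ^ r"
proof (induction r)
  case 0
  have "B undefined 0 = {undefined}" by auto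
  then show ?case by (simp add: NB_def)
next
  case (Suc r)
  have "NB (Suc r) \<le> NB r * NB 1" by (rule NB_Suc)
  also have "\<dots> \<le> NB 1 ^ r * NB 1" using Suc by (rule mult_right_mono) simp
  finally show ?case by (simp add: mult.commute)
qed
end

locale tgraph_inf = tgraph +
  assumes inf_UNIV: "infinite (UNIV :: 'a set)"
begin

lemma ex_far: "\<exists>y. d v y = n"
proof -
  have "\<exists>y. y \<notin> B v n" using inf_UNIV finite_B[of v n] by (metis UNIV_I ex_new_if_finite)
  then obtain y where "\<not> d v y \<le> n" by auto
  then have "n \<le> d v y" by simp
  then show ?thesis using d_split[of n v y] by blast
qed

lemma SW_ne: "SW v n \<noteq> {}"
proof -
  obtain y where "d v y = n" using ex_far by blast
  then show ?thesis using geodesic[of v y] by (auto simp: SW_def)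
qed

lemma c_ge1: "c n \<ge> 1"
proof -
  obtain xs where xs: "xs \<in> SW undefined n" using SW_ne by blast
  have "1 \<le> wt xs" using xs wt_ge1 by (auto simp: SW_def saw_def)
  also have "\<dots> \<le> c n" unfolding c_def by (rule member_le_sum[OF xs]) (auto simp: finite_SW)
  finally show ?thesis .
qed

definition mu :: real where "mu = lim (\<lambda>n. root n (c n))"

lemma mu_props: shows mu_ge1: "mu \<ge> 1" and mu_lim: "(\<lambda>n. root n (c n)) \<longlonglongrightarrow> mu" and mu_le: "mu ^ n \<le> c n"
proof -
  obtain L where L: "L \<ge> 1" "(\<lambda>n. root n (c n)) \<longlonglongrightarrow> L" "\<forall>n. L ^ n \<le> c n"
    using submultiplicative_limit[of c, OF c_ge1 c_submult] by blast
  have "mu = L" unfolding mu_def using L(2) by (rule limI)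
  then show "mu \<ge> 1" "(\<lambda>n. root n (c n)) \<longlonglongrightarrow> mu" "mu ^ n \<le> c n" using L by auto
qed
lemma mu_pos: "mu > 0" using mu_ge1 by linarith

lemma c_subexp: assumes "\<kappa> > mu" shows "\<exists>K>0. \<forall>n. c n \<le> K * \<kappa> ^ n"
proof -
  have "\<forall>\<^sub>F n in sequentially. root n (c n) < \<kappa>"
    using order_tendstoD(2)[OF mu_lim assms] .
  then obtain N where N: "\<forall>n\<ge>N. root n (c n) < \<kappa>" by (auto simp: eventually_sequentially)
  have "c (Suc N) < \<kappa> ^ Suc N"
  proof -
    have "root (Suc N) (c (Suc N)) ^ Suc N < \<kappa> ^ Suc N"
      using N[rule_format, of "Suc N"] c_nonneg by (intro power_strict_mono) auto
    moreover have "root (Suc N) (c (Suc N)) ^ Suc N = c (Suc N)"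
      using c_nonneg[of "Suc N"] by (intro real_root_pow_pos2) auto
    ultimately show ?thesis by simp
  qed
  then obtain \<nu> K where nu: "0 < \<nu>" "\<nu> < \<kappa>" "K > 0" "\<forall>n. c n \<le> K * \<nu> ^ n"
    using submultiplicative_growth[of c "Suc N" \<kappa>] c_nonneg c_submult assms mu_pos by auto
  have "c n \<le> K * \<kappa> ^ n" for n
    using nu by (meson less_imp_le mult_left_mono order_trans power_mono)
  then show ?thesis using nu by blast
qed

definition cx :: "nat \<Rightarrow> 'a \<Rightarrow> 'a \<Rightarrow> real" where
  "cx n v x = (\<Sum>xs\<in>{xs\<in>SW v n. last xs = x}. wt xs)"

text \<open>The ball of radius \<open>r\<close> has at most \<open>NB 1 ^ r\<close> vertices, so
  ending in it has weight at most of order \<open>(A * NB 1) ^ r * \<nu> ^ n\<close>. For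
  \<open>r\<close> a small multiple of \<open>n\<close> this is still exponentially below
  \<open>mu ^ n\<close>.\<close>

lemma ballistic:
  assumes nu: "0 < \<nu>" "\<nu> < mu" and A: "A \<ge> 1" and K: "K > 0"
    and bd: "\<And>n x. cx n v x \<le> K * A ^ d v x * \<nu> ^ n"
  shows "\<exists>b t. b > 0 \<and> t > 0 \<and> (\<forall>n\<ge>1. (\<Sum>xs\<in>{xs\<in>SW v n. real (d v (last xs)) < b * real n}. wt xs)
     \<le> exp (- t * real n) * c n)"
proof -
  define D where "D = A * real (NB 1) + 1"
  have D: "D > 1" using A NB_pos[of 1] by (simp add: D_def)
  have ND: "A * real (NB 1) \<le> D" by (simp add: D_def)
  \<comment> \<open>\<open>q\<close> is the square root of the gap \<open>mu / \<nu>\<close>: one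
    factor pays for the ball, through \<open>D powr b0 = q\<close>, and the other is left as the
    decay \<open>1 / q\<close>.\<close>
  define q where "q = (mu / \<nu>) powr (1/2)"
  have r1: "mu / \<nu> > 1" using nu by simp
  have q: "q > 1" "q * q = mu / \<nu>" using r1 nu mu_pos
    by (auto simp: q_def powr_add[symmetric] gr_one_powr)
  define b0 where "b0 = ln q / ln D"
  have b0: "b0 > 0" "D powr b0 = q" using q D by (auto simp: b0_def powr_def)
  have rho: "0 < 1 / q" "1 / q < 1" using q by auto
  obtain t N where t: "t > 0" "\<forall>n\<ge>N. K * (1 / q) ^ n \<le> exp (- t * real n)"
    using exp_decay_bound[OF rho K] by blast
  \<comment> \<open>The second bound takes care of \<open>n < N\<close>: there
    \<open>b * n < 1\<close>, and the event is empty because the end points of the walk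
    differ.\<close>
  define b where "b = min b0 (1 / (real N + 1))"
  have b: "b > 0" "b \<le> b0" using b0 by (auto simp: b_def)
  have "(\<Sum>xs\<in>{xs\<in>SW v n. real (d v (last xs)) < b * real n}. wt xs) \<le> exp (- t * real n) * c n"
    if n: "n \<ge> 1" for n
  proof (cases "n \<ge> N")
    case False
    have "b * real n \<le> 1 / (real N + 1) * real n" by (intro mult_right_mono) (auto simp: b_def)
    also have "\<dots> < 1" using False by (simp add: field_simps)
    finally have "b * real n < 1" .
    moreover have "d v (last xs) \<ge> 1" if "xs \<in> SW v n" for xs
    proof -
      have "hd xs \<noteq> last xs" using that n by (auto simp: SW_def saw_def hd_conv_nth last_conv_nth nth_eq_iff_index_eq)
      then have "d v (last xs) \<noteq> 0" using that by (auto simp: SW_def)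
      then show ?thesis by linarith
    qed
    ultimately have "{xs\<in>SW v n. real (d v (last xs)) < b * real n} = {}"
      by (smt (verit, best) Collect_empty_eq One_nat_def of_nat_1 of_nat_le_iff)
    then show ?thesis using c_nonneg by (simp only: sum.empty) simp
  next
    case True
    define r where "r = nat \<lfloor>b * real n\<rfloor>"
    have r: "real r \<le> b * real n" using b by (simp add: r_def)
    have inr: "d v x \<le> r" if "real (d v x) < b * real n" for x
      unfolding r_def using that by linarith
    have "(\<Sum>xs\<in>{xs\<in>SW v n. real (d v (last xs)) < b * real n}. wt xs)
        \<le> (\<Sum>xs\<in>(\<Union>x\<in>B v r. {xs\<in>SW v n. last xs = x}). wt xs)"
      using inr by (intro sum_mono2) (auto simp: finite_SW finite_B)
    also have "\<dots> = (\<Sum>x\<in>B v r. cx n v x)"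
      unfolding cx_def by (rule sum.UNION_disjoint) (auto simp: finite_SW finite_B)
    also have "\<dots> \<le> (\<Sum>x\<in>B v r. K * A ^ r * \<nu> ^ n)"
    proof (intro sum_mono order_trans[OF bd])
      fix x assume "x \<in> B v r"
      then show "K * A ^ d v x * \<nu> ^ n \<le> K * A ^ r * \<nu> ^ n"
        using A K nu by (intro mult_right_mono mult_left_mono power_increasing) auto
    qed
    also have "\<dots> = real (NB r) * A ^ r * (K * \<nu> ^ n)" by (simp add: card_B)
    also have "\<dots> \<le> real (NB 1) ^ r * A ^ r * (K * \<nu> ^ n)"
      using NB_pow[of r] A K nu
      by (intro mult_right_mono) (auto simp flip: of_nat_power)
    also have "\<dots> = (A * real (NB 1)) ^ r * (K * \<nu> ^ n)" by (simp add: power_mult_distrib mult_ac)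
    also have "\<dots> \<le> D ^ r * (K * \<nu> ^ n)"
      using ND A K nu by (intro mult_right_mono power_mono) auto
    also have "D ^ r = D powr real r" using D by (simp add: powr_realpow)
    also have "\<dots> \<le> D powr (b0 * real n)"
      using r b D mult_right_mono[of b b0 "real n"] by (intro powr_mono) auto
    also have "\<dots> = q ^ n" using b0 q D by (simp add: powr_powr[symmetric] powr_realpow)
    finally have 1: "(\<Sum>xs\<in>{xs\<in>SW v n. real (d v (last xs)) < b * real n}. wt xs) \<le> q ^ n * (K * \<nu> ^ n)"
      using K nu by (simp add: mult_right_mono)
    have "q * \<nu> = mu * (1 / q)"
      using q nu by (simp add: field_simps)
    have "q ^ n * (K * \<nu> ^ n) = K * (q * \<nu>) ^ n" by (simp add: power_mult_distrib)
    also have "\<dots> = K * (1 / q) ^ n * mu ^ n"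
      unfolding \<open>q * \<nu> = mu * (1 / q)\<close> by (simp only: power_mult_distrib mult_ac)
    also have "\<dots> \<le> exp (- t * real n) * c n"
      by (rule mult_mono) (use t(2) True mu_le[of n] mu_pos in auto)
    finally show ?thesis using 1 by linarith
  qed
  then show ?thesis using b t by blast
qed

end

section \<open>Mass transport\<close>

context tgraph begin

text \<open>Orbit of \<open>y\<close> under the stabiliser of \<open>x\<close>. It is finite because
  the stabiliser preserves the distance to \<open>x\<close>.\<close>

definition orb :: "'a \<Rightarrow> 'a \<Rightarrow> 'a set" where
  "orb x y = {g y | g. g \<in> Gam \<and> g x = x}"

lemma orbI: "g \<in> Gam \<Longrightarrow> g x = x \<Longrightarrow> g y = z \<Longrightarrow> z \<in> orb x y" by (auto simp: orb_def)
lemma orb_sub_B: "orb x y \<subseteq> B x (d x y)"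
proof
  fix z assume "z \<in> orb x y"
  then obtain g where g: "g \<in> Gam" "g x = x" "z = g y" by (auto simp: orb_def)
  then have "d x z = d (g x) (g y)" by simp
  then show "z \<in> B x (d x y)" using d_Gam[OF g(1)] by simp
qed
lemma finite_orb: "finite (orb x y)" using orb_sub_B finite_B by (rule finite_subset)
lemma orb_self: "y \<in> orb x y" by (rule orbI[OF Gam_id]) auto
lemma card_orb_pos: "card (orb x y) > 0" using finite_orb orb_self by (metis card_gt_0_iff empty_iff)

lemma orb_Gam: assumes g: "g \<in> Gam" shows "orb (g x) (g y) = g ` orb x y"
proof
  show "orb (g x) (g y) \<subseteq> g ` orb x y"
  proof
    fix z assume "z \<in> orb (g x) (g y)"
    then obtain k where k: "k \<in> Gam" "k (g x) = g x" "z = k (g y)" by (auto simp: orb_def)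
    let ?k = "inv g \<circ> (k \<circ> g)"
    have "?k \<in> Gam" using g k Gam_comp Gam_inv by auto
    moreover have "?k x = x" using k(2) Gam_inv_f[OF g] by simp
    ultimately have "?k y \<in> orb x y" by (rule orbI) (rule refl)
    moreover have "g (?k y) = z" using k(3) Gam_f_inv[OF g] by simp
    ultimately show "z \<in> g ` orb x y" by (metis image_eqI)
  qed
  show "g ` orb x y \<subseteq> orb (g x) (g y)"
  proof
    fix z assume "z \<in> g ` orb x y"
    then obtain k where k: "k \<in> Gam" "k x = x" "z = g (k y)" by (auto simp: orb_def)
    let ?k = "g \<circ> (k \<circ> inv g)"
    have "?k \<in> Gam" using g k Gam_comp Gam_inv by auto
    moreover have "?k (g x) = g x" "?k (g y) = z" using k Gam_inv_f[OF g] by auto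
    ultimately show "z \<in> orb (g x) (g y)" by (rule orbI)
  qed
qed
lemma card_orb_Gam: assumes "g \<in> Gam" shows "card (orb (g x) (g y)) = card (orb x y)"
  unfolding orb_Gam[OF assms] using Gam_inj[OF assms] by (intro card_image) (auto intro: inj_on_subset)

text \<open>The modular function of the automorphism group, in terms of stabiliser orbits instead of
  Haar measure.\<close>

definition Del :: "'a \<Rightarrow> 'a \<Rightarrow> real" where
  "Del x y = real (card (orb y x)) / real (card (orb x y))"

lemma Del_pos: "Del x y > 0" using card_orb_pos by (simp add: Del_def)
lemma Del_Gam: "g \<in> Gam \<Longrightarrow> Del (g x) (g y) = Del x y" by (simp add: Del_def card_orb_Gam)

text \<open>Mass transport: both sides count the pairs \<open>(y, y')\<close> for which some automorphism carries
  \<open>(y, x)\<close> to \<open>(x, y')\<close>, weighted by the common value of the kernel.\<close>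
lemma mass_transport:
  fixes F :: "'a \<Rightarrow> 'a \<Rightarrow> real"
  assumes F: "\<And>g u w. g \<in> Gam \<Longrightarrow> F (g u) (g w) = F u w"
  shows "(\<Sum>y\<in>B x r. F x y) = (\<Sum>y\<in>B x r. F y x * Del x y)"
proof -
  define K where "K y y' \<longleftrightarrow> (\<exists>g\<in>Gam. g x = y' \<and> g y = x)" for y y'
  have Kd: "d x y = d x y'" if K: "K y y'" for y y'
  proof -
    obtain g where "g \<in> Gam" "g x = y'" "g y = x" using K by (auto simp: K_def)
    then show ?thesis using d_Gam[of g x y] d_sym[of y' x] by simp
  qed
  have KF: "F x y = F y' x" if K: "K y y'" for y y' using K F[of _ x y] by (auto simp: K_def)
  have ex: "\<exists>y'. K y y'" for y using Gam_trans[of y x] by (auto simp: K_def)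
  have ex': "\<exists>y. K y y'" for y'
  proof -
    obtain g where g: "g \<in> Gam" "g x = y'" using Gam_trans by blast
    then have "K (inv g x) y'" using Gam_f_inv[OF g(1)] by (auto simp: K_def)
    then show ?thesis by blast
  qed
  have S1: "{y'. K y y'} = orb x y'" if K: "K y y'" for y y'
  proof -
    obtain g where g: "g \<in> Gam" "g x = y'" "g y = x" using K by (auto simp: K_def)
    show ?thesis
    proof safe
      fix z assume "K y z"
      then obtain k where k: "k \<in> Gam" "k x = z" "k y = x" by (auto simp: K_def)
      have "(k \<circ> inv g) \<in> Gam" "(k \<circ> inv g) x = x" "(k \<circ> inv g) y' = z"
        using g k Gam_comp Gam_inv Gam_inv_f[OF g(1), of x] Gam_inv_f[OF g(1), of y] by auto
      then show "z \<in> orb x y'" by (rule orbI)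
    next
      fix z assume "z \<in> orb x y'"
      then obtain k where k: "k \<in> Gam" "k x = x" "z = k y'" by (auto simp: orb_def)
      then have "(k \<circ> g) \<in> Gam" "(k \<circ> g) x = z" "(k \<circ> g) y = x" using g Gam_comp by auto
      then show "K y z" unfolding K_def by blast
    qed
  qed
  have S2: "{y. K y y'} = orb x y" if K: "K y y'" for y y'
  proof -
    obtain g where g: "g \<in> Gam" "g x = y'" "g y = x" using K by (auto simp: K_def)
    show ?thesis
    proof safe
      fix z assume "K z y'"
      then obtain k where k: "k \<in> Gam" "k x = y'" "k z = x" by (auto simp: K_def)
      have "(inv k \<circ> g) \<in> Gam" "(inv k \<circ> g) x = x" "(inv k \<circ> g) y = z"
        using g k Gam_comp Gam_inv Gam_inv_f[OF k(1), of x] Gam_inv_f[OF k(1), of z] by auto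
      then show "z \<in> orb x y" by (rule orbI)
    next
      fix z assume "z \<in> orb x y"
      then obtain k where k: "k \<in> Gam" "k x = x" "z = k y" by (auto simp: orb_def)
      have "(g \<circ> inv k) \<in> Gam" "(g \<circ> inv k) x = y'" "(g \<circ> inv k) z = x"
        using g k Gam_comp Gam_inv Gam_inv_f[OF k(1), of x] Gam_inv_f[OF k(1), of y] by auto
      then show "K z y'" unfolding K_def by blast
    qed
  qed
  have card: "card (orb x y) = card (orb y' x)" if K: "K y y'" for y y'
  proof -
    obtain g where g: "g \<in> Gam" "g x = y'" "g y = x" using K by (auto simp: K_def)
    then show ?thesis using card_orb_Gam[OF g(1), of x y] by simp
  qed
  have fin: "finite (B x r)" by (rule finite_B)
  \<comment> \<open>For fixed \<open>y\<close> the admissible \<open>y'\<close> form a single orbit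
    \<open>orb x y'\<close>, and dividing by its size makes their total equal to
    \<open>F x y\<close>.\<close>
  have one: "(\<Sum>y'\<in>B x r. if K y y' then F y' x / real (card (orb x y')) else 0) = F x y" if y: "y \<in> B x r" for y
  proof -
    obtain y0 where y0: "K y y0" using ex by blast
    have sub: "{y'. K y y'} \<subseteq> B x r" using Kd y by auto
    have cst: "F y' x / real (card (orb x y')) = F x y / real (card (orb x y0))" if "K y y'" for y'
      using KF[OF that] S1[OF that] S1[OF y0] by simp
    have "(\<Sum>y'\<in>B x r. if K y y' then F y' x / real (card (orb x y')) else 0)
        = (\<Sum>y'\<in>{y'. K y y'}. F y' x / real (card (orb x y')))"
      using sub fin by (simp add: sum.If_cases Int_absorb1)
    also have "\<dots> = (\<Sum>y'\<in>{y'. K y y'}. F x y / real (card (orb x y0)))"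
      by (rule sum.cong) (use cst in auto)
    also have "\<dots> = F x y" using S1[OF y0] card_orb_pos[of x y0] by simp
    finally show ?thesis .
  qed
  \<comment> \<open>For fixed \<open>y'\<close> the admissible \<open>y\<close> form an orbit
    \<open>orb x y\<close>, of the same size as \<open>orb y' x\<close>; the quotient of sizes that
    remains is the modular factor.\<close>
  have two: "(\<Sum>y\<in>B x r. if K y y' then F y' x / real (card (orb x y')) else 0) = F y' x * Del x y'"
    if y': "y' \<in> B x r" for y'
  proof -
    obtain y0 where y0: "K y0 y'" using ex' by blast
    have sub: "{y. K y y'} \<subseteq> B x r" using Kd y' by fastforce
    have "(\<Sum>y\<in>B x r. if K y y' then F y' x / real (card (orb x y')) else 0)
        = (\<Sum>y\<in>{y. K y y'}. F y' x / real (card (orb x y')))"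
      using sub fin by (simp add: sum.If_cases Int_absorb1)
    also have "\<dots> = real (card (orb y' x)) * (F y' x / real (card (orb x y')))"
      using S2[OF y0] card[OF y0] by simp
    finally show ?thesis by (simp add: Del_def)
  qed
  have "(\<Sum>y\<in>B x r. F x y) = (\<Sum>y\<in>B x r. \<Sum>y'\<in>B x r. if K y y' then F y' x / real (card (orb x y')) else 0)"
    using one by simp
  also have "\<dots> = (\<Sum>y'\<in>B x r. \<Sum>y\<in>B x r. if K y y' then F y' x / real (card (orb x y')) else 0)"
    by (rule sum.swap)
  also have "\<dots> = (\<Sum>y\<in>B x r. F y x * Del x y)" using two by simp
  finally show ?thesis .
qed

section \<open>The cocycle identity for the modular function\<close>

definition orb3 :: "'a \<Rightarrow> 'a \<Rightarrow> 'a \<Rightarrow> 'a \<Rightarrow> ('a \<times> 'a \<times> 'a) set" where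
  "orb3 u x y z = {(g x, g y, g z) | g. g \<in> Gam \<and> g u = u}"

definition orb2 :: "'a \<Rightarrow> 'a \<Rightarrow> 'a \<Rightarrow> 'a set" where
  "orb2 x y z = {g z | g. g \<in> Gam \<and> g x = x \<and> g y = y}"

lemma orb2_commute: "orb2 x y z = orb2 y x z" by (auto simp: orb2_def)

text \<open>Orbit-stabiliser for pairs: the orbit of \<open>(y, z)\<close> under the stabiliser of
  \<open>x\<close> fibres over \<open>orb x y\<close>, and each fibre is a translate of the orbit of
  \<open>z\<close> under the stabiliser of both \<open>x\<close> and \<open>y\<close>. The bijection
  \<open>f\<close> only adapts the shape of the tuples.\<close>

lemma card_orb3_gen:
  assumes sel: "bij_betw f {(y', z'). \<exists>g\<in>Gam. g x = x \<and> y' = g y \<and> z' = g z} T"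
  shows "card T = card (orb x y) * card (orb2 x y z)"
proof -
  let ?P = "{(y', z'). \<exists>g\<in>Gam. g x = x \<and> y' = g y \<and> z' = g z}"
  define G where "G y' = (SOME g. g \<in> Gam \<and> g x = x \<and> g y = y')" for y'
  have G: "G y' \<in> Gam \<and> G y' x = x \<and> G y' y = y'" if "y' \<in> orb x y" for y'
  proof -
    have "\<exists>g. g \<in> Gam \<and> g x = x \<and> g y = y'" using that by (auto simp: orb_def)
    then show ?thesis unfolding G_def by (rule someI_ex)
  qed
  have "bij_betw (\<lambda>(y', w). (y', G y' w)) (orb x y \<times> orb2 x y z) ?P"
  proof (rule bij_betwI')
    fix p q assume p: "p \<in> orb x y \<times> orb2 x y z" and q: "q \<in> orb x y \<times> orb2 x y z"
    show "((case p of (y', w) \<Rightarrow> (y', G y' w)) = (case q of (y', w) \<Rightarrow> (y', G y' w))) = (p = q)"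
      using p q G Gam_eq by (auto split: prod.splits)
  next
    fix p assume "p \<in> orb x y \<times> orb2 x y z"
    then obtain y' w k where p: "p = (y', w)" "y' \<in> orb x y" "k \<in> Gam" "k x = x" "k y = y" "w = k z"
      by (auto simp: orb2_def)
    let ?g = "G y' \<circ> k"
    have "?g \<in> Gam" "?g x = x" "?g y = y'" "?g z = G y' w" using p G[OF p(2)] Gam_comp by auto
    then have "\<exists>g\<in>Gam. g x = x \<and> y' = g y \<and> G y' w = g z" by metis
    then show "(case p of (y', w) \<Rightarrow> (y', G y' w)) \<in> ?P" using p(1) by simp
  next
    fix q assume "q \<in> ?P"
    then obtain g where g: "g \<in> Gam" "g x = x" "q = (g y, g z)" by auto
    have o: "g y \<in> orb x y" using g by (auto simp: orb_def)
    let ?k = "inv (G (g y)) \<circ> g"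
    have Gg: "G (g y) \<in> Gam" "G (g y) x = x" "G (g y) y = g y" using G[OF o] by auto
    have "?k \<in> Gam" using Gg g Gam_comp Gam_inv by auto
    moreover have "?k x = x" using Gam_inv_f[OF Gg(1), of x] Gg g by simp
    moreover have "?k y = y" using Gam_inv_f[OF Gg(1), of y] Gg g by simp
    ultimately have "?k z \<in> orb2 x y z" unfolding orb2_def by blast
    moreover have "G (g y) (?k z) = g z" using Gam_f_inv[OF Gg(1)] by simp
    ultimately show "\<exists>p\<in>orb x y \<times> orb2 x y z. q = (case p of (y', w) \<Rightarrow> (y', G y' w))"
      using g o by (intro bexI[of _ "(g y, ?k z)"]) auto
  qed
  then have "card (orb x y \<times> orb2 x y z) = card ?P" by (rule bij_betw_same_card)
  also have "\<dots> = card T" using sel by (rule bij_betw_same_card)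
  finally show ?thesis by (simp add: card_cartesian_product)
qed

lemma card_orb3_1: "card (orb3 x x y z) = card (orb x y) * card (orb2 x y z)"
proof (rule card_orb3_gen[where f = "\<lambda>(y', z'). (x, y', z')"])
  have "orb3 x x y z = (\<lambda>(y', z'). (x, y', z')) ` {(y', z'). \<exists>g\<in>Gam. g x = x \<and> y' = g y \<and> z' = g z}"
    unfolding orb3_def by (auto simp: image_iff) metis
  then show "bij_betw (\<lambda>(y', z'). (x, y', z')) {(y', z'). \<exists>g\<in>Gam. g x = x \<and> y' = g y \<and> z' = g z} (orb3 x x y z)"
    by (auto simp: bij_betw_def inj_on_def)
qed
lemma card_orb3_2: "card (orb3 y x y z) = card (orb y x) * card (orb2 y x z)"
proof (rule card_orb3_gen[where f = "\<lambda>(x', z'). (x', y, z')"])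
  have "orb3 y x y z = (\<lambda>(x', z'). (x', y, z')) ` {(x', z'). \<exists>g\<in>Gam. g y = y \<and> x' = g x \<and> z' = g z}"
    unfolding orb3_def by (auto simp: image_iff)
  then show "bij_betw (\<lambda>(x', z'). (x', y, z')) {(x', z'). \<exists>g\<in>Gam. g y = y \<and> x' = g x \<and> z' = g z} (orb3 y x y z)"
    by (auto simp: bij_betw_def inj_on_def)
qed

lemma orb2_pos: "card (orb2 x y z) > 0"
proof -
  have "orb2 x y z \<subseteq> orb x z" by (auto simp: orb2_def orb_def)
  then have "finite (orb2 x y z)" using finite_orb by (rule finite_subset)
  moreover have "z \<in> orb2 x y z" unfolding orb2_def using Gam_id by (intro CollectI exI[of _ id]) simp
  ultimately show ?thesis by (metis card_gt_0_iff empty_iff)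
qed

text \<open>The common factor from \<open>orb2\<close> cancels. Now \<open>Del x y\<close> compares
  the orbits of one and the same triple under two stabilisers, and the cocycle identity
  telescopes.\<close>

lemma Del_orb3: "Del x y = real (card (orb3 y x y z)) / real (card (orb3 x x y z))"
  unfolding card_orb3_1 card_orb3_2 Del_def orb2_commute[of y x] using orb2_pos[of x y z] by simp

lemma orb3_perm: "card (orb3 u y z x) = card (orb3 u x y z)"
proof -
  have "orb3 u y z x = (\<lambda>(a, b, c). (b, c, a)) ` orb3 u x y z"
    unfolding orb3_def by force
  then have "bij_betw (\<lambda>(a, b, c). (b, c, a)) (orb3 u x y z) (orb3 u y z x)"
    by (auto simp: bij_betw_def inj_on_def)
  then show ?thesis by (metis bij_betw_same_card)
qed
lemma orb3_swap: "card (orb3 u x z y) = card (orb3 u x y z)"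
proof -
  have "orb3 u x z y = (\<lambda>(a, b, c). (a, c, b)) ` orb3 u x y z"
    unfolding orb3_def by force
  then have "bij_betw (\<lambda>(a, b, c). (a, c, b)) (orb3 u x y z) (orb3 u x z y)"
    by (auto simp: bij_betw_def inj_on_def)
  then show ?thesis by (metis bij_betw_same_card)
qed
lemma orb3_pos: "card (orb3 x x y z) > 0" "card (orb3 y x y z) > 0"
  unfolding card_orb3_1 card_orb3_2 using orb2_pos card_orb_pos by auto

lemma Del_cocycle: "Del x y * Del y z = Del x z"
proof -
  have 1: "Del x y = card (orb3 y x y z) / card (orb3 x x y z)" by (rule Del_orb3)
  have 2: "Del y z = card (orb3 z x y z) / card (orb3 y x y z)"
    using Del_orb3[of y z x] by (simp add: orb3_perm)
  have 3: "Del x z = card (orb3 z x y z) / card (orb3 x x y z)"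
    using Del_orb3[of x z y] by (simp add: orb3_swap)
  show ?thesis unfolding 1 2 3 using orb3_pos(2)[of y x z] by simp
qed

lemma Del_self [simp]: "Del x x = 1" by (simp add: Del_def) (use card_orb_pos in fastforce)

section \<open>Half-spaces\<close>

definition con :: "'a set \<Rightarrow> 'a \<Rightarrow> 'a \<Rightarrow> bool" where
  "con K = (\<lambda>x y. adj x y \<and> x \<notin> K \<and> y \<notin> K)\<^sup>*\<^sup>*"

lemma con_refl [simp]: "con K x x" by (simp add: con_def)
lemma con_trans: "con K x y \<Longrightarrow> con K y z \<Longrightarrow> con K x z" by (simp add: con_def)
lemma con_step: "adj x y \<Longrightarrow> x \<notin> K \<Longrightarrow> y \<notin> K \<Longrightarrow> con K x y" by (auto simp: con_def)
lemma con_into: "con K x y \<Longrightarrow> adj y z \<Longrightarrow> y \<notin> K \<Longrightarrow> z \<notin> K \<Longrightarrow> con K x z"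
  using con_trans con_step by blast
lemma con_induct [consumes 1, case_names base step]:
  assumes "con K x y" "P x"
    "\<And>y z. con K x y \<Longrightarrow> adj y z \<Longrightarrow> y \<notin> K \<Longrightarrow> z \<notin> K \<Longrightarrow> P y \<Longrightarrow> P z"
  shows "P y"
  using assms(1,2) unfolding con_def
proof (induction rule: rtranclp_induct)
  case (step y z) then show ?case using assms(3)[of y z] by (auto simp: con_def)
qed
lemma con_sym: "con K x y \<Longrightarrow> con K y x"
proof (induction rule: con_induct)
  case (step y z)
  then have "con K z y" using adj_sym con_step by blast
  then show ?case using step con_trans by blast
qed simp
lemma con_mono: "K' \<subseteq> K \<Longrightarrow> con K x y \<Longrightarrow> con K' x y"
  unfolding con_def by (erule rtranclp_mono[THEN predicate2D, rotated]) auto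
lemma con_notin: "con K x y \<Longrightarrow> x \<noteq> y \<Longrightarrow> x \<notin> K \<and> y \<notin> K"
  unfolding con_def by (induction rule: rtranclp_induct) auto
lemma con_Gam: assumes g: "g \<in> Gam" shows "con (g ` K) (g x) (g y) \<longleftrightarrow> con K x y"
proof -
  have 1: "con (k ` K) (k x) (k y)" if "k \<in> Gam" "con K x y" for k K x y
    using that(2)
  proof (induction rule: con_induct)
    case (step y z)
    then show ?case using Gam_adj[OF that(1)] Gam_eq[OF that(1)]
      by (intro con_into[of "k ` K" "k x" "k y" "k z"]) (auto simp: image_iff)
  qed simp
  have "inv g ` g ` K = K" using Gam_inv_f[OF g] by (auto simp: image_iff)
  then show ?thesis using 1[OF g, of K x y] 1[OF Gam_inv[OF g], of "g ` K" "g x" "g y"] Gam_inv_f[OF g] by auto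
qed
lemma con_path: "apath xs \<Longrightarrow> xs \<noteq> [] \<Longrightarrow> set xs \<inter> K = {} \<Longrightarrow> y \<in> set xs \<Longrightarrow> con K (hd xs) y"
proof (induction xs rule: induct_list012)
  case (3 a b xs)
  then have "con K a b" by (auto intro: con_step)
  then show ?case using 3 by (auto intro: con_trans)
qed auto

text \<open>Components of the complement of the ball of radius \<open>R\<close> about \<open>v\<close>; junk (a singleton) inside the ball.\<close>
definition Cp :: "nat \<Rightarrow> 'a \<Rightarrow> 'a \<Rightarrow> 'a set" where "Cp R v x = {y. con (B v R) x y}"

lemma Cp_self [simp]: "x \<in> Cp R v x" by (simp add: Cp_def)
lemma Cp_eq: "y \<in> Cp R v x \<Longrightarrow> Cp R v y = Cp R v x"
  unfolding Cp_def using con_trans con_sym by blast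
lemma Cp_sym: "y \<in> Cp R v x \<longleftrightarrow> x \<in> Cp R v y" unfolding Cp_def using con_sym by blast
lemma Cp_out: "y \<in> Cp R v x \<Longrightarrow> d v x > R \<Longrightarrow> d v y > R"
  using con_notin[of "B v R" x y] by (cases "x = y") (auto simp: Cp_def)
lemma Cp_Gam: assumes g: "g \<in> Gam" shows "Cp R (g v) (g x) = g ` Cp R v x"
proof
  show "Cp R (g v) (g x) \<subseteq> g ` Cp R v x"
  proof
    fix y assume "y \<in> Cp R (g v) (g x)"
    then have "con (g ` B v R) (g x) (g (inv g y))" by (simp add: Cp_def B_Gam[OF g] Gam_f_inv[OF g])
    then have "inv g y \<in> Cp R v x" using con_Gam[OF g] by (simp add: Cp_def)
    then show "y \<in> g ` Cp R v x" using Gam_f_inv[OF g, of y] by (metis image_eqI)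
  qed
  show "g ` Cp R v x \<subseteq> Cp R (g v) (g x)" using con_Gam[OF g] by (auto simp: Cp_def B_Gam[OF g])
qed
lemma Cp_Gam_iff: "g \<in> Gam \<Longrightarrow> g y \<in> Cp R (g v) (g x) \<longleftrightarrow> y \<in> Cp R v x"
  using Gam_eq[of g] by (auto simp: Cp_Gam[of g] image_iff)

text \<open>A geodesic from \<open>x\<close> to a point outside its component has to cross the ball.
  The metric criteria \<open>Cp_near\<close> and \<open>Cp_dist\<close> come from this.\<close>

lemma Cp_exit: assumes "y \<notin> Cp R v x" "d v x > R"
  shows "\<exists>w. d v w \<le> R \<and> d x y = d x w + d w y"
proof -
  obtain xs where xs: "saw xs" "hd xs = x" "last xs = y" "\<forall>w\<in>set xs. d x w + d w y = d x y"
    using geodesic[of x y] by blast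
  have ne: "xs \<noteq> []" "apath xs" using xs(1) by (auto simp: saw_def)
  then have yin: "y \<in> set xs" using xs(3) last_in_set by blast
  have "\<exists>w\<in>set xs. w \<in> B v R"
  proof (rule ccontr)
    assume "\<not> ?thesis"
    then have "set xs \<inter> B v R = {}" by blast
    then have "con (B v R) x y" using con_path[OF ne(2,1) _ yin] xs(2) by blast
    then show False using assms(1) by (simp add: Cp_def)
  qed
  then obtain w where "w \<in> set xs" "d v w \<le> R" by auto
  then show ?thesis using xs(4) by metis
qed
lemma Cp_near: "d x y + R < d v x \<Longrightarrow> y \<in> Cp R v x"
proof (rule ccontr)
  assume a: "d x y + R < d v x" "y \<notin> Cp R v x"
  then obtain w where w: "d v w \<le> R" "d x y = d x w + d w y" using Cp_exit[of y R v x] by auto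
  then show False using a(1) d_tri[of v x w] d_sym[of w x] by linarith
qed
lemma Cp_dist: "y \<notin> Cp R v x \<Longrightarrow> d v x > R \<Longrightarrow> d v x \<le> d x y + R"
  using Cp_near[of x y R v] by (meson not_le)

lemma hit_ball_con: assumes "d v x > R" shows "\<exists>w w'. con (B v R) x w \<and> adj w w' \<and> d v w' \<le> R"
proof (rule ccontr)
  assume no: "\<not> ?thesis"
  have "con (B v R) x u \<and> d v u > R" for u
  proof -
    have "con {} x u" using adj_conn by (simp add: con_def)
    then show ?thesis
    proof (induction rule: con_induct)
      case (step y z)
      then have "\<not> d v z \<le> R" using no by blast
      then show ?case using step con_into[of "B v R" x y z] by auto
    qed (use assms in simp)
  qed
  from this[of v] show False by simp
qed

text \<open>Disjoint balls behave like two vertices of a tree. A point cut off from \<open>y\<close>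
  by the ball about \<open>z\<close> reaches that ball without meeting the ball about
  \<open>y\<close>, so from \<open>y\<close> it is seen on the side of \<open>z\<close>. This is the
  source of the disjointness and nesting of half-spaces.\<close>

lemma cover: assumes "d y z > 2 * R" shows "x \<in> Cp R y z \<or> x \<in> Cp R z y"
proof (cases "x \<in> Cp R z y")
  case False
  have ball: "p \<in> Cp R y z" if "d z p \<le> R" for p
    by (rule Cp_near) (use that assms in linarith)
  have ball': "p \<in> Cp R z y" if "d y p \<le> R" for p
    by (rule Cp_near) (use that assms d_sym[of y z] in linarith)
  show ?thesis
  proof (cases "d z x \<le> R")
    case True then show ?thesis using ball by blast
  next
    case out: False
    then obtain w w' where w: "con (B z R) x w" "adj w w'" "d z w' \<le> R"
      using hit_ball_con[of R z x] by auto
    have nb: "p \<notin> B y R" if "con (B z R) x p" for p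
    proof
      assume "p \<in> B y R"
      then have "p \<in> Cp R z y" using ball' by simp
      moreover have "p \<in> Cp R z x" using that by (simp add: Cp_def)
      ultimately have "x \<in> Cp R z y" using Cp_eq Cp_sym by metis
      then show False using False by blast
    qed
    have "con (B y R) x w" using w(1)
    proof (induction rule: con_induct)
      case (step p q)
      have "con (B z R) x q" using con_into[OF step(1-4)] .
      then show ?case using con_into[OF step(5,2)] nb[OF step(1)] nb by blast
    qed simp
    moreover have w'b: "w' \<in> Cp R y z" using ball w by simp
    have "d y w' > R" using Cp_out[OF w'b] assms by linarith
    then have "con (B y R) w w'" using w nb[OF w(1)] by (intro con_step) auto
    ultimately have "con (B y R) w' x" using con_sym con_trans by blast
    then show ?thesis using w'b con_trans by (auto simp: Cp_def)
  qed
qed simp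

lemma Cp_disjoint: "x \<notin> Cp R v y \<Longrightarrow> Cp R v x \<inter> Cp R v y = {}"
  using Cp_eq Cp_sym by blast

lemma Cp_apart: assumes "d y z > 2 * R" "z \<notin> Cp R y a" "y \<notin> Cp R z b" shows "Cp R y a \<inter> Cp R z b = {}"
proof (rule ccontr)
  assume "\<not> ?thesis"
  then obtain x where x: "x \<in> Cp R y a" "x \<in> Cp R z b" by blast
  then show False using cover[OF assms(1), of x] assms(2,3) Cp_eq Cp_sym by metis
qed
lemma Cp_nest: assumes "d y z > 2 * R" "y \<notin> Cp R z b" "x \<in> Cp R z b" shows "x \<in> Cp R y z"
  using cover[OF assms(1), of x] assms(2,3) Cp_eq Cp_sym by metis

lemma Cp_level: assumes "infinite (Cp R v x)" "d v x > R" "k > R" shows "\<exists>y\<in>Cp R v x. d v y = k"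
proof -
  obtain y where y: "y \<in> Cp R v x" "y \<notin> B v k" using assms(1) finite_B[of v k] by (meson finite_subset subsetI)
  obtain w where w: "d v w = k" "d w y = d v y - k" using d_split[of k v y] y(2) by auto
  have "w \<in> Cp R v y"
    by (rule Cp_near) (use w d_sym[of y w] y(2) assms(3) in simp)
  then show ?thesis using w y(1) Cp_eq by metis
qed

end

section \<open>Three infinite half-spaces at every vertex\<close>

locale tgraph_ends = tgraph_inf +
  assumes three: "\<exists>K x1 x2 x3. finite K \<and> x1 \<notin> K \<and> x2 \<notin> K \<and> x3 \<notin> K \<and>
    infinite {y. con K x1 y} \<and> infinite {y. con K x2 y} \<and> infinite {y. con K x3 y} \<and>
    \<not> con K x1 x2 \<and> \<not> con K x1 x3 \<and> \<not> con K x2 x3"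
begin

text \<open>Deleting the larger finite set \<open>L\<close> breaks a component into finitely many
  pieces, since each of them contains \<open>x\<close> or a neighbour of \<open>L\<close>; so one
  piece stays infinite. This allows the separating set to be replaced by a ball.\<close>

lemma inf_con_mono: assumes "finite L" "K \<subseteq> L" "infinite {y. con K x y}"
  shows "\<exists>x'. con K x x' \<and> x' \<notin> L \<and> infinite {y. con L x' y}"
proof (rule ccontr)
  assume no: "\<not> ?thesis"
  define N where "N = (\<Union>l\<in>L. {y. adj l y}) \<inter> {y. con K x y} - L"
  have finN: "finite N" using assms(1) finite_nb by (auto simp: N_def)
  have fin: "finite {y. con L x' y}" if "x' \<in> N" for x' using no that by (auto simp: N_def)
  have "{y. con K x y} \<subseteq> L \<union> (\<Union>x'\<in>N. {y. con L x' y}) \<union> (if x \<in> L then {} else {y. con L x y})"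
  proof
    fix y assume "y \<in> {y. con K x y}"
    then have "con K x y" by simp
    then show "y \<in> L \<union> (\<Union>x'\<in>N. {y. con L x' y}) \<union> (if x \<in> L then {} else {y. con L x y})"
    proof (induction rule: con_induct)
      case (step y z)
      have cz: "con K x z" using con_into[OF step(1-4)] .
      show ?case
      proof (cases "z \<in> L")
        case zL: False
        show ?thesis
        proof (cases "y \<in> L")
          case True
          then have "z \<in> N" using step(2) cz zL by (auto simp: N_def)
          then show ?thesis by (intro UnI1 UnI2 UN_I[of z]) auto
        next
          case False
          then have yz: "con L y z" using step(2) zL by (intro con_step) auto
          show ?thesis using step(5) False con_trans[OF _ yz] by (auto split: if_splits)
        qed
      qed simp
    qed simp
  qed
  moreover have "finite (if x \<in> L then {} else {y. con L x y})" using no con_refl[of K x] by (metis finite.emptyI)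
  ultimately have "finite {y. con K x y}" using finN fin assms(1) by (auto intro: finite_subset)
  then show False using assms(3) by blast
qed

definition inf3 :: "nat \<Rightarrow> 'a \<Rightarrow> bool" where
  "inf3 R v \<longleftrightarrow> (\<exists>x1 x2 x3. d v x1 > R \<and> d v x2 > R \<and> d v x3 > R \<and> infinite (Cp R v x1) \<and> infinite (Cp R v x2)
     \<and> infinite (Cp R v x3) \<and> x2 \<notin> Cp R v x1 \<and> x3 \<notin> Cp R v x1 \<and> x3 \<notin> Cp R v x2)"

lemma ex_R: "\<exists>R. inf3 R undefined"
proof -
  obtain K x1 x2 x3 where K: "finite K" "infinite {y. con K x1 y}" "infinite {y. con K x2 y}" "infinite {y. con K x3 y}"
    "\<not> con K x1 x2" "\<not> con K x1 x3" "\<not> con K x2 x3" using three by auto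
  define R where "R = (\<Sum>x\<in>K. d undefined x)"
  have sub: "K \<subseteq> B undefined R"
    unfolding R_def using K(1) by (auto intro: member_le_sum)
  obtain y1 where y1: "con K x1 y1" "y1 \<notin> B undefined R" "infinite {y. con (B undefined R) y1 y}"
    using inf_con_mono[OF finite_B sub K(2)] by blast
  obtain y2 where y2: "con K x2 y2" "y2 \<notin> B undefined R" "infinite {y. con (B undefined R) y2 y}"
    using inf_con_mono[OF finite_B sub K(3)] by blast
  obtain y3 where y3: "con K x3 y3" "y3 \<notin> B undefined R" "infinite {y. con (B undefined R) y3 y}"
    using inf_con_mono[OF finite_B sub K(4)] by blast
  have no: "\<not> con (B undefined R) y y'" if "con K x y" "con K x' y'" "\<not> con K x x'" for x x' y y'
    using that con_mono[OF sub, of y y'] con_sym con_trans by meson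
  have "inf3 R undefined" unfolding inf3_def Cp_def
    using y1 y2 y3 no[OF y1(1) y2(1) K(5)] no[OF y1(1) y3(1) K(6)] no[OF y2(1) y3(1) K(7)]
    by (intro exI[of _ y1] exI[of _ y2] exI[of _ y3]) auto
  then show ?thesis by blast
qed

definition R :: nat where "R = (SOME R. inf3 R undefined)"
lemma inf3_R: "inf3 R v"
proof -
  have 1: "inf3 R undefined" unfolding R_def by (rule someI_ex[OF ex_R])
  obtain g where g: "g \<in> Gam" "g undefined = v" using Gam_trans by blast
  from 1 obtain x1 x2 x3 where x: "d undefined x1 > R" "d undefined x2 > R" "d undefined x3 > R"
    "infinite (Cp R undefined x1)" "infinite (Cp R undefined x2)" "infinite (Cp R undefined x3)"
    "x2 \<notin> Cp R undefined x1" "x3 \<notin> Cp R undefined x1" "x3 \<notin> Cp R undefined x2"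
    by (auto simp: inf3_def)
  have fin: "finite (g ` S) \<longleftrightarrow> finite S" for S
    using Gam_inj[OF g(1)] by (meson finite_image_iff inj_on_subset subset_UNIV)
  show ?thesis unfolding inf3_def
    by (rule exI[of _ "g x1"], rule exI[of _ "g x2"], rule exI[of _ "g x3"])
      (use x in \<open>simp add: g(2)[symmetric] d_Gam[OF g(1)] Cp_Gam[OF g(1)] Gam_eq[OF g(1)] image_iff fin\<close>)
qed

abbreviation "CP \<equiv> Cp R"

text \<open>Two given points can spoil at most two of three disjoint half-spaces. The representative
  of the remaining one is taken on the sphere of radius \<open>Suc R\<close>, so that only finitely
  many choices occur.\<close>

lemma third: "\<exists>e. d v e = Suc R \<and> infinite (CP v e) \<and> e \<notin> CP v x \<and> y \<notin> CP v e"
proof -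
  from inf3_R[of v] obtain x1 x2 x3 where x: "d v x1 > R" "d v x2 > R" "d v x3 > R"
    "infinite (CP v x1)" "infinite (CP v x2)" "infinite (CP v x3)"
    "x2 \<notin> CP v x1" "x3 \<notin> CP v x1" "x3 \<notin> CP v x2" by (auto simp: inf3_def)
  have n: "\<not> (w \<in> CP v a \<and> w \<in> CP v b)" if "b \<notin> CP v a" for w a b
    using that Cp_eq[of w R v] Cp_self by blast
  have s: "z \<in> CP v x \<longleftrightarrow> x \<in> CP v z" for z by (rule Cp_sym)
  have "\<exists>z. d v z > R \<and> infinite (CP v z) \<and> z \<notin> CP v x \<and> y \<notin> CP v z"
    unfolding s using x(1-6) n[OF x(7), of x] n[OF x(8), of x] n[OF x(9), of x]
      n[OF x(7), of y] n[OF x(8), of y] n[OF x(9), of y] by blast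
  then obtain z where z: "d v z > R" "infinite (CP v z)" "z \<notin> CP v x" "y \<notin> CP v z" by blast
  obtain e where e: "e \<in> CP v z" "d v e = Suc R" using Cp_level[OF z(2,1), of "Suc R"] by auto
  then show ?thesis using z Cp_eq[OF e(1)] Cp_eq[of e R v x] by (metis Cp_sym)
qed

end

lemma affine_lt_pow2: "\<exists>k. A + B * k < (2::nat) ^ k"
proof -
  define j where "j = A + 2 * B + 1"
  have "j + 1 \<le> 2 ^ j" by (simp add: Suc_le_eq)
  then have "(j + 1) * (j + 1) \<le> 2 ^ j * 2 ^ j" by (intro mult_mono) auto
  then have "(j + 1) * (j + 1) \<le> 2 ^ (2 * j)" by (simp add: power_add[symmetric] mult_2)
  moreover have "A + B * (2 * j) < (j + 1) * (j + 1)"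
  proof -
    have "2 * B * j \<le> j * j" by (rule mult_right_mono) (simp_all add: j_def)
    moreover have "A \<le> j" by (simp add: j_def)
    moreover have "A + B * (2 * j) = A + 2 * B * j" "(j + 1) * (j + 1) = j * j + j + (j + 1)" by simp_all
    ultimately show ?thesis by linarith
  qed
  ultimately show ?thesis by (intro exI[of _ "2 * j"]) linarith
qed

section \<open>Placing half-spaces when the modular function is trivial\<close>

locale tgraph_uni = tgraph_ends +
  assumes uni: "Del x y = 1"
begin

lemma mass_transport_uni:
  fixes F :: "'a \<Rightarrow> 'a \<Rightarrow> real"
  assumes "\<And>g u w. g \<in> Gam \<Longrightarrow> F (g u) (g w) = F u w"
  shows "(\<Sum>y\<in>B x r. F x y) = (\<Sum>y\<in>B x r. F y x)"
  using mass_transport[of F x r, OF assms] by (simp add: uni)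

lemma finite_d [simp]: "finite {a. d v a \<le> D \<and> P a}"
  by (rule finite_subset[OF _ finite_B[of v D]]) auto

text \<open>If no translate of a half-space were disjoint from it, then all half-spaces in its orbit would
  point towards a common end. A vertex would lie outside of only linearly many of those centred in
  the ball of radius \<open>D\<close>, while every half-space misses exponentially many vertices of that ball
  around its centre, contradicting the mass transport principle.\<close>
lemma back_to_back: assumes f: "d v f > R"
  shows "\<exists>g\<in>Gam. 2 * R + 2 < d v (g v) \<and> CP v f \<inter> CP (g v) (g f) = {}"
proof (rule ccontr)
  assume no: "\<not> ?thesis"
  \<comment> \<open>Carried around by automorphisms, the assumption says that any two translates of
    this half-space with distant centres intersect.\<close>
  have meet: "CP a (g f) \<inter> CP b (k f) \<noteq> {}"
    if "g \<in> Gam" "k \<in> Gam" "g v = a" "k v = b" "2 * R + 2 < d a b" for a b g k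
  proof -
    let ?h = "inv g \<circ> k"
    have h: "?h \<in> Gam" using that Gam_comp Gam_inv by auto
    have gh: "g (?h w) = k w" for w using Gam_f_inv[OF that(1)] by simp
    have "d v (?h v) = d a b" using d_Gam[OF that(1), of v "?h v"] that(3,4) gh[of v] by simp
    then have "2 * R + 2 < d v (?h v)" using that(5) by simp
    then have "CP v f \<inter> CP (?h v) (?h f) \<noteq> {}" using no h by blast
    then obtain w where w: "w \<in> CP v f" "w \<in> CP (?h v) (?h f)" by blast
    have "g w \<in> CP a (g f)" using w(1) Cp_Gam_iff[OF that(1), of w R v f] that(3) by simp
    moreover have "g w \<in> CP b (k f)"
      using w(2) Cp_Gam_iff[OF that(1), of w R "?h v" "?h f"] that(4) by (simp only: gh)
    ultimately show ?thesis by blast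
  qed
  \<comment> \<open>Here \<open>a\<close> sends mass to \<open>b\<close> when some translate centred
    at \<open>b\<close> misses \<open>a\<close>. The existential quantifier makes \<open>P\<close>
    invariant under the whole group.\<close>
  define P where "P D a b \<longleftrightarrow> 2 * R + 2 < d a b \<and> d a b \<le> D \<and> (\<exists>g\<in>Gam. g v = b \<and> a \<notin> CP b (g f))" for D a b
  have P_inv1: "P D (h a) (h b)" if h: "h \<in> Gam" and p: "P D a b" for D h a b
  proof -
    obtain g where g: "g \<in> Gam" "g v = b" "a \<notin> CP b (g f)" using p by (auto simp: P_def)
    have "h \<circ> g \<in> Gam" "(h \<circ> g) v = h b" "h a \<notin> CP (h b) ((h \<circ> g) f)"
      using g h Gam_comp Cp_Gam_iff[OF h, of a R b "g f"] by auto
    then show ?thesis using p d_Gam[OF h] unfolding P_def by metis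
  qed
  have P_inv: "P D (h a) (h b) \<longleftrightarrow> P D a b" if "h \<in> Gam" for D h a b
    using P_inv1[OF that, of D a b] P_inv1[OF Gam_inv[OF that], of D "h a" "h b"] Gam_inv_f[OF that] by auto
  have card_eq: "card {b. P D v b} = card {a. P D a v}" for D
  proof -
    let ?F = "\<lambda>a b. of_bool (P D a b) :: real"
    have "(\<Sum>y\<in>B v D. ?F v y) = (\<Sum>y\<in>B v D. ?F y v)"
      by (rule mass_transport_uni) (simp add: P_inv)
    moreover have "(\<Sum>y\<in>B v D. ?F v y) = card {b. P D v b}"
    proof -
      have "{b. P D v b} = B v D \<inter> {b. P D v b}" by (auto simp: P_def)
      then show ?thesis using finite_B[of v D] by (simp add: of_bool_def sum.If_cases)
    qed
    moreover have "(\<Sum>y\<in>B v D. ?F y v) = card {a. P D a v}"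
    proof -
      have "{b. P D b v} = B v D \<inter> {b. P D b v}" using d_sym by (auto simp: P_def)
      then show ?thesis using finite_B[of v D] by (simp add: of_bool_def sum.If_cases)
    qed
    ultimately show ?thesis by linarith
  qed
  \<comment> \<open>Mass sent out by \<open>v\<close>: let \<open>S q\<close> be minimal under
    inclusion among chosen translates missing \<open>v\<close>. Any other one centred far from
    \<open>q\<close> must contain \<open>q\<close> while it misses \<open>v\<close>, so its ball
    meets a geodesic from \<open>q\<close> to \<open>v\<close>. This leaves linearly many
    centres.\<close>
  have up: "card {b. P D v b} \<le> NB (2 * R + 2) + Suc D * NB R" for D
  proof (cases "{b. P D v b} = {}")
    case False
    let ?X = "{b. P D v b}"
    have finX: "finite ?X" by (rule finite_subset[OF _ finite_B[of v D]]) (auto simp: P_def)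
    have "\<exists>g. \<forall>b\<in>?X. g b \<in> Gam \<and> g b v = b \<and> v \<notin> CP b (g b f)"
      by (rule bchoice) (auto simp: P_def)
    then obtain g where g: "\<And>b. b \<in> ?X \<Longrightarrow> g b \<in> Gam \<and> g b v = b \<and> v \<notin> CP b (g b f)" by blast
    define S where "S b = CP b (g b f)" for b
    have "finite (S ` ?X)" "S ` ?X \<noteq> {}" using finX False by auto
    then obtain M where M: "M \<in> S ` ?X" "\<And>N. N \<in> S ` ?X \<Longrightarrow> N \<subseteq> M \<Longrightarrow> M = N"
      using finite_has_minimal[of "S ` ?X"] by auto
    then obtain q where q: "q \<in> ?X" "M = S q" by blast
    obtain xs where xs: "saw xs" "hd xs = q" "last xs = v" "length xs = Suc (d q v)"
      using geodesic[of q v] by blast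
    have ne: "xs \<noteq> []" "apath xs" using xs(1) by (auto simp: saw_def)
    have vin: "v \<in> set xs" using xs(3) ne last_in_set by blast
    have "?X \<subseteq> B q (2 * R + 2) \<union> (\<Union>w\<in>set xs. B w R)"
    proof
      fix b assume b: "b \<in> ?X"
      show "b \<in> B q (2 * R + 2) \<union> (\<Union>w\<in>set xs. B w R)"
      proof (cases "d q b \<le> 2 * R + 2")
        case far: False
        have gb: "g b \<in> Gam" "g b v = b" "v \<notin> S b" and gq: "g q \<in> Gam" "g q v = q" "v \<notin> S q"
          using g[OF b] g[OF q(1)] by (auto simp: S_def)
        have I: "S b \<inter> S q \<noteq> {}"
          unfolding S_def using meet[OF gb(1) gq(1) gb(2) gq(2)] far d_sym[of b q] by simp
        have f1: "2 * R < d q b" "2 * R < d b q" using far d_sym[of b q] by auto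
        have qS: "q \<in> S b"
        proof (rule ccontr)
          assume qn: "q \<notin> S b"
          then have bS: "b \<in> S q" using Cp_apart[OF f1(1), of "g q f" "g b f"] I by (auto simp: S_def)
          have "S b \<subseteq> S q"
            using Cp_nest[OF f1(1), of "g b f"] qn Cp_eq[of b R q "g q f"] bS by (auto simp: S_def)
          then have "S q = S b" using M(2)[of "S b"] b q(2) by blast
          then have "b \<in> S b" using bS by simp
          moreover have "d b (g b f) > R" using d_Gam[OF gb(1), of v f] gb(2) f by simp
          ultimately show False using Cp_out[of b R b "g b f"] by (simp add: S_def)
        qed
        have "\<exists>w\<in>set xs. w \<in> B b R"
        proof (rule ccontr)
          assume "\<not> ?thesis"
          then have "con (B b R) q v" using con_path[OF ne(2,1) _ vin] xs(2) by blast
          then have "v \<in> CP b q" by (simp add: Cp_def)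
          then show False using gb(3) qS Cp_eq[of q R b "g b f"] by (simp add: S_def)
        qed
        then show ?thesis using d_sym[of b] by auto
      qed simp
    qed
    then have "card ?X \<le> card (B q (2 * R + 2) \<union> (\<Union>w\<in>set xs. B w R))"
      by (intro card_mono) (auto simp: finite_B)
    also have "\<dots> \<le> card (B q (2 * R + 2)) + card (\<Union>w\<in>set xs. B w R)" by (rule card_Un_le)
    also have "card (\<Union>w\<in>set xs. B w R) \<le> (\<Sum>w\<in>set xs. card (B w R))" by (rule card_UN_le) simp
    also have "\<dots> = card (set xs) * NB R" by (simp add: card_B)
    also have "card (set xs) \<le> Suc D"
      using card_length[of xs] xs(4) q(1) d_sym[of q v] by (auto simp: P_def)
    finally show ?thesis by (simp add: card_B)
  qed simp
  define u where "u D = card {a \<in> B v D. a \<notin> CP v f}" for D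
  obtain e1 where e1: "d v e1 = Suc R" "infinite (CP v e1)" "e1 \<notin> CP v f" using third[of v f f] by blast
  obtain e2 where e2: "d v e2 = Suc R" "infinite (CP v e2)" "e2 \<notin> CP v f" "e1 \<notin> CP v e2"
    using third[of v f e1] by blast
  let ?l = "2 * R + 3"
  obtain z1 where z1: "z1 \<in> CP v e1" "d v z1 = ?l" using Cp_level[OF e1(2), of ?l] e1(1) by auto
  obtain z2 where z2: "z2 \<in> CP v e2" "d v z2 = ?l" using Cp_level[OF e2(2), of ?l] e2(1) by auto
  \<comment> \<open>As \<open>z\<close> lies outside the half-space at \<open>v\<close>, which meets
    its translate at \<open>z\<close>, that translate contains \<open>v\<close>. What misses the
    translate is therefore on the side of \<open>z\<close> as seen from \<open>v\<close>.\<close>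
  have sub: "\<exists>g\<in>Gam. g ` {a \<in> B v D. a \<notin> CP v f} \<subseteq> B v (D + ?l) \<inter> CP v z"
    if z: "d v z = ?l" "z \<notin> CP v f" for z D
  proof -
    obtain g where g: "g \<in> Gam" "g v = z" using Gam_trans by blast
    have far: "2 * R < d v z" using z by simp
    have "CP v (id f) \<inter> CP z (g f) \<noteq> {}" by (rule meet[OF Gam_id g(1) _ g(2)]) (use z in simp_all)
    then have vin: "v \<in> CP z (g f)" using Cp_apart[OF far, of f "g f"] z by auto
    have "g a \<in> B v (D + ?l) \<inter> CP v z" if "a \<in> B v D" "a \<notin> CP v f" for a
    proof -
      have "g a \<notin> CP z (g f)" using that(2) Cp_Gam_iff[OF g(1), of a R v f] g(2) by simp
      then have "g a \<in> CP v z" using cover[OF far, of "g a"] Cp_eq[OF vin] by blast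
      moreover have "d v (g a) \<le> D + ?l"
        using d_tri[of v "g a" z] d_Gam[OF g(1), of v a] g(2) that(1) z by simp
      ultimately show ?thesis by simp
    qed
    then show ?thesis using g(1) by blast
  qed
  \<comment> \<open>Two disjoint copies of the missed part of a ball fit into the missed part of a
    slightly larger ball, whence exponential growth.\<close>
  have dbl: "2 * u D \<le> u (D + ?l)" for D
  proof -
    have zn: "z1 \<notin> CP v f" "z2 \<notin> CP v f" "z2 \<notin> CP v z1"
      using z1(1) z2(1) e1(3) e2(3,4) Cp_eq Cp_sym by metis+
    obtain g1 where g1: "g1 \<in> Gam" "g1 ` {a \<in> B v D. a \<notin> CP v f} \<subseteq> B v (D + ?l) \<inter> CP v z1"
      using sub[OF z1(2) zn(1)] by blast
    obtain g2 where g2: "g2 \<in> Gam" "g2 ` {a \<in> B v D. a \<notin> CP v f} \<subseteq> B v (D + ?l) \<inter> CP v z2"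
      using sub[OF z2(2) zn(2)] by blast
    let ?A = "{a \<in> B v D. a \<notin> CP v f}"
    have "card (g1 ` ?A \<union> g2 ` ?A) = card (g1 ` ?A) + card (g2 ` ?A)"
    proof (rule card_Un_disjoint)
      show "g1 ` ?A \<inter> g2 ` ?A = {}" using g1(2) g2(2) Cp_disjoint[OF zn(3)] by blast
    qed (rule finite_imageI, rule finite_subset[OF _ finite_B[of v D]], blast)+
    also have "\<dots> = 2 * u D" unfolding u_def
      using Gam_inj[OF g1(1)] Gam_inj[OF g2(1)] by (subst (1 2) card_image) (auto intro: inj_on_subset)
    finally have c2: "card (g1 ` ?A \<union> g2 ` ?A) = 2 * u D" .
    have "g1 ` ?A \<union> g2 ` ?A \<subseteq> {a \<in> B v (D + ?l). a \<notin> CP v f}"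
      using g1(2) g2(2) Cp_disjoint[OF zn(1)] Cp_disjoint[OF zn(2)] by blast
    then have "card (g1 ` ?A \<union> g2 ` ?A) \<le> u (D + ?l)"
      unfolding u_def by (intro card_mono) (auto simp: finite_B)
    then show ?thesis using c2 by simp
  qed
  have pow: "2 ^ k \<le> u (k * ?l)" for k
  proof (induction k)
    case 0
    have "v \<in> {a \<in> B v 0. a \<notin> CP v f}" using Cp_out[of v R v f] f by auto
    then have "u 0 > 0" unfolding u_def using finite_B[of v 0] by (intro card_gt_0_iff[THEN iffD2]) auto
    then show ?case by simp
  next
    case (Suc k)
    have "2 ^ Suc k \<le> 2 * u (k * ?l)" using Suc by simp
    also have "\<dots> \<le> u (Suc k * ?l)" using dbl[of "k * ?l"] by (simp add: add.commute)
    finally show ?case .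
  qed
  have low: "u D \<le> NB (2 * R + 2) + card {a. P D a v}" for D
  proof -
    have "{a \<in> B v D. a \<notin> CP v f} \<subseteq> B v (2 * R + 2) \<union> {a. P D a v}"
    proof
      fix a assume a: "a \<in> {a \<in> B v D. a \<notin> CP v f}"
      then have "\<exists>g\<in>Gam. g v = v \<and> a \<notin> CP v (g f)" using Gam_id by (intro bexI[of _ id]) auto
      then show "a \<in> B v (2 * R + 2) \<union> {a. P D a v}" using a d_sym[of a v] by (auto simp: P_def)
    qed
    moreover have "finite {a. P D a v}"
      by (rule finite_subset[OF _ finite_B[of v D]]) (auto simp: P_def d_sym)
    ultimately have "u D \<le> card (B v (2 * R + 2) \<union> {a. P D a v})"
      unfolding u_def by (intro card_mono) (auto simp: finite_B)
    also have "\<dots> \<le> card (B v (2 * R + 2)) + card {a. P D a v}" by (rule card_Un_le)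
    finally show ?thesis by (simp add: card_B)
  qed
  obtain k where k: "(NB (2 * R + 2) + NB (2 * R + 2) + NB R) + (?l * NB R) * k < 2 ^ k"
    using affine_lt_pow2 by blast
  have "2 ^ k \<le> NB (2 * R + 2) + (NB (2 * R + 2) + Suc (k * ?l) * NB R)"
    using pow[of k] low[of "k * ?l"] up[of "k * ?l"] card_eq[of "k * ?l"] by linarith
  then show False using k by (simp add: algebra_simps)
qed

lemma to_sphere: "d v x > R \<Longrightarrow> \<exists>y. d v y = Suc R \<and> CP v y = CP v x"
proof -
  assume x: "d v x > R"
  then obtain w where w: "d v w = Suc R" "d w x = d v x - Suc R" using d_split[of "Suc R" v x] by auto
  have "w \<in> CP v x" by (rule Cp_near) (use w x d_sym[of x w] in linarith)
  then show ?thesis using w Cp_eq by blast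
qed

text \<open>A first automorphism moves \<open>z'\<close> deep into the half-space of
  \<open>e\<close>. If the moved half-space contains \<open>z\<close>, it is replaced by its
  translate from \<open>back_to_back\<close>, which is disjoint from it and so turned away from
  \<open>z\<close>.\<close>

lemma placing0: assumes e: "d z e > R" "infinite (CP z e)" and x: "d z' x > R"
  shows "\<exists>g\<in>Gam. g z' \<in> CP z e \<and> z \<notin> CP (g z') (g x) \<and> L < d z (g z')"
proof -
  \<comment> \<open>The surplus over \<open>L\<close> makes the two balls disjoint and covers the
    loss of \<open>R\<close> when the half-space is flipped.\<close>
  define k where "k = L + 2 * R + 2"
  obtain y where y: "y \<in> CP z e" "d z y = k" using Cp_level[OF e(2,1), of k] by (auto simp: k_def)
  obtain g where g: "g \<in> Gam" "g z' = y" using Gam_trans by blast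
  show ?thesis
  proof (cases "z \<in> CP y (g x)")
    case False then show ?thesis using g y by (intro bexI[of _ g]) (auto simp: k_def)
  next
    case True
    obtain h where h: "h \<in> Gam" "2 * R + 2 < d z' (h z')" "CP z' x \<inter> CP (h z') (h x) = {}"
      using back_to_back[OF x] by blast
    let ?g = "g \<circ> h"
    have gh: "?g \<in> Gam" using g h Gam_comp by blast
    have disj: "CP y (g x) \<inter> CP (?g z') (?g x) = {}"
    proof -
      have "CP y (g x) = g ` CP z' x" using Cp_Gam[OF g(1), of R z' x] g(2) by simp
      moreover have "CP (?g z') (?g x) = g ` CP (h z') (h x)" using Cp_Gam[OF g(1), of R "h z'" "h x"] by simp
      ultimately show ?thesis using h(3) image_Int[OF Gam_inj[OF g(1)], of "CP z' x" "CP (h z') (h x)"] by simp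
    qed
    have dy: "2 * R + 2 < d y (?g z')" using h(2) d_Gam[OF g(1), of z' "h z'"] g(2) by simp
    have zn: "z \<notin> CP (?g z') (?g x)" using True disj by blast
    have gx: "d (?g z') (?g x) > R" using x d_Gam[OF gh, of z' x] by simp
    have out: "?g z' \<notin> CP y (g x)"
    proof
      assume a: "?g z' \<in> CP y (g x)"
      obtain w where w: "d (?g z') w = Suc R" "CP (?g z') w = CP (?g z') (?g x)" using to_sphere[OF gx] by blast
      have "w \<in> CP y (?g z')"
        by (rule Cp_near) (use dy w d_sym in linarith)
      then have "w \<in> CP y (g x)" using a Cp_eq by metis
      then show False using disj w(2) Cp_self by blast
    qed
    have far: "2 * R < d z y" using y by (simp add: k_def)
    have "?g z' \<in> CP z y" using cover[OF far, of "?g z'"] out Cp_eq[OF True] by blast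
    then have in_e: "?g z' \<in> CP z e" using y(1) Cp_eq by metis
    have zR: "d y z > R" using far d_sym[of z y] by simp
    have "?g z' \<notin> CP y z" using out Cp_eq[OF True] by simp
    then have "d y z \<le> d z (?g z') + R" using Cp_dist[of "?g z'" R y z] zR by simp
    then have "L < d z (?g z')" using y(2) d_sym[of z y] by (simp add: k_def)
    then show ?thesis using gh in_e zn by blast
  qed
qed

text \<open>Up to automorphisms only finitely many pairs of half-spaces, represented on spheres of
  radius \<open>Suc R\<close>, occur; so the distance of the placement is bounded uniformly.\<close>

lemma placing: "\<exists>C. \<forall>z e z' x. d z e = Suc R \<longrightarrow> infinite (CP z e) \<longrightarrow> d z' x > R \<longrightarrow>
   (\<exists>g\<in>Gam. g z' \<in> CP z e \<and> z \<notin> CP (g z') (g x) \<and> L < d z (g z') \<and> d z (g z') \<le> C)"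
proof -
  let ?v = "undefined :: 'a"
  let ?S = "{e. d ?v e = Suc R}"
  have finS: "finite ?S" by (rule finite_subset[OF _ finite_B[of ?v "Suc R"]]) auto
  have "\<forall>p\<in>?S \<times> ?S. \<exists>n. infinite (CP ?v (fst p)) \<longrightarrow>
    (\<exists>g\<in>Gam. g ?v \<in> CP ?v (fst p) \<and> ?v \<notin> CP (g ?v) (g (snd p)) \<and> L < d ?v (g ?v) \<and> d ?v (g ?v) \<le> n)"
  proof
    fix p assume p: "p \<in> ?S \<times> ?S"
    show "\<exists>n. infinite (CP ?v (fst p)) \<longrightarrow>
    (\<exists>g\<in>Gam. g ?v \<in> CP ?v (fst p) \<and> ?v \<notin> CP (g ?v) (g (snd p)) \<and> L < d ?v (g ?v) \<and> d ?v (g ?v) \<le> n)"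
    proof (cases "infinite (CP ?v (fst p))")
      case True
      have "d ?v (fst p) > R" "d ?v (snd p) > R" using p by auto
      then obtain g where "g \<in> Gam" "g ?v \<in> CP ?v (fst p)" "?v \<notin> CP (g ?v) (g (snd p))" "L < d ?v (g ?v)"
        using placing0[of ?v "fst p" ?v "snd p" L] True by blast
      then show ?thesis by (intro exI[of _ "d ?v (g ?v)"]) blast
    qed simp
  qed
  then obtain N where N: "\<And>p. p \<in> ?S \<times> ?S \<Longrightarrow> infinite (CP ?v (fst p)) \<Longrightarrow>
    (\<exists>g\<in>Gam. g ?v \<in> CP ?v (fst p) \<and> ?v \<notin> CP (g ?v) (g (snd p)) \<and> L < d ?v (g ?v) \<and> d ?v (g ?v) \<le> N p)"
    by metis
  define C where "C = (\<Sum>p\<in>?S \<times> ?S. N p)"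
  have NC: "N p \<le> C" if "p \<in> ?S \<times> ?S" for p
    unfolding C_def using that finS by (intro member_le_sum) auto
  have "\<exists>g\<in>Gam. g z' \<in> CP z e \<and> z \<notin> CP (g z') (g x) \<and> L < d z (g z') \<and> d z (g z') \<le> C"
    if e: "d z e = Suc R" and inf: "infinite (CP z e)" and x: "d z' x > R" for z e z' x
  proof -
    obtain x' where x': "d z' x' = Suc R" "CP z' x' = CP z' x" using to_sphere[OF x] by blast
    obtain g1 where g1: "g1 \<in> Gam" "g1 ?v = z" using Gam_trans by blast
    obtain g2 where g2: "g2 \<in> Gam" "g2 ?v = z'" using Gam_trans by blast
    define e0 where "e0 = inv g1 e"
    define x0 where "x0 = inv g2 x'"
    have e0: "g1 e0 = e" and x0: "g2 x0 = x'" by (auto simp: e0_def x0_def Gam_f_inv g1 g2)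
    have p: "(e0, x0) \<in> ?S \<times> ?S"
      using d_Gam[OF g1(1), of ?v e0] d_Gam[OF g2(1), of ?v x0] e x'(1) by (simp add: g1 g2 e0 x0)
    have "CP z e = g1 ` CP ?v e0" using Cp_Gam[OF g1(1), of R ?v e0] by (simp add: g1 e0)
    then have "infinite (CP ?v e0)" using inf by auto
    then obtain g where g: "g \<in> Gam" "g ?v \<in> CP ?v e0" "?v \<notin> CP (g ?v) (g x0)" "L < d ?v (g ?v)" "d ?v (g ?v) \<le> N (e0, x0)"
      using N[OF p] by auto
    let ?g = "g1 \<circ> (g \<circ> inv g2)"
    have gz: "?g z' = g1 (g ?v)" "?g x' = g1 (g x0)"
      using Gam_inv_f[OF g2(1), of ?v] Gam_inv_f[OF g2(1), of x0] by (auto simp: g2 x0)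
    have G: "?g \<in> Gam" using g g1 g2 Gam_comp Gam_inv by auto
    have "CP (?g z') (?g x) = CP (?g z') (?g x')" using x'(2) Cp_Gam[OF G, of R z'] by metis
    moreover have "z \<notin> CP (?g z') (?g x')"
      unfolding gz using g(3) Cp_Gam_iff[OF g1(1), of ?v R "g ?v" "g x0"] g1(2) by simp
    moreover have "?g z' \<in> CP z e"
      unfolding gz using g(2) Cp_Gam_iff[OF g1(1), of "g ?v" R ?v e0] by (simp add: g1 e0)
    moreover have "d z (?g z') = d ?v (g ?v)" unfolding gz using d_Gam[OF g1(1), of ?v "g ?v"] g1(2) by simp
    ultimately show ?thesis using G g(4,5) NC[OF p] by (intro bexI[of _ ?g]) auto
  qed
  then show ?thesis by blast
qed

section \<open>Half-spaces avoided by a separated set\<close>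

definition Infc :: "'a \<Rightarrow> 'a set set" where
  "Infc z = {CP z e | e. d z e = Suc R \<and> infinite (CP z e)}"

lemma finite_Infc: "finite (Infc z)"
proof -
  have "Infc z \<subseteq> CP z ` B z (Suc R)" by (auto simp: Infc_def)
  then show ?thesis using finite_B by (metis finite_imageI finite_subset)
qed
lemma card_Infc: "card (Infc z) \<ge> 3" and card_Infc': "card (Infc z - {CP z x}) \<ge> 2"
proof -
  have two: "card (Infc z - {CP z x}) \<ge> 2" for x
  proof -
    obtain e1 where e1: "d z e1 = Suc R" "infinite (CP z e1)" "e1 \<notin> CP z x" using third[of z x x] by blast
    obtain e2 where e2: "d z e2 = Suc R" "infinite (CP z e2)" "e2 \<notin> CP z x" "e1 \<notin> CP z e2"
      using third[of z x e1] by blast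
    have "CP z e1 \<in> Infc z" "CP z e2 \<in> Infc z" using e1 e2 by (auto simp: Infc_def)
    moreover have "CP z e1 \<noteq> CP z x" "CP z e2 \<noteq> CP z x" using e1(3) e2(3) Cp_self[of e1 R z] Cp_self[of e2 R z] by blast+
    ultimately have "{CP z e1, CP z e2} \<subseteq> Infc z - {CP z x}" by blast
    then have "card {CP z e1, CP z e2} \<le> card (Infc z - {CP z x})"
      using finite_Infc by (intro card_mono) auto
    moreover have "CP z e1 \<noteq> CP z e2" using e2(4) Cp_self by metis
    ultimately show ?thesis by simp
  qed
  then show "card (Infc z - {CP z x}) \<ge> 2" .
  obtain e1 where e1: "d z e1 = Suc R" "infinite (CP z e1)" using third[of z z z] by blast
  have "CP z e1 \<in> Infc z" using e1 by (auto simp: Infc_def)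
  then have "card (Infc z) = Suc (card (Infc z - {CP z e1}))"
    using finite_Infc by (metis card_Suc_Diff1)
  then show "card (Infc z) \<ge> 3" using two[of e1] by simp
qed
lemma Infc_eq: "E \<in> Infc z \<Longrightarrow> x \<in> E \<Longrightarrow> E = CP z x" using Cp_eq by (auto simp: Infc_def)
lemma Infc_out: "E \<in> Infc z \<Longrightarrow> x \<in> E \<Longrightarrow> d z x > R" using Cp_out by (force simp: Infc_def)
definition leaves :: "'a set \<Rightarrow> ('a \<times> 'a set) set" where
  "leaves Z = {(z, E). z \<in> Z \<and> E \<in> Infc z \<and> E \<inter> Z = {}}"

lemma finite_leaves: "finite Z \<Longrightarrow> finite (leaves Z)"
proof -
  assume Z: "finite Z"
  have "leaves Z \<subseteq> (SIGMA z:Z. Infc z)" by (auto simp: leaves_def)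
  then show ?thesis using Z finite_Infc by (auto intro: finite_subset)
qed

lemma leaves_disjoint:
  assumes sep: "\<And>y z. y \<in> Z \<Longrightarrow> z \<in> Z \<Longrightarrow> y \<noteq> z \<Longrightarrow> 2 * R < d y z"
    and "(y, E) \<in> leaves Z" "(z, E') \<in> leaves Z" "(y, E) \<noteq> (z, E')"
  shows "E \<inter> E' = {}"
proof (cases "y = z")
  case True
  then show ?thesis using assms(2-4) Infc_eq[of E y] Infc_eq[of E' y] by (fastforce simp: leaves_def)
next
  case False
  have "E \<in> Infc y" "E' \<in> Infc z" "z \<notin> E" "y \<notin> E'" "y \<in> Z" "z \<in> Z"
    using assms(2,3) by (auto simp: leaves_def)
  then show ?thesis using Cp_apart[of R y z] sep[OF _ _ False] by (auto simp: Infc_def)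
qed

text \<open>The count of leaves of a tree whose branch points have degree at least three. All other
  points are seen from an outermost \<open>z1\<close> in a single half-space. Adding
  \<open>z1\<close> back creates at least two leaves at \<open>z1\<close> and destroys at most one,
  the leaf that contains \<open>z1\<close>.\<close>

lemma card_leaves:
  assumes "finite Z" "Z \<noteq> {}" "\<And>y z. y \<in> Z \<Longrightarrow> z \<in> Z \<Longrightarrow> y \<noteq> z \<Longrightarrow> 2 * R < d y z"
  shows "card (leaves Z) \<ge> card Z + 2"
  using assms
proof (induction "card Z" arbitrary: Z rule: less_induct)
  case less
  note fin = less(2) and ne = less(3) and sep = less(4)
  show ?case
  proof (cases "card Z = 1")
    case True
    then obtain z where Z: "Z = {z}" by (auto simp: card_1_singleton_iff)
    have "leaves Z = Pair z ` Infc z"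
      using Infc_out[of _ z z] by (auto simp: leaves_def Z)
    then have "card (leaves Z) = card (Infc z)" by (simp add: card_image inj_on_def)
    then show ?thesis using card_Infc[of z] Z by simp
  next
    case False
    have c2: "card Z \<ge> 2" using False ne fin by (cases "card Z"; cases "card Z - 1") auto
    \<comment> \<open>Take a pair \<open>(z, x)\<close> whose half-space \<open>CP z x\<close>
      contains the fewest points of \<open>Z\<close>. Then \<open>x\<close> is outermost: a point of
      \<open>Z\<close> on another side of \<open>x\<close> than \<open>z\<close> would span a
      half-space at \<open>x\<close> with strictly fewer points.\<close>
    have "\<exists>z1\<in>Z. \<exists>z. \<forall>y\<in>Z - {z1}. y \<in> CP z1 z"
    proof -
      define T where "T = {(z, x). z \<in> Z \<and> x \<in> Z \<and> z \<noteq> x}"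
      have "T \<noteq> {}"
      proof -
        obtain z where z: "z \<in> Z" using ne by blast
        have "Z \<noteq> {z}" using c2 by auto
        then obtain x where "x \<in> Z" "x \<noteq> z" using z by blast
        then show ?thesis using z by (auto simp: T_def)
      qed
      then obtain p where p: "p \<in> T" "\<And>q. q \<in> T \<Longrightarrow> card (CP (fst p) (snd p) \<inter> Z) \<le> card (CP (fst q) (snd q) \<inter> Z)"
        using ex_has_least_nat[of "\<lambda>p. p \<in> T" _ "\<lambda>p. card (CP (fst p) (snd p) \<inter> Z)"] by fastforce
      obtain z x where zx: "p = (z, x)" by force
      have z: "z \<in> Z" "x \<in> Z" "z \<noteq> x" using p(1) zx by (auto simp: T_def)
      have "y \<in> CP x z" if y: "y \<in> Z - {x}" for y
      proof (rule ccontr)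
        assume n: "y \<notin> CP x z"
        have zn: "z \<notin> CP x y" using n Cp_sym by metis
        have far: "2 * R < d z x" using sep z by blast
        have sub: "CP x y \<subseteq> CP z x" using Cp_nest[OF far zn] by blast
        have "d x y > R" using sep[of x y] y z by auto
        then have "x \<notin> CP x y" using Cp_out[of x R x y] by auto
        then have "CP x y \<inter> Z \<subset> CP z x \<inter> Z" using sub z by auto
        then have "card (CP x y \<inter> Z) < card (CP z x \<inter> Z)" using fin by (intro psubset_card_mono) auto
        moreover have "(x, y) \<in> T" using y z by (auto simp: T_def)
        ultimately show False using p(2)[of "(x, y)"] zx by simp
      qed
      then show ?thesis using z(2) by blast
    qed
    then obtain z1 z where z1: "z1 \<in> Z" "\<And>y. y \<in> Z - {z1} \<Longrightarrow> y \<in> CP z1 z" by blast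
    let ?Z = "Z - {z1}"
    have cZ: "card Z = Suc (card ?Z)" using z1(1) fin by (metis card_Suc_Diff1)
    have IH: "card (leaves ?Z) \<ge> card ?Z + 2"
    proof (rule less(1))
      show "?Z \<noteq> {}"
      proof
        assume "?Z = {}"
        then have "card ?Z = 0" by (simp only: card.empty)
        then show False using cZ c2 by simp
      qed
    qed (use fin cZ sep in auto)
    let ?old = "{p \<in> leaves ?Z. z1 \<notin> snd p}" and ?bad = "{p \<in> leaves ?Z. z1 \<in> snd p}"
    let ?new = "Pair z1 ` (Infc z1 - {CP z1 z})"
    have "p = q" if "p \<in> ?bad" "q \<in> ?bad" for p q
    proof (rule ccontr)
      assume "p \<noteq> q"
      then have "snd p \<inter> snd q = {}"
        using leaves_disjoint[of ?Z "fst p" "snd p" "fst q" "snd q"] that sep by auto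
      then show False using that by auto
    qed
    then have bad: "card ?bad \<le> 1"
      using finite_leaves[of ?Z] fin by (intro card_le_Suc0_iff_eq[THEN iffD2, simplified One_nat_def[symmetric]]) auto
    have "card (leaves ?Z) = card (?old \<union> ?bad)" by (rule arg_cong[of _ _ card]) auto
    also have "\<dots> \<le> card ?old + card ?bad" by (rule card_Un_le)
    finally have old: "card (leaves ?Z) \<le> card ?old + 1" using bad by linarith
    have new: "card ?new \<ge> 2" using card_Infc'[of z1 z] by (simp add: card_image inj_on_def)
    have "?new \<subseteq> leaves Z"
    proof
      fix p assume "p \<in> ?new"
      then obtain E where E: "p = (z1, E)" "E \<in> Infc z1" "E \<noteq> CP z1 z" by auto
      have "x \<notin> E" if "x \<in> Z" for x
      proof
        assume xE: "x \<in> E"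
        then have "E = CP z1 x" using Infc_eq[OF E(2)] by blast
        moreover have "x \<noteq> z1" using Infc_out[OF E(2) xE] by auto
        ultimately show False using z1(2)[of x] that E(3) Cp_eq by blast
      qed
      then show "p \<in> leaves Z" using E z1(1) by (auto simp: leaves_def)
    qed
    moreover have "?old \<subseteq> leaves Z" by (auto simp: leaves_def)
    ultimately have "card (?old \<union> ?new) \<le> card (leaves Z)" using finite_leaves[OF fin] by (intro card_mono) auto
    moreover have "card (?old \<union> ?new) = card ?old + card ?new"
      using fin finite_leaves[of ?Z] finite_Infc by (intro card_Un_disjoint) (auto simp: leaves_def)
    ultimately show ?thesis using old new IH cZ by linarith
  qed
qed

end

section \<open>Scripts\<close>

context tgraph begin

lemma loop_erasure: "apath xs \<Longrightarrow> xs \<noteq> [] \<Longrightarrow>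
  \<exists>ys. saw ys \<and> hd ys = hd xs \<and> last ys = last xs \<and> set ys \<subseteq> set xs"
proof (induction xs)
  case (Cons x xs)
  show ?case
  proof (cases "xs = []")
    case True then show ?thesis by (intro exI[of _ "[x]"]) (auto simp: saw_def)
  next
    case False
    then have ad: "adj x (hd xs)" "apath xs" using Cons.prems(1) by (auto simp: successively_Cons)
    then obtain ys where ys: "saw ys" "hd ys = hd xs" "last ys = last xs" "set ys \<subseteq> set xs"
      using Cons.IH False by blast
    show ?thesis
    proof (cases "x \<in> set ys")
      case True
      then obtain us vs where uv: "ys = us @ x # vs" by (meson split_list)
      have "saw (x # vs)" using ys(1) uv saw_append[of us "x # vs"] by (auto split: if_splits)
      then show ?thesis using ys uv False by (intro exI[of _ "x # vs"]) auto
    next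
      case n: False
      have "saw (x # ys)" using ys ad n by (auto simp: saw_def successively_Cons)
      moreover have "ys \<noteq> []" using ys(1) by (auto simp: saw_def)
      ultimately show ?thesis using ys False by (intro exI[of _ "x # ys"]) auto
    qed
  qed
qed simp

definition W :: "real \<Rightarrow> 'a list \<Rightarrow> real" where "W \<zeta> xs = wt xs * \<zeta> ^ (length xs - 1)"

lemma W_glue: "xs \<noteq> [] \<Longrightarrow> ys \<noteq> [] \<Longrightarrow> hd ys = last xs \<Longrightarrow> W \<zeta> (xs @ tl ys) = W \<zeta> xs * W \<zeta> ys"
proof -
  assume a: "xs \<noteq> []" "ys \<noteq> []" "hd ys = last xs"
  have "length (xs @ tl ys) - 1 = (length xs - 1) + (length ys - 1)" using a(1,2) by (cases xs; cases ys) auto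
  then show ?thesis unfolding W_def wt_glue[OF a] by (simp add: power_add)
qed
lemma W_map [simp]: "g \<in> Gam \<Longrightarrow> W \<zeta> (map g xs) = W \<zeta> xs" by (simp add: W_def)
lemma W_rev [simp]: "W \<zeta> (rev xs) = W \<zeta> xs" by (simp add: W_def)
lemma W_nonneg [simp]: "0 \<le> \<zeta> \<Longrightarrow> 0 \<le> W \<zeta> xs" by (simp add: W_def)
lemma W_single [simp]: "W \<zeta> [x] = 1" by (simp add: W_def)

lemma W_ge: assumes "apath xs" "0 < \<zeta>" shows "W \<zeta> xs \<ge> \<zeta> ^ (length xs - 1)"
  using wt_ge1[OF assms(1)] assms(2) mult_right_mono[of 1 "wt xs" "\<zeta> ^ (length xs - 1)"] by (simp add: W_def)

definition M :: real where "M = real (\<Sum>y\<in>{y. adj undefined y}. m undefined y) + 1"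
lemma m_le_M: "real (m x y) \<le> M"
proof (cases "adj x y")
  case True
  obtain g where g: "g \<in> Gam" "g x = undefined" using Gam_trans by blast
  have "m x y = m undefined (g y)" using Gam_m[OF g(1), of x y] g(2) by simp
  also have "\<dots> \<le> (\<Sum>y\<in>{y. adj undefined y}. m undefined y)"
    using True g Gam_adj[OF g(1), of x y] finite_nb by (intro member_le_sum) auto
  finally show ?thesis by (simp add: M_def del: of_nat_sum)
qed (simp add: adj_def M_def del: of_nat_sum)
lemma M_ge1: "M \<ge> 1" by (simp add: M_def del: of_nat_sum)
lemma wt_le: "wt xs \<le> M ^ length xs"
proof (induction xs rule: wt.induct)
  case (1 x y zs)
  have "wt (x # y # zs) \<le> M * M ^ length (y # zs)"
    using 1 m_le_M[of x y] M_ge1 by (simp del: length_Cons power_Suc) (intro mult_mono; simp)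
  then show ?case by simp
qed (use M_ge1 in auto)

lemma W_join: assumes "p \<noteq> []" "r \<noteq> []"
  shows "W \<zeta> (p @ q @ r) = W \<zeta> p * W \<zeta> (last p # q @ [hd r]) * W \<zeta> r"
proof -
  have "W \<zeta> ((p @ tl (last p # q @ [hd r])) @ tl r) = W \<zeta> (p @ tl (last p # q @ [hd r])) * W \<zeta> r"
    using assms by (intro W_glue) auto
  also have "W \<zeta> (p @ tl (last p # q @ [hd r])) = W \<zeta> p * W \<zeta> (last p # q @ [hd r])"
    using assms by (intro W_glue) auto
  finally show ?thesis using assms by simp
qed

text \<open>As \<open>Q\<close> grows with the rank in \<open>I\<close>, up to the defect
  \<open>K\<close>, the sum is dominated by a geometric series, however large \<open>I\<close> is.
  It will be applied to the possible positions of the first mark.\<close>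

lemma rank_sum: fixes s :: real
  assumes "finite I" "0 < s" "s < 1" "\<And>i. i \<in> I \<Longrightarrow> card {j\<in>I. j < i} \<le> Q i + K"
  shows "(\<Sum>i\<in>(I :: nat set). s ^ Q i) \<le> (1 / s) ^ K / (1 - s)"
proof -
  have 1: "s ^ Q i \<le> s ^ card {j\<in>I. j < i} * (1 / s) ^ K" if "i \<in> I" for i
  proof -
    have "s ^ (Q i + K) \<le> s ^ card {j\<in>I. j < i}" using assms that by (intro power_decreasing) auto
    then show ?thesis using assms by (simp add: power_add field_simps)
  qed
  have 2: "(\<Sum>i\<in>I. s ^ card {j\<in>I. j < i}) \<le> (\<Sum>r<card I. s ^ r)"
  proof (rule sum_le_inj[where h = "\<lambda>i. card {j\<in>I. j < i}"])
    show "inj_on (\<lambda>i. card {j\<in>I. j < i}) I"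
    proof (rule linorder_inj_onI')
      fix i k assume ik: "i \<in> I" "k \<in> I" "i < k"
      then have "{j\<in>I. j < i} \<subset> {j\<in>I. j < k}" by auto
      then show "card {j\<in>I. j < i} \<noteq> card {j\<in>I. j < k}"
        using psubset_card_mono[of "{j\<in>I. j < k}" "{j\<in>I. j < i}"] assms(1) by simp
    qed
    show "(\<lambda>i. card {j\<in>I. j < i}) ` I \<subseteq> {..<card I}"
    proof safe
      fix i assume i: "i \<in> I"
      have "{j\<in>I. j < i} \<subseteq> I - {i}" by auto
      then have "{j\<in>I. j < i} \<subset> I" using i by blast
      then show "card {j\<in>I. j < i} < card I" using assms(1) by (rule psubset_card_mono[rotated])
    qed
  qed (use assms in auto)
  also have "(\<Sum>r<card I. s ^ r) \<le> 1 / (1 - s)"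
    using assms by (simp add: sum_gp_strict divide_right_mono)
  finally have 3: "(\<Sum>i\<in>I. s ^ card {j\<in>I. j < i}) \<le> 1 / (1 - s)" .
  have "(\<Sum>i\<in>I. s ^ Q i) \<le> (\<Sum>i\<in>I. s ^ card {j\<in>I. j < i}) * (1 / s) ^ K"
    unfolding sum_distrib_right by (rule sum_mono[OF 1])
  also have "\<dots> \<le> 1 / (1 - s) * (1 / s) ^ K" using 3 assms by (intro mult_right_mono) auto
  finally show ?thesis by simp
qed

end

section \<open>Anchored pieces and gluing\<close>

context tgraph_uni begin

text \<open>Largest distance of a piece from its anchor. It is big enough for
  \<open>free_marks\<close>: a point at depth \<open>Ca\<close> in a half-space that avoids a
  \<open>2 * R\<close>-net of a walk stays farther than \<open>R\<close> from the whole
  walk.\<close>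

definition Ca :: nat where "Ca = 5 * R + 2"
text \<open>Least distance over which a piece is moved. It exceeds two anchor distances and two
  radii, so that whatever lies near one centre is well on one side of the ball about the
  other.\<close>

definition L :: nat where "L = 2 * Ca + 2 * R"
definition Cpl :: nat where "Cpl = (SOME C. \<forall>z e z' x. d z e = Suc R \<longrightarrow> infinite (CP z e) \<longrightarrow> d z' x > R \<longrightarrow>
   (\<exists>g\<in>Gam. g z' \<in> CP z e \<and> z \<notin> CP (g z') (g x) \<and> L < d z (g z') \<and> d z (g z') \<le> C))"
definition place :: "'a \<Rightarrow> 'a \<Rightarrow> 'a \<Rightarrow> 'a \<Rightarrow> 'a \<Rightarrow> 'a" where
  "place z e z' x = (SOME g. g \<in> Gam \<and> g z' \<in> CP z e \<and> z \<notin> CP (g z') (g x) \<and> L < d z (g z') \<and> d z (g z') \<le> Cpl)"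

lemma place: assumes "d z e = Suc R" "infinite (CP z e)" "d z' x > R"
  shows "place z e z' x \<in> Gam" "place z e z' x z' \<in> CP z e" "z \<notin> CP (place z e z' x z') (place z e z' x x)"
    "L < d z (place z e z' x z')" "d z (place z e z' x z') \<le> Cpl"
proof -
  have "\<exists>g. g \<in> Gam \<and> g z' \<in> CP z e \<and> z \<notin> CP (g z') (g x) \<and> L < d z (g z') \<and> d z (g z') \<le> Cpl"
    using someI_ex[OF placing[of L], folded Cpl_def] assms by blast
  from someI_ex[OF this, folded place_def]
  show "place z e z' x \<in> Gam" "place z e z' x z' \<in> CP z e" "z \<notin> CP (place z e z' x z') (place z e z' x x)"
    "L < d z (place z e z' x z')" "d z (place z e z' x z') \<le> Cpl" by auto
qed

text \<open>The last vertex is the one nearest to the anchor \<open>z\<close>, but outside its ball.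
  Hence the piece stays in one component, and a geodesic from its last vertex to \<open>z\<close>
  meets it nowhere else.\<close>

definition endA :: "'a list \<Rightarrow> 'a \<Rightarrow> bool" where
  "endA p z \<longleftrightarrow> R < d z (last p) \<and> d z (last p) \<le> Ca \<and> (\<forall>y\<in>set p. d z (last p) \<le> d z y)"
definition startA :: "'a list \<Rightarrow> 'a \<Rightarrow> bool" where
  "startA p z \<longleftrightarrow> R < d z (hd p) \<and> d z (hd p) \<le> Ca \<and> (\<forall>y\<in>set p. d z (hd p) \<le> d z y)"

lemma startA_sub: assumes "apath p" "p \<noteq> []" "startA p z" "y \<in> set p" shows "y \<in> CP z (hd p)"
  unfolding Cp_def using con_path[OF assms(1,2) _ assms(4), of "B z R"] assms(3) by (fastforce simp: startA_def)
lemma endA_rev: "p \<noteq> [] \<Longrightarrow> endA (rev p) z \<longleftrightarrow> startA p z"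
  by (auto simp: endA_def startA_def last_rev)
lemma startA_rev: "p \<noteq> [] \<Longrightarrow> startA (rev p) z \<longleftrightarrow> endA p z"
  by (auto simp: endA_def startA_def hd_rev)
lemma endA_sub: assumes "apath p" "p \<noteq> []" "endA p z" "y \<in> set p" shows "y \<in> CP z (last p)"
  using startA_sub[of "rev p" z y] assms by (simp add: path_rev startA_rev hd_rev del: successively_rev)
lemma startA_map: "g \<in> Gam \<Longrightarrow> p \<noteq> [] \<Longrightarrow> startA (map g p) (g z) \<longleftrightarrow> startA p z"
  using d_Gam[of g] by (auto simp: startA_def hd_map)

text \<open>The number of vertices on three geodesics of lengths at most \<open>Ca\<close>,
  \<open>Cpl\<close> and \<open>Ca\<close>.\<close>

definition Cq :: nat where "Cq = 2 * Ca + Cpl + 3"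

text \<open>The connector is the interior of the loop erasure of three geodesics, from
  \<open>last a\<close> to \<open>z\<close>, on to \<open>z1\<close>, and on to \<open>hd b\<close>.
  By \<open>n1\<close> and \<open>n2\<close> each piece is turned away from the centre of the other,
  so the geodesics meet the pieces in \<open>last a\<close> and \<open>hd b\<close> only.\<close>

lemma glue:
  assumes a: "saw a" "endA a z" and b: "saw b" "startA b z1"
    and n1: "z1 \<notin> CP z (last a)" and n2: "z \<notin> CP z1 (hd b)" and far: "L < d z z1" "d z z1 \<le> Cpl"
  shows "\<exists>q. saw (a @ q @ b) \<and> length q \<le> Cq \<and> set q \<subseteq> B z (Cpl + Ca)"
proof -
  have an: "a \<noteq> []" "apath a" and bn: "b \<noteq> []" "apath b" using a b by (auto simp: saw_def)
  have aS: "y \<in> CP z (last a)" "R < d z y" if "y \<in> set a" for y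
    using endA_sub[OF an(2,1) a(2) that] that a(2) by (auto simp: endA_def)
  have bS: "y \<in> CP z1 (hd b)" "R < d z1 y" if "y \<in> set b" for y
    using startA_sub[OF bn(2,1) b(2) that] that b(2) by (auto simp: startA_def)
  have nota: "y \<notin> set a" if "y \<in> CP z z1" for y
    using that n1 aS(1) Cp_eq Cp_sym by metis
  have notb: "y \<notin> set b" if "y \<in> CP z1 z" for y
    using that n2 bS(1) Cp_eq Cp_sym by metis
  have ab: "set a \<inter> set b = {}"
  proof -
    have "2 * R < d z z1" using far by (simp add: L_def)
    then show ?thesis using Cp_apart[OF _ n1 n2] aS(1) bS(1) by blast
  qed
  have zz: "d z1 z = d z z1" by (rule d_sym)
  obtain g1 where g1: "saw g1" "hd g1 = last a" "last g1 = z" "length g1 = Suc (d (last a) z)"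
    "\<forall>y\<in>set g1. d (last a) y + d y z = d (last a) z" using geodesic by blast
  obtain g2 where g2: "saw g2" "hd g2 = z" "last g2 = z1" "length g2 = Suc (d z z1)"
    "\<forall>y\<in>set g2. d z y + d y z1 = d z z1" using geodesic by blast
  obtain g3 where g3: "saw g3" "hd g3 = z1" "last g3 = hd b" "length g3 = Suc (d z1 (hd b))"
    "\<forall>y\<in>set g3. d z1 y + d y (hd b) = d z1 (hd b)" using geodesic by blast
  have da: "d (last a) z = d z (last a)" "d z (last a) \<le> Ca" and db: "d z1 (hd b) \<le> Ca"
    using a(2) b(2) d_sym by (auto simp: endA_def startA_def)
  have G1: "(y \<in> set a \<longrightarrow> y = last a) \<and> y \<notin> set b \<and> d z y \<le> Cpl + Ca" if y: "y \<in> set g1" for y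
  proof -
    have s: "d (last a) y + d y z = d (last a) z" "d y z = d z y" using g1(5) y d_sym by auto
    have "y = last a" if "y \<in> set a"
    proof -
      have "d z (last a) \<le> d z y" using that a(2) by (simp add: endA_def)
      then have "d (last a) y = 0" using s da by linarith
      then show ?thesis by simp
    qed
    moreover have "y \<in> CP z1 z" by (rule Cp_near) (use s da far zz in \<open>simp add: L_def\<close>)
    ultimately show ?thesis using notb s da by auto
  qed
  have G2: "y \<notin> set a \<and> y \<notin> set b \<and> d z y \<le> Cpl + Ca" if y: "y \<in> set g2" for y
  proof -
    have s: "d z y + d y z1 = d z z1" "d y z1 = d z1 y" using g2(5) y d_sym by auto
    have "y \<in> CP z z1" if "R < d z y" by (rule Cp_near) (use that s in linarith)
    moreover have "y \<in> CP z1 z" if "R < d z1 y" by (rule Cp_near) (use that s zz in linarith)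
    ultimately show ?thesis using nota notb aS(2) bS(2) s far by fastforce
  qed
  have G3: "y \<notin> set a \<and> (y \<in> set b \<longrightarrow> y = hd b) \<and> d z y \<le> Cpl + Ca" if y: "y \<in> set g3" for y
  proof -
    have s: "d z1 y + d y (hd b) = d z1 (hd b)" using g3(5) y by auto
    have "y = hd b" if "y \<in> set b"
    proof -
      have "d z1 (hd b) \<le> d z1 y" using that b(2) by (simp add: startA_def)
      then have "d y (hd b) = 0" using s by linarith
      then show ?thesis by simp
    qed
    moreover have "y \<in> CP z z1" by (rule Cp_near) (use s db far in \<open>simp add: L_def\<close>)
    moreover have "d z y \<le> Cpl + Ca" using d_tri[of z y z1] s db far by linarith
    ultimately show ?thesis using nota by auto
  qed
  let ?xs = "(g1 @ tl g2) @ tl g3"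
  have ne: "g1 \<noteq> []" "g2 \<noteq> []" "g3 \<noteq> []" and pa: "apath g1" "apath g2" "apath g3"
    using g1 g2 g3 by (auto simp: saw_def)
  have tlp: "apath (xs @ tl ys)" "last (xs @ tl ys) = last ys" "hd (xs @ tl ys) = hd xs"
    if "apath xs" "apath ys" "xs \<noteq> []" "ys \<noteq> []" "hd ys = last xs" for xs ys
    using that by (cases ys; cases "tl ys"; auto simp: successively_append_iff)+
  have p1: "apath (g1 @ tl g2)" "last (g1 @ tl g2) = z1" "hd (g1 @ tl g2) = last a"
    using tlp[OF pa(1,2) ne(1,2)] g1 g2 by auto
  have p2: "apath ?xs" "last ?xs = hd b" "hd ?xs = last a"
    using tlp[OF p1(1) pa(3) _ ne(3)] ne p1 g3 by auto
  obtain ys where ys: "saw ys" "hd ys = last a" "last ys = hd b" "set ys \<subseteq> set ?xs"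
    using loop_erasure[OF p2(1)] p2(2,3) ne by auto
  have sx: "set ?xs \<subseteq> set g1 \<union> set g2 \<union> set g3" by (auto dest: list.set_sel(2)[OF ne(2)] list.set_sel(2)[OF ne(3)])
  have Y: "(y \<in> set a \<longrightarrow> y = last a) \<and> (y \<in> set b \<longrightarrow> y = hd b) \<and> d z y \<le> Cpl + Ca" if "y \<in> set ys" for y
    using ys(4) sx G1 G2 G3 that by blast
  have lh: "last a \<noteq> hd b" using ab an bn by (metis disjoint_iff hd_in_set last_in_set)
  obtain q where q: "ys = last a # q @ [hd b]"
  proof -
    obtain ys' where y': "ys = last a # ys'" using ys(1,2) by (cases ys) (auto simp: saw_def)
    then have "ys' \<noteq> []" using ys(3) lh by auto
    then have "ys' = butlast ys' @ [hd b]" using ys(3) y' by (metis append_butlast_last_id last_ConsR)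
    then show ?thesis using that y' by metis
  qed
  have dq: "distinct ys" "apath ys" using ys(1) by (auto simp: saw_def)
  have "set q \<inter> set a = {}" "set q \<inter> set b = {}" using Y q dq(1) by auto
  moreover have "saw (a @ q @ b)"
  proof -
    have "apath (a @ q @ b)"
    proof -
      obtain x bs where x: "b = x # bs" using bn by (cases b) auto
      then show ?thesis
        using an bn(2) dq(2) q by (cases q) (auto simp: successively_append_iff successively_Cons hd_append)
    qed
    then show ?thesis using calculation ab a(1) b(1) dq(1) q an by (auto simp: saw_def)
  qed
  moreover have "length q \<le> Cq"
  proof -
    have "length ys = card (set ys)" using dq(1) by (simp add: distinct_card)
    also have "\<dots> \<le> card (set g1 \<union> set g2 \<union> set g3)" using ys(4) sx by (intro card_mono) auto
    also have "\<dots> \<le> card (set g1) + card (set g2) + card (set g3)"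
      by (meson add_right_mono card_Un_le order_trans)
    also have "\<dots> \<le> length g1 + length g2 + length g3" by (intro add_mono card_length)
    finally show ?thesis using q g1(4) g2(4) g3(4) da db far by (simp add: Cq_def)
  qed
  moreover have "set q \<subseteq> B z (Cpl + Ca)"
  proof
    fix y assume "y \<in> set q"
    then have "d z y \<le> Cpl + Ca" using Y[of y] q by simp
    then show "y \<in> B z (Cpl + Ca)" by simp
  qed
  ultimately show ?thesis by blast
qed

text \<open>In a glued walk the moved part begins at most \<open>Cq + 1\<close> steps after the
  fixed piece ends. \<open>Cs\<close> counts the vertices of such a stretch, both ends
  included.\<close>

definition C1 :: nat where "C1 = Cq + 1"
definition Cs :: nat where "Cs = Cq + 2"
definition D2 :: nat where "D2 = 2 * Ca + Cpl + R + 1"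

type_synonym 'b entry = "bool \<times> 'b list \<times> 'b \<times> 'b \<times> 'b \<times> 'b list"

text \<open>Keeps consecutive operations apart, so that what is attached later comes no closer to
  the anchor \<open>z0\<close> than the start of the piece; see \<open>glued_exists\<close>.\<close>

fun nextfar :: "'a \<Rightarrow> 'a entry list \<Rightarrow> bool" where
  "nextfar z0 [] = True"
| "nextfar z0 ((f, sg, z, z', e, p') # es) = (D2 \<le> d z0 z)"

text \<open>A script \<open>(p, es)\<close> records a walk cut into pieces. At each entry the walk leaves its current
  piece near the centre \<open>z\<close> and the following piece \<open>p'\<close>, anchored at \<open>z'\<close>, is to be moved into the
  half-space of \<open>e\<close>. The flag distinguishes marks from turns; turns happen at cuts whose far side
  contains the target \<open>t\<close> and move the following piece away from \<open>t\<close>.\<close>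
fun validS :: "'a \<Rightarrow> 'a list \<Rightarrow> 'a entry list \<Rightarrow> bool" where
  "validS t p [] = saw p"
| "validS t p ((f, sg, z, z', e, p') # es) = (saw p \<and> endA p z \<and> startA p' z' \<and> sg \<noteq> [] \<and> apath sg \<and>
     hd sg = last p \<and> last sg = hd p' \<and> length sg \<le> Cs \<and> d z e = Suc R \<and> infinite (CP z e) \<and> e \<notin> CP z (last p) \<and>
     (f \<longrightarrow> sg = [last p]) \<and>
     (\<not> f \<longrightarrow> CP z (last p) \<inter> CP z' (hd p') = {} \<and> t \<in> CP z' (hd p') \<and> t \<notin> CP z e) \<and>
     nextfar z' es \<and> validS t p' es)"

text \<open>A relation rather than a function, as only the existence of a connector \<open>q\<close>
  is known. The conditions on \<open>u\<close> are recorded because reading a script off its result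
  relies on them.\<close>

inductive glued :: "'a list \<Rightarrow> 'a entry list \<Rightarrow> 'a list \<Rightarrow> bool" where
  glued_Nil: "glued p [] p"
| glued_Cons: "glued p' es u \<Longrightarrow> saw (p @ q @ map (place z e z' (hd p')) u) \<Longrightarrow> length q \<le> Cq \<Longrightarrow>
    set q \<subseteq> B z (Cpl + Ca) \<Longrightarrow> startA u z' \<Longrightarrow> hd u = hd p' \<Longrightarrow> saw u \<Longrightarrow>
    glued p ((f, sg, z, z', e, p') # es) (p @ q @ map (place z e z' (hd p')) u)"

text \<open>The automorphism \<open>place\<close> turns the half-space of the remainder away from
  \<open>z\<close>, which nests it in the half-space of \<open>e\<close>.\<close>

lemma moved_sub:
  assumes "d z e = Suc R" "infinite (CP z e)" "startA u z'" "hd u = x" "saw u" "y \<in> set u"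
  shows "place z e z' x y \<in> CP z e"
proof -
  have x: "R < d z' x" using assms(3,4) by (simp add: startA_def)
  note P = place[OF assms(1,2) x]
  have "y \<in> CP z' x" using startA_sub[of u z' y] assms by (auto simp: saw_def)
  then have "place z e z' x y \<in> CP (place z e z' x z') (place z e z' x x)" using Cp_Gam_iff[OF P(1)] by simp
  then have "place z e z' x y \<in> CP z (place z e z' x z')"
    using Cp_nest[of R z "place z e z' x z'"] P(3,4) by (simp add: L_def)
  then show ?thesis using P(2) Cp_eq by metis
qed

text \<open>Gluing proceeds from the back. To be glued again, the partial result must still start
  nearest to its anchor, so this property is carried through the induction.\<close>

lemma glued_exists: "validS t p es \<Longrightarrow> \<exists>u. glued p es u \<and> saw u \<and> hd u = hd p \<and>
    (\<forall>z0. startA p z0 \<longrightarrow> nextfar z0 es \<longrightarrow> startA u z0)"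
proof (induction es arbitrary: p)
  case Nil then show ?case by (intro exI[of _ p]) (auto intro: glued_Nil)
next
  case (Cons en es)
  obtain f sg z z' e p' where en: "en = (f, sg, z, z', e, p')" by (metis prod.exhaust)
  note v = Cons.prems[unfolded en validS.simps]
  obtain u where u: "glued p' es u" "saw u" "hd u = hd p'" "startA u z'"
    using Cons.IH[of p'] v by blast
  let ?g = "place z e z' (hd p')"
  have x: "R < d z' (hd p')" using v by (simp add: startA_def)
  have P: "?g \<in> Gam" "?g z' \<in> CP z e" "z \<notin> CP (?g z') (?g (hd p'))" "L < d z (?g z')" "d z (?g z') \<le> Cpl"
    using place[of z e z' "hd p'"] x v by auto
  have un: "u \<noteq> []" and pn: "p \<noteq> []" "apath p" using u(2) v by (auto simp: saw_def)
  have n1: "?g z' \<notin> CP z (last p)" using P(2) v Cp_eq Cp_sym by metis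
  have "\<exists>q. saw (p @ q @ map ?g u) \<and> length q \<le> Cq \<and> set q \<subseteq> B z (Cpl + Ca)"
    using v u un P by (intro glue[OF _ _ _ _ n1]) (auto simp: saw_map startA_map hd_map)
  then obtain q where q: "saw (p @ q @ map ?g u)" "length q \<le> Cq" "set q \<subseteq> B z (Cpl + Ca)" by blast
  have "startA (p @ q @ map ?g u) z0" if z0: "startA p z0" "D2 \<le> d z0 z" for z0
  proof -
    have h: "R < d z0 (hd p)" "d z0 (hd p) \<le> Ca" "\<forall>y\<in>set p. d z0 (hd p) \<le> d z0 y" using z0 by (auto simp: startA_def)
    have zz: "d z z0 = d z0 z" by (rule d_sym)
    \<comment> \<open>The anchor \<open>z0\<close> and the piece \<open>p\<close> lie on the same
      side of \<open>z\<close>, the moved part lies on the side of \<open>e\<close>. So the ball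
      about \<open>z\<close> separates the moved part from \<open>z0\<close> and keeps it far
      away.\<close>
    have "hd p \<in> CP z z0" by (rule Cp_near) (use h z0(2) zz in \<open>simp add: D2_def\<close>)
    moreover have "hd p \<in> CP z (last p)" using endA_sub[of p z "hd p"] pn v by auto
    ultimately have eq: "CP z z0 = CP z (last p)" using Cp_eq by metis
    have "d z0 (hd p) \<le> d z0 y" if "y \<in> set q" for y
    proof -
      have "d z y \<le> Cpl + Ca" using q(3) that by auto
      then show ?thesis using d_tri[of z0 z y] d_sym[of z y] h z0(2) by (simp add: D2_def)
    qed
    moreover have "d z0 (hd p) \<le> d z0 (?g y)" if "y \<in> set u" for y
    proof -
      have "?g y \<in> CP z e" using moved_sub[of z e u z' "hd p'" y] u v that by auto
      then have "?g y \<notin> CP z z0" using v eq Cp_eq Cp_sym by metis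
      then have "d z z0 \<le> d z0 (?g y) + R" using zz z0(2) by (intro Cp_dist) (auto simp: D2_def)
      then show ?thesis using zz z0(2) h by (simp add: D2_def)
    qed
    ultimately show ?thesis using h pn by (auto simp: startA_def)
  qed
  moreover have "glued p (en # es) (p @ q @ map ?g u)"
    unfolding en by (rule glued_Cons) (use u q in auto)
  moreover have "hd (p @ q @ map ?g u) = hd p" using pn by simp
  ultimately show ?case using q(1) by (intro exI[of _ "p @ q @ map ?g u"]) (simp add: en)
qed

text \<open>The pattern that gluing leaves behind: the walk up to \<open>i\<close> and the walk from
  \<open>j\<close> on lie in disjoint half-spaces, each anchored at its end. The short stretch in
  between is free.\<close>

definition cut :: "'a list \<Rightarrow> nat \<Rightarrow> bool" where
  "cut a i \<longleftrightarrow> (\<exists>j z z'. i \<le> j \<and> j \<le> i + C1 \<and> j < length a \<and> endA (take (Suc i) a) z \<and> startA (drop j a) z' \<and>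
     CP z (a ! i) \<inter> CP z' (a ! j) = {})"

lemma cut_prefix: assumes "cut u i" "i + C1 < k" "k \<le> length u" shows "cut (take k u) i"
proof -
  obtain j z z' where j: "i \<le> j" "j \<le> i + C1" "j < length u" "endA (take (Suc i) u) z" "startA (drop j u) z'"
    "CP z (u ! i) \<inter> CP z' (u ! j) = {}" using assms(1) by (auto simp: cut_def)
  have jk: "j < k" using j assms by simp
  have "hd (drop j (take k u)) = hd (drop j u)" using jk j(3) assms(3) by (simp add: hd_drop_conv_nth)
  moreover have "set (drop j (take k u)) \<subseteq> set (drop j u)" by (metis drop_take set_take_subset)
  ultimately have "startA (drop j (take k u)) z'" using j(5) by (auto simp: startA_def)
  moreover have "take (Suc i) (take k u) = take (Suc i) u" using jk j(1) by (simp add: min_def)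
  ultimately show ?thesis using j jk assms(3) unfolding cut_def
    by (intro exI[of _ j] exI[of _ z] exI[of _ z']) auto
qed

definition D3 :: nat where "D3 = 3 * Ca + R + 2 * Cs + 1"
text \<open>Cuts near the end points of a piece are not counted, because only the others are certain
  to remain cuts inside a longer walk; see \<open>wit_extend\<close>.\<close>

definition Q :: "'a list \<Rightarrow> nat" where
  "Q p = card {i. i < length p \<and> cut p i \<and> D3 < d (p ! i) (hd p) \<and> D3 < d (p ! i) (last p)}"

lemma card_index_near: assumes "distinct u" shows "card {i. i < length u \<and> d x (u ! i) \<le> r} \<le> NB r"
proof -
  have "card {i. i < length u \<and> d x (u ! i) \<le> r} = card ((!) u ` {i. i < length u \<and> d x (u ! i) \<le> r})"
    using assms by (intro card_image[symmetric]) (auto simp: inj_on_def nth_eq_iff_index_eq)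
  also have "\<dots> \<le> NB r" by (rule card_le_NB[of _ x]) auto
  finally show ?thesis .
qed

text \<open>The moved remainder is anchored at the image of \<open>z'\<close> and turned away from
  \<open>z\<close>, so the first operation of a script shows in the result as a cut. This limits the
  candidates for its position.\<close>

lemma mark_cut: assumes v: "validS t p (en # es)" and g: "glued p (en # es) u"
  shows "cut u (length p - 1)" "take (length p) u = p" "p \<noteq> []" "length p < length u" "saw u"
proof -
  obtain f sg z z' e p' where en: "en = (f, sg, z, z', e, p')" by (metis prod.exhaust)
  note v = v[unfolded en validS.simps]
  let ?g = "place z e z' (hd p')"
  obtain q u' where u: "u = p @ q @ map ?g u'" "glued p' es u'" "saw u" "length q \<le> Cq"
    "startA u' z'" "hd u' = hd p'" "saw u'"
    using g[unfolded en] by (cases rule: glued.cases) auto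
  have P: "?g \<in> Gam" "?g z' \<in> CP z e" "z \<notin> CP (?g z') (?g (hd p'))" "L < d z (?g z')"
    using place[of z e z' "hd p'"] v by (auto simp: startA_def)
  have un: "u' \<noteq> []" using u(7) by (auto simp: saw_def)
  show pn: "p \<noteq> []" using v by (auto simp: saw_def)
  show "take (length p) u = p" using u by simp
  show "length p < length u" using u(1) un by simp
  show "saw u" using u by simp
  define j where "j = length p + length q"
  have dj: "drop j u = map ?g u'" using u(1) by (simp add: j_def)
  have uj: "u ! j = ?g (hd p')" using u(1,6) un by (simp add: j_def nth_append hd_conv_nth)
  have ui: "u ! (length p - 1) = last p" using u(1) pn by (simp add: nth_append last_conv_nth)
  have n1: "?g z' \<notin> CP z (last p)" using P(2) v Cp_eq Cp_sym by metis
  have "CP z (last p) \<inter> CP (?g z') (?g (hd p')) = {}"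
    by (rule Cp_apart) (use n1 P in \<open>auto simp: L_def\<close>)
  moreover have "endA (take (Suc (length p - 1)) u) z" using u(1) pn v by simp
  moreover have "startA (drop j u) (?g z')" unfolding dj using startA_map[OF P(1) un] u(5) by simp
  moreover have "length p - 1 \<le> j" "j \<le> length p - 1 + C1" "j < length u"
    using u pn un by (auto simp: j_def C1_def Suc_le_eq)
  ultimately show "cut u (length p - 1)" unfolding cut_def ui[symmetric] uj[symmetric] by blast
qed

definition D1 :: nat where "D1 = 5 * Ca + Cpl + Cs + 3 * R + 10"

text \<open>Since turns move the rest of the walk away from the target, the place of the first turn can
  be read off from the result, up to a bounded distance.\<close>
lemma turn_close:
  assumes v1: "validS t p1 ((False, sg1, z1, z1', e1, p1') # es1)" and g1: "glued p1 ((False, sg1, z1, z1', e1, p1') # es1) u"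
    and v2: "validS t p2 ((False, sg2, z2, z2', e2, p2') # es2)" and g2: "glued p2 ((False, sg2, z2, z2', e2, p2') # es2) u"
    and len: "length p1 < length p2"
  shows "d (last p1) (last p2) \<le> D1"
proof (rule ccontr)
  assume far: "\<not> ?thesis"
  let ?g = "place z1 e1 z1' (hd p1')"
  obtain q u' where u: "u = p1 @ q @ map ?g u'" "set q \<subseteq> B z1 (Cpl + Ca)" "startA u' z1'" "hd u' = hd p1'" "saw u'"
    using g1 by (cases rule: glued.cases) auto
  have pn: "p1 \<noteq> []" "p2 \<noteq> []" using mark_cut(3)[OF v1 g1] mark_cut(3)[OF v2 g2] by auto
  have p2: "p2 = take (length p2) u" using mark_cut(2)[OF v2 g2] by simp
  have lp2: "length p2 < length u" by (rule mark_cut(4)[OF v2 g2])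
  have e2: "endA p2 z2" "saw p2" "startA p2' z2'" "CP z2 (last p2) \<inter> CP z2' (hd p2') = {}" "t \<in> CP z2' (hd p2')"
    "sg2 \<noteq> []" "apath sg2" "hd sg2 = last p2" "last sg2 = hd p2'" "length sg2 \<le> Cs" using v2 by auto
  have e1: "d z1 e1 = Suc R" "infinite (CP z1 e1)" "t \<notin> CP z1 e1" "d z1 (last p1) \<le> Ca" using v1 by (auto simp: endA_def)
  have "last p2 = u ! (length p2 - 1)" using p2 pn(2) lp2 by (metis diff_less last_conv_nth length_greater_0_conv nth_take zero_less_one)
  also have "\<dots> = (q @ map ?g u') ! (length p2 - 1 - length p1)"
    unfolding u(1) using len by (subst nth_append) auto
  finally have nth: "last p2 = (q @ map ?g u') ! (length p2 - 1 - length p1)" .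
  have "length u = length p1 + length (q @ map ?g u')" using u(1) by simp
  then have "length p2 - 1 - length p1 < length (q @ map ?g u')" using len lp2 by linarith
  then have "last p2 \<in> set (q @ map ?g u')" unfolding nth by (rule nth_mem)
  moreover have "last p2 \<notin> set q"
  proof
    assume "last p2 \<in> set q"
    then have "d z1 (last p2) \<le> Cpl + Ca" using u(2) by auto
    then show False using far d_tri[of "last p1" "last p2" z1] d_sym[of "last p1" z1] e1(4) by (simp add: D1_def)
  qed
  ultimately obtain y where y: "y \<in> set u'" "last p2 = ?g y" by auto
  \<comment> \<open>Beyond the first turn all but the short connector lies in the half-space of
    \<open>e1\<close>, which misses \<open>t\<close>. Hence \<open>z2'\<close> sees \<open>t\<close>
    on the side of \<open>z1\<close>, together with \<open>last p1\<close>. But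
    \<open>last p1\<close> belongs to \<open>p2\<close>, which is on the other side of the second
    turn.\<close>
  have inE: "last p2 \<in> CP z1 e1" unfolding y(2) by (rule moved_sub) (use e1 u y in auto)
  have dz: "d z1 (last p2) > D1 - Ca"
    using far d_tri[of "last p1" "last p2" z1] d_sym[of "last p1" z1] e1(4) by (simp add: D1_def)
  have ds: "d (last p2) (hd p2') \<le> Cs"
    using path_dist[of sg2 "last sg2"] e2 by (metis last_in_set less_imp_le order_trans)
  have "d (hd p2') z2' \<le> Ca" using e2(3) d_sym by (auto simp: startA_def)
  then have d2: "d (last p2) z2' \<le> Ca + Cs" using ds d_tri[of "last p2" z2' "hd p2'"] by linarith
  have "z2' \<in> CP z1 (last p2)" by (rule Cp_near) (use d2 dz in \<open>simp add: D1_def\<close>)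
  then have zE: "z2' \<in> CP z1 e1" using inE Cp_eq by metis
  have dzz: "d z1 z2' > 2 * Ca + Cpl + 2 * R"
    using dz d2 d_tri[of z1 "last p2" z2'] d_sym[of "last p2" z2'] by (simp add: D1_def)
  have "t \<notin> CP z1 z2'" using zE e1(3) Cp_eq by metis
  then have "t \<in> CP z2' z1" using cover[of R z1 z2' t] dzz by simp
  then have eq: "CP z2' (hd p2') = CP z2' z1" using e2(5) Cp_eq by metis
  have "last p1 \<in> CP z2' z1" by (rule Cp_near) (use e1(4) dzz d_sym[of z1 z2'] in simp)
  moreover have "last p1 \<in> CP z2 (last p2)"
  proof (rule endA_sub)
    have "last p1 = u ! (length p1 - 1)" using u(1) pn by (simp add: nth_append last_conv_nth)
    moreover have "length p1 - 1 < length p2" using len by simp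
    ultimately show "last p1 \<in> set p2" using p2 lp2 by (metis in_set_conv_nth nth_take)
  qed (use e2 in \<open>auto simp: saw_def\<close>)
  ultimately show False using e2(4) eq by blast
qed

text \<open>Marks and turns weigh \<open>ca\<close> and \<open>cb\<close>. The factor \<open>s\<close> per cut pays for the ambiguity in locating the
  marks: every mark becomes a cut of the glued walk.\<close>
fun om :: "real \<Rightarrow> real \<Rightarrow> real \<Rightarrow> real \<Rightarrow> 'a list \<Rightarrow> 'a entry list \<Rightarrow> real" where
  "om s \<zeta> ca cb p [] = s ^ Q p * W \<zeta> p"
| "om s \<zeta> ca cb p ((f, sg, z, z', e, p') # es) =
     s ^ Q p * W \<zeta> p * (if f then ca else cb) * W \<zeta> sg * om s \<zeta> ca cb p' es"

lemma om_nonneg: "0 \<le> s \<Longrightarrow> 0 \<le> \<zeta> \<Longrightarrow> 0 \<le> ca \<Longrightarrow> 0 \<le> cb \<Longrightarrow> 0 \<le> om s \<zeta> ca cb p es"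
  by (induction s \<zeta> ca cb p es rule: om.induct) auto

definition Fib :: "'a \<Rightarrow> nat \<Rightarrow> 'a \<Rightarrow> 'a list \<Rightarrow> ('a list \<times> 'a entry list) set" where
  "Fib t n v u = {(p, es). validS t p es \<and> hd p = v \<and> length es = n \<and> glued p es u}"

definition Cw :: nat where "Cw = Ca + Cs + R + 1"
text \<open>What has to be known about an operation besides its kind and its position
  \<open>x\<close>: the removed segment, both centres, the half-space and the length of the
  connector. All of it is confined to a bounded region, whence the constant
  \<open>Kd\<close>.\<close>

definition Dat :: "'a \<Rightarrow> ('a list \<times> 'a \<times> 'a \<times> 'a \<times> nat) set" where
  "Dat x = {xs. set xs \<subseteq> B x Cw \<and> length xs \<le> Cs} \<times> B x Cw \<times> B x Cw \<times> B x Cw \<times> {..Cq}"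
definition Kd :: real where "Kd = real ((\<Sum>i\<le>Cs. NB Cw ^ i) * (NB Cw * (NB Cw * (NB Cw * (Cq + 1)))))"

lemma finite_Dat: "finite (Dat x)" and card_Dat: "real (card (Dat x)) = Kd"
proof -
  have "finite {xs. set xs \<subseteq> B x Cw \<and> length xs \<le> Cs}" using finite_lists_length_le[OF finite_B] .
  then show "finite (Dat x)" unfolding Dat_def by (simp add: finite_B del: in_B)
  have "card (Dat x) = (\<Sum>i\<le>Cs. NB Cw ^ i) * (NB Cw * (NB Cw * (NB Cw * (Cq + 1))))"
    unfolding Dat_def card_cartesian_product card_lists_length_le[OF finite_B] card_B by simp
  then show "real (card (Dat x)) = Kd" by (simp add: Kd_def)
qed
lemma Kd_nonneg: "Kd \<ge> 0" by (simp only: Kd_def of_nat_0_le_iff)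

text \<open>The price of one operation in weight: the removed segment weighs at most
  \<open>M ^ Cs\<close>, and the added connector at least
  \<open>\<zeta>0 ^ (Cq + 1)\<close>.\<close>

definition Kw :: "real \<Rightarrow> real" where "Kw \<zeta>0 = M ^ Cs * (1 / \<zeta>0) ^ (Cq + 1)"

definition first_op :: "bool \<Rightarrow> 'a \<Rightarrow> 'a \<Rightarrow> 'a list \<Rightarrow> nat set" where
  "first_op f t v u = {length p - 1 | p sg z z' e p' es. validS t p ((f, sg, z, z', e, p') # es) \<and>
     hd p = v \<and> glued p ((f, sg, z, z', e, p') # es) u}"

lemma first_op_sub: "first_op f t v u \<subseteq> {..<length u}"
proof
  fix i assume "i \<in> first_op f t v u"
  then obtain p en es where "i = length p - 1" "validS t p (en # es)" "glued p (en # es) u"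
    unfolding first_op_def by blast
  then show "i \<in> {..<length u}" using mark_cut(4)[of t p en es u] by simp
qed

text \<open>All earlier candidates are cuts of \<open>u\<close>. They are counted by
  \<open>Q\<close> of the prefix unless they are among its last \<open>C1\<close> positions or
  within \<open>D3\<close> of its end vertices. So \<open>Q\<close> of the prefix grows with the
  rank of the candidate, and \<open>rank_sum\<close> applies.\<close>

lemma first_marks: fixes s :: real assumes s: "0 < s" "s < 1" and u: "saw u"
  shows "(\<Sum>i\<in>first_op True t v u. s ^ Q (take (Suc i) u)) \<le> (1 / s) ^ (C1 + 2 * NB D3) / (1 - s)"
proof (rule rank_sum[OF _ s(1) s(2)])
  let ?I = "first_op True t v u"
  show "finite ?I" by (rule finite_subset[OF first_op_sub]) simp
  fix i assume i: "i \<in> ?I"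
  have il: "i < length u" using i first_op_sub by blast
  have cuts: "cut u k" if k: "k \<in> ?I" for k
  proof -
    obtain p en es where "k = length p - 1" "validS t p (en # es)" "glued p (en # es) u"
      using k unfolding first_op_def by blast
    then show ?thesis using mark_cut(1)[of t p en es u] by simp
  qed
  let ?p = "take (Suc i) u"
  have lp: "length ?p = Suc i" using il by simp
  have dp: "distinct ?p" using u by (simp add: saw_def)
  let ?X = "{k. k < length ?p \<and> cut ?p k \<and> D3 < d (?p ! k) (hd ?p) \<and> D3 < d (?p ! k) (last ?p)}"
  have "{j \<in> ?I. j < i} \<subseteq> {i - C1..<i} \<union> ({k. k < length ?p \<and> d (hd ?p) (?p ! k) \<le> D3} \<union>
     ({k. k < length ?p \<and> d (last ?p) (?p ! k) \<le> D3} \<union> ?X))"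
  proof
    fix k assume k: "k \<in> {j \<in> ?I. j < i}"
    show "k \<in> {i - C1..<i} \<union> ({k. k < length ?p \<and> d (hd ?p) (?p ! k) \<le> D3} \<union>
     ({k. k < length ?p \<and> d (last ?p) (?p ! k) \<le> D3} \<union> ?X))"
    proof (cases "k + C1 < Suc i")
      case True
      have "cut ?p k" using cut_prefix[OF cuts True] k il by simp
      then show ?thesis using k lp d_sym[of "?p ! k"] by (auto simp: not_less)
    next
      case False then show ?thesis using k by auto
    qed
  qed
  then have "card {j \<in> ?I. j < i} \<le> card ({i - C1..<i} \<union> ({k. k < length ?p \<and> d (hd ?p) (?p ! k) \<le> D3} \<union>
     ({k. k < length ?p \<and> d (last ?p) (?p ! k) \<le> D3} \<union> ?X)))" by (intro card_mono) auto
  also have "\<dots> \<le> card {i - C1..<i} + (card {k. k < length ?p \<and> d (hd ?p) (?p ! k) \<le> D3} +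
     (card {k. k < length ?p \<and> d (last ?p) (?p ! k) \<le> D3} + card ?X))"
    by (intro order_trans[OF card_Un_le] add_left_mono order_refl)
  also have "\<dots> \<le> C1 + (NB D3 + (NB D3 + Q ?p))"
    unfolding Q_def using card_index_near[OF dp] by (intro add_mono) auto
  finally show "card {j \<in> ?I. j < i} \<le> Q ?p + (C1 + 2 * NB D3)" by simp
qed

lemma first_turns: assumes u: "saw u" shows "card (first_op False t v u) \<le> NB D1"
proof (cases "first_op False t v u = {}")
  case False
  then obtain i where i: "i \<in> first_op False t v u" by blast
  have "first_op False t v u \<subseteq> {k. k < length u \<and> d (u ! i) (u ! k) \<le> D1}"
  proof
    fix k assume k: "k \<in> first_op False t v u"
    obtain p sg z z' e p' es where p: "i = length p - 1" "validS t p ((False, sg, z, z', e, p') # es)"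
      "glued p ((False, sg, z, z', e, p') # es) u" using i by (auto simp: first_op_def)
    obtain r sg2 z2 z2' e2 r' es2 where r: "k = length r - 1" "validS t r ((False, sg2, z2, z2', e2, r') # es2)"
      "glued r ((False, sg2, z2, z2', e2, r') # es2) u" using k by (auto simp: first_op_def)
    have ui: "u ! i = last p" and uk: "u ! k = last r"
      using mark_cut(2-4)[OF p(2,3)] mark_cut(2-4)[OF r(2,3)] p(1) r(1)
      by (metis diff_less last_conv_nth length_greater_0_conv nth_take zero_less_one)+
    consider "length p < length r" | "length r < length p" | "length p = length r" by linarith
    then have "d (last p) (last r) \<le> D1"
    proof cases
      case 1 then show ?thesis using turn_close[OF p(2,3) r(2,3)] by simp
    next
      case 2 then show ?thesis using turn_close[OF r(2,3) p(2,3)] d_sym by simp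
    next
      case 3
      then have "p = r" using mark_cut(2)[OF p(2,3)] mark_cut(2)[OF r(2,3)] by metis
      then show ?thesis by simp
    qed
    then show "k \<in> {k. k < length u \<and> d (u ! i) (u ! k) \<le> D1}"
      using ui uk subsetD[OF first_op_sub k] by auto
  qed
  then have "card (first_op False t v u) \<le> card {k. k < length u \<and> d (u ! i) (u ! k) \<le> D1}"
    by (intro card_mono) auto
  also have "\<dots> \<le> NB D1" using card_index_near u by (simp add: saw_def)
  finally show ?thesis .
qed simp

text \<open>Scripts are peeled off operation by operation: the position and the bounded data of the
  first operation determine its piece and, once the automorphism is undone, the result of the
  remaining script. By \<open>h1\<close> and \<open>h2\<close> marks and turns contribute at most a
  quarter each, hence the factor \<open>1 / 2\<close> per operation.\<close>

theorem fibre_bound: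
  assumes s: "0 < s" "s < 1" and z0: "0 < \<zeta>0" "\<zeta>0 \<le> \<zeta>" "\<zeta> \<le> 1" and cc: "0 \<le> ca" "0 \<le> cb"
    and h1: "Kd * Kw \<zeta>0 * ca * ((1 / s) ^ (C1 + 2 * NB D3) / (1 - s)) \<le> 1 / 4"
    and h2: "Kd * Kw \<zeta>0 * cb * NB D1 \<le> 1 / 4"
  shows "finite (Fib t n v u) \<and> (\<Sum>(p, es)\<in>Fib t n v u. om s \<zeta> ca cb p es) \<le> (1 / 2) ^ n * W \<zeta> u"
proof (induction n arbitrary: v u)
  case 0
  have sub: "Fib t 0 v u \<subseteq> {(u, [])}" by (auto simp: Fib_def elim: glued.cases)
  have "(\<Sum>(p, es)\<in>Fib t 0 v u. om s \<zeta> ca cb p es) \<le> (\<Sum>(p, es)\<in>{(u, [])}. om s \<zeta> ca cb p es)"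
    using sub s z0 by (intro sum_mono2) auto
  also have "\<dots> \<le> 1 * W \<zeta> u"
    using s z0 mult_right_mono[of "s ^ Q u" 1 "W \<zeta> u"] by (simp add: power_le_one)
  finally show ?case using sub by (auto intro: finite_subset)
next
  case (Suc n)
  show ?case
  proof (cases "Fib t (Suc n) v u = {}")
    case True then show ?thesis using z0 by simp
  next
    case False
    have su: "saw u"
    proof -
      obtain p en es where "validS t p (en # es)" "glued p (en # es) u"
        using False by (auto simp: Fib_def length_Suc_conv)
      then show ?thesis by (rule mark_cut(5))
    qed
    have zp: "\<zeta> > 0" using z0 by simp
    define Key where "Key = {(f, i, sg, z, z', e, l). i \<in> first_op f t v u \<and> (sg, z, z', e, l) \<in> Dat (u ! i) \<and>
      Suc i + l < length u \<and> d z e = Suc R \<and> infinite (CP z e) \<and> R < d z' (last sg)}"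
    \<comment> \<open>The remaining script starts at \<open>last sg\<close> and has to produce what
      is left of \<open>u\<close> behind the connector, moved back.\<close>
    define rest where "rest = (\<lambda>(f :: bool, i, sg, z, z', e, l).
      (last sg, map (inv (place z e z' (last sg))) (drop (Suc i + l) u)))"
    define wk where "wk = (\<lambda>(f, i, sg, z :: 'a, z' :: 'a, e :: 'a, l :: nat).
      s ^ Q (take (Suc i) u) * W \<zeta> (take (Suc i) u) * (if f then ca else cb) * W \<zeta> sg)"
    let ?T = "\<lambda>key. Fib t n (fst (rest key)) (snd (rest key))"
    have IH: "finite (Fib t n v' u')" "(\<Sum>(p, es)\<in>Fib t n v' u'. om s \<zeta> ca cb p es) \<le> (1 / 2) ^ n * W \<zeta> u'" for v' u'
      using Suc.IH by auto
    have Keysub: "Key \<subseteq> (\<Union>f\<in>UNIV. Pair f ` (SIGMA i:first_op f t v u. Dat (u ! i)))"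
      by (auto simp: Key_def image_iff)
    have finfo: "finite (first_op f t v u)" for f by (rule finite_subset[OF first_op_sub]) simp
    have finS: "finite (SIGMA i:first_op f t v u. Dat (u ! i))" for f using finfo finite_Dat by auto
    then have finK: "finite Key" using Keysub by (rule_tac finite_subset) auto
    define pre where "pre = (\<lambda>(p :: 'a list, es) ((f, i, sg, z, z', e, l), (p', es')).
      es = (f, sg, z, z', e, p') # es' \<and> i = length p - 1 \<and> (f, i, sg, z, z', e, l) \<in> Key \<and>
      (p', es') \<in> ?T (f, i, sg, z, z', e, l))"
    have ex: "\<exists>k. pre x k" if x: "x \<in> Fib t (Suc n) v u" for x
    proof -
      obtain p f sg z z' e p' es where px: "x = (p, (f, sg, z, z', e, p') # es)" "validS t p ((f, sg, z, z', e, p') # es)"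
        "hd p = v" "length es = n" "glued p ((f, sg, z, z', e, p') # es) u"
        using x by (auto simp: Fib_def length_Suc_conv)
      note v = px(2)[unfolded validS.simps]
      let ?g = "place z e z' (hd p')"
      obtain q u' where u: "u = p @ q @ map ?g u'" "glued p' es u'" "length q \<le> Cq" "saw u'"
        using px(5) by (cases rule: glued.cases) auto
      let ?i = "length p - 1"
      have pn: "p \<noteq> []" using v by (auto simp: saw_def)
      have ui: "u ! ?i = last p" using u(1) pn by (simp add: nth_append last_conv_nth)
      have un: "u' \<noteq> []" using u(4) by (auto simp: saw_def)
      have ls: "last sg = hd p'" "R < d z' (last sg)" "d z (last p) \<le> Ca" "d z' (hd p') \<le> Ca" "hd sg = last p"
        using v by (auto simp: startA_def endA_def)
      have G: "?g \<in> Gam" using place(1)[of z e z' "hd p'"] v ls by auto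
      have sgd: "d (last p) y \<le> Cs" if "y \<in> set sg" for y
        using path_dist[of sg y] that v by fastforce
      have "d (last p) (last sg) \<le> Cs" using sgd v last_in_set by blast
      then have "d (last p) z' \<le> Cw" using d_tri[of "last p" z' "last sg"] ls d_sym[of "hd p'" z'] by (simp add: Cw_def)
      moreover have "d (last p) z \<le> Ca" using ls d_sym by simp
      moreover then have "d (last p) e \<le> Cw" using d_tri[of "last p" e z] v by (simp add: Cw_def)
      ultimately have "(sg, z, z', e, length q) \<in> Dat (u ! ?i)"
        unfolding ui using sgd v u(3) by (fastforce simp: Dat_def Cw_def)
      moreover have "?i \<in> first_op f t v u" using px unfolding first_op_def by blast
      ultimately have key: "(f, ?i, sg, z, z', e, length q) \<in> Key"
        using v ls u(1) pn un by (simp add: Key_def)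
      have "map (inv ?g) (drop (Suc ?i + length q) u) = u'"
        using u(1) pn Gam_inv_f[OF G] by (simp add: comp_def)
      then have "(p', es) \<in> ?T (f, ?i, sg, z, z', e, length q)"
        using v u(2) px(4) ls(1) by (simp add: rest_def Fib_def)
      then show ?thesis using key px(1) by (intro exI[of _ "((f, ?i, sg, z, z', e, length q), (p', es))"]) (simp add: pre_def)
    qed
    define h where "h x = (SOME k. pre x k)" for x
    have h: "pre x (h x)" if "x \<in> Fib t (Suc n) v u" for x
      unfolding h_def by (rule someI_ex[OF ex[OF that]])
    \<comment> \<open>The first piece is the prefix of \<open>u\<close> ending at the recorded
      position, so it does not appear in the key.\<close>
    have tk: "fst x = take (Suc (length (fst x) - 1)) u" if x: "x \<in> Fib t (Suc n) v u" for x
    proof -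
      obtain p es' where x': "x = (p, es')" "validS t p es'" "length es' = Suc n" "glued p es' u"
        using x by (auto simp: Fib_def simp del: validS.simps)
      moreover obtain en es where "es' = en # es" using x'(3) by (cases es') auto
      ultimately have "x = (p, en # es)" "validS t p (en # es)" "glued p (en # es) u" by auto
      then show ?thesis using mark_cut(2,3)[of t p en es u] by simp
    qed
    have preD: "\<exists>p f sg z z' e l p' es'. x = (p, (f, sg, z, z', e, p') # es') \<and>
        h x = ((f, length p - 1, sg, z, z', e, l), (p', es')) \<and> fst (h x) \<in> Key \<and> snd (h x) \<in> ?T (fst (h x))"
      if x: "x \<in> Fib t (Suc n) v u" for x
    proof -
      obtain p es where xp: "x = (p, es)" by force
      obtain f i sg z z' e l p' es' where hx: "h x = ((f, i, sg, z, z', e, l), (p', es'))" by (metis prod.exhaust)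
      have "pre (p, es) ((f, i, sg, z, z', e, l), (p', es'))" using h[OF x] xp hx by simp
      note this[unfolded pre_def prod.case]
      then have *: "es = (f, sg, z, z', e, p') # es'" "i = length p - 1" "(f, i, sg, z, z', e, l) \<in> Key"
        "(p', es') \<in> ?T (f, i, sg, z, z', e, l)" by blast+
      show ?thesis
        by (rule exI[of _ p], rule exI[of _ f], rule exI[of _ sg], rule exI[of _ z], rule exI[of _ z'],
            rule exI[of _ e], rule exI[of _ l], rule exI[of _ p'], rule exI[of _ es'])
          (insert * xp hx, hypsubst, simp)
    qed
    have fin: "finite (Sigma Key ?T)" using finK IH(1) by auto
    have inj: "inj_on h (Fib t (Suc n) v u)"
    proof (rule inj_onI)
      fix x y assume x: "x \<in> Fib t (Suc n) v u" and y: "y \<in> Fib t (Suc n) v u" and eq: "h x = h y"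
      have "length (fst x) - 1 = length (fst y) - 1 \<and> snd x = snd y"
        using preD[OF x] preD[OF y] eq by (elim exE conjE) simp
      then show "x = y" using tk[OF x] tk[OF y] by (metis prod.expand)
    qed
    have img: "h ` Fib t (Suc n) v u \<subseteq> Sigma Key ?T"
    proof
      fix k assume "k \<in> h ` Fib t (Suc n) v u"
      then obtain x where x: "x \<in> Fib t (Suc n) v u" "k = h x" by blast
      have k: "fst k \<in> Key" "snd k \<in> ?T (fst k)" using preD[OF x(1)] unfolding x(2)[symmetric] by blast+
      obtain k1 k2 where "k = (k1, k2)" by (cases k)
      then show "k \<in> Sigma Key ?T" using k by (simp only: mem_Sigma_iff fst_conv snd_conv simp_thms)
    qed
    have finF: "finite (Fib t (Suc n) v u)" by (rule inj_on_finite[OF inj img fin])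
    have wk0: "wk key \<ge> 0" for key
      using s z0 cc by (cases key) (auto simp: wk_def)
    have "(\<Sum>(p, es)\<in>Fib t (Suc n) v u. om s \<zeta> ca cb p es)
      \<le> (\<Sum>k\<in>Sigma Key ?T. wk (fst k) * (case snd k of (p, es) \<Rightarrow> om s \<zeta> ca cb p es))"
    proof (rule sum_le_inj[OF fin inj img])
      fix x assume x: "x \<in> Fib t (Suc n) v u"
      show "(case x of (p, es) \<Rightarrow> om s \<zeta> ca cb p es)
         \<le> wk (fst (h x)) * (case snd (h x) of (p, es) \<Rightarrow> om s \<zeta> ca cb p es)"
      proof -
        obtain p f sg z z' e l p' es' where *: "x = (p, (f, sg, z, z', e, p') # es')"
          "h x = ((f, length p - 1, sg, z, z', e, l), (p', es'))" using preD[OF x] by blast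
        have "take (Suc (length p - 1)) u = p" using tk[OF x] *(1) by simp
        then show ?thesis using * by (simp add: wk_def)
      qed
    next
      fix k
      show "0 \<le> wk (fst k) * (case snd k of (p, es) \<Rightarrow> om s \<zeta> ca cb p es)"
        using wk0 om_nonneg[of s \<zeta> ca cb] s z0 cc by (auto split: prod.splits)
    qed
    also have "\<dots> = (\<Sum>key\<in>Key. wk key * (\<Sum>(p, es)\<in>?T key. om s \<zeta> ca cb p es))"
      using sum.Sigma[of Key ?T "\<lambda>key y. wk key * (case y of (p, es) \<Rightarrow> om s \<zeta> ca cb p es)"] finK IH(1)
      by (simp add: sum_distrib_left case_prod_unfold)
    also have "\<dots> \<le> (\<Sum>key\<in>Key. wk key * ((1 / 2) ^ n * W \<zeta> (snd (rest key))))"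
      using IH(2) wk0 by (intro sum_mono mult_left_mono) auto
    also have "\<dots> \<le> (\<Sum>key\<in>Key. (case key of (f, i, dt) \<Rightarrow> s ^ Q (take (Suc i) u) * (if f then ca else cb))
          * (Kw \<zeta>0 * ((1 / 2) ^ n * W \<zeta> u)))"
    proof (rule sum_mono)
      fix key assume k: "key \<in> Key"
      obtain f i sg z z' e l where key: "key = (f, i, sg, z, z', e, l)" by (metis prod.exhaust)
      have kk: "Suc i + l < length u" "d z e = Suc R" "infinite (CP z e)" "R < d z' (last sg)"
        "length sg \<le> Cs" "l \<le> Cq" using k by (auto simp: Key_def key Dat_def)
      have G: "inv (place z e z' (last sg)) \<in> Gam" using place(1)[OF kk(2-4)] Gam_inv by blast
      let ?p = "take (Suc i) u" and ?q = "take l (drop (Suc i) u)" and ?r = "drop (Suc i + l) u"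
      have dec: "u = ?p @ ?q @ ?r" by (metis add.commute append_take_drop_id drop_drop)
      have ne: "?p \<noteq> []" "?r \<noteq> []" using kk(1) by auto
      have "apath u" using su by (simp add: saw_def)
      then have ap: "apath (last ?p # ?q @ [hd ?r])"
      proof -
        obtain x xs where r: "?r = x # xs" using ne(2) by (cases ?r) auto
        obtain y ys where p: "?p = ys @ [y]" using ne(1) by (metis rev_exhaust)
        have "u = ys @ (y # ?q @ [x]) @ xs" using dec p r by simp
        then have "apath (y # ?q @ [x])" using \<open>apath u\<close> by (metis successively_append_iff)
        then show ?thesis using p r by simp
      qed
      have "\<zeta>0 ^ (Cq + 1) \<le> \<zeta> ^ (Cq + 1)" using z0 by (intro power_mono) auto
      also have "\<dots> \<le> \<zeta> ^ (length (last ?p # ?q @ [hd ?r]) - 1)"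
        using z0 kk(1,6) by (intro power_decreasing) auto
      also have "\<dots> \<le> W \<zeta> (last ?p # ?q @ [hd ?r])" by (rule W_ge[OF ap zp])
      finally have wq: "\<zeta>0 ^ (Cq + 1) \<le> W \<zeta> (last ?p # ?q @ [hd ?r])" .
      have "W \<zeta> sg \<le> M ^ Cs * 1"
        unfolding W_def
      proof (rule mult_mono)
        show "wt sg \<le> M ^ Cs" using wt_le[of sg] power_increasing[OF kk(5) M_ge1] by linarith
      qed (use z0 M_ge1 in \<open>auto simp: power_le_one\<close>)
      then have wsg: "W \<zeta> sg \<le> M ^ Cs" by simp
      have "W \<zeta> ?p * \<zeta>0 ^ (Cq + 1) * W \<zeta> ?r \<le> W \<zeta> ?p * W \<zeta> (last ?p # ?q @ [hd ?r]) * W \<zeta> ?r"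
        using wq z0 by (intro mult_right_mono mult_left_mono) auto
      also have "\<dots> = W \<zeta> u" using W_join[OF ne, of \<zeta> ?q] dec by simp
      finally have w1: "W \<zeta> ?p * W \<zeta> ?r \<le> (1 / \<zeta>0) ^ (Cq + 1) * W \<zeta> u"
        using z0 by (simp add: field_simps power_divide)
      have "W \<zeta> sg * (W \<zeta> ?p * W \<zeta> ?r) \<le> M ^ Cs * ((1 / \<zeta>0) ^ (Cq + 1) * W \<zeta> u)"
        by (rule mult_mono[OF wsg w1]) (use z0 M_ge1 in auto)
      then have w2: "W \<zeta> ?p * W \<zeta> sg * W \<zeta> ?r \<le> Kw \<zeta>0 * W \<zeta> u" by (simp add: Kw_def mult_ac)
      have "wk key * ((1 / 2) ^ n * W \<zeta> (snd (rest key)))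
        = (s ^ Q ?p * (if f then ca else cb) * (1 / 2) ^ n) * (W \<zeta> ?p * W \<zeta> sg * W \<zeta> ?r)"
        by (simp add: wk_def rest_def key W_map[OF G])
      also have "\<dots> \<le> (s ^ Q ?p * (if f then ca else cb) * (1 / 2) ^ n) * (Kw \<zeta>0 * W \<zeta> u)"
        using w2 s cc by (intro mult_left_mono) auto
      finally show "wk key * ((1 / 2) ^ n * W \<zeta> (snd (rest key)))
        \<le> (case key of (f, i, dt) \<Rightarrow> s ^ Q (take (Suc i) u) * (if f then ca else cb)) * (Kw \<zeta>0 * ((1 / 2) ^ n * W \<zeta> u))"
        by (simp add: key mult_ac)
    qed
    also have "\<dots> = (\<Sum>key\<in>Key. (case key of (f, i, dt) \<Rightarrow> s ^ Q (take (Suc i) u) * (if f then ca else cb)))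
          * (Kw \<zeta>0 * ((1 / 2) ^ n * W \<zeta> u))" by (simp add: sum_distrib_right)
    also have "\<dots> \<le> (Kd * ca * ((1 / s) ^ (C1 + 2 * NB D3) / (1 - s)) + Kd * cb * NB D1) * (Kw \<zeta>0 * ((1 / 2) ^ n * W \<zeta> u))"
    proof (rule mult_right_mono)
      let ?F = "\<lambda>f i. s ^ Q (take (Suc i) u) * (if f then ca else cb)"
      have "(\<Sum>key\<in>Key. (case key of (f, i, dt) \<Rightarrow> ?F f i))
        \<le> (\<Sum>key\<in>(\<Union>f\<in>UNIV. Pair f ` (SIGMA i:first_op f t v u. Dat (u ! i))). (case key of (f, i, dt) \<Rightarrow> ?F f i))"
        using Keysub finS s cc by (intro sum_mono2) auto
      also have "\<dots> = (\<Sum>f\<in>UNIV. \<Sum>key\<in>Pair f ` (SIGMA i:first_op f t v u. Dat (u ! i)). (case key of (f, i, dt) \<Rightarrow> ?F f i))"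
        using finS by (intro sum.UNION_disjoint) auto
      also have "\<dots> = (\<Sum>f\<in>UNIV. \<Sum>i\<in>first_op f t v u. ?F f i * Kd)"
      proof (rule sum.cong[OF refl])
        fix f :: bool
        have "(\<Sum>key\<in>Pair f ` (SIGMA i:first_op f t v u. Dat (u ! i)). (case key of (f, i, dt) \<Rightarrow> ?F f i))
          = (\<Sum>(i, dt)\<in>(SIGMA i:first_op f t v u. Dat (u ! i)). ?F f i)"
          by (subst sum.reindex) (auto simp: inj_on_def case_prod_unfold)
        also have "\<dots> = (\<Sum>i\<in>first_op f t v u. \<Sum>dt\<in>Dat (u ! i). ?F f i)"
          using finfo finite_Dat by (intro sum.Sigma[symmetric]) auto
        finally show "(\<Sum>key\<in>Pair f ` (SIGMA i:first_op f t v u. Dat (u ! i)). (case key of (f, i, dt) \<Rightarrow> ?F f i))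
           = (\<Sum>i\<in>first_op f t v u. ?F f i * Kd)" by (simp add: card_Dat mult.commute)
      qed
      also have "\<dots> = (\<Sum>i\<in>first_op True t v u. s ^ Q (take (Suc i) u)) * (ca * Kd)
          + (\<Sum>i\<in>first_op False t v u. s ^ Q (take (Suc i) u)) * (cb * Kd)"
        by (simp add: UNIV_bool sum_distrib_right sum_distrib_left mult_ac)
      also have "\<dots> \<le> ((1 / s) ^ (C1 + 2 * NB D3) / (1 - s)) * (ca * Kd) + NB D1 * (cb * Kd)"
      proof (intro add_mono mult_right_mono first_marks[OF s su])
        have "(\<Sum>i\<in>first_op False t v u. s ^ Q (take (Suc i) u)) \<le> (\<Sum>i\<in>first_op False t v u. 1)"
          using s by (intro sum_mono) (auto simp: power_le_one)
        also have "\<dots> \<le> real (NB D1)" using first_turns[OF su] by simp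
        finally show "(\<Sum>i\<in>first_op False t v u. s ^ Q (take (Suc i) u)) \<le> real (NB D1)" .
      qed (use cc Kd_nonneg in auto)
      finally show "(\<Sum>key\<in>Key. (case key of (f, i, dt) \<Rightarrow> ?F f i))
         \<le> Kd * ca * ((1 / s) ^ (C1 + 2 * NB D3) / (1 - s)) + Kd * cb * NB D1" by (simp add: mult_ac)
    qed (use z0 M_ge1 in \<open>auto simp: Kw_def\<close>)
    also have "\<dots> = (Kd * Kw \<zeta>0 * ca * ((1 / s) ^ (C1 + 2 * NB D3) / (1 - s)) + Kd * Kw \<zeta>0 * cb * NB D1) * ((1 / 2) ^ n * W \<zeta> u)"
      by (simp add: algebra_simps)
    also have "\<dots> \<le> (1 / 4 + 1 / 4) * ((1 / 2) ^ n * W \<zeta> u)"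
      using h1 h2 z0 by (intro mult_right_mono add_mono) auto
    finally show ?thesis using finF by simp
  qed
qed

end

section \<open>Cuts of marked walks\<close>

text \<open>Both ends are included; adjacent slices share a vertex and are rejoined through
  \<open>tl\<close>.\<close>

definition slice :: "'b list \<Rightarrow> nat \<Rightarrow> nat \<Rightarrow> 'b list" where "slice w l r = take (Suc r - l) (drop l w)"

lemma slice_length: "l \<le> r \<Longrightarrow> r < length w \<Longrightarrow> length (slice w l r) = Suc r - l" by (simp add: slice_def)
lemma slice_nth: "l \<le> r \<Longrightarrow> r < length w \<Longrightarrow> k \<le> r - l \<Longrightarrow> slice w l r ! k = w ! (l + k)" by (simp add: slice_def)
lemma slice_ne: "l \<le> r \<Longrightarrow> r < length w \<Longrightarrow> slice w l r \<noteq> []" using slice_length[of l r w] by auto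
lemma slice_hd: "l \<le> r \<Longrightarrow> r < length w \<Longrightarrow> hd (slice w l r) = w ! l"
  using slice_nth[of l r w 0] slice_ne[of l r w] by (simp add: hd_conv_nth)
lemma slice_last: "l \<le> r \<Longrightarrow> r < length w \<Longrightarrow> last (slice w l r) = w ! r"
  using slice_nth[of l r w "r - l"] slice_ne[of l r w] slice_length[of l r w] by (simp add: last_conv_nth Suc_diff_le)
lemma slice_set: assumes "l \<le> r" "r < length w" shows "set (slice w l r) = {w ! k | k. l \<le> k \<and> k \<le> r}"
proof -
  have "set (slice w l r) = {slice w l r ! k | k. k < Suc r - l}"
    using slice_length[OF assms] by (auto simp: set_conv_nth)
  also have "\<dots> = {w ! k | k. l \<le> k \<and> k \<le> r}"
  proof safe
    fix k assume "k < Suc r - l"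
    then show "\<exists>k'. slice w l r ! k = w ! k' \<and> l \<le> k' \<and> k' \<le> r"
      using slice_nth[OF assms, of k] assms by (intro exI[of _ "l + k"]) auto
  next
    fix k assume "l \<le> k" "k \<le> r"
    then show "\<exists>k'. w ! k = slice w l r ! k' \<and> k' < Suc r - l"
      using slice_nth[OF assms, of "k - l"] assms by (intro exI[of _ "k - l"]) auto
  qed
  finally show ?thesis .
qed
lemma slice_drop: "j \<le> r \<Longrightarrow> r < length w \<Longrightarrow> r = length w - 1 \<Longrightarrow> slice w j r = drop j w"
  by (simp add: slice_def)
lemma slice_take: "i < length w \<Longrightarrow> slice w 0 i = take (Suc i) w" by (simp add: slice_def)
lemma slice_glue: assumes "l \<le> i" "i \<le> r" "r < length w"
  shows "slice w l i @ tl (slice w i r) = slice w l r"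
proof -
  have "tl (slice w i r) = take (r - i) (drop (Suc i) w)"
    using assms by (simp add: slice_def tl_take drop_Suc tl_drop Suc_diff_le)
  moreover have "slice w l r = take (Suc i - l + (r - i)) (drop l w)" using assms by (simp add: slice_def)
  moreover have "drop (Suc i - l) (drop l w) = drop (Suc i) w" using assms by (simp add: add.commute)
  ultimately show ?thesis by (simp add: slice_def take_add)
qed

context tgraph begin
lemma slice_apath: "apath w \<Longrightarrow> apath (slice w l r)"
  unfolding slice_def by (metis append_take_drop_id successively_append_iff)
lemma slice_saw: "saw w \<Longrightarrow> l \<le> r \<Longrightarrow> r < length w \<Longrightarrow> saw (slice w l r)"
  using slice_apath[of w l r] slice_ne[of l r w] by (auto simp: saw_def slice_def)
lemma walk_dist: assumes "apath w" "i \<le> j" "j < length w" shows "d (w ! i) (w ! j) \<le> j - i"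
proof -
  have "w ! j \<in> set (slice w i j)" using assms by (auto simp: slice_set)
  then have "d (hd (slice w i j)) (w ! j) < length (slice w i j)"
    using path_dist[OF slice_apath[OF assms(1)] slice_ne[OF assms(2,3)]] by blast
  then show ?thesis using assms by (simp add: slice_hd slice_length)
qed
text \<open>A greedily built separated subset is also a net, so passing to it costs at most the
  factor \<open>NB r\<close>.\<close>

lemma thinning: assumes "finite X"
  shows "\<exists>Y\<subseteq>X. (\<forall>x\<in>Y. \<forall>y\<in>Y. x \<noteq> y \<longrightarrow> r < d x y) \<and> (\<forall>x\<in>X. \<exists>y\<in>Y. d y x \<le> r) \<and> card X \<le> NB r * card Y"
proof -
  have "\<exists>Y\<subseteq>X. (\<forall>x\<in>Y. \<forall>y\<in>Y. x \<noteq> y \<longrightarrow> r < d x y) \<and> (\<forall>x\<in>X. \<exists>y\<in>Y. d y x \<le> r)"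
    using assms
  proof (induction X rule: finite_induct)
    case (insert x X)
    then obtain Y where Y: "Y \<subseteq> X" "\<forall>x\<in>Y. \<forall>y\<in>Y. x \<noteq> y \<longrightarrow> r < d x y" "\<forall>x\<in>X. \<exists>y\<in>Y. d y x \<le> r" by blast
    show ?case
    proof (cases "\<exists>y\<in>Y. d y x \<le> r")
      case True then show ?thesis using Y by (intro exI[of _ Y]) auto
    next
      case False
      then have "\<forall>y\<in>Y. r < d y x \<and> r < d x y" using d_sym by (metis not_le)
      then have "\<forall>a\<in>insert x Y. \<forall>b\<in>insert x Y. a \<noteq> b \<longrightarrow> r < d a b" using Y(2) by auto
      moreover have "\<forall>a\<in>insert x X. \<exists>y\<in>insert x Y. d y a \<le> r" using Y(3) by auto
      moreover have "insert x Y \<subseteq> insert x X" using Y(1) by auto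
      ultimately show ?thesis by blast
    qed
  qed auto
  then obtain Y where Y: "Y \<subseteq> X" "\<forall>x\<in>Y. \<forall>y\<in>Y. x \<noteq> y \<longrightarrow> r < d x y" "\<forall>x\<in>X. \<exists>y\<in>Y. d y x \<le> r" by blast
  have fY: "finite Y" using Y(1) assms finite_subset by blast
  have "X \<subseteq> (\<Union>y\<in>Y. B y r)" using Y(3) by auto
  then have "card X \<le> card (\<Union>y\<in>Y. B y r)" using fY finite_B by (intro card_mono) auto
  also have "\<dots> \<le> (\<Sum>y\<in>Y. card (B y r))" by (rule card_UN_le[OF fY])
  also have "\<dots> = NB r * card Y" by (simp add: card_B)
  finally show ?thesis using Y by blast
qed
end

context tgraph_uni begin

text \<open>A cut relative to the stretch from \<open>l\<close> to \<open>r\<close>, with its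
  witnesses exposed so that the same ones can be tested on a longer stretch.\<close>

definition wit :: "'a list \<Rightarrow> nat \<Rightarrow> nat \<Rightarrow> nat \<Rightarrow> nat \<Rightarrow> 'a \<Rightarrow> 'a \<Rightarrow> bool" where
  "wit w l r i j z z' \<longleftrightarrow> l \<le> i \<and> i \<le> j \<and> j \<le> r \<and> j \<le> i + C1 \<and> endA (slice w l i) z \<and> startA (slice w j r) z' \<and>
     CP z (w ! i) \<inter> CP z' (w ! j) = {}"

lemma cut_slice: assumes "l \<le> r" "r < length w" "cut (slice w l r) k"
  shows "\<exists>j z z'. wit w l r (l + k) j z z'"
proof -
  let ?p = "slice w l r"
  have len: "length ?p = Suc r - l" using slice_length assms by blast
  obtain j z z' where c: "k \<le> j" "j \<le> k + C1" "j < length ?p" "endA (take (Suc k) ?p) z" "startA (drop j ?p) z'"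
    "CP z (?p ! k) \<inter> CP z' (?p ! j) = {}" using assms(3) by (auto simp: cut_def)
  have jl: "l + j \<le> r" using c(3) len by simp
  have 1: "take (Suc k) ?p = slice w l (l + k)" using c(1) jl by (simp add: slice_def min_def)
  have 2: "drop j ?p = slice w (l + j) r" using jl by (simp add: slice_def drop_take add.commute)
  have 3: "?p ! k = w ! (l + k)" "?p ! j = w ! (l + j)" using slice_nth[OF assms(1,2)] c(1) jl by auto
  show ?thesis unfolding wit_def
    by (intro exI[of _ "l + j"] exI[of _ z] exI[of _ z']) (use c 1 2 3 jl in auto)
qed

lemma wit_less: "wit w l r i j z z' \<Longrightarrow> i < j"
  unfolding wit_def using Cp_self by (metis disjoint_iff le_neq_implies_less)

lemma wit_out: assumes "wit w l r i j z z'" "r < length w"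
  shows "R < d z (w ! i)" "d z (w ! i) \<le> Ca" "R < d z' (w ! j)" "d z' (w ! j) \<le> Ca"
    "\<And>k. l \<le> k \<Longrightarrow> k \<le> i \<Longrightarrow> d z (w ! i) \<le> d z (w ! k)" "\<And>k. j \<le> k \<Longrightarrow> k \<le> r \<Longrightarrow> d z' (w ! j) \<le> d z' (w ! k)"
  using assms slice_last[of l i w] slice_hd[of j r w] slice_set[of l i w] slice_set[of j r w]
  unfolding wit_def endA_def startA_def by fastforce+

lemma startA_slice: assumes "apath w" "l \<le> k" "k \<le> r" "r < length w" "startA (slice w l r) z"
  shows "w ! k \<in> CP z (w ! l)"
proof -
  have "w ! k \<in> set (slice w l r)" using assms by (auto simp: slice_set)
  then show ?thesis using startA_sub[OF slice_apath[OF assms(1)] slice_ne assms(5)] assms slice_hd[of l r w] by simp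
qed
lemma endA_slice: assumes "apath w" "l \<le> k" "k \<le> r" "r < length w" "endA (slice w l r) z"
  shows "w ! k \<in> CP z (w ! r)"
proof -
  have "w ! k \<in> set (slice w l r)" using assms by (auto simp: slice_set)
  then show ?thesis using endA_sub[OF slice_apath[OF assms(1)] slice_ne assms(5)] assms slice_last[of l r w] by simp
qed

lemma anchored_away:
  assumes "d z1 x0 \<le> Ca" "v \<in> CP z1 x0" "3 * Ca + R \<le> d v x0" "d z v \<le> Ca" "y \<notin> CP z1 x0 \<or> d x0 y \<le> Cs" "R < d z1 x0"
    "2 * Ca + Cs \<le> d v x0"
  shows "Ca \<le> d z y"
proof (cases "d x0 y \<le> Cs")
  case True
  then show ?thesis using assms(7,4) d_tri[of v x0 z] d_tri[of z x0 y] d_sym[of z v] d_sym[of y x0] by linarith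
next
  case False
  then have y: "y \<notin> CP z1 x0" using assms(5) by blast
  have z1v: "d z1 v \<ge> 2 * Ca + R" using assms(1,3) d_tri[of v x0 z1] d_sym[of z1 v] by linarith
  have Ca: "Ca > 0" by (simp add: Ca_def)
  have "z \<in> CP z1 v" by (rule Cp_near) (use z1v assms(4) d_sym[of v z] Ca in linarith)
  then have eq: "CP z1 z = CP z1 x0" using assms(2) Cp_eq by metis
  have zz: "d z1 z \<ge> Ca + R" using z1v assms(4) d_tri[of z1 v z] by linarith
  then have "d z1 z \<le> d z y + R" using y eq Ca by (intro Cp_dist) auto
  then show ?thesis using zz by linarith
qed

lemma wit_extend:
  assumes s: "apath w" "r < length w" "L0 \<le> l" "l \<le> r" "r \<le> H0" "H0 < length w"
    and c: "wit w l r i j z z'" and far: "D3 < d (w ! i) (w ! l)" "D3 < d (w ! i) (w ! r)"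
    and left: "l = L0 \<or> (\<exists>i1 z1 z1'. wit w L0 H0 i1 l z1 z1')"
    and right: "r = H0 \<or> (\<exists>j1 z1 z1'. wit w L0 H0 r j1 z1 z1')"
  shows "wit w L0 H0 i j z z'"
proof -
  have ij: "l \<le> i" "i < j" "j \<le> r" "j \<le> i + C1" using c wit_less[OF c] by (auto simp: wit_def)
  note O = wit_out[OF c s(2)]
  have dj: "d (w ! i) (w ! j) \<le> C1" using walk_dist[OF s(1), of i j] ij s by simp
  have ext1: "d z (w ! i) \<le> d z (w ! k)" if k: "L0 \<le> k" "k \<le> i" for k
  proof (cases "l \<le> k")
    case False
    then obtain i1 z1 z1' where p: "wit w L0 H0 i1 l z1 z1'" using left k by auto
    note P = wit_out[OF p s(6)]
    have "w ! i \<in> CP z1' (w ! l)"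
      using startA_slice[OF s(1), of l i H0] p s ij by (simp add: wit_def)
    moreover have "w ! k \<notin> CP z1' (w ! l) \<or> d (w ! l) (w ! k) \<le> Cs"
    proof (cases "k \<le> i1")
      case True
      have "w ! k \<in> CP z1 (w ! i1)"
        using endA_slice[OF s(1), of L0 k i1] p s k True by (simp add: wit_def)
      then show ?thesis using p by (auto simp: wit_def)
    next
      case F: False
      have "d (w ! k) (w ! l) \<le> l - k" using walk_dist[OF s(1), of k l] False s by simp
      then show ?thesis using F p d_sym[of "w ! k"] by (auto simp: wit_def C1_def Cs_def)
    qed
    ultimately have "Ca \<le> d z (w ! k)"
      using anchored_away[OF P(4) _ _ O(2) _ P(3)] far(1) by (auto simp: D3_def)
    then show ?thesis using O(2) by linarith
  qed (use O(5) k in blast)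
  have ext2: "d z' (w ! j) \<le> d z' (w ! k)" if k: "j \<le> k" "k \<le> H0" for k
  proof (cases "k \<le> r")
    case False
    then obtain j1 z1 z1' where p: "wit w L0 H0 r j1 z1 z1'" using right k by auto
    note P = wit_out[OF p s(6)]
    have farj: "3 * Ca + R \<le> d (w ! j) (w ! r)" "2 * Ca + Cs \<le> d (w ! j) (w ! r)"
      using dj far(2) d_tri[of "w ! i" "w ! r" "w ! j"] by (simp_all add: D3_def Cs_def C1_def)
    have "w ! j \<in> CP z1 (w ! r)"
      using endA_slice[OF s(1), of L0 j r] p s ij by (simp add: wit_def)
    then have j1: "w ! j \<in> CP z1 (w ! r)" .
    have j2: "w ! k \<notin> CP z1 (w ! r) \<or> d (w ! r) (w ! k) \<le> Cs"
    proof (cases "j1 \<le> k")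
      case True
      have "w ! k \<in> CP z1' (w ! j1)"
        using startA_slice[OF s(1), of j1 k H0] p s k True by (simp add: wit_def)
      then show ?thesis using p by (auto simp: wit_def)
    next
      case F: False
      have "d (w ! r) (w ! k) \<le> k - r" using walk_dist[OF s(1), of r k] False s k by simp
      then show ?thesis using F p by (auto simp: wit_def C1_def Cs_def)
    qed
    have "Ca \<le> d z' (w ! k)"
      by (rule anchored_away[OF P(2) j1 farj(1) O(4) j2 P(1) farj(2)])
    then show ?thesis using O(4) by linarith
  qed (use O(6) k in blast)
  show ?thesis unfolding wit_def endA_def startA_def
    using ij s O ext1 ext2 c slice_last[of L0 i w] slice_hd[of j H0 w] slice_set[of L0 i w] slice_set[of j H0 w]
    by (auto simp: wit_def)
qed

end

lemma slice_rev: assumes "l \<le> r" "r < length w"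
  shows "slice (rev w) (length w - 1 - r) (length w - 1 - l) = rev (slice w l r)"
proof (rule nth_equalityI)
  let ?n = "length w - 1"
  have len: "length (slice (rev w) (?n - r) (?n - l)) = Suc r - l" "length (slice w l r) = Suc r - l"
    using assms slice_length[of "?n - r" "?n - l" "rev w"] slice_length[of l r w] by auto
  then show "length (slice (rev w) (?n - r) (?n - l)) = length (rev (slice w l r))" by simp
  fix k assume "k < length (slice (rev w) (?n - r) (?n - l))"
  then have k: "k < Suc r - l" using len by simp
  have 1: "slice (rev w) (?n - r) (?n - l) ! k = rev w ! (?n - r + k)" by (rule slice_nth) (use assms k in auto)
  have 2: "rev (slice w l r) ! k = slice w l r ! (r - l - k)" using k len by (simp add: rev_nth Suc_diff_le)
  have 3: "slice w l r ! (r - l - k) = w ! (l + (r - l - k))" by (rule slice_nth) (use assms k in auto)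
  have 4: "rev w ! (?n - r + k) = w ! (r - k)"
  proof -
    have "?n - r + k < length w" using assms k by linarith
    moreover have "length w - Suc (?n - r + k) = r - k" using assms k by linarith
    ultimately show ?thesis by (simp add: rev_nth)
  qed
  have "l + (r - l - k) = r - k" using k assms by linarith
  then show "slice (rev w) (?n - r) (?n - l) ! k = rev (slice w l r) ! k" using 1 2 3 4 by simp
qed

text \<open>The arc of \<open>i\<close> between consecutive marks runs from \<open>lo\<close> to
  \<open>hi\<close>, with \<open>0\<close> and \<open>n\<close> as defaults. A mark belongs to the
  arc that it opens.\<close>

definition lo :: "nat set \<Rightarrow> nat \<Rightarrow> nat" where "lo K i = Max (insert 0 {k\<in>K. k \<le> i})"
definition hi :: "nat \<Rightarrow> nat set \<Rightarrow> nat \<Rightarrow> nat" where "hi n K i = Min (insert n {k\<in>K. i < k \<and> k \<le> n})"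

lemma lo_props: "lo K i \<le> i" "lo K i \<in> insert 0 K" "k \<in> K \<Longrightarrow> k \<le> i \<Longrightarrow> k \<le> lo K i"
proof -
  have f: "finite (insert 0 {k\<in>K. k \<le> i})" by auto
  have "lo K i \<in> insert 0 {k\<in>K. k \<le> i}" unfolding lo_def using f by (intro Max_in) auto
  then show "lo K i \<le> i" "lo K i \<in> insert 0 K" by auto
  show "k \<in> K \<Longrightarrow> k \<le> i \<Longrightarrow> k \<le> lo K i" unfolding lo_def using f by (intro Max_ge) auto
qed
lemma hi_props: "hi n K i \<le> n" "hi n K i \<in> insert n K" "k \<in> K \<Longrightarrow> i < k \<Longrightarrow> k \<le> n \<Longrightarrow> hi n K i \<le> k"
  "i < n \<Longrightarrow> i < hi n K i"
proof -
  have f: "finite (insert n {k\<in>K. i < k \<and> k \<le> n})" by auto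
  have "hi n K i \<in> insert n {k\<in>K. i < k \<and> k \<le> n}" unfolding hi_def using f by (intro Min_in) auto
  then show "hi n K i \<le> n" "hi n K i \<in> insert n K" "i < n \<Longrightarrow> i < hi n K i" by auto
  show "k \<in> K \<Longrightarrow> i < k \<Longrightarrow> k \<le> n \<Longrightarrow> hi n K i \<le> k" unfolding hi_def using f by (intro Min_le) auto
qed
lemma lo_eqI: "l \<le> i \<Longrightarrow> l \<in> insert 0 K \<Longrightarrow> (\<And>k. k \<in> K \<Longrightarrow> k \<le> i \<Longrightarrow> k \<le> l) \<Longrightarrow> lo K i = l"
  unfolding lo_def by (rule Max_eqI) auto
lemma hi_eqI: "l \<le> n \<Longrightarrow> i < l \<Longrightarrow> l \<in> insert n K \<Longrightarrow> (\<And>k. k \<in> K \<Longrightarrow> i < k \<Longrightarrow> k \<le> n \<Longrightarrow> l \<le> k) \<Longrightarrow> hi n K i = l"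
  unfolding hi_def by (rule Min_eqI) auto
lemma same_arc: assumes "i \<le> k" "\<And>m. m \<in> K \<Longrightarrow> i < m \<Longrightarrow> k < m"
  shows "lo K i = lo K k" "hi n K i = hi n K k"
proof -
  have "{m\<in>K. m \<le> i} = {m\<in>K. m \<le> k}" using assms by fastforce
  then show "lo K i = lo K k" by (simp add: lo_def)
  have "{m\<in>K. i < m \<and> m \<le> n} = {m\<in>K. k < m \<and> m \<le> n}" using assms by fastforce
  then show "hi n K i = hi n K k" by (simp add: hi_def)
qed

context tgraph_uni begin

definition awit :: "'a list \<Rightarrow> nat set \<Rightarrow> nat \<Rightarrow> nat \<Rightarrow> 'a \<Rightarrow> 'a \<Rightarrow> bool" where
  "awit w K i j z z' \<longleftrightarrow> i < length w \<and> wit w (lo K i) (hi (length w - 1) K i) i j z z'"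
text \<open>The sites \<open>CS\<close> are the cuts of the arcs between consecutive marks; those in \<open>TS\<close> and \<open>TA\<close> have the
  target \<open>t\<close> on their far and on their near side, respectively.\<close>
definition CS :: "'a list \<Rightarrow> nat set \<Rightarrow> nat set" where "CS w K = {i. \<exists>j z z'. awit w K i j z z'}"
definition TS :: "'a list \<Rightarrow> nat set \<Rightarrow> 'a \<Rightarrow> nat set" where
  "TS w K t = {i. \<exists>j z z'. awit w K i j z z' \<and> t \<in> CP z' (w ! j)}"
definition TA :: "'a list \<Rightarrow> nat set \<Rightarrow> 'a \<Rightarrow> nat set" where
  "TA w K t = {i. \<exists>j z z'. awit w K i j z z' \<and> t \<in> CP z (w ! i)}"

lemma awit_range: assumes "awit w K i j z z'"
  shows "lo K i \<le> i" "i < j" "j \<le> hi (length w - 1) K i" "hi (length w - 1) K i < length w" "j \<le> i + C1" "j < length w"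
proof -
  have i: "i < length w" and wt: "wit w (lo K i) (hi (length w - 1) K i) i j z z'" using assms by (auto simp: awit_def)
  show "hi (length w - 1) K i < length w" using hi_props(1)[of "length w - 1" K i] i by linarith
  show "lo K i \<le> i" by (rule lo_props)
  show "i < j" by (rule wit_less[OF wt])
  show "j \<le> hi (length w - 1) K i" "j \<le> i + C1" using wt by (auto simp: wit_def)
  then show "j < length w" using \<open>hi (length w - 1) K i < length w\<close> by linarith
qed

lemma finite_CS: "finite (CS w K)"
  by (rule finite_subset[of _ "{..<length w}"]) (auto simp: CS_def awit_def)

lemma TS_sub: "TS w K t \<subseteq> CS w K" and TA_sub: "TA w K t \<subseteq> CS w K"
  by (auto simp: TS_def TA_def CS_def)

definition D4 :: nat where "D4 = 4 * Ca + 2 * R + C1 + 10"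

text \<open>If the two sites were far apart, the centres \<open>z'\<close> and \<open>z2\<close>
  would have disjoint balls, and \<open>cover\<close> would put \<open>t\<close> on the far side of
  the first cut or on the near side of the second.\<close>

lemma neither_near:
  assumes w: "apath w" and ik: "i < k" and same: "lo K i = lo K k" "hi (length w - 1) K i = hi (length w - 1) K k"
    and a: "awit w K i j z z'" "t \<notin> CP z' (w ! j)" and b: "awit w K k j2 z2 z2'" "t \<notin> CP z2 (w ! k)"
  shows "d (w ! i) (w ! k) \<le> D4"
proof (rule ccontr)
  assume far: "\<not> ?thesis"
  note A = awit_range[OF a(1)] and Bb = awit_range[OF b(1)]
  have wa: "wit w (lo K i) (hi (length w - 1) K i) i j z z'" and wb: "wit w (lo K k) (hi (length w - 1) K k) k j2 z2 z2'"
    using a b by (auto simp: awit_def)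
  note Oa = wit_out[OF wa A(4)] and Ob = wit_out[OF wb Bb(4)]
  have kn: "k < length w" using b(1) by (simp add: awit_def)
  have jk: "j \<le> k"
  proof (rule ccontr)
    assume "\<not> j \<le> k"
    then have "k - i \<le> C1" using A(5) by simp
    then show False using walk_dist[OF w less_imp_le[OF ik] kn] far by (simp add: D4_def)
  qed
  have dij: "d (w ! i) (w ! j) \<le> C1" using walk_dist[OF w, of i j] A(2,5,6) by simp
  then have djk: "d (w ! j) (w ! k) > 4 * Ca + 2 * R" using far d_tri[of "w ! i" "w ! k" "w ! j"] by (simp add: D4_def)
  have "w ! k \<in> CP z' (w ! j)"
    by (rule startA_slice[OF w jk _ A(4)]) (use wa Bb(2,3) same in \<open>auto simp: wit_def\<close>)
  moreover have z1k: "d z' (w ! k) \<ge> 3 * Ca + 2 * R" using djk Oa(4) d_tri[of "w ! j" "w ! k" z'] d_sym[of "w ! j" z'] by linarith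
  have Ca: "Ca > 2 * R" by (simp add: Ca_def)
  have "z2 \<in> CP z' (w ! k)" by (rule Cp_near) (use z1k Ob(2) d_sym[of "w ! k" z2] Ca in linarith)
  ultimately have "t \<notin> CP z' z2" using a(2) Cp_eq by metis
  moreover have "d z' z2 > 2 * R" using z1k Ob(2) d_tri[of z' "w ! k" z2] d_sym[of "w ! k" z2] Ca by linarith
  ultimately have tz: "t \<in> CP z2 z'" using cover by blast
  have "w ! j \<in> CP z2 (w ! k)"
    by (rule endA_slice[OF w _ jk kn, of "lo K k"]) (use wb A same in \<open>auto simp: wit_def\<close>)
  moreover have z2j: "d z2 (w ! j) \<ge> 3 * Ca + 2 * R" using djk Ob(2) d_tri[of "w ! j" "w ! k" z2] d_sym[of "w ! j" z2] by linarith
  moreover have "z' \<in> CP z2 (w ! j)" by (rule Cp_near) (use z2j Oa(4) d_sym[of "w ! j" z'] Ca in linarith)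
  ultimately have "t \<in> CP z2 (w ! k)" using tz Cp_eq by metis
  then show False using b(2) by simp
qed

text \<open>The sites that have the target on neither side are clustered within distance
  \<open>D4\<close> in each arc by \<open>neither_near\<close>, and there are at most
  \<open>card K + 1\<close> arcs.\<close>

lemma card_CS_le: assumes w: "saw w" and K: "finite K"
  shows "card (CS w K) \<le> card (TS w K t) + card (TA w K t) + (card K + 1) * NB D4"
proof -
  let ?X = "CS w K - TS w K t - TA w K t"
  have aw: "apath w" "distinct w" using w by (auto simp: saw_def)
  have fin: "finite (TS w K t)" "finite (TA w K t)" "finite ?X"
    using finite_CS[of w K] finite_subset[OF TS_sub finite_CS] finite_subset[OF TA_sub finite_CS] by auto
  have fib: "card {i\<in>?X. lo K i = l} \<le> NB D4" for l
  proof (cases "{i\<in>?X. lo K i = l} = {}")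
    case False
    then obtain i where i: "i \<in> ?X" "lo K i = l" by blast
    have "{i\<in>?X. lo K i = l} \<subseteq> {k. k < length w \<and> d (w ! i) (w ! k) \<le> D4}"
    proof
      fix k assume k: "k \<in> {i\<in>?X. lo K i = l}"
      have near: "d (w ! a) (w ! b) \<le> D4" if ab: "a < b" "a \<in> ?X" "b \<in> ?X" "lo K a = lo K b" for a b
      proof -
        obtain j z z' where 1: "awit w K a j z z'" using ab by (auto simp: CS_def)
        obtain j2 z2 z2' where 2: "awit w K b j2 z2 z2'" using ab by (auto simp: CS_def)
        have "hi (length w - 1) K a = hi (length w - 1) K b"
        proof (rule same_arc)
          fix m assume "m \<in> K" "a < m"
          then show "b < m" using lo_props(3)[of m K b] lo_props(1)[of K a] ab(4) by (metis leD leI le_trans)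
        qed (use ab in simp)
        moreover have "t \<notin> CP z' (w ! j)" using 1 ab(2) unfolding TS_def by blast
        moreover have "t \<notin> CP z2 (w ! b)" using 2 ab(3) unfolding TA_def by blast
        ultimately show ?thesis using neither_near[OF aw(1) ab(1,4) _ 1 _ 2] by blast
      qed
      have "k < length w" using k by (auto simp: CS_def awit_def)
      moreover have "d (w ! i) (w ! k) \<le> D4"
      proof (cases "i = k")
        case False
        then consider "i < k" | "k < i" by linarith
        then show ?thesis
        proof cases
          case 1 then show ?thesis using near[of i k] i k by auto
        next
          case 2 then show ?thesis using near[of k i] i k d_sym[of "w ! i"] by auto
        qed
      qed simp
      ultimately show "k \<in> {k. k < length w \<and> d (w ! i) (w ! k) \<le> D4}" by simp
    qed
    then have "card {i\<in>?X. lo K i = l} \<le> card {k. k < length w \<and> d (w ! i) (w ! k) \<le> D4}"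
      by (intro card_mono) auto
    then show ?thesis using card_index_near[OF aw(2), of "w ! i" D4] by linarith
  next
    case True then show ?thesis by (simp only: card.empty)
  qed
  have fK: "finite (insert 0 K)" using K by simp
  have "?X \<subseteq> (\<Union>l\<in>insert 0 K. {i\<in>?X. lo K i = l})" using lo_props(2)[of K] by blast
  then have "card ?X \<le> card (\<Union>l\<in>insert 0 K. {i\<in>?X. lo K i = l})"
    by (rule card_mono[rotated]) (rule finite_subset[OF _ fin(3)], blast)
  also have "\<dots> \<le> (\<Sum>l\<in>insert 0 K. card {i\<in>?X. lo K i = l})" by (rule card_UN_le[OF fK])
  also have "\<dots> \<le> (\<Sum>l\<in>insert 0 K. NB D4)" by (intro sum_mono fib)
  also have "\<dots> \<le> (card K + 1) * NB D4" using K card_insert_le_m1[of "card K + 1" K 0] by (simp add: card_insert_if)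
  finally have X: "card ?X \<le> (card K + 1) * NB D4" .
  have "CS w K \<subseteq> (TS w K t \<union> TA w K t) \<union> ?X" by auto
  then have "card (CS w K) \<le> card ((TS w K t \<union> TA w K t) \<union> ?X)" using fin by (intro card_mono) auto
  also have "\<dots> \<le> card (TS w K t \<union> TA w K t) + card ?X" by (rule card_Un_le)
  also have "card (TS w K t \<union> TA w K t) \<le> card (TS w K t) + card (TA w K t)" by (rule card_Un_le)
  finally show ?thesis using X by linarith
qed

definition rvs :: "'a list \<Rightarrow> nat set \<Rightarrow> nat set" where "rvs w K = (\<lambda>k. length w - 1 - k) ` K"

lemma rvs_rvs: "K \<subseteq> {..<length w} \<Longrightarrow> rvs (rev w) (rvs w K) = K"
  unfolding rvs_def image_image by (force simp: image_iff)
lemma rvs_sub: "w \<noteq> [] \<Longrightarrow> rvs w K \<subseteq> {..<length (rev w)}" by (auto simp: rvs_def)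

lemma awit_rev: assumes K: "K \<subseteq> {..<length w}" and a: "awit w K i j z z'"
  shows "awit (rev w) (rvs w K) (length w - 1 - j) (length w - 1 - i) z' z"
proof -
  let ?n = "length w - 1"
  let ?l = "lo K i" and ?r = "hi ?n K i"
  note A = awit_range[OF a]
  have wt: "wit w ?l ?r i j z z'" using a by (simp add: awit_def)
  have lo: "lo (rvs w K) (?n - j) = ?n - ?r"
  proof (rule lo_eqI)
    show "?n - ?r \<le> ?n - j" using A(3) by simp
    show "?n - ?r \<in> insert 0 (rvs w K)" using hi_props(2)[of ?n K i] by (auto simp: rvs_def)
    fix k assume "k \<in> rvs w K" "k \<le> ?n - j"
    then obtain k' where k': "k' \<in> K" "k = ?n - k'" by (auto simp: rvs_def)
    have "k' \<le> ?n" using k' K by fastforce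
    moreover have "i < k'" using k' \<open>k \<le> ?n - j\<close> A(2,6) calculation by linarith
    ultimately have "?r \<le> k'" using hi_props(3)[of k' K i ?n] k'(1) by blast
    then show "k \<le> ?n - ?r" using k' by simp
  qed
  have hi: "hi ?n (rvs w K) (?n - j) = ?n - ?l"
  proof (rule hi_eqI)
    show "?n - ?l \<le> ?n" by simp
    show "?n - j < ?n - ?l" using A by linarith
    show "?n - ?l \<in> insert ?n (rvs w K)" using lo_props(2)[of K i] by (auto simp: rvs_def)
    fix k assume "k \<in> rvs w K" "?n - j < k" "k \<le> ?n"
    then obtain k' where k': "k' \<in> K" "k = ?n - k'" "?n - j < ?n - k'" by (auto simp: rvs_def)
    have "k' \<le> i"
    proof (rule ccontr)
      assume "\<not> k' \<le> i"
      moreover have "k' \<le> ?n" using k' K by fastforce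
      ultimately have "?r \<le> k'" using hi_props(3)[of k' K i ?n] k'(1) by simp
      then show False using k'(3) A(3) by linarith
    qed
    then show "?n - ?l \<le> k" using lo_props(3)[of k' K i] k' by simp
  qed
  have s1: "slice (rev w) (?n - ?r) (?n - j) = rev (slice w j ?r)" using slice_rev[of j ?r w] A by simp
  have s2: "slice (rev w) (?n - i) (?n - ?l) = rev (slice w ?l i)" using slice_rev[of ?l i w] A by simp
  have "i < length w" using A by linarith
  then have ne: "slice w j ?r \<noteq> []" "slice w ?l i \<noteq> []" using slice_ne[OF A(3,4)] slice_ne[OF A(1)] by auto
  have nth: "rev w ! (?n - j) = w ! j" "rev w ! (?n - i) = w ! i" using A by (auto simp: rev_nth Suc_diff_Suc)
  have "wit (rev w) (?n - ?r) (?n - ?l) (?n - j) (?n - i) z' z"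
    unfolding wit_def s1 s2 nth using wt A ne by (auto simp: wit_def endA_rev startA_rev Int_commute)
  then show ?thesis unfolding awit_def using lo hi A by simp
qed

text \<open>Reversal sends a site to the mirror image of its companion index \<open>j\<close>. As
  \<open>j\<close> is at most \<open>C1\<close> beyond the site, at most \<open>C1 + 1\<close> sites
  share an image.\<close>

lemma card_fibres: assumes "finite Y" "\<And>i. i \<in> X \<Longrightarrow> \<exists>y\<in>Y. i \<le> a - y \<and> a - y \<le> i + C1"
  shows "card (X :: nat set) \<le> (C1 + 1) * card Y"
proof -
  have "X \<subseteq> (\<Union>y\<in>Y. {a - y - C1..a - y})" using assms(2) by fastforce
  then have "card X \<le> card (\<Union>y\<in>Y. {a - y - C1..a - y})" using assms(1) by (intro card_mono) auto
  also have "\<dots> \<le> (\<Sum>y\<in>Y. card {a - y - C1..a - y})" by (rule card_UN_le[OF assms(1)])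
  also have "\<dots> \<le> (\<Sum>y\<in>Y. C1 + 1)" by (rule sum_mono) auto
  finally show ?thesis by (simp add: mult.commute)
qed

lemma TA_rev: assumes "K \<subseteq> {..<length w}" shows "card (TA w K t) \<le> (C1 + 1) * card (TS (rev w) (rvs w K) t)"
proof (rule card_fibres[where a = "length w - 1"])
  show "finite (TS (rev w) (rvs w K) t)"
    by (rule finite_subset[OF TS_sub finite_CS])
  fix i assume "i \<in> TA w K t"
  then obtain j z z' where a: "awit w K i j z z'" "t \<in> CP z (w ! i)" by (auto simp: TA_def)
  note A = awit_range[OF a(1)]
  have "rev w ! (length w - 1 - i) = w ! i" using A by (auto simp: rev_nth Suc_diff_Suc)
  then have "length w - 1 - j \<in> TS (rev w) (rvs w K) t"
    using awit_rev[OF assms a(1)] a(2) unfolding TS_def by (metis (mono_tags, lifting) mem_Collect_eq)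
  then show "\<exists>y\<in>TS (rev w) (rvs w K) t. i \<le> length w - 1 - y \<and> length w - 1 - y \<le> i + C1"
    by (rule bexI[rotated]) (use A in auto)
qed

lemma CS_rev: assumes "K \<subseteq> {..<length w}" shows "card (CS w K) \<le> (C1 + 1) * card (CS (rev w) (rvs w K))"
proof (rule card_fibres[where a = "length w - 1", OF finite_CS])
  fix i assume "i \<in> CS w K"
  then obtain j z z' where a: "awit w K i j z z'" by (auto simp: CS_def)
  note A = awit_range[OF a(1)]
  have "length w - 1 - j \<in> CS (rev w) (rvs w K)" using awit_rev[OF assms a(1)] by (auto simp: CS_def)
  then show "\<exists>y\<in>CS (rev w) (rvs w K). i \<le> length w - 1 - y \<and> length w - 1 - y \<le> i + C1"
    by (rule bexI[rotated]) (use A in auto)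
qed

definition A1 :: nat where "A1 = (C1 + 1) * (C1 + 2) * (NB D4 + 1)"
text \<open>Turns are available at a fixed proportion of the cuts, up to the number of marks. Under
  this condition the gain from turning can repay the factor \<open>s\<close> per cut.\<close>

definition maj :: "'a list \<Rightarrow> nat set \<Rightarrow> 'a \<Rightarrow> bool" where
  "maj w K t \<longleftrightarrow> card (CS w K) \<le> A1 * (card (TS w K t) + card K + 1)"

text \<open>Reversal exchanges the sides of a cut. If the sites with the target on the far side do
  not suffice, those with the target on the near side do, and they become usable in the reversed
  walk.\<close>

lemma maj_or: assumes w: "saw w" and K: "K \<subseteq> {..<length w}"
  shows "maj w K t \<or> maj (rev w) (rvs w K) t"
proof -
  have fK: "finite K" using K finite_subset by blast
  have wn: "w \<noteq> []" using w by (simp add: saw_def)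
  have cK: "card (rvs w K) = card K"
    unfolding rvs_def
  proof (rule card_image, rule inj_onI)
    fix a b assume "a \<in> K" "b \<in> K" "length w - 1 - a = length w - 1 - b"
    moreover from this have "a < length w" "b < length w" using K by auto
    ultimately show "a = b" by linarith
  qed
  let ?a = "card (TS w K t)" and ?b = "card (TS (rev w) (rvs w K) t)"
  have 1: "card (CS w K) \<le> ?a + (C1 + 1) * ?b + (card K + 1) * NB D4"
    using card_CS_le[OF w fK, of t] TA_rev[OF K, of t] by linarith
  show ?thesis
  proof (cases "?b \<le> ?a")
    case True
    have "(C1 + 1) * ?b \<le> (C1 + 1) * ?a" using True by (rule mult_left_mono) simp
    then have "card (CS w K) \<le> (C1 + 2) * ?a + (card K + 1) * NB D4" using 1 by simp
    also have "\<dots> \<le> A1 * ?a + A1 * (card K + 1)"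
    proof (rule add_mono)
      show "(C1 + 2) * ?a \<le> A1 * ?a" unfolding A1_def by (intro mult_right_mono) (simp_all add: algebra_simps)
      have "NB D4 \<le> A1" unfolding A1_def by (simp add: algebra_simps)
      then show "(card K + 1) * NB D4 \<le> A1 * (card K + 1)" by (metis mult.commute mult_le_mono2)
    qed
    finally show ?thesis by (simp add: maj_def algebra_simps)
  next
    case False
    then have "?a + (C1 + 1) * ?b \<le> (C1 + 2) * ?b" by simp
    then have 2: "card (CS w K) \<le> (C1 + 2) * ?b + (card K + 1) * NB D4" using 1 by linarith
    have "rvs (rev w) (rvs w K) = K" by (rule rvs_rvs[OF K])
    then have "card (CS (rev w) (rvs w K)) \<le> (C1 + 1) * card (CS w K)"
      using CS_rev[OF rvs_sub[OF wn], of K] by simp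
    also have "\<dots> \<le> (C1 + 1) * ((C1 + 2) * ?b + (card K + 1) * NB D4)" using 2 by (rule mult_left_mono) simp
    also have "\<dots> = (C1 + 1) * (C1 + 2) * ?b + (C1 + 1) * NB D4 * (card K + 1)" by (simp add: algebra_simps)
    also have "\<dots> \<le> A1 * ?b + A1 * (card K + 1)"
    proof (rule add_mono)
      show "(C1 + 1) * (C1 + 2) * ?b \<le> A1 * ?b" unfolding A1_def by (intro mult_right_mono) simp_all
      have "(C1 + 1) * NB D4 \<le> A1" unfolding A1_def by (simp add: algebra_simps)
      then show "(C1 + 1) * NB D4 * (card K + 1) \<le> A1 * (card K + 1)" by (intro mult_right_mono) auto
    qed
    finally show ?thesis by (simp add: maj_def cK algebra_simps)
  qed
qed

end

lemma slice_glue3: assumes "l \<le> i" "i \<le> j" "j < length w"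
  shows "slice w l i @ tl (slice w i j) @ tl (drop j w) = drop l w"
proof -
  have d: "slice w k (length w - 1) = drop k w" if "k < length w" for k using slice_drop[of k "length w - 1" w] that by simp
  have "(slice w l i @ tl (slice w i j)) @ tl (slice w j (length w - 1)) = slice w l (length w - 1)"
    using slice_glue[of l i j w] slice_glue[of l j "length w - 1" w] assms by simp
  then show ?thesis using d[of j] d[of l] assms by simp
qed

context tgraph_uni begin

type_synonym 'b oprec = "bool \<times> nat \<times> 'b \<times> 'b \<times> 'b"

text \<open>A record consists of the flag, the index where the walk resumes, both centres and the
  half-space. A mark cuts the walk in one vertex with a common anchor; a turn removes the stretch
  from \<open>i\<close> to \<open>j\<close>. The condition \<open>j \<notin> K\<close> keeps the
  resumed walk off the next mark.\<close>

definition opok :: "'a list \<Rightarrow> nat set \<Rightarrow> 'a \<Rightarrow> nat \<Rightarrow> 'a oprec \<Rightarrow> bool" where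
  "opok w K t i r = (case r of (f, j, z, z', e) \<Rightarrow> i < length w \<and>
     d z e = Suc R \<and> infinite (CP z e) \<and> e \<notin> CP z (w ! i) \<and> (f \<longleftrightarrow> i \<in> K) \<and>
     (if f then j = i \<and> z' = z \<and> R < d z (w ! i) \<and> d z (w ! i) \<le> Ca \<and> (\<forall>y\<in>set w. d z (w ! i) \<le> d z y)
      else awit w K i j z z' \<and> t \<in> CP z' (w ! j) \<and> t \<notin> CP z e \<and> j \<notin> K))"

fun scr :: "'a list \<Rightarrow> (nat \<Rightarrow> 'a oprec) \<Rightarrow> nat \<Rightarrow> nat list \<Rightarrow> 'a list \<times> 'a entry list" where
  "scr w rc l [] = (drop l w, [])"
| "scr w rc l (i # is) = (case rc i of (f, j, z, z', e) \<Rightarrow>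
     (slice w l i, (f, slice w i j, z, z', e, fst (scr w rc j is)) # snd (scr w rc j is)))"

text \<open>All marks beyond \<open>l\<close> have to occur in the list. Hence no piece runs across
  a mark, and each piece stays within a single arc.\<close>

fun chain :: "'a list \<Rightarrow> nat set \<Rightarrow> 'a \<Rightarrow> (nat \<Rightarrow> 'a oprec) \<Rightarrow> nat \<Rightarrow> nat list \<Rightarrow> bool" where
  "chain w K t rc l [] = (l < length w \<and> (\<forall>k\<in>K. k \<le> l))"
| "chain w K t rc l (i # is) = (l \<le> i \<and> (\<forall>k\<in>K. l < k \<longrightarrow> i \<le> k) \<and> opok w K t i (rc i) \<and>
    (case rc i of (f, j, z, z', e) \<Rightarrow> (\<forall>k js. is = k # js \<longrightarrow> D2 \<le> d z' (fst (snd (snd (rc k))))) \<and>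
      chain w K t rc j is))"

lemma opok_range: assumes "opok w K t i (f, j, z, z', e)"
  shows "i < length w" "i \<le> j" "j < length w" "j \<le> i + C1" "R < d z (w ! i)" "d z (w ! i) \<le> Ca" "R < d z' (w ! j)" "d z' (w ! j) \<le> Ca"
proof -
  have i: "i < length w" using assms by (simp add: opok_def)
  show "i < length w" by (rule i)
  have "i \<le> j \<and> j < length w \<and> j \<le> i + C1 \<and> R < d z (w ! i) \<and> d z (w ! i) \<le> Ca \<and> R < d z' (w ! j) \<and> d z' (w ! j) \<le> Ca"
  proof (cases f)
    case True then show ?thesis using assms i by (simp add: opok_def)
  next
    case False
    then have a: "awit w K i j z z'" using assms by (simp add: opok_def)
    have wt: "wit w (lo K i) (hi (length w - 1) K i) i j z z'" using a by (simp add: awit_def)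
    show ?thesis using awit_range[OF a] wit_out[OF wt awit_range(4)[OF a]] by auto
  qed
  then show "i \<le> j" "j < length w" "j \<le> i + C1" "R < d z (w ! i)" "d z (w ! i) \<le> Ca" "R < d z' (w ! j)" "d z' (w ! j) \<le> Ca"
    by auto
qed

lemma scr_hd: "chain w K t rc l is \<Longrightarrow> fst (scr w rc l is) \<noteq> [] \<and> hd (fst (scr w rc l is)) = w ! l"
proof (cases "is")
  case Nil
  assume "chain w K t rc l is"
  then show ?thesis using Nil by (simp add: hd_drop_conv_nth)
next
  case (Cons i js)
  assume c: "chain w K t rc l is"
  obtain f j z z' e where r: "rc i = (f, j, z, z', e)" by (metis prod.exhaust)
  have "l \<le> i" "i < length w" using c Cons r opok_range(1)[of w K t i f j z z' e] by auto
  then show ?thesis using Cons r slice_ne[of l i w] slice_hd[of l i w] by simp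
qed

text \<open>At a mark the anchor is nearest relative to the whole walk, at a turn only relative to
  its arc. The chain condition keeps the next piece inside that arc.\<close>

lemma scr_startA: assumes w: "apath w" and op: "opok w K t i (f, j, z, z', e)" and c: "chain w K t rc j is"
  shows "startA (fst (scr w rc j is)) z'"
proof -
  note O = opok_range[OF op]
  have sub: "\<exists>r. j \<le> r \<and> r < length w \<and> fst (scr w rc j is) = slice w j r \<and> (\<forall>k\<in>K. j < k \<longrightarrow> r \<le> k)"
  proof (cases "is")
    case Nil
    then show ?thesis using c O slice_drop[of j "length w - 1" w] by (intro exI[of _ "length w - 1"]) auto
  next
    case (Cons k ks)
    obtain f2 j2 z2 z2' e2 where r: "rc k = (f2, j2, z2, z2', e2)" by (metis prod.exhaust)
    show ?thesis using c Cons r opok_range(1)[of w K t k f2 j2 z2 z2' e2] by (intro exI[of _ k]) auto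
  qed
  then obtain r where r: "j \<le> r" "r < length w" "fst (scr w rc j is) = slice w j r" "\<forall>k\<in>K. j < k \<longrightarrow> r \<le> k" by blast
  have h: "hd (slice w j r) = w ! j" using slice_hd r by blast
  have min: "d z' (w ! j) \<le> d z' y" if y: "y \<in> set (slice w j r)" for y
  proof (cases f)
    case True
    have "y \<in> set w" using y slice_set[OF r(1,2)] r(2) by (auto intro: nth_mem order_le_less_trans)
    then show ?thesis using op True by (simp add: opok_def)
  next
    case False
    then have a: "awit w K i j z z'" "j \<notin> K" using op by (auto simp: opok_def)
    have wt: "wit w (lo K i) (hi (length w - 1) K i) i j z z'" using a by (simp add: awit_def)
    have rh: "r \<le> hi (length w - 1) K i"
    proof (cases "hi (length w - 1) K i = length w - 1")
      case True then show ?thesis using r(2) by simp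
    next
      case False
      then have hk: "hi (length w - 1) K i \<in> K" using hi_props(2)[of "length w - 1" K i] by auto
      then have "j < hi (length w - 1) K i" using awit_range(3)[OF a(1)] a(2) by (metis le_neq_implies_less)
      then show ?thesis using r(4) hk by blast
    qed
    obtain k where k: "y = w ! k" "j \<le> k" "k \<le> r" using y slice_set[OF r(1,2)] by auto
    have "k \<le> hi (length w - 1) K i" using k(3) rh by simp
    then show ?thesis using wit_out(6)[OF wt awit_range(4)[OF a(1)] k(2)] k(1) by simp
  qed
  show ?thesis unfolding startA_def r(3) h using O min by blast
qed

lemma validS_scr: assumes w: "saw w"
  shows "chain w K t rc l is \<Longrightarrow> validS t (fst (scr w rc l is)) (snd (scr w rc l is))"
proof (induction "is" arbitrary: l)
  case Nil
  have aw: "apath w" "distinct w" using w by (auto simp: saw_def)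
  have "l \<le> length w - 1" "length w - 1 < length w" using Nil by auto
  then have "saw (drop l w)" using w slice_saw[of w l "length w - 1"] slice_drop[of l "length w - 1" w] by metis
  then show ?case by simp
next
  case (Cons i js)
  have aw: "apath w" using w by (auto simp: saw_def)
  obtain f j z z' e where r: "rc i = (f, j, z, z', e)" by (metis prod.exhaust)
  have c: "l \<le> i" "\<forall>k\<in>K. l < k \<longrightarrow> i \<le> k" "opok w K t i (f, j, z, z', e)" "chain w K t rc j js"
    "\<forall>k ks. js = k # ks \<longrightarrow> D2 \<le> d z' (fst (snd (snd (rc k))))" using Cons.prems r by auto
  note O = opok_range[OF c(3)]
  have v: "validS t (fst (scr w rc j js)) (snd (scr w rc j js))" by (rule Cons.IH[OF c(4)])
  have h: "hd (fst (scr w rc j js)) = w ! j" using scr_hd[OF c(4)] by blast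
  have st: "startA (fst (scr w rc j js)) z'" by (rule scr_startA[OF aw c(3,4)])
  have lst: "last (slice w l i) = w ! i" by (rule slice_last[OF c(1) O(1)])
  have min: "d z (w ! i) \<le> d z y" if y: "y \<in> set (slice w l i)" for y
  proof (cases f)
    case True
    have "y \<in> set w" using y slice_set[OF c(1) O(1)] O(1) by (auto intro: nth_mem order_le_less_trans)
    then show ?thesis using c(3) True by (simp add: opok_def)
  next
    case False
    then have a: "awit w K i j z z'" "i \<notin> K" using c(3) by (auto simp: opok_def)
    have wt: "wit w (lo K i) (hi (length w - 1) K i) i j z z'" using a by (simp add: awit_def)
    have lh: "lo K i \<le> l"
    proof (rule ccontr)
      assume n: "\<not> lo K i \<le> l"
      then have "lo K i \<in> K" using lo_props(2)[of K i] by auto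
      then have "i \<le> lo K i" using n c(2) by auto
      then show False using lo_props(1)[of K i] a(2) \<open>lo K i \<in> K\<close> by auto
    qed
    obtain k where k: "y = w ! k" "l \<le> k" "k \<le> i" using y slice_set[OF c(1) O(1)] by auto
    then show ?thesis using wit_out(5)[OF wt awit_range(4)[OF a(1)], of k] lh by simp
  qed
  have en: "endA (slice w l i) z" unfolding endA_def lst using O min by blast
  have sg: "slice w i j \<noteq> []" "apath (slice w i j)" "hd (slice w i j) = w ! i" "last (slice w i j) = w ! j"
    "length (slice w i j) = Suc j - i"
    using slice_ne[OF O(2,3)] slice_apath[OF aw] slice_hd[OF O(2,3)] slice_last[OF O(2,3)] slice_length[OF O(2,3)] by auto
  have sgl: "length (slice w i j) \<le> Cs" using sg(5) O(4) by (simp add: Cs_def C1_def)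
  have sgf: "f \<longrightarrow> slice w i j = [w ! i]"
  proof
    assume f
    then have "j = i" using c(3) by (simp add: opok_def)
    then show "slice w i j = [w ! i]" using sg by (cases "slice w i j") auto
  qed
  have nf: "\<not> f \<longrightarrow> CP z (w ! i) \<inter> CP z' (w ! j) = {} \<and> t \<in> CP z' (w ! j) \<and> t \<notin> CP z e"
    using c(3) by (auto simp: opok_def awit_def wit_def)
  have far: "nextfar z' (snd (scr w rc j js))"
  proof (cases js)
    case (Cons k ks)
    obtain f2 j2 z2 z2' e2 where r2: "rc k = (f2, j2, z2, z2', e2)" by (metis prod.exhaust)
    show ?thesis using c(5) Cons r2 by simp
  qed simp
  have e: "d z e = Suc R" "infinite (CP z e)" "e \<notin> CP z (w ! i)" using c(3) by (auto simp: opok_def)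
  show ?case unfolding scr.simps r prod.case fst_conv snd_conv validS.simps lst h sg(3,4)
    using slice_saw[OF w c(1) O(1)] en st sg(1,2) sgl sgf nf far v e by simp
qed

text \<open>Left inverses for the passage from marked walks to scripts: pieces and segments spell
  out the walk, and the flags tell marks from turns. They make the map injective in
  \<open>marked_sum\<close>.\<close>

fun joinS :: "'a list \<Rightarrow> 'a entry list \<Rightarrow> 'a list" where
  "joinS p [] = p"
| "joinS p ((f, sg, z, z', e, p') # es) = p @ tl sg @ tl (joinS p' es)"
fun tagsS :: "nat \<Rightarrow> 'a list \<Rightarrow> 'a entry list \<Rightarrow> (nat \<times> bool) list" where
  "tagsS l p [] = []"
| "tagsS l p ((f, sg, z, z', e, p') # es) = (l + length p - 1, f) # tagsS (l + length p - 1 + length sg - 1) p' es"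

lemma scr_decode: "chain w K t rc l is \<Longrightarrow> joinS (fst (scr w rc l is)) (snd (scr w rc l is)) = drop l w \<and>
    tagsS l (fst (scr w rc l is)) (snd (scr w rc l is)) = map (\<lambda>i. (i, i \<in> K)) is"
proof (induction "is" arbitrary: l)
  case (Cons i js)
  obtain f j z z' e where r: "rc i = (f, j, z, z', e)" by (metis prod.exhaust)
  have c: "l \<le> i" "opok w K t i (f, j, z, z', e)" "chain w K t rc j js" using Cons.prems r by auto
  note O = opok_range[OF c(2)]
  have ih: "joinS (fst (scr w rc j js)) (snd (scr w rc j js)) = drop j w"
    "tagsS j (fst (scr w rc j js)) (snd (scr w rc j js)) = map (\<lambda>i. (i, i \<in> K)) js" using Cons.IH[OF c(3)] by auto
  have f: "f \<longleftrightarrow> i \<in> K" using c(2) by (simp add: opok_def)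
  have p: "l + length (slice w l i) - 1 = i" using slice_length[OF c(1) O(1)] c(1) by simp
  have j: "i + length (slice w i j) - 1 = j" using slice_length[OF O(2,3)] O(2) by simp
  show ?case unfolding scr.simps r prod.case fst_conv snd_conv joinS.simps tagsS.simps p j ih
    using slice_glue3[OF c(1) O(2,3)] f by simp
qed simp

text \<open>The cuts counted by \<open>Q\<close> are far from the ends of the piece, so
  \<open>wit_extend\<close> makes them sites of the surrounding arc. Different pieces use up
  different sites, and the factors \<open>s ^ Q\<close> of a script multiply to at least
  \<open>s ^ card (CS w K)\<close>.\<close>

lemma Q_slice: assumes w: "apath w" and lr: "l \<le> r" "r < length w" and K: "\<forall>k\<in>K. l < k \<longrightarrow> r \<le> k"
    and left: "l = 0 \<or> l \<in> K \<or> (\<exists>i1 z z'. awit w K i1 l z z' \<and> l \<notin> K)"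
    and right: "r = length w - 1 \<or> r \<in> K \<or> (\<exists>j z z'. awit w K r j z z')"
  shows "Q (slice w l r) \<le> card {x\<in>CS w K. l \<le> x \<and> x < r}"
proof -
  let ?p = "slice w l r"
  have len: "length ?p = Suc r - l" by (rule slice_length[OF lr])
  let ?X = "{i. i < length ?p \<and> cut ?p i \<and> D3 < d (?p ! i) (hd ?p) \<and> D3 < d (?p ! i) (last ?p)}"
  have "(\<lambda>k. l + k) ` ?X \<subseteq> {x\<in>CS w K. l \<le> x \<and> x < r}"
  proof safe
    fix k assume k: "k < length ?p" "cut ?p k" "D3 < d (?p ! k) (hd ?p)" "D3 < d (?p ! k) (last ?p)"
    have kr: "l + k \<le> r" using k(1) len lr by linarith
    have nth: "?p ! k = w ! (l + k)" by (rule slice_nth[OF lr]) (use kr in simp)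
    have far: "D3 < d (w ! (l + k)) (w ! l)" "D3 < d (w ! (l + k)) (w ! r)"
      using k(3,4) nth slice_hd[OF lr] slice_last[OF lr] by auto
    then have "l + k \<noteq> r" by auto
    then have kr': "l + k < r" using kr by simp
    then show "l + k < r" .
    obtain j z z' where c: "wit w l r (l + k) j z z'" using cut_slice[OF lr k(2)] by blast
    let ?n = "length w - 1"
    define L0 where "L0 = lo K (l + k)"
    define H0 where "H0 = hi ?n K (l + k)"
    have L: "L0 \<le> l"
    proof (rule ccontr)
      assume n: "\<not> L0 \<le> l"
      then have "L0 \<in> K" using lo_props(2)[of K "l + k"] by (auto simp: L0_def)
      then show False using K n lo_props(1)[of K "l + k"] kr' by (fastforce simp: L0_def)
    qed
    have H: "r \<le> H0"
    proof (rule ccontr)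
      assume n: "\<not> r \<le> H0"
      then have "H0 \<noteq> ?n" using lr(2) by auto
      then have "H0 \<in> K" using hi_props(2)[of ?n K "l + k"] by (auto simp: H0_def)
      moreover have "l + k < H0" unfolding H0_def by (rule hi_props(4)) (use kr' lr in simp)
      ultimately show False using K n by auto
    qed
    have Hn: "H0 < length w" using hi_props(1)[of ?n K "l + k"] lr(2) by (simp add: H0_def)
    have "wit w L0 H0 (l + k) j z z'"
    proof (rule wit_extend[OF w lr(2) L lr(1) H Hn c far])
      show "l = L0 \<or> (\<exists>i1 z1 z1'. wit w L0 H0 i1 l z1 z1')"
      proof (cases "l = L0")
        case False
        then have "l \<notin> K" using lo_props(3)[of l K "l + k"] L by (auto simp: L0_def)
        then obtain i1 z1 z1' where a: "awit w K i1 l z1 z1'" using left False L by auto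
        have il: "i1 < l" using awit_range(2)[OF a] .
        have nb: "l + k < x" if x: "x \<in> K" "i1 < x" for x
        proof -
          have "x \<noteq> l" using x \<open>l \<notin> K\<close> by blast
          moreover have "l \<le> x"
          proof (cases "x \<le> ?n")
            case True
            then show ?thesis using hi_props(3)[of x K i1 ?n] x awit_range(3)[OF a] by simp
          next
            case False then show ?thesis using lr by simp
          qed
          ultimately show ?thesis using K x(1) kr' by (metis le_neq_implies_less less_le_trans)
        qed
        have "lo K i1 = L0" "hi ?n K i1 = H0" unfolding L0_def H0_def
          using same_arc[of i1 "l + k" K] il nb by auto
        then show ?thesis using a by (auto simp: awit_def)
      qed simp
      show "r = H0 \<or> (\<exists>j1 z1 z1'. wit w L0 H0 r j1 z1 z1')"
      proof (cases "r = H0")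
        case False
        then have rK: "r \<notin> K" using hi_props(3)[of r K "l + k" ?n] H kr' lr(2) unfolding H0_def by linarith
        have "r \<noteq> ?n" using False H Hn by auto
        then obtain j1 z1 z1' where a: "awit w K r j1 z1 z1'" using right rK by auto
        have nb: "r < x" if x: "x \<in> K" "l + k < x" for x
        proof -
          have "r \<le> x" using K x by auto
          then show ?thesis using x(1) rK by (metis le_neq_implies_less)
        qed
        have "L0 = lo K r" "H0 = hi ?n K r" unfolding L0_def H0_def
          using same_arc[of "l + k" r K] kr' nb by auto
        then show ?thesis using a by (auto simp: awit_def)
      qed simp
    qed
    then have "awit w K (l + k) j z z'" using kr' lr by (simp add: awit_def L0_def H0_def)
    then show "l + k \<in> CS w K" by (auto simp: CS_def)
  qed simp
  then have "card ((\<lambda>k. l + k) ` ?X) \<le> card {x\<in>CS w K. l \<le> x \<and> x < r}"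
    by (intro card_mono) (auto simp: finite_CS)
  then show ?thesis unfolding Q_def by (simp add: card_image)
qed

lemma om_scr: assumes w: "saw w" and s: "0 < s" "s < 1" and z: "0 \<le> \<zeta>" "0 \<le> ca" "0 \<le> cb"
  shows "chain w K t rc l is \<Longrightarrow> l = 0 \<or> l \<in> K \<or> (\<exists>i1 z z'. awit w K i1 l z z' \<and> l \<notin> K) \<Longrightarrow>
    s ^ card {x\<in>CS w K. l \<le> x} * (prod_list (map (\<lambda>i. if i \<in> K then ca else cb) is) * W \<zeta> (drop l w))
      \<le> om s \<zeta> ca cb (fst (scr w rc l is)) (snd (scr w rc l is))"
proof (induction "is" arbitrary: l)
  case Nil
  have aw: "apath w" using w by (auto simp: saw_def)
  have l: "l < length w" "\<forall>k\<in>K. k \<le> l" using Nil by auto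
  have sl: "slice w l (length w - 1) = drop l w" using slice_drop[of l "length w - 1" w] l by simp
  have "Q (drop l w) \<le> card {x\<in>CS w K. l \<le> x \<and> x < length w - 1}"
    using Q_slice[OF aw, of l "length w - 1" K] Nil.prems l sl by fastforce
  also have "\<dots> \<le> card {x\<in>CS w K. l \<le> x}" by (intro card_mono) (auto simp: finite_CS)
  finally have "s ^ card {x\<in>CS w K. l \<le> x} \<le> s ^ Q (drop l w)" using s by (intro power_decreasing) auto
  then show ?case using mult_right_mono[OF _ W_nonneg[OF z(1)]] by simp
next
  case (Cons i js)
  have aw: "apath w" using w by (auto simp: saw_def)
  obtain f j z z' e where r: "rc i = (f, j, z, z', e)" by (metis prod.exhaust)
  have c: "l \<le> i" "opok w K t i (f, j, z, z', e)" "chain w K t rc j js" "\<forall>k\<in>K. l < k \<longrightarrow> i \<le> k" using Cons.prems r by auto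
  note O = opok_range[OF c(2)]
  let ?P = "prod_list (map (\<lambda>i. if i \<in> K then ca else cb) js)"
  let ?c = "if i \<in> K then ca else cb"
  have f: "f \<longleftrightarrow> i \<in> K" using c(2) by (simp add: opok_def)
  have jl: "j = 0 \<or> j \<in> K \<or> (\<exists>i1 z z'. awit w K i1 j z z' \<and> j \<notin> K)"
    using c(2) by (cases f) (auto simp: opok_def)
  have ih: "s ^ card {x\<in>CS w K. j \<le> x} * (?P * W \<zeta> (drop j w)) \<le> om s \<zeta> ca cb (fst (scr w rc j js)) (snd (scr w rc j js))"
    by (rule Cons.IH[OF c(3) jl])
  have "Q (slice w l i) \<le> card {x\<in>CS w K. l \<le> x \<and> x < i}"
    by (rule Q_slice[OF aw c(1) O(1) c(4) Cons.prems(2)]) (use c(2) in \<open>cases f; auto simp: opok_def\<close>)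
  moreover have "card {x\<in>CS w K. l \<le> x \<and> x < i} + card {x\<in>CS w K. j \<le> x} \<le> card {x\<in>CS w K. l \<le> x}"
  proof -
    have "card {x\<in>CS w K. l \<le> x \<and> x < i} + card {x\<in>CS w K. j \<le> x} = card ({x\<in>CS w K. l \<le> x \<and> x < i} \<union> {x\<in>CS w K. j \<le> x})"
      using O(2) by (intro card_Un_disjoint[symmetric]) (auto simp: finite_CS)
    also have "\<dots> \<le> card {x\<in>CS w K. l \<le> x}" using O(2) c(1) by (intro card_mono) (auto simp: finite_CS)
    finally show ?thesis .
  qed
  ultimately have "s ^ card {x\<in>CS w K. l \<le> x} \<le> s ^ (Q (slice w l i) + card {x\<in>CS w K. j \<le> x})"
    using s by (intro power_decreasing) auto
  then have sp: "s ^ card {x\<in>CS w K. l \<le> x} \<le> s ^ Q (slice w l i) * s ^ card {x\<in>CS w K. j \<le> x}" by (simp add: power_add)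
  have Wd: "W \<zeta> (drop l w) = W \<zeta> (slice w l i) * W \<zeta> (slice w i j) * W \<zeta> (drop j w)"
  proof -
    have ne: "slice w l i \<noteq> []" "slice w i j \<noteq> []" "drop j w \<noteq> []" using slice_ne[OF c(1) O(1)] slice_ne[OF O(2,3)] O(3) by auto
    have e1: "hd (slice w i j) = last (slice w l i)" using slice_hd[OF O(2,3)] slice_last[OF c(1) O(1)] by simp
    have "slice w l i @ tl (slice w i j) = slice w l j" by (rule slice_glue[OF c(1) O(2,3)])
    then have e2: "last (slice w l i @ tl (slice w i j)) = w ! j" using slice_last[of l j w] c(1) O(2,3) by simp
    have "W \<zeta> ((slice w l i @ tl (slice w i j)) @ tl (drop j w)) = W \<zeta> (slice w l i @ tl (slice w i j)) * W \<zeta> (drop j w)"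
      by (rule W_glue) (use ne e2 O(3) in \<open>auto simp: hd_drop_conv_nth\<close>)
    then show ?thesis using W_glue[OF ne(1,2) e1] slice_glue3[OF c(1) O(2,3)] by simp
  qed
  have nn: "0 \<le> W \<zeta> (slice w l i)" "0 \<le> W \<zeta> (slice w i j)" "0 \<le> W \<zeta> (drop j w)" "0 \<le> ?P" "0 \<le> ?c"
    using z by (auto intro!: prod_list_nonneg)
  have "s ^ card {x\<in>CS w K. l \<le> x} * (?c * ?P * W \<zeta> (drop l w))
     \<le> (s ^ Q (slice w l i) * s ^ card {x\<in>CS w K. j \<le> x}) * (?c * ?P * W \<zeta> (drop l w))"
    using sp nn Wd by (intro mult_right_mono) auto
  also have "\<dots> = (s ^ Q (slice w l i) * W \<zeta> (slice w l i) * ?c * W \<zeta> (slice w i j)) * (s ^ card {x\<in>CS w K. j \<le> x} * (?P * W \<zeta> (drop j w)))"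
    unfolding Wd by (simp add: mult_ac)
  also have "\<dots> \<le> (s ^ Q (slice w l i) * W \<zeta> (slice w l i) * ?c * W \<zeta> (slice w i j)) * om s \<zeta> ca cb (fst (scr w rc j js)) (snd (scr w rc j js))"
    using ih nn s by (intro mult_left_mono) auto
  finally show ?case using f r by simp
qed

end

section \<open>Entropy gain in the unimodular case\<close>

lemma sum_Pow_power: fixes a :: real assumes "finite X" shows "(\<Sum>S\<in>Pow X. a ^ card S) = (1 + a) ^ card X"
proof -
  have "(\<Prod>i\<in>X. a + 1) = (\<Sum>S\<in>Pow X. (\<Prod>i\<in>S. a) * (\<Prod>i\<in>X - S. 1))" by (rule prod_add[OF assms])
  then show ?thesis by (simp add: add.commute)
qed

context tgraph_inf begin

lemma sum_saw_length: assumes U: "finite U" "\<And>u. u \<in> U \<Longrightarrow> saw u \<and> hd u = v" and z: "0 < \<zeta>"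
    and Kz: "\<And>N. (\<Sum>k<N. c k * \<zeta> ^ k) \<le> Kz"
  shows "(\<Sum>u\<in>U. W \<zeta> u) \<le> Kz"
proof -
  define N where "N = Suc (Max (insert 0 (length ` U)))"
  have N: "length u < N" if "u \<in> U" for u
  proof -
    have "length u \<le> Max (insert 0 (length ` U))" using U(1) that by (intro Max_ge) auto
    then show ?thesis by (simp add: N_def)
  qed
  have "(\<Sum>u\<in>U. W \<zeta> u) \<le> (\<Sum>(k, u)\<in>(SIGMA k:{..<N}. SW v k). W \<zeta> u)"
  proof (rule sum_le_inj[where h = "\<lambda>u. (length u - 1, u)"])
    show "(\<lambda>u. (length u - 1, u)) ` U \<subseteq> (SIGMA k:{..<N}. SW v k)"
    proof safe
      fix u assume u: "u \<in> U"
      then show "length u - 1 < N" using N[of u] by simp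
      show "u \<in> SW v (length u - 1)" using U(2)[OF u] by (cases u) (auto simp: SW_def saw_def)
    qed
  qed (use z in \<open>auto simp: finite_SW inj_on_def\<close>)
  also have "\<dots> = (\<Sum>k<N. \<Sum>u\<in>SW v k. W \<zeta> u)" by (rule sum.Sigma[symmetric]) (auto simp: finite_SW)
  also have "\<dots> = (\<Sum>k<N. c k * \<zeta> ^ k)"
  proof (rule sum.cong)
    fix k show "(\<Sum>u\<in>SW v k. W \<zeta> u) = c k * \<zeta> ^ k"
      unfolding c_eq[of v k, symmetric] sum_distrib_right by (rule sum.cong) (auto simp: W_def SW_def)
  qed simp
  finally show ?thesis using Kz[of N] by simp
qed

lemma generating_bound: assumes z: "0 < \<zeta>" "\<zeta> * mu < 1"
  shows "\<exists>Kz>0. \<forall>N. (\<Sum>k<N. c k * \<zeta> ^ k) \<le> Kz"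
proof -
  define ka where "ka = (mu + 1 / \<zeta>) / 2"
  have ka: "mu < ka" "ka * \<zeta> < 1" "ka > 0" 
  proof -
    have "mu < 1 / \<zeta>" using z by (simp add: pos_less_divide_eq mult.commute)
    then have "mu < ka" "ka < 1 / \<zeta>" by (auto simp: ka_def)
    then show "mu < ka" "ka * \<zeta> < 1" "ka > 0" using z mu_ge1 by (auto simp: pos_less_divide_eq)
  qed
  obtain K where K: "K > 0" "\<forall>n. c n \<le> K * ka ^ n" using c_subexp[OF ka(1)] by blast
  have "(\<Sum>k<N. c k * \<zeta> ^ k) \<le> K / (1 - ka * \<zeta>)" for N
  proof -
    have "(\<Sum>k<N. c k * \<zeta> ^ k) \<le> (\<Sum>k<N. K * (ka * \<zeta>) ^ k)"
    proof (rule sum_mono)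
      fix k show "c k * \<zeta> ^ k \<le> K * (ka * \<zeta>) ^ k"
        using mult_right_mono[OF K(2)[rule_format, of k], of "\<zeta> ^ k"] z by (simp add: power_mult_distrib mult_ac)
    qed
    also have "\<dots> = K * (\<Sum>k<N. (ka * \<zeta>) ^ k)" by (simp add: sum_distrib_left)
    also have "(\<Sum>k<N. (ka * \<zeta>) ^ k) = (1 - (ka * \<zeta>) ^ N) / (1 - ka * \<zeta>)" using ka by (simp add: sum_gp_strict)
    also have "K * \<dots> \<le> K / (1 - ka * \<zeta>)" using ka z K by (simp add: divide_right_mono mult_le_cancel_left1)
    finally show ?thesis .
  qed
  then show ?thesis using K ka by (intro exI[of _ "K / (1 - ka * \<zeta>)"]) auto
qed

end

context tgraph_uni begin

definition D5 :: nat where "D5 = D2 + 2 * Ca + C1"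
text \<open>The distance to an anchor is minimal at its mark over the whole walk and not just over
  an arc; this is why every subset of the marks is again admissible.\<close>

definition marksys :: "'a list \<Rightarrow> nat set \<Rightarrow> (nat \<Rightarrow> 'a) \<Rightarrow> bool" where
  "marksys w K az \<longleftrightarrow> K \<subseteq> {..<length w} \<and>
    (\<forall>i\<in>K. R < d (az i) (w ! i) \<and> d (az i) (w ! i) \<le> Ca \<and> (\<forall>y\<in>set w. d (az i) (w ! i) \<le> d (az i) y)) \<and>
    (\<forall>i\<in>K. \<forall>k\<in>K. i \<noteq> k \<longrightarrow> D2 \<le> d (az i) (az k))"

text \<open>All chosen operations may be carried out at once and must then be far apart. So the
  turns are thinned and kept away from the marks, at the cost of a factor
  \<open>NB D5\<close>.\<close>

lemma separated_turns: assumes w: "saw w" and K: "K \<subseteq> {..<length w}"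
  shows "\<exists>\<Theta>\<subseteq>TS w K t. (\<forall>i\<in>\<Theta>. \<forall>k\<in>\<Theta>. i \<noteq> k \<longrightarrow> D5 < d (w ! i) (w ! k)) \<and>
     (\<forall>i\<in>\<Theta>. \<forall>k\<in>K. D5 < d (w ! i) (w ! k)) \<and> card (TS w K t) \<le> NB D5 * (card \<Theta> + card K)"
proof -
  have dw: "distinct w" using w by (simp add: saw_def)
  have fK: "finite K" using K finite_subset by blast
  have lw: "TS w K t \<subseteq> {..<length w}" by (auto simp: TS_def awit_def)
  then have fT: "finite (TS w K t)" using finite_subset by blast
  define X where "X = {i\<in>TS w K t. \<forall>k\<in>K. D5 < d (w ! i) (w ! k)}"
  have Xs: "X \<subseteq> TS w K t" "X \<subseteq> {..<length w}" "finite X" using lw fT by (auto simp: X_def)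
  have inj: "inj_on ((!) w) X"
  proof (rule inj_onI)
    fix x y assume "x \<in> X" "y \<in> X" "w ! x = w ! y"
    moreover from this have "x < length w" "y < length w" using Xs(2) by auto
    ultimately show "x = y" using nth_eq_iff_index_eq[OF dw] by blast
  qed
  from thinning[OF finite_imageI[OF Xs(3)], of "(!) w" D5]
  obtain Y where Y: "Y \<subseteq> (!) w ` X" "\<forall>x\<in>Y. \<forall>y\<in>Y. x \<noteq> y \<longrightarrow> D5 < d x y" "card ((!) w ` X) \<le> NB D5 * card Y"
    by (elim exE conjE) (rule that)
  define Th where "Th = {i\<in>X. w ! i \<in> Y}"
  have cT: "card Th = card Y"
  proof -
    have "Y = (!) w ` Th" using Y(1) by (auto simp: Th_def)
    then show ?thesis using card_image[OF inj_on_subset[OF inj, of Th]] by (auto simp: Th_def)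
  qed
  have "TS w K t - X \<subseteq> (\<Union>k\<in>K. {i. i < length w \<and> d (w ! k) (w ! i) \<le> D5})"
  proof
    fix i assume i: "i \<in> TS w K t - X"
    then obtain k where k: "k \<in> K" "\<not> D5 < d (w ! i) (w ! k)" by (auto simp: X_def)
    then have "d (w ! k) (w ! i) \<le> D5" by (simp add: d_sym[of "w ! k" "w ! i"])
    then show "i \<in> (\<Union>k\<in>K. {i. i < length w \<and> d (w ! k) (w ! i) \<le> D5})" using i k lw by blast
  qed
  then have "card (TS w K t - X) \<le> card (\<Union>k\<in>K. {i. i < length w \<and> d (w ! k) (w ! i) \<le> D5})"
    using fK by (intro card_mono) auto
  also have "\<dots> \<le> (\<Sum>k\<in>K. card {i. i < length w \<and> d (w ! k) (w ! i) \<le> D5})" by (rule card_UN_le[OF fK])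
  also have "\<dots> \<le> (\<Sum>k\<in>K. NB D5)" by (intro sum_mono card_index_near[OF dw])
  finally have 1: "card (TS w K t - X) \<le> card K * NB D5" by simp
  have "card (TS w K t) = card X + card (TS w K t - X)"
    using card_Diff_subset[OF Xs(3,1)] card_mono[OF fT Xs(1)] by simp
  also have "\<dots> \<le> NB D5 * card Y + card K * NB D5" using 1 Y(3) card_image[OF inj] by simp
  finally have 2: "card (TS w K t) \<le> NB D5 * (card Th + card K)" by (simp add: cT algebra_simps)
  show ?thesis
  proof (intro exI[of _ Th] conjI)
    show "\<forall>i\<in>Th. \<forall>k\<in>Th. i \<noteq> k \<longrightarrow> D5 < d (w ! i) (w ! k)"
    proof (intro ballI impI)
      fix i k assume ik: "i \<in> Th" "k \<in> Th" "i \<noteq> k"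
      then have "w ! i \<noteq> w ! k" using inj by (auto simp: Th_def inj_on_def)
      then show "D5 < d (w ! i) (w ! k)" using Y(2) ik by (auto simp: Th_def)
    qed
  qed (use 2 Xs in \<open>auto simp: Th_def X_def\<close>)
qed

lemma rec_exists: assumes m: "marksys w K az" and Th: "\<Theta> \<subseteq> TS w K t" "\<forall>i\<in>\<Theta>. \<forall>k\<in>K. D5 < d (w ! i) (w ! k)" and w: "saw w"
    and i: "i \<in> K \<union> \<Theta>"
  shows "\<exists>r. opok w K t i r \<and> (i \<in> K \<longrightarrow> fst (snd (snd r)) = az i)"
proof (cases "i \<in> K")
  case True
  obtain e where e: "d (az i) e = Suc R" "infinite (CP (az i) e)" "e \<notin> CP (az i) (w ! i)" using third[of "az i" "w ! i"] by blast
  show ?thesis using True e m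
    by (intro exI[of _ "(True, i, az i, az i, e)"]) (auto simp: opok_def marksys_def)
next
  case False
  then have iT: "i \<in> \<Theta>" using i by simp
  then obtain j z z' where a: "awit w K i j z z'" "t \<in> CP z' (w ! j)" using Th(1) by (auto simp: TS_def)
  obtain e where e: "d z e = Suc R" "infinite (CP z e)" "e \<notin> CP z (w ! i)" "t \<notin> CP z e" using third[of z "w ! i" t] by blast
  have "j \<notin> K"
  proof
    assume "j \<in> K"
    then have "D5 < d (w ! i) (w ! j)" using Th(2) iT by blast
    moreover have "d (w ! i) (w ! j) \<le> C1" using walk_dist[of w i j] w awit_range[OF a(1)] by (simp add: saw_def)
    ultimately show False by (simp add: D5_def)
  qed
  moreover have "i < length w" using a by (simp add: awit_def)
  ultimately show ?thesis using False a e
    by (intro exI[of _ "(False, j, z, z', e)"]) (auto simp: opok_def)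
qed

text \<open>If one of two operations is a turn, the separation of their vertices passes to their
  centres with a loss of two anchor distances and one gap. This is the difference between
  \<open>D5\<close> and \<open>D2\<close>.\<close>

lemma chain_build:
  assumes w: "saw w" and m: "marksys w K az" and rc: "\<And>i. i \<in> K \<union> \<Theta> \<Longrightarrow> opok w K t i (rc i)"
    "\<And>i. i \<in> K \<Longrightarrow> fst (snd (snd (rc i))) = az i"
    and sep: "\<forall>i\<in>\<Theta>. \<forall>k\<in>\<Theta>. i \<noteq> k \<longrightarrow> D5 < d (w ! i) (w ! k)" "\<forall>i\<in>\<Theta>. \<forall>k\<in>K. D5 < d (w ! i) (w ! k)"
  shows "sorted_wrt (<) is \<Longrightarrow> set is \<subseteq> K \<union> \<Theta> \<Longrightarrow> \<forall>k\<in>set is. l \<le> k \<Longrightarrow> \<forall>k\<in>K. l < k \<longrightarrow> k \<in> set is \<Longrightarrow>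
     l < length w \<Longrightarrow> chain w K t rc l is"
proof (induction "is" arbitrary: l)
  case Nil then show ?case by (auto simp: not_less[symmetric])
next
  case (Cons i js)
  obtain f j z z' e where r: "rc i = (f, j, z, z', e)" by (metis prod.exhaust)
  have op: "opok w K t i (f, j, z, z', e)" using rc(1)[of i] Cons.prems(2) r by simp
  note O = opok_range[OF op]
  have aw: "apath w" using w by (simp add: saw_def)
  have f: "f \<longleftrightarrow> i \<in> K" using op by (simp add: opok_def)
  have gap: "j \<le> k \<and> D2 \<le> d z' (fst (snd (snd (rc k))))" if k: "k \<in> set js" for k
  proof -
    have ik: "i < k" using k Cons.prems(1) by simp
    have kU: "k \<in> K \<union> \<Theta>" using k Cons.prems(2) by auto
    obtain f2 j2 z2 z2' e2 where r2: "rc k = (f2, j2, z2, z2', e2)" by (metis prod.exhaust)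
    have op2: "opok w K t k (f2, j2, z2, z2', e2)" using rc(1)[OF kU] r2 by simp
    note O2 = opok_range[OF op2]
    show ?thesis
    proof (cases "i \<in> K \<and> k \<in> K")
      case True
      then have "j = i" "z' = z" using op f by (auto simp: opok_def)
      then show ?thesis using ik True m rc(2)[of i] rc(2)[of k] r by (auto simp: marksys_def)
    next
      case False
      have far: "D5 < d (w ! i) (w ! k)"
      proof (cases "i \<in> \<Theta>")
        case True
        have "i \<noteq> k" using ik by simp
        then show ?thesis using sep True kU by (elim UnE) blast+
      next
        case F: False
        have "i \<in> K \<union> \<Theta>" using Cons.prems(2) by simp
        then have "i \<in> K" using F by simp
        moreover from this have "k \<in> \<Theta>" using False kU by simp
        ultimately have "i \<in> K" "k \<in> \<Theta>" .
        then have "D5 < d (w ! k) (w ! i)" using sep(2) by blast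
        then show ?thesis by (simp only: d_sym[of "w ! i" "w ! k"])
      qed
      moreover have "d (w ! i) (w ! k) \<le> k - i" by (rule walk_dist[OF aw less_imp_le[OF ik] O2(1)])
      ultimately have jk: "j \<le> k" using O(4) by (simp add: D5_def)
      have "d (w ! i) (w ! j) \<le> C1" using walk_dist[OF aw O(2,3)] O(4) by linarith
      moreover have "d (w ! i) (w ! k) \<le> d (w ! i) (w ! j) + (d (w ! j) z' + (d z' z2 + d z2 (w ! k)))"
        using d_tri[of "w ! i" "w ! k" "w ! j"] d_tri[of "w ! j" "w ! k" z'] d_tri[of z' "w ! k" z2] by linarith
      ultimately have "D2 \<le> d z' z2" using far O(8) O2(6) d_sym[of z' "w ! j"] by (simp add: D5_def)
      then show ?thesis using jk r2 by simp
    qed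
  qed
  have "chain w K t rc j js"
  proof (rule Cons.IH)
    show "\<forall>k\<in>K. j < k \<longrightarrow> k \<in> set js"
    proof (intro ballI impI)
      fix k assume k: "k \<in> K" "j < k"
      have "l \<le> i" using Cons.prems(3) by simp
      then have "l < k" using k(2) O(2) by linarith
      then have "k \<in> set (i # js)" using Cons.prems(4) k(1) by blast
      then show "k \<in> set js" using k O(2) by auto
    qed
  qed (use Cons.prems gap O in auto)
  moreover have "\<forall>k\<in>K. l < k \<longrightarrow> i \<le> k"
  proof (intro ballI impI)
    fix k assume "k \<in> K" "l < k"
    then have "k = i \<or> k \<in> set js" using Cons.prems(4) by auto
    then show "i \<le> k" using Cons.prems(1) by auto
  qed
  ultimately show ?case using Cons.prems op r gap by auto
qed

text \<open>The records \<open>rc\<close> are fixed before \<open>S\<close>, so whether to turn can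
  be decided independently at every site of \<open>\<Theta>\<close>.\<close>

lemma script_family: assumes w: "saw w" and m: "marksys w K az" and mj: "maj w K t"
  shows "\<exists>\<Theta> rc. finite \<Theta> \<and> \<Theta> \<inter> K = {} \<and> (\<forall>S\<subseteq>\<Theta>. chain w K t rc 0 (sorted_list_of_set (K \<union> S))) \<and>
    card (CS w K) \<le> A1 * (NB D5 * card \<Theta> + (NB D5 + 1) * card K + 1)"
proof -
  have K: "K \<subseteq> {..<length w}" "finite K" using m finite_subset[of K "{..<length w}"] by (auto simp: marksys_def)
  from separated_turns[OF w K(1), of t]
  obtain Th where Th: "Th \<subseteq> TS w K t" "\<forall>i\<in>Th. \<forall>k\<in>Th. i \<noteq> k \<longrightarrow> D5 < d (w ! i) (w ! k)"
     "\<forall>i\<in>Th. \<forall>k\<in>K. D5 < d (w ! i) (w ! k)" "card (TS w K t) \<le> NB D5 * (card Th + card K)"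
    by (elim exE conjE) (rule that)
  have fT: "finite Th" by (rule finite_subset[OF subset_trans[OF Th(1) TS_sub] finite_CS])
  define rc where "rc i = (SOME r. opok w K t i r \<and> (i \<in> K \<longrightarrow> fst (snd (snd r)) = az i))" for i
  have rc: "opok w K t i (rc i) \<and> (i \<in> K \<longrightarrow> fst (snd (snd (rc i))) = az i)" if "i \<in> K \<union> Th" for i
    unfolding rc_def by (rule someI_ex[OF rec_exists[OF m Th(1,3) w that]])
  have "chain w K t rc 0 (sorted_list_of_set (K \<union> S))" if S: "S \<subseteq> Th" for S
  proof (rule chain_build[OF w m _ _ Th(2,3)])
    have fin: "finite (K \<union> S)" using K fT S finite_subset by blast
    show "sorted_wrt (<) (sorted_list_of_set (K \<union> S))" by simp
    show "set (sorted_list_of_set (K \<union> S)) \<subseteq> K \<union> Th" using fin S by auto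
    show "\<forall>k\<in>K. 0 < k \<longrightarrow> k \<in> set (sorted_list_of_set (K \<union> S))" using fin by auto
    show "0 < length w" using w by (simp add: saw_def)
  qed (use rc in auto)
  moreover have "Th \<inter> K = {}" using Th(3) by fastforce
  moreover have "card (CS w K) \<le> A1 * (NB D5 * card Th + (NB D5 + 1) * card K + 1)"
  proof -
    have "card (CS w K) \<le> A1 * (card (TS w K t) + card K + 1)" using mj by (simp add: maj_def)
    also have "\<dots> \<le> A1 * (NB D5 * (card Th + card K) + card K + 1)" using Th(4) by (intro mult_left_mono) auto
    finally show ?thesis by (simp add: algebra_simps)
  qed
  ultimately show ?thesis using fT by blast
qed

text \<open>The factors \<open>(1 / 2) ^ n\<close> sum to at most \<open>2\<close>, so scripts with
  any number of operations can be treated together.\<close>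

lemma finite_Fib_family: assumes U: "finite (U :: 'a list set)" and z: "0 < \<zeta>" and fb: "\<And>n u. finite (Fib t n v u) \<and> (\<Sum>(p, es)\<in>Fib t n v u. om s \<zeta> ca cb p es) \<le> (1 / 2) ^ n * W \<zeta> u"
    and J: "finite J" "\<And>p es. (p, es) \<in> J \<Longrightarrow> \<exists>u\<in>U. (p, es) \<in> Fib t (length es) v u"
    and nn: "0 \<le> s" "0 \<le> ca" "0 \<le> cb"
  shows "(\<Sum>(p, es)\<in>J. om s \<zeta> ca cb p es) \<le> 2 * (\<Sum>u\<in>U. W \<zeta> u)"
proof -
  define N where "N = Suc (Max (insert 0 ((\<lambda>r. length (snd r)) ` J)))"
  have N: "length es < N" if "(p, es) \<in> J" for p es
  proof -
    have "length (snd (p, es)) \<in> (\<lambda>r. length (snd r)) ` J" using that by (rule imageI)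
    then have "length (snd (p, es)) \<le> Max (insert 0 ((\<lambda>r. length (snd r)) ` J))" using J(1) by (intro Max_ge) auto
    then show ?thesis by (simp add: N_def)
  qed
  define ch where "ch r = (SOME u. u \<in> U \<and> r \<in> Fib t (length (snd r)) v u)" for r
  have ch: "ch r \<in> U \<and> r \<in> Fib t (length (snd r)) v (ch r)" if "r \<in> J" for r
  proof -
    have "\<exists>u. u \<in> U \<and> r \<in> Fib t (length (snd r)) v u" using J(2)[of "fst r" "snd r"] that by auto
    then show ?thesis unfolding ch_def by (rule someI_ex)
  qed
  let ?T = "SIGMA nu : {..<N} \<times> U. Fib t (fst nu) v (snd nu)"
  have om0: "0 \<le> om s \<zeta> ca cb p es" for p es using z by (intro om_nonneg nn) auto
  have "(\<Sum>(p, es)\<in>J. om s \<zeta> ca cb p es) \<le> (\<Sum>(nu, p, es)\<in>?T. om s \<zeta> ca cb p es)"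
    by (rule sum_le_inj[where h = "\<lambda>r. ((length (snd r), ch r), r)"]) (use U fb ch N om0 in \<open>auto intro!: inj_onI\<close>)
  also have "\<dots> = (\<Sum>nu\<in>{..<N} \<times> U. \<Sum>(p, es)\<in>Fib t (fst nu) v (snd nu). om s \<zeta> ca cb p es)"
    by (rule sum.Sigma[symmetric]) (use U fb in auto)
  also have "\<dots> \<le> (\<Sum>nu\<in>{..<N} \<times> U. (1 / 2) ^ fst nu * W \<zeta> (snd nu))" using fb by (intro sum_mono) auto
  also have "\<dots> = (\<Sum>n<N. (1 / 2) ^ n) * (\<Sum>u\<in>U. W \<zeta> u)"
    by (simp add: sum_product sum.cartesian_product case_prod_beta)
  also have "\<dots> \<le> 2 * (\<Sum>u\<in>U. W \<zeta> u)"
    using z by (intro mult_right_mono sum_nonneg) (auto simp: sum_gp_strict)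
  finally show ?thesis .
qed

text \<open>Each marked walk yields one script for every subset of its turns. Summing over the
  subsets gives \<open>(1 + cb) ^ card \<Theta>\<close>, and by \<open>big\<close> this outweighs
  the part of the damping that is proportional to the number of turns; the rest is charged to the
  marks and to \<open>s ^ A1\<close>. On the other side all scripts glue to walks counted by
  \<open>Kz\<close>, with multiplicities controlled by \<open>fb\<close>.\<close>

lemma marked_sum:
  assumes fb: "\<And>n u. finite (Fib t n v u) \<and> (\<Sum>(p, es)\<in>Fib t n v u. om s \<zeta> ca cb p es) \<le> (1 / 2) ^ n * W \<zeta> u"
    and s: "0 < s" "s < 1" and cc: "0 \<le> ca" "0 \<le> cb" and z: "0 < \<zeta>"
    and big: "s ^ (A1 * NB D5) * (1 + cb) \<ge> 1"
    and Kz: "\<And>N. (\<Sum>k<N. c k * \<zeta> ^ k) \<le> Kz"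
    and P: "finite P" "\<And>w K. (w, K) \<in> P \<Longrightarrow> saw w \<and> hd w = v \<and> (\<exists>az. marksys w K az) \<and> maj w K t"
  shows "(\<Sum>(w, K)\<in>P. W \<zeta> w * (ca * s ^ (A1 * (NB D5 + 1))) ^ card K) * s ^ A1 \<le> 2 * Kz"
proof -
  let ?ok = "\<lambda>w K T. finite (fst T) \<and> fst T \<inter> K = {} \<and> (\<forall>S\<subseteq>fst T. chain w K t (snd T) 0 (sorted_list_of_set (K \<union> S))) \<and>
    card (CS w K) \<le> A1 * (NB D5 * card (fst T) + (NB D5 + 1) * card K + 1)"
  define F where "F w K = (SOME T. ?ok w K T)" for w K
  have F: "?ok w K (F w K)" if wK: "(w, K) \<in> P" for w K
  proof -
    obtain az where "saw w" "marksys w K az" "maj w K t" using P(2)[OF wK] by blast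
    from script_family[OF this] have "\<exists>T. ?ok w K T" by simp
    then show ?thesis unfolding F_def by (rule someI_ex)
  qed
  have fK: "finite K" if "(w, K) \<in> P" for w K
    using P(2)[OF that] finite_subset[of K "{..<length w}"] by (auto simp: marksys_def)
  define li where "li K S = sorted_list_of_set (K \<union> S)" for K S :: "nat set"
  define phi where "phi = (\<lambda>(wK, S). scr (fst wK) (snd (F (fst wK) (snd wK))) 0 (li (snd wK) S))"
  define I where "I = (SIGMA wK:P. Pow (fst (F (fst wK) (snd wK))))"
  have fI: "finite I" unfolding I_def using P(1) F by (intro finite_SigmaI) auto
  have ch: "chain w K t (snd (F w K)) 0 (li K S)" if "((w, K), S) \<in> I" for w K S
    using that F[of w K] by (auto simp: I_def li_def)
  have fU: "finite (K \<union> S)" "S \<inter> K = {}" if "((w, K), S) \<in> I" for w K S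
    using that F[of w K] fK[of w K] by (auto simp: I_def intro: finite_subset)
  have inj: "inj_on phi I"
  proof (rule inj_onI)
    fix x y assume xy: "x \<in> I" "y \<in> I" "phi x = phi y"
    obtain w K S where x: "x = ((w, K), S)" by (metis prod.exhaust)
    obtain w2 K2 S2 where y: "y = ((w2, K2), S2)" by (metis prod.exhaust)
    note cx = scr_decode[OF ch[OF xy(1)[unfolded x]]] and cy = scr_decode[OF ch[OF xy(2)[unfolded y]]]
    have e: "scr w (snd (F w K)) 0 (li K S) = scr w2 (snd (F w2 K2)) 0 (li K2 S2)" using xy(3) by (simp add: x y phi_def)
    have ww: "w = w2" using cx cy e by simp
    have tg: "map (\<lambda>i. (i, i \<in> K)) (li K S) = map (\<lambda>i. (i, i \<in> K2)) (li K2 S2)" using cx cy e by simp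
    have st: "set (li K S) = K \<union> S" "set (li K2 S2) = K2 \<union> S2"
      using fU[OF xy(1)[unfolded x]] fU[OF xy(2)[unfolded y]] by (simp_all add: li_def)
    have g: "(\<lambda>i. (i, i \<in> K)) ` (K \<union> S) = (\<lambda>i. (i, i \<in> K2)) ` (K2 \<union> S2)" using arg_cong[OF tg, of set] st by simp
    have g1: "(i, b) \<in> (\<lambda>i. (i, i \<in> K)) ` (K \<union> S) \<longleftrightarrow> i \<in> K \<union> S \<and> b = (i \<in> K)" for i b by auto
    have g2: "(i, b) \<in> (\<lambda>i. (i, i \<in> K2)) ` (K2 \<union> S2) \<longleftrightarrow> i \<in> K2 \<union> S2 \<and> b = (i \<in> K2)" for i b by auto
    have both: "i \<in> K \<union> S \<and> b = (i \<in> K) \<longleftrightarrow> i \<in> K2 \<union> S2 \<and> b = (i \<in> K2)" for i b using g g1 g2 by metis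
    have "K = K2" using both by blast
    moreover have "K \<union> S = K2 \<union> S2" using both by blast
    ultimately have "S = S2" using fU(2)[OF xy(1)[unfolded x]] fU(2)[OF xy(2)[unfolded y]] by blast
    then show "x = y" using ww \<open>K = K2\<close> by (simp add: x y)
  qed
  let ?om = "\<lambda>r. om s \<zeta> ca cb (fst r) (snd r)"
  have val: "validS t (fst (phi x)) (snd (phi x)) \<and> hd (fst (phi x)) = v" if x: "x \<in> I" for x
  proof -
    obtain w K S where xe: "x = ((w, K), S)" by (metis prod.exhaust)
    have wP: "(w, K) \<in> P" using x by (simp add: I_def xe)
    have sw: "saw w" "hd w = v" using P(2)[OF wP] by auto
    have "w \<noteq> []" using sw by (simp add: saw_def)
    then have "hd (fst (phi x)) = v" using scr_hd[OF ch[OF x[unfolded xe]]] sw by (simp add: xe phi_def hd_conv_nth)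
    then show ?thesis using validS_scr[OF sw(1) ch[OF x[unfolded xe]]] by (simp add: xe phi_def)
  qed
  define ug where "ug r = (SOME u. glued (fst r) (snd r) u \<and> saw u \<and> hd u = hd (fst r))" for r :: "'a list \<times> 'a entry list"
  have ug: "glued (fst r) (snd r) (ug r) \<and> saw (ug r) \<and> hd (ug r) = hd (fst r)" if "validS t (fst r) (snd r)" for r
  proof -
    have "\<exists>u. glued (fst r) (snd r) u \<and> saw u \<and> hd u = hd (fst r)" using glued_exists[OF that] by blast
    then show ?thesis unfolding ug_def by (rule someI_ex)
  qed
  have "(\<Sum>x\<in>I. ?om (phi x)) = (\<Sum>r\<in>phi ` I. ?om r)" using inj by (simp add: sum.reindex)
  also have "\<dots> = (\<Sum>(p, es)\<in>phi ` I. om s \<zeta> ca cb p es)" by (simp add: case_prod_beta)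
  also have "\<dots> \<le> 2 * (\<Sum>u\<in>ug ` phi ` I. W \<zeta> u)"
  proof (rule finite_Fib_family[OF _ z fb])
    fix p es assume pe: "(p, es) \<in> phi ` I"
    then obtain x where x: "x \<in> I" "phi x = (p, es)" by (metis image_iff)
    have "(p, es) \<in> Fib t (length es) v (ug (p, es))" using val[OF x(1)] ug[of "(p, es)"] x(2) by (simp add: Fib_def)
    then show "\<exists>u\<in>ug ` phi ` I. (p, es) \<in> Fib t (length es) v u" using pe by blast
  qed (use fI s cc in auto)
  also have "\<dots> \<le> 2 * Kz"
  proof -
    have "(\<Sum>u\<in>ug ` phi ` I. W \<zeta> u) \<le> Kz"
    proof (rule sum_saw_length[OF _ _ z Kz])
      fix u assume "u \<in> ug ` phi ` I"
      then obtain x where "x \<in> I" "u = ug (phi x)" by blast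
      then show "saw u \<and> hd u = v" using ug[of "phi x"] val[of x] by simp
    qed (use fI in simp)
    then show ?thesis by simp
  qed
  finally have up: "(\<Sum>x\<in>I. ?om (phi x)) \<le> 2 * Kz" .
  let ?ka = "s ^ (A1 * (NB D5 + 1))"
  have "(\<Sum>(w, K)\<in>P. W \<zeta> w * (ca * ?ka) ^ card K) * s ^ A1 \<le> (\<Sum>wK\<in>P. \<Sum>S\<in>Pow (fst (F (fst wK) (snd wK))). ?om (phi (wK, S)))"
    unfolding sum_distrib_right
  proof (rule sum_mono)
    fix wK assume wK: "wK \<in> P"
    obtain w K where e: "wK = (w, K)" by (metis prod.exhaust)
    have wP: "(w, K) \<in> P" using wK e by simp
    let ?T = "fst (F w K)"
    have Fw: "finite ?T" "?T \<inter> K = {}" "card (CS w K) \<le> A1 * (NB D5 * card ?T + (NB D5 + 1) * card K + 1)" using F[OF wP] by auto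
    have sw: "saw w" using P(2)[OF wP] by auto
    have W0: "0 \<le> W \<zeta> w" using z by simp
    have low: "s ^ card (CS w K) * (ca ^ card K * cb ^ card S * W \<zeta> w) \<le> ?om (phi (wK, S))" if S: "S \<in> Pow ?T" for S
    proof -
      have xI: "((w, K), S) \<in> I" using wP S by (simp add: I_def)
      note fin = fU[OF xI]
      have "prod_list (map (\<lambda>i. if i \<in> K then ca else cb) (li K S)) = (\<Prod>i\<in>set (li K S). if i \<in> K then ca else cb)"
        by (rule prod.distinct_set_conv_list[symmetric]) (simp add: li_def)
      also have "\<dots> = (\<Prod>i\<in>K \<union> S. if i \<in> K then ca else cb)" using fin by (simp add: li_def)
      also have "\<dots> = (\<Prod>i\<in>K. if i \<in> K then ca else cb) * (\<Prod>i\<in>S. if i \<in> K then ca else cb)"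
        using fin by (intro prod.union_disjoint) auto
      also have "(\<Prod>i\<in>S. if i \<in> K then ca else cb) = (\<Prod>i\<in>S. cb)" using fin(2) by (intro prod.cong) auto
      finally have pl: "prod_list (map (\<lambda>i. if i \<in> K then ca else cb) (li K S)) = ca ^ card K * cb ^ card S" by simp
      have "{x\<in>CS w K. 0 \<le> x} = CS w K" by simp
      then show ?thesis using om_scr[OF sw s less_imp_le[OF z] cc ch[OF xI]] pl by (simp add: phi_def e)
    qed
    have "s ^ (A1 * (NB D5 * card ?T + (NB D5 + 1) * card K + 1)) \<le> s ^ card (CS w K)"
      using s Fw(3) by (intro power_decreasing) auto
    moreover have "s ^ (A1 * (NB D5 * card ?T + (NB D5 + 1) * card K + 1)) = (s ^ (A1 * NB D5)) ^ card ?T * ?ka ^ card K * s ^ A1"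
      by (simp add: power_add[symmetric] power_mult[symmetric] algebra_simps del: power_Suc)
    ultimately have p1: "(s ^ (A1 * NB D5)) ^ card ?T * ?ka ^ card K * s ^ A1 \<le> s ^ card (CS w K)" by simp
    have "1 * (?ka ^ card K * s ^ A1) \<le> (s ^ (A1 * NB D5) * (1 + cb)) ^ card ?T * (?ka ^ card K * s ^ A1)"
      using one_le_power[OF big] s by (intro mult_right_mono) auto
    also have "\<dots> = ((s ^ (A1 * NB D5)) ^ card ?T * ?ka ^ card K * s ^ A1) * (1 + cb) ^ card ?T" by (simp add: power_mult_distrib)
    also have "\<dots> \<le> s ^ card (CS w K) * (1 + cb) ^ card ?T" using p1 cc by (intro mult_right_mono) auto
    finally have p2: "?ka ^ card K * s ^ A1 \<le> s ^ card (CS w K) * (1 + cb) ^ card ?T" by simp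
    have "W \<zeta> w * (ca * ?ka) ^ card K * s ^ A1 = (ca ^ card K * W \<zeta> w) * (?ka ^ card K * s ^ A1)" by (simp add: power_mult_distrib)
    also have "\<dots> \<le> (ca ^ card K * W \<zeta> w) * (s ^ card (CS w K) * (1 + cb) ^ card ?T)"
      using p2 cc W0 by (intro mult_left_mono) auto
    also have "\<dots> = (\<Sum>S\<in>Pow ?T. s ^ card (CS w K) * (ca ^ card K * cb ^ card S * W \<zeta> w))"
      unfolding sum_Pow_power[OF Fw(1), of cb, symmetric] sum_distrib_left by (simp add: mult_ac)
    also have "\<dots> \<le> (\<Sum>S\<in>Pow ?T. ?om (phi (wK, S)))" by (rule sum_mono[OF low])
    finally show "(case wK of (w, K) \<Rightarrow> W \<zeta> w * (ca * ?ka) ^ card K) * s ^ A1 \<le> (\<Sum>S\<in>Pow (fst (F (fst wK) (snd wK))). ?om (phi (wK, S)))"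
      by (simp add: e)
  qed
  also have "\<dots> = (\<Sum>(wK, S)\<in>I. ?om (phi (wK, S)))" unfolding I_def
    by (rule sum.Sigma) (use P(1) F in auto)
  finally show ?thesis using up by (simp add: case_prod_beta)
qed

lemma marksys_sub: "marksys w K az \<Longrightarrow> K' \<subseteq> K \<Longrightarrow> marksys w K' az"
  unfolding marksys_def by blast

lemma marksys_rev: assumes "marksys w K az" shows "marksys (rev w) (rvs w K) (\<lambda>i. az (length w - 1 - i))"
proof -
  have K: "k < length w" if "k \<in> K" for k using assms that by (auto simp: marksys_def)
  have nth: "rev w ! (length w - 1 - k) = w ! k" "length w - 1 - (length w - 1 - k) = k" if "k \<in> K" for k
    using K[OF that] by (auto simp: rev_nth Suc_diff_Suc)
  show ?thesis unfolding marksys_def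
  proof (intro conjI)
    show "rvs w K \<subseteq> {..<length (rev w)}" using K by (force simp: rvs_def)
    show "\<forall>i\<in>rvs w K. R < d (az (length w - 1 - i)) (rev w ! i) \<and> d (az (length w - 1 - i)) (rev w ! i) \<le> Ca \<and>
      (\<forall>y\<in>set (rev w). d (az (length w - 1 - i)) (rev w ! i) \<le> d (az (length w - 1 - i)) y)"
    proof
      fix i assume "i \<in> rvs w K"
      then obtain k where k: "k \<in> K" "i = length w - 1 - k" by (auto simp: rvs_def)
      then show "R < d (az (length w - 1 - i)) (rev w ! i) \<and> d (az (length w - 1 - i)) (rev w ! i) \<le> Ca \<and>
        (\<forall>y\<in>set (rev w). d (az (length w - 1 - i)) (rev w ! i) \<le> d (az (length w - 1 - i)) y)"
        unfolding k(2) nth[OF k(1)] using assms by (auto simp: marksys_def)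
    qed
    show "\<forall>i\<in>rvs w K. \<forall>k\<in>rvs w K. i \<noteq> k \<longrightarrow> D2 \<le> d (az (length w - 1 - i)) (az (length w - 1 - k))"
    proof (intro ballI impI)
      fix i k assume "i \<in> rvs w K" "k \<in> rvs w K" and ne: "i \<noteq> k"
      then obtain i' k' where ik: "i' \<in> K" "i = length w - 1 - i'" "k' \<in> K" "k = length w - 1 - k'" by (auto simp: rvs_def)
      then have "i' \<noteq> k'" using ne by auto
      then show "D2 \<le> d (az (length w - 1 - i)) (az (length w - 1 - k))"
        unfolding ik(2,4) nth(2)[OF ik(1)] nth(2)[OF ik(3)] using assms ik by (auto simp: marksys_def)
    qed
  qed
qed

definition N0 :: nat where "N0 = NB (2 * R) * (NB D2 * NB Ca)"

text \<open>A \<open>2 * R\<close>-separated net of the walk has more leaves than points. A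
  \<open>tip\<close> at depth \<open>Ca\<close> in a leaf serves as anchor, and the mark is an index
  where the walk comes closest to it. Passing to the net, separating the tips and identifying equal
  marks lose the three factors of \<open>N0\<close>.\<close>

lemma free_marks: assumes w: "saw w" shows "\<exists>K az. marksys w K az \<and> length w \<le> N0 * card K"
proof -
  have wne: "set w \<noteq> {}" "distinct w" using w by (auto simp: saw_def)
  from thinning[OF finite_set, of w "2 * R"]
  obtain Y where Y: "Y \<subseteq> set w" "\<forall>x\<in>Y. \<forall>y\<in>Y. x \<noteq> y \<longrightarrow> 2 * R < d x y" "\<forall>x\<in>set w. \<exists>y\<in>Y. d y x \<le> 2 * R"
    "card (set w) \<le> NB (2 * R) * card Y"
    by (elim exE conjE) (rule that)
  have fY: "finite Y" using Y(1) finite_subset by blast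
  have Yne: "Y \<noteq> {}"
  proof
    assume "Y = {}"
    then have "set w = {}" using Y(3) by fastforce
    then show False using wne(1) by blast
  qed
  have sep: "\<And>y z. y \<in> Y \<Longrightarrow> z \<in> Y \<Longrightarrow> y \<noteq> z \<Longrightarrow> 2 * R < d y z" using Y(2) by blast
  have cl: "card Y \<le> card (leaves Y)" using card_leaves[OF fY Yne sep] by simp
  have fl: "finite (leaves Y)" by (rule finite_leaves[OF fY])
  define tip where "tip zE = (SOME x. x \<in> snd zE \<and> d (fst zE) x = Ca)" for zE
  have tip: "tip zE \<in> snd zE \<and> d (fst zE) (tip zE) = Ca" if zE: "zE \<in> leaves Y" for zE
  proof -
    obtain e where e: "snd zE = CP (fst zE) e" "d (fst zE) e = Suc R" "infinite (CP (fst zE) e)"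
      using zE by (auto simp: leaves_def Infc_def)
    have "\<exists>x\<in>CP (fst zE) e. d (fst zE) x = Ca" by (rule Cp_level[OF e(3)]) (use e in \<open>auto simp: Ca_def\<close>)
    then have "\<exists>x. x \<in> snd zE \<and> d (fst zE) x = Ca" using e by auto
    then show ?thesis unfolding tip_def by (rule someI_ex)
  qed
  have inj: "inj_on tip (leaves Y)"
  proof (rule inj_onI)
    fix a b assume ab: "a \<in> leaves Y" "b \<in> leaves Y" "tip a = tip b"
    show "a = b"
    proof (rule ccontr)
      assume "a \<noteq> b"
      then have "snd a \<inter> snd b = {}"
        using leaves_disjoint[OF sep, where y = "fst a" and E = "snd a" and z = "fst b" and E' = "snd b"] ab by simp
      then show False using tip[OF ab(1)] tip[OF ab(2)] ab(3) by auto
    qed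
  qed
  have away: "R < d (tip zE) y" if zE: "zE \<in> leaves Y" and y: "y \<in> set w" for zE y
  proof -
    obtain z E where e: "zE = (z, E)" by (metis prod.exhaust)
    have t: "tip zE \<in> E" "d z (tip zE) = Ca" using tip[OF zE] by (auto simp: e)
    obtain z2 where z2: "z2 \<in> Y" "d z2 y \<le> 2 * R" using Y(3) y by blast
    have "2 * R + R + 1 < d (tip zE) z2"
    proof (cases "z2 = z")
      case True then show ?thesis using t(2) d_sym[of "tip zE" z] by (simp add: Ca_def)
    next
      case False
      have EI: "E \<in> Infc z" "E \<inter> Y = {}" using zE by (auto simp: leaves_def e)
      have "E = CP z (tip zE)" by (rule Infc_eq[OF EI(1) t(1)])
      then have "z2 \<notin> CP z (tip zE)" using EI(2) z2(1) by blast
      then have "d z (tip zE) \<le> d (tip zE) z2 + R" by (rule Cp_dist) (use t(2) in \<open>simp add: Ca_def\<close>)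
      then show ?thesis using t(2) by (simp add: Ca_def)
    qed
    then show ?thesis using d_tri[of "tip zE" z2 y] d_sym[of y z2] z2(2) by linarith
  qed
  from thinning[OF finite_imageI[OF fl], of tip D2]
  obtain X where X: "X \<subseteq> tip ` leaves Y" "\<forall>x\<in>X. \<forall>y\<in>X. x \<noteq> y \<longrightarrow> D2 < d x y" "card (tip ` leaves Y) \<le> NB D2 * card X"
    by (elim exE conjE) (rule that)
  have fX: "finite X" using X(1) fl finite_subset by blast
  define ix where "ix x = (ARG_MIN (\<lambda>i. d x (w ! i)) i. i < length w)" for x
  have ix: "ix x < length w" "\<And>k. k < length w \<Longrightarrow> d x (w ! ix x) \<le> d x (w ! k)" for x
    using arg_min_nat_lemma[of "\<lambda>i. i < length w" 0 "\<lambda>i. d x (w ! i)"] wne by (auto simp: ix_def)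
  have ixm: "d x (w ! ix x) \<le> d x y" if "y \<in> set w" for x y
    using ix(2)[of _ x] that by (auto simp: in_set_conv_nth)
  have near: "R < d x (w ! ix x) \<and> d x (w ! ix x) \<le> Ca" if x: "x \<in> X" for x
  proof -
    obtain zE where zE: "zE \<in> leaves Y" "x = tip zE" using x X(1) by blast
    have "fst zE \<in> set w" using zE(1) Y(1) by (auto simp: leaves_def)
    then have "d x (w ! ix x) \<le> d x (fst zE)" by (rule ixm)
    also have "\<dots> = Ca" using tip[OF zE(1)] zE(2) d_sym[of x "fst zE"] by simp
    finally show ?thesis using away[OF zE(1), of "w ! ix x"] ix(1)[of x] zE(2) by simp
  qed
  define K where "K = ix ` X"
  define az where "az i = (SOME x. x \<in> X \<and> ix x = i)" for i
  have az: "az i \<in> X \<and> ix (az i) = i" if "i \<in> K" for i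
  proof -
    have "\<exists>x. x \<in> X \<and> ix x = i" using that by (auto simp: K_def)
    then show ?thesis unfolding az_def by (rule someI_ex)
  qed
  have "marksys w K az" unfolding marksys_def
  proof (intro conjI)
    show "K \<subseteq> {..<length w}" using ix(1) by (auto simp: K_def)
    show "\<forall>i\<in>K. R < d (az i) (w ! i) \<and> d (az i) (w ! i) \<le> Ca \<and> (\<forall>y\<in>set w. d (az i) (w ! i) \<le> d (az i) y)"
      using az near ixm by metis
    show "\<forall>i\<in>K. \<forall>k\<in>K. i \<noteq> k \<longrightarrow> D2 \<le> d (az i) (az k)" using az X(2) by (metis less_imp_le)
  qed
  moreover have "card X \<le> NB Ca * card K"
  proof -
    have "X \<subseteq> (\<Union>i\<in>K. {x. d (w ! i) x \<le> Ca})"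
    proof
      fix x assume x: "x \<in> X"
      then have "d (w ! ix x) x \<le> Ca" using near[OF x] d_sym[of x] by simp
      then show "x \<in> (\<Union>i\<in>K. {x. d (w ! i) x \<le> Ca})" using x by (auto simp: K_def)
    qed
    moreover have fK: "finite K" using fX by (simp add: K_def)
    moreover have "finite {x. d (w ! i) x \<le> Ca}" for i using finite_B[of "w ! i" Ca] by (simp add: B_def)
    ultimately have "card X \<le> card (\<Union>i\<in>K. {x. d (w ! i) x \<le> Ca})" by (intro card_mono) auto
    also have "\<dots> \<le> (\<Sum>i\<in>K. card {x. d (w ! i) x \<le> Ca})" by (rule card_UN_le[OF fK])
    also have "\<dots> = (\<Sum>i\<in>K. NB Ca)" using card_B by (intro sum.cong) (auto simp: B_def)
    finally show ?thesis by (simp add: mult.commute)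
  qed
  moreover have "length w \<le> NB (2 * R) * (NB D2 * card X)"
  proof -
    have "card Y \<le> NB D2 * card X" using cl X(3) card_image[OF inj] by simp
    then have "NB (2 * R) * card Y \<le> NB (2 * R) * (NB D2 * card X)" by (rule mult_left_mono) simp
    moreover have "length w \<le> NB (2 * R) * card Y" using Y(4) distinct_card[OF wne(2)] by simp
    ultimately show ?thesis by (rule order_trans[rotated])
  qed
  moreover have "NB (2 * R) * (NB D2 * card X) \<le> NB (2 * R) * (NB D2 * (NB Ca * card K))"
    using calculation(2) by (intro mult_left_mono) auto
  ultimately have "marksys w K az" "length w \<le> NB (2 * R) * (NB D2 * (NB Ca * card K))" by (blast, meson order_trans)
  then have "marksys w K az" "length w \<le> N0 * card K" by (simp_all only: N0_def mult.assoc)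
  then show ?thesis by blast
qed

lemma frac_quarter: assumes "(a::real) \<ge> 0" shows "a * (1 / (4 * (a + 1))) \<le> 1 / 4"
  using assms by (simp add: field_simps)

text \<open>Summing over all subsets of the marks gains a factor per mark, hence at least
  \<open>\<rho>\<close> per step. The target is \<open>v\<close> throughout. Pairs without enough
  turns are reversed, and since the end point \<open>x\<close> is fixed, the reversed walks also
  have a common start.\<close>

lemma endpoint_bound:
  assumes fb: "\<And>t v n u. finite (Fib t n v u) \<and> (\<Sum>(p, es)\<in>Fib t n v u. om s \<zeta> ca cb p es) \<le> (1 / 2) ^ n * W \<zeta> u"
    and s: "0 < s" "s < 1" and cc: "0 \<le> ca" "0 \<le> cb" and z: "0 < \<zeta>"
    and big: "s ^ (A1 * NB D5) * (1 + cb) \<ge> 1"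
    and Kz: "\<And>N. (\<Sum>k<N. c k * \<zeta> ^ k) \<le> Kz"
    and rho: "1 \<le> \<rho>" "\<rho> ^ N0 \<le> 1 + ca * s ^ (A1 * (NB D5 + 1))"
  shows "cx n v x * (\<zeta> * \<rho>) ^ n * s ^ A1 \<le> 4 * Kz"
proof -
  let ?y = "ca * s ^ (A1 * (NB D5 + 1))"
  have y0: "0 \<le> ?y" using cc s by simp
  define SX where "SX = {w \<in> SW v n. last w = x}"
  have fS: "finite SX" by (simp add: SX_def finite_SW)
  have sS: "saw w" "hd w = v" "last w = x" "length w = Suc n" if "w \<in> SX" for w using that by (auto simp: SX_def SW_def)
  define MK where "MK w = (SOME T. marksys w (fst T) (snd T) \<and> length w \<le> N0 * card (fst T))" for w
  have MK: "marksys w (fst (MK w)) (snd (MK w)) \<and> length w \<le> N0 * card (fst (MK w))" if "w \<in> SX" for w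
  proof -
    have "\<exists>T. marksys w (fst T) (snd T) \<and> length w \<le> N0 * card (fst T)" using free_marks[OF sS(1)[OF that]] by simp
    then show ?thesis unfolding MK_def by (rule someI_ex)
  qed
  have fM: "finite (fst (MK w))" "fst (MK w) \<subseteq> {..<length w}" if "w \<in> SX" for w
    using MK[OF that] finite_subset[of "fst (MK w)" "{..<length w}"] by (auto simp: marksys_def)
  define P where "P = (SIGMA w:SX. Pow (fst (MK w)))"
  have fP: "finite P" unfolding P_def using fS fM by (intro finite_SigmaI) auto
  have Pm: "saw w \<and> hd w = v \<and> last w = x \<and> marksys w K (snd (MK w)) \<and> K \<subseteq> {..<length w}" if "(w, K) \<in> P" for w K
  proof -
    have w: "w \<in> SX" "K \<subseteq> fst (MK w)" using that by (auto simp: P_def)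
    show ?thesis using sS[OF w(1)] marksys_sub[of w "fst (MK w)" "snd (MK w)" K] MK[OF w(1)] w(2) fM(2)[OF w(1)] by auto
  qed
  define P1 where "P1 = {(w, K) \<in> P. maj w K v}"
  define P2 where "P2 = (\<lambda>(w, K). (rev w, rvs w K)) ` (P - P1)"
  let ?f = "\<lambda>(w, K). W \<zeta> w * ?y ^ card K"
  have "sum ?f P1 * s ^ A1 \<le> 2 * Kz"
    by (rule marked_sum[OF fb s cc z big Kz]) (use fP Pm in \<open>auto simp: P1_def intro: finite_subset[of _ P]\<close>)
  moreover have "sum ?f P2 * s ^ A1 \<le> 2 * Kz"
  proof (rule marked_sum[OF fb s cc z big Kz])
    show "finite P2" using fP by (simp add: P2_def)
    fix w' K' assume "(w', K') \<in> P2"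
    then obtain w K where wK: "(w, K) \<in> P" "\<not> maj w K v" "w' = rev w" "K' = rvs w K" by (auto simp: P2_def P1_def)
    have pm: "saw w" "last w = x" "marksys w K (snd (MK w))" "K \<subseteq> {..<length w}" using Pm[OF wK(1)] by auto
    have "maj w' K' v" using maj_or[OF pm(1,4), of v] wK by simp
    moreover have "saw w'" using pm(1) wK(3) by (simp add: saw_rev)
    moreover have "hd w' = x" using pm(1,2) wK(3) by (simp add: saw_def hd_rev)
    ultimately show "saw w' \<and> hd w' = x \<and> (\<exists>az. marksys w' K' az) \<and> maj w' K' v"
      using marksys_rev[OF pm(3)] wK by blast
  qed
  moreover have "sum ?f P \<le> sum ?f P1 + sum ?f P2"
  proof -
    have inj: "inj_on (\<lambda>(w, K). (rev w, rvs w K)) (P - P1)"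
    proof (rule inj_onI)
      fix a b assume ab: "a \<in> P - P1" "b \<in> P - P1" "(\<lambda>(w, K). (rev w, rvs w K)) a = (\<lambda>(w, K). (rev w, rvs w K)) b"
      obtain w K where a: "a = (w, K)" by (metis prod.exhaust)
      obtain w2 K2 where b: "b = (w2, K2)" by (metis prod.exhaust)
      have ww: "w2 = w" "rvs w K = rvs w2 K2" using ab(3) by (auto simp: a b)
      have "rvs (rev w) (rvs w K) = K" using rvs_rvs[of K w] Pm[of w K] ab(1) a by blast
      moreover have "rvs (rev w) (rvs w K2) = K2" using rvs_rvs[of K2 w] Pm[of w2 K2] ab(2) b ww(1) by blast
      ultimately have "K = K2" using ww by metis
      then show "a = b" using ww by (simp add: a b)
    qed
    have "sum ?f P2 = (\<Sum>a\<in>P - P1. ?f ((\<lambda>(w, K). (rev w, rvs w K)) a))" unfolding P2_def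
      using inj by (simp add: sum.reindex)
    also have "\<dots> = sum ?f (P - P1)"
    proof (rule sum.cong[OF refl])
      fix a assume a: "a \<in> P - P1"
      obtain w K where e: "a = (w, K)" by (metis prod.exhaust)
      have "card (rvs w K) = card K" unfolding rvs_def
      proof (rule card_image, rule inj_onI)
        fix i k assume "i \<in> K" "k \<in> K" "length w - 1 - i = length w - 1 - k"
        moreover from this have "i < length w" "k < length w" using Pm[of w K] a e by auto
        ultimately show "i = k" by linarith
      qed
      then show "?f ((\<lambda>(w, K). (rev w, rvs w K)) a) = ?f a" by (simp add: e)
    qed
    moreover have "sum ?f P = sum ?f (P - P1) + sum ?f P1" by (rule sum.subset_diff) (use fP in \<open>auto simp: P1_def\<close>)
    ultimately show ?thesis by simp
  qed
  ultimately have S1: "sum ?f P * s ^ A1 \<le> 4 * Kz"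
    using mult_right_mono[of "sum ?f P" "sum ?f P1 + sum ?f P2" "s ^ A1"] s by (simp add: distrib_right)
  have S2: "cx n v x * (\<zeta> * \<rho>) ^ n \<le> sum ?f P"
  proof -
    have "sum ?f P = (\<Sum>w\<in>SX. \<Sum>K\<in>Pow (fst (MK w)). W \<zeta> w * ?y ^ card K)" unfolding P_def
      by (rule sum.Sigma[symmetric]) (use fS fM in auto)
    also have "\<dots> = (\<Sum>w\<in>SX. W \<zeta> w * (1 + ?y) ^ card (fst (MK w)))"
      by (rule sum.cong) (auto simp: sum_distrib_left[symmetric] sum_Pow_power fM)
    also have "\<dots> \<ge> (\<Sum>w\<in>SX. wt w * (\<zeta> * \<rho>) ^ n)"
    proof (rule sum_mono)
      fix w assume w: "w \<in> SX"
      have Wn: "W \<zeta> w = wt w * \<zeta> ^ n" using sS(4)[OF w] by (simp add: W_def)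
      have "\<rho> ^ n \<le> \<rho> ^ (N0 * card (fst (MK w)))"
        using MK[OF w] sS(4)[OF w] rho(1) by (intro power_increasing) auto
      also have "\<dots> \<le> (1 + ?y) ^ card (fst (MK w))" unfolding power_mult[of \<rho>]
        using rho by (intro power_mono) auto
      finally have "W \<zeta> w * \<rho> ^ n \<le> W \<zeta> w * (1 + ?y) ^ card (fst (MK w))" using z by (intro mult_left_mono) auto
      then show "wt w * (\<zeta> * \<rho>) ^ n \<le> W \<zeta> w * (1 + ?y) ^ card (fst (MK w))" by (simp add: Wn power_mult_distrib mult_ac)
    qed
    finally show ?thesis by (simp add: cx_def SX_def sum_distrib_right)
  qed
  have "cx n v x * (\<zeta> * \<rho>) ^ n * s ^ A1 \<le> sum ?f P * s ^ A1" using S2 s by (intro mult_right_mono) auto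
  then show ?thesis using S1 by (rule order_trans)
qed

text \<open>The order of the constants matters: \<open>cb\<close> makes turns recoverable,
  \<open>s\<close> is then so close to \<open>1\<close> that turns repay the cuts, \<open>ca\<close>
  pays for the marks at this \<open>s\<close>, and \<open>\<zeta>\<close> is finally so close to
  \<open>1 / mu\<close> that the gain \<open>\<rho>\<close> per step wins.\<close>

theorem endpoint_decay: "\<exists>K \<nu>. K > 0 \<and> 0 < \<nu> \<and> \<nu> < mu \<and> (\<forall>n v x. cx n v x \<le> K * \<nu> ^ n)"
proof -
  define z0 where "z0 = 1 / (2 * mu)"
  have z0: "0 < z0" using mu_ge1 by (simp add: z0_def)
  have KK: "0 \<le> Kd * Kw z0" using Kd_nonneg M_ge1 z0 by (simp add: Kw_def)
  define cb where "cb = 1 / (4 * (Kd * Kw z0 * NB D1 + 1))"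
  have KN: "0 \<le> Kd * Kw z0 * NB D1" using KK by simp
  have cb: "0 < cb" "Kd * Kw z0 * cb * NB D1 \<le> 1 / 4"
    using frac_quarter[OF KN] KN by (auto simp: cb_def mult_ac add_nonneg_pos)
  define k where "k = Suc (A1 * NB D5)"
  \<comment> \<open>Chosen for Bernoulli's inequality, which gives
    \<open>1 / (1 + cb) \<le> s ^ k\<close>. The successor in \<open>k\<close> prevents a division
    by zero.\<close>
  define s where "s = 1 - cb / ((1 + cb) * real k)"
  have "0 < 1 + cb" "0 < real k" using cb by (simp, simp only: k_def of_nat_0_less_iff zero_less_Suc)
  then have dk: "0 < cb / ((1 + cb) * real k)" using cb by (intro divide_pos_pos mult_pos_pos)
  have dk1: "cb / ((1 + cb) * real k) < 1"
  proof -
    have "cb < (1 + cb) * 1" using cb by simp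
    also have "\<dots> \<le> (1 + cb) * real k" using cb by (intro mult_left_mono) (auto simp: k_def)
    finally show ?thesis using cb by (simp add: k_def)
  qed
  have s: "0 < s" "s < 1" using dk dk1 by (auto simp: s_def)
  have big: "s ^ (A1 * NB D5) * (1 + cb) \<ge> 1"
  proof -
    have "1 + real k * (- (cb / ((1 + cb) * real k))) \<le> (1 + - (cb / ((1 + cb) * real k))) ^ k"
      by (rule Bernoulli_inequality) (use dk1 in simp)
    then have "1 - cb / (1 + cb) \<le> s ^ k" by (simp add: s_def k_def del: power_Suc of_nat_Suc)
    moreover have "s ^ k \<le> s ^ (A1 * NB D5)" using s by (intro power_decreasing) (auto simp: k_def)
    moreover have "1 / (1 + cb) = 1 - cb / (1 + cb)" using cb(1) by (simp add: field_simps)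
    ultimately have "1 / (1 + cb) \<le> s ^ (A1 * NB D5)" by linarith
    then have "1 / (1 + cb) * (1 + cb) \<le> s ^ (A1 * NB D5) * (1 + cb)" using cb(1) by (intro mult_right_mono) auto
    then show ?thesis using cb(1) by simp
  qed
  define a where "a = Kd * Kw z0 * ((1 / s) ^ (C1 + 2 * NB D3) / (1 - s))"
  have a0: "0 \<le> a" using KK s by (simp add: a_def)
  define ca where "ca = 1 / (4 * (a + 1))"
  have ca: "0 < ca" using a0 by (simp add: ca_def)
  have "Kd * Kw z0 * ca * ((1 / s) ^ (C1 + 2 * NB D3) / (1 - s)) = a * ca" unfolding a_def by (simp only: mult_ac)
  then have h1: "Kd * Kw z0 * ca * ((1 / s) ^ (C1 + 2 * NB D3) / (1 - s)) \<le> 1 / 4" using frac_quarter[OF a0] by (simp add: ca_def)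
  define y where "y = ca * s ^ (A1 * (NB D5 + 1))"
  have y: "y > 0" using ca s by (simp add: y_def)
  define \<rho> where "\<rho> = root (Suc N0) (1 + y)"
  have rho: "1 < \<rho>" using y by (simp add: \<rho>_def)
  have rN: "\<rho> ^ N0 \<le> 1 + ca * s ^ (A1 * (NB D5 + 1))"
  proof -
    have "\<rho> ^ N0 \<le> \<rho> ^ Suc N0" using rho by (intro power_increasing) auto
    also have "\<dots> = 1 + y" unfolding \<rho>_def using y by (intro real_root_pow_pos2) auto
    finally show ?thesis by (simp add: y_def)
  qed
  \<comment> \<open>Below \<open>1 / mu\<close>, for the generating function to converge, and above
    \<open>1 / (\<rho> * mu)\<close>, so that \<open>\<nu> = 1 / (\<zeta> * \<rho>)\<close> is
    smaller than \<open>mu\<close>.\<close>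
  define \<zeta> where "\<zeta> = (max (1 / (\<rho> * mu)) z0 + 1 / mu) / 2"
  have mm: "1 / (\<rho> * mu) < 1 / mu" "z0 < 1 / mu" using rho mu_ge1 by (auto simp: z0_def field_simps)
  have ze: "z0 \<le> \<zeta>" "\<zeta> < 1 / mu" "1 / (\<rho> * mu) < \<zeta>" using mm by (auto simp: \<zeta>_def max_def)
  have "1 / mu \<le> 1" using mu_ge1 by simp
  then have z1: "\<zeta> \<le> 1" "0 < \<zeta>" using ze z0 by linarith+
  have zm: "\<zeta> * mu < 1" using ze(2) mu_ge1 by (simp add: field_simps)
  obtain Kz where Kz: "Kz > 0" "\<And>N. (\<Sum>k<N. c k * \<zeta> ^ k) \<le> Kz" using generating_bound[OF z1(2) zm] by blast
  define \<nu> where "\<nu> = 1 / (\<zeta> * \<rho>)"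
  have nu: "0 < \<nu>" "\<nu> < mu"
  proof -
    show "0 < \<nu>" using z1 rho by (simp add: \<nu>_def)
    have "1 < \<zeta> * \<rho> * mu" using ze(3) rho mu_ge1 by (simp add: field_simps)
    then show "\<nu> < mu" using z1 rho by (simp add: \<nu>_def field_simps)
  qed
  have "cx n v x \<le> 4 * Kz / s ^ A1 * \<nu> ^ n" for n v x
  proof -
    have fb: "\<And>t v n u. finite (Fib t n v u) \<and> (\<Sum>(p, es)\<in>Fib t n v u. om s \<zeta> ca cb p es) \<le> (1 / 2) ^ n * W \<zeta> u"
      using fibre_bound[OF s z0 ze(1) z1(1) less_imp_le[OF ca] less_imp_le[OF cb(1)] h1 cb(2)] by blast
    have "cx n v x * (\<zeta> * \<rho>) ^ n * s ^ A1 \<le> 4 * Kz"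
      by (rule endpoint_bound[OF fb s less_imp_le[OF ca] less_imp_le[OF cb(1)] z1(2) big Kz(2) less_imp_le[OF rho] rN])
    moreover have pos: "0 < (\<zeta> * \<rho>) ^ n" "0 < s ^ A1" using z1 rho s by auto
    ultimately have "cx n v x \<le> 4 * Kz / ((\<zeta> * \<rho>) ^ n * s ^ A1)" by (simp only: pos_le_divide_eq mult_pos_pos mult.assoc)
    also have "\<dots> = 4 * Kz / s ^ A1 * \<nu> ^ n" by (simp add: \<nu>_def power_one_over)
    finally show ?thesis .
  qed
  then show ?thesis using nu Kz s by (intro exI[of _ "4 * Kz / s ^ A1"] exI[of _ \<nu>]) auto
qed

end

section \<open>The upper bound in the unimodular case\<close>

text \<open>A value above \<open>D\<close> would be squared with every doubling of the index:
  \<open>S (2 ^ k * m) / D\<close> is at least \<open>x ^ (2 ^ k)\<close> with \<open>x > 1\<close>.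
  This is exponential in the index, against the growth condition \<open>gr\<close>.\<close>

lemma square_doubling_bounded:
  fixes S :: "nat \<Rightarrow> real"
  assumes D: "D > 0" and S0: "\<And>n. 0 \<le> S n" and sq: "\<And>m. S m ^ 2 \<le> D * S (2 * m)"
    and gr: "\<And>y. y > 1 \<Longrightarrow> \<exists>K. \<forall>n. S n \<le> K * y ^ n"
  shows "S m \<le> D"
proof (rule ccontr)
  assume "\<not> S m \<le> D"
  define x where "x = S m / D"
  have x: "x > 1" using \<open>\<not> S m \<le> D\<close> D by (simp add: x_def)
  have up: "x ^ (2 ^ k) \<le> S (2 ^ k * m) / D" for k
  proof (induction k)
    case 0 then show ?case by (simp add: x_def)
  next
    case (Suc k)
    have "x ^ (2 ^ Suc k) = (x ^ (2 ^ k)) ^ 2" by (simp add: power_mult[symmetric] mult.commute)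
    also have "\<dots> \<le> (S (2 ^ k * m) / D) ^ 2" using Suc x by (intro power_mono) auto
    also have "\<dots> \<le> D * S (2 * (2 ^ k * m)) / D ^ 2" using sq[of "2 ^ k * m"] D by (simp add: power_divide divide_right_mono)
    also have "\<dots> = S (2 ^ Suc k * m) / D" using D by (simp add: power2_eq_square mult.assoc)
    finally show ?case .
  qed
  define h where "h = (1 + x) / 2"
  have h: "1 < h" "h < x" using x by (auto simp: h_def)
  define y where "y = root (Suc m) h"
  have y: "1 < y" using h by (simp add: y_def)
  have ym: "y ^ m \<le> h"
  proof -
    have "y ^ m \<le> y ^ Suc m" using y by (intro power_increasing) auto
    also have "\<dots> = h" unfolding y_def using h by (intro real_root_pow_pos2) auto
    finally show ?thesis .
  qed
  obtain K where K: "\<forall>n. S n \<le> K * y ^ n" using gr[OF y] by blast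
  have K0: "0 \<le> K" using K[rule_format, of 0] S0[of 0] by simp
  have bd: "(x / h) ^ (2 ^ k) \<le> K / D" for k
  proof -
    have "x ^ (2 ^ k) \<le> K * y ^ (2 ^ k * m) / D"
      using up[of k] K[rule_format, of "2 ^ k * m"] D by (meson divide_right_mono less_imp_le order_trans)
    also have "y ^ (2 ^ k * m) = (y ^ m) ^ (2 ^ k)" by (simp add: power_mult[symmetric] mult.commute)
    also have "K * (y ^ m) ^ (2 ^ k) / D \<le> K * h ^ (2 ^ k) / D"
      using ym y K0 D by (intro divide_right_mono mult_left_mono power_mono) auto
    finally show ?thesis using h D by (simp add: power_divide field_simps)
  qed
  have "1 < x / h" using h by simp
  then obtain k where k: "K / D < (x / h) ^ k" using real_arch_pow by blast
  also have "(x / h) ^ k \<le> (x / h) ^ (2 ^ k)" using h by (intro power_increasing) (auto simp: less_imp_le)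
  finally show False using bd[of k] by simp
qed

context tgraph_uni begin

text \<open>Mass transport moves the marked vertex to the start.\<close>
lemma sum_marked: assumes "k \<le> n"
  shows "(\<Sum>y\<in>B v n. \<Sum>w\<in>{w\<in>SW y n. w ! k = v}. wt w) = c n"
proof -
  define F where "F x y = (\<Sum>w\<in>{w\<in>SW x n. w ! k = y}. wt w)" for x y
  have inv: "F (g x) (g y) = F x y" if g: "g \<in> Gam" for g x y
  proof -
    have eq: "(\<Sum>w\<in>{w\<in>SW u n. w ! k = t}. wt w) = (\<Sum>w\<in>SW u n. if w ! k = t then wt w else 0)" for u t
      by (simp add: sum.inter_filter finite_SW)
    show ?thesis unfolding F_def eq sum_SW_map[OF g]
    proof (rule sum.cong)
      fix w assume "w \<in> SW x n"
      then have "map g w ! k = g (w ! k)" using assms by (auto simp: SW_def)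
      then show "(if map g w ! k = g y then wt (map g w) else 0) = (if w ! k = y then wt w else 0)" by (simp add: g Gam_eq[OF g])
    qed simp
  qed
  have "(\<Sum>y\<in>B v n. F y v) = (\<Sum>y\<in>B v n. F v y)" using mass_transport_uni[of F v n] inv by simp
  also have "\<dots> = (\<Sum>w\<in>SW v n. wt w)" unfolding F_def
  proof (rule sum.group[OF finite_SW finite_B])
    show "(\<lambda>w. w ! k) ` SW v n \<subseteq> B v n"
    proof
      fix y assume "y \<in> (\<lambda>w. w ! k) ` SW v n"
      then obtain w where w: "w \<in> SW v n" "y = w ! k" by blast
      then have "y \<in> set w" "set w \<subseteq> B v n" using SW_sub[of v n] assms by (auto simp: SW_def)
      then show "y \<in> B v n" by blast
    qed
  qed
  finally show ?thesis by (simp add: F_def c_eq)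
qed

section \<open>Anchored walks and their products\<close>

definition Anc :: "'a \<Rightarrow> nat \<Rightarrow> 'a list set" where "Anc v n = {w\<in>SW v n. \<exists>z. startA w z}"
definition Aw :: "nat \<Rightarrow> real" where "Aw n = (\<Sum>w\<in>Anc undefined n. wt w)"

lemma finite_Anc: "finite (Anc v n)" by (simp add: Anc_def finite_SW)

lemma Aw_eq: "(\<Sum>w\<in>Anc v n. wt w) = Aw n"
proof -
  obtain g where g: "g \<in> Gam" "g undefined = v" using Gam_trans by blast
  have st: "(\<exists>z. startA (map g w) z) \<longleftrightarrow> (\<exists>z. startA w z)" if "w \<noteq> []" for w
    using startA_map[OF g(1) that] Gam_f_inv[OF g(1)] by metis
  have eq: "(\<Sum>w\<in>Anc u n. wt w) = (\<Sum>w\<in>SW u n. if \<exists>z. startA w z then wt w else 0)" for u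
    by (simp add: Anc_def sum.inter_filter finite_SW)
  show ?thesis unfolding Aw_def eq g(2)[symmetric] sum_SW_map[OF g(1)]
  proof (rule sum.cong)
    fix w assume "w \<in> SW undefined n"
    then have "w \<noteq> []" by (auto simp: SW_def)
    then show "(if \<exists>z. startA (map g w) z then wt (map g w) else 0) = (if \<exists>z. startA w z then wt w else 0)"
      using st g(1) by simp
  qed simp
qed

lemma Aw_nonneg: "0 \<le> Aw n" unfolding Aw_def by (intro sum_nonneg) auto

lemma Aw_le: "Aw n \<le> c n"
  unfolding Aw_def c_def Anc_def by (intro sum_mono2) (auto simp: finite_SW)

text \<open>After its last visit to the ball of radius \<open>Suc R\<close> about \<open>v\<close>
  the walk is anchored at \<open>v\<close>. If that visit is at its end, the remainder is a single
  vertex, anchored at any point at distance \<open>Suc R\<close>.\<close>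

lemma anchor_split: assumes w: "w \<in> SW v n"
  shows "\<exists>j\<le>n. d v (w ! j) \<le> Suc R \<and> (\<exists>z. startA (drop j w) z)"
proof -
  have sw: "saw w" "hd w = v" "length w = Suc n" using w by (auto simp: SW_def)
  define I where "I = {i. i \<le> n \<and> d v (w ! i) \<le> Suc R}"
  have fI: "finite I" by (simp add: I_def)
  have w0: "w ! 0 = v" using sw by (simp add: hd_conv_nth saw_def)
  then have "0 \<in> I" by (simp add: I_def)
  then have m: "Max I \<in> I" "\<And>i. i \<in> I \<Longrightarrow> i \<le> Max I" using fI by (auto intro: Max_in)
  let ?j = "Max I"
  have j: "?j \<le> n" "d v (w ! ?j) \<le> Suc R" using m(1) by (auto simp: I_def)
  have h: "hd (drop ?j w) = w ! ?j" using j sw by (simp add: hd_drop_conv_nth)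
  have "\<exists>z. startA (drop ?j w) z"
  proof (cases "?j = n")
    case True
    have dr: "drop ?j w = [w ! n]" using True sw(3) by (simp add: Cons_nth_drop_Suc[symmetric])
    obtain z where "d (w ! n) z = Suc R" using ex_far by blast
    then have "d z (w ! n) = Suc R" using d_sym by metis
    then have "startA [w ! n] z" by (simp add: startA_def Ca_def)
    then show ?thesis using dr by auto
  next
    case False
    then have jn: "Suc ?j \<le> n" using j by simp
    have far: "Suc R < d v (w ! i)" if "?j < i" "i \<le> n" for i
    proof (rule ccontr)
      assume "\<not> ?thesis"
      then have "i \<in> I" using that by (simp add: I_def)
      then show False using m(2) that by fastforce
    qed
    have "adj (w ! ?j) (w ! Suc ?j)" using sw jn by (auto simp: saw_def successively_conv_nth)
    then have "d (w ! ?j) (w ! Suc ?j) = 1" by (rule d_adj)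
    moreover have "Suc R < d v (w ! Suc ?j)" by (rule far) (use jn in auto)
    ultimately have dj: "d v (w ! ?j) = Suc R" using j(2) d_tri[of v "w ! Suc ?j" "w ! ?j"] by linarith
    have "startA (drop ?j w) v" unfolding startA_def h dj
    proof (intro conjI ballI)
      fix y assume "y \<in> set (drop ?j w)"
      then obtain k where k: "k < length w - ?j" "y = w ! (?j + k)" using sw(3) j by (auto simp: in_set_conv_nth)
      show "Suc R \<le> d v y"
      proof (cases "k = 0")
        case True then show ?thesis using k dj by simp
      next
        case False
        have "Suc R < d v (w ! (?j + k))" by (rule far) (use False k sw(3) in linarith)+
        then show ?thesis unfolding k(2) by (rule less_imp_le)
      qed
    qed (auto simp: Ca_def)
    then show ?thesis by blast
  qed
  then show ?thesis using j by blast
qed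

text \<open>The part up to the last visit ends close to its start, so \<open>cx\<close> bounds it
  with a rate below \<open>mu\<close>. Thus the growth of \<open>c\<close> is controlled by that of
  the anchored walks.\<close>

lemma c_le_Aw: "c n \<le> (\<Sum>j\<le>n. \<Sum>x\<in>B undefined (Suc R). cx j undefined x * Aw (n - j))"
proof -
  let ?v = "undefined :: 'a"
  define J where "J w = (SOME j. j \<le> n \<and> d ?v (w ! j) \<le> Suc R \<and> (\<exists>z. startA (drop j w) z))" for w
  have J: "J w \<le> n \<and> d ?v (w ! J w) \<le> Suc R \<and> (\<exists>z. startA (drop (J w) w) z)" if "w \<in> SW ?v n" for w
  proof -
    have "\<exists>j. j \<le> n \<and> d ?v (w ! j) \<le> Suc R \<and> (\<exists>z. startA (drop j w) z)" using anchor_split[OF that] by blast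
    then show ?thesis unfolding J_def by (rule someI_ex)
  qed
  let ?T = "SIGMA jx : {..n} \<times> B ?v (Suc R). {w\<in>SW ?v (fst jx). last w = snd jx} \<times> Anc (snd jx) (n - fst jx)"
  have fT: "finite ?T" by (intro finite_SigmaI finite_cartesian_product finite_B) (auto simp: finite_SW finite_Anc)
  have "c n = (\<Sum>w\<in>SW ?v n. wt w)" by (simp add: c_def)
  also have "\<dots> \<le> (\<Sum>(jx, w1, w2)\<in>?T. wt w1 * wt w2)"
  proof (rule sum_le_inj[where h = "\<lambda>w. ((J w, w ! J w), take (Suc (J w)) w, drop (J w) w)", OF fT])
    have split: "w = take (Suc (J w)) w @ tl (drop (J w) w)" for w by (metis append_take_drop_id drop_Suc tl_drop)
    show "inj_on (\<lambda>w. ((J w, w ! J w), take (Suc (J w)) w, drop (J w) w)) (SW ?v n)"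
      by (rule inj_onI) (metis split prod.inject)
    show "(\<lambda>w. ((J w, w ! J w), take (Suc (J w)) w, drop (J w) w)) ` SW ?v n \<subseteq> ?T"
    proof
      fix r assume "r \<in> (\<lambda>w. ((J w, w ! J w), take (Suc (J w)) w, drop (J w) w)) ` SW ?v n"
      then obtain w where w: "w \<in> SW ?v n" "r = ((J w, w ! J w), take (Suc (J w)) w, drop (J w) w)" by blast
      have sw: "saw w" "hd w = ?v" "length w = Suc n" using w by (auto simp: SW_def)
      note Jw = J[OF w(1)]
      have ne: "drop (J w) w \<noteq> []" "take (Suc (J w)) w \<noteq> []" using sw(3) Jw by auto
      have s1: "saw (take (Suc (J w)) w)" using slice_saw[OF sw(1), of 0 "J w"] Jw sw(3) by (simp add: slice_take)
      have jn: "J w \<le> n" "n < length w" "n = length w - 1" using Jw sw(3) by auto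
      have s2: "saw (drop (J w) w)" using slice_saw[OF sw(1) jn(1,2)] unfolding slice_drop[OF jn] .
      have l1: "last (take (Suc (J w)) w) = w ! J w" using slice_last[of 0 "J w" w] Jw sw(3) by (simp add: slice_take)
      have h2: "hd (drop (J w) w) = w ! J w" using Jw sw(3) by (simp add: hd_drop_conv_nth)
      have "take (Suc (J w)) w \<in> SW ?v (J w)" using s1 sw Jw ne by (simp add: SW_def)
      moreover have "drop (J w) w \<in> Anc (w ! J w) (n - J w)" using s2 h2 sw Jw by (auto simp: Anc_def SW_def)
      ultimately show "r \<in> ?T" using w(2) l1 Jw by auto
    qed
    fix w assume w: "w \<in> SW ?v n"
    have sw: "saw w" "length w = Suc n" using w by (auto simp: SW_def)
    have "wt (take (Suc (J w)) w @ tl (drop (J w) w)) = wt (take (Suc (J w)) w) * wt (drop (J w) w)"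
      by (rule wt_glue) (use J[OF w] sw slice_last[of 0 "J w" w] in \<open>auto simp: slice_take hd_drop_conv_nth\<close>)
    then show "wt w \<le> (case ((J w, w ! J w), take (Suc (J w)) w, drop (J w) w) of (jx, w1, w2) \<Rightarrow> wt w1 * wt w2)"
      using split[of w] by simp
  qed (auto simp: case_prod_beta)
  also have "\<dots> = (\<Sum>jx\<in>{..n} \<times> B ?v (Suc R). \<Sum>(w1, w2)\<in>{w\<in>SW ?v (fst jx). last w = snd jx} \<times> Anc (snd jx) (n - fst jx). wt w1 * wt w2)"
    by (rule sum.Sigma[symmetric]) (use finite_B in \<open>auto simp: finite_SW finite_Anc simp del: in_B\<close>)
  also have "\<dots> = (\<Sum>jx\<in>{..n} \<times> B ?v (Suc R). cx (fst jx) ?v (snd jx) * Aw (n - fst jx))"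
    by (simp add: sum.cartesian_product[symmetric] sum_product[symmetric] cx_def Aw_eq)
  also have "\<dots> = (\<Sum>j\<le>n. \<Sum>x\<in>B ?v (Suc R). cx j ?v x * Aw (n - j))"
    by (simp add: sum.cartesian_product case_prod_beta)
  finally show ?thesis .
qed

definition Zb :: "'a \<Rightarrow> ('a \<times> 'a \<times> 'a) set" where "Zb v = B v Cw \<times> B v Cw \<times> B v Cw"

text \<open>The first walk is reversed and the second is moved into a half-space at the anchor of
  the first that avoids the base vertex; \<open>glue\<close> joins them. The result has the base
  vertex at index \<open>m\<close> instead of at its start, which \<open>sum_marked\<close> repairs.
  The data in \<open>Zb\<close> and the length of the connector make the decoding unique.\<close>

lemma anchored_product:
  "\<exists>Dp. \<forall>m m'. Aw m * Aw m' \<le> Dp * (\<Sum>l\<le>Cq. c (m + m' + l + 1))"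
proof -
  let ?v = "undefined :: 'a"
  define pr where "pr a b = (SOME r. case r of (l, (z, e, z1), u) \<Rightarrow> l \<le> Cq \<and> (z, e, z1) \<in> Zb ?v \<and>
     saw u \<and> (\<exists>q. length q = l \<and> u = rev a @ q @ map (place z e z1 ?v) b \<and> place z e z1 ?v \<in> Gam))" for a b :: "'a list"
  have pr: "case pr a b of (l, (z, e, z1), u) \<Rightarrow> l \<le> Cq \<and> (z, e, z1) \<in> Zb ?v \<and>
     saw u \<and> (\<exists>q. length q = l \<and> u = rev a @ q @ map (place z e z1 ?v) b \<and> place z e z1 ?v \<in> Gam)"
    if ab: "a \<in> Anc ?v m" "b \<in> Anc ?v m'" for a b m m'
  proof -
    obtain z z1 where z: "startA a z" "startA b z1" using ab by (auto simp: Anc_def)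
    have s: "saw a" "saw b" "hd a = ?v" "hd b = ?v" "a \<noteq> []" "b \<noteq> []" using ab by (auto simp: Anc_def SW_def saw_def)
    obtain e where e: "d z e = Suc R" "infinite (CP z e)" "e \<notin> CP z ?v" using third by blast
    have x1: "d z1 ?v > R" "d z1 ?v \<le> Ca" "d z ?v \<le> Ca" using z s by (auto simp: startA_def)
    let ?g = "place z e z1 ?v"
    note P = place[OF e(1,2) x1(1)]
    have ra: "saw (rev a)" "last (rev a) = ?v" "endA (rev a) z" using s z by (auto simp: saw_rev last_rev endA_rev)
    have bn: "saw (map ?g b)" "hd (map ?g b) = ?g ?v" "startA (map ?g b) (?g z1)"
      using s z P(1) by (auto simp: saw_map hd_map startA_map)
    have n1: "?g z1 \<notin> CP z (last (rev a))" unfolding ra(2) using P(2) e(3) Cp_eq Cp_sym by metis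
    have "\<exists>q. saw (rev a @ q @ map ?g b) \<and> length q \<le> Cq \<and> set q \<subseteq> B z (Cpl + Ca)"
      by (rule glue[OF ra(1,3) bn(1,3) n1]) (use P bn(2) in auto)
    then obtain q where q: "saw (rev a @ q @ map ?g b)" "length q \<le> Cq" by blast
    have "d ?v e \<le> Ca + Suc R" using d_tri[of ?v e z] x1(3) e(1) d_sym[of ?v z] by simp
    then have "(z, e, z1) \<in> Zb ?v" using x1 d_sym[of ?v z] d_sym[of ?v z1] by (simp add: Zb_def Cw_def)
    then have "\<exists>r. case r of (l, (z, e, z1), u) \<Rightarrow> l \<le> Cq \<and> (z, e, z1) \<in> Zb ?v \<and>
       saw u \<and> (\<exists>q. length q = l \<and> u = rev a @ q @ map (place z e z1 ?v) b \<and> place z e z1 ?v \<in> Gam)"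
      using q P(1) by (intro exI[of _ "(length q, (z, e, z1), rev a @ q @ map ?g b)"]) auto
    then show ?thesis unfolding pr_def by (rule someI_ex)
  qed
  have fZ: "finite (Zb ?v)" unfolding Zb_def by (intro finite_cartesian_product finite_B)
  have "Aw m * Aw m' \<le> real (card (Zb ?v)) * (\<Sum>l\<le>Cq. c (m + m' + l + 1))" for m m'
  proof -
    let ?N = "\<lambda>l. m + m' + l + 1"
    let ?T = "SIGMA l:{..Cq}. Zb ?v \<times> (SIGMA y : B ?v (?N l). {w\<in>SW y (?N l). w ! m = ?v})"
    have fT: "finite ?T" using fZ by (intro finite_SigmaI finite_cartesian_product finite_B) (auto simp: finite_SW)
    have "Aw m * Aw m' = (\<Sum>(a, b)\<in>Anc ?v m \<times> Anc ?v m'. wt a * wt b)"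
      by (simp add: Aw_def sum_product sum.cartesian_product)
    also have "\<dots> \<le> (\<Sum>(l, zz, y, u)\<in>?T. wt u)"
    proof (rule sum_le_inj[where h = "\<lambda>(a, b). case pr a b of (l, zz, u) \<Rightarrow> (l, zz, hd u, u)", OF fT])
      have dec: "\<exists>l z e z1 q. pr a b = (l, (z, e, z1), rev a @ q @ map (place z e z1 ?v) b) \<and> l \<le> Cq \<and> (z, e, z1) \<in> Zb ?v \<and>
          length q = l \<and> saw (rev a @ q @ map (place z e z1 ?v) b) \<and> place z e z1 ?v \<in> Gam"
        if "a \<in> Anc ?v m" "b \<in> Anc ?v m'" for a b
        using pr[OF that] by (auto split: prod.splits)
      show "inj_on (\<lambda>(a, b). case pr a b of (l, zz, u) \<Rightarrow> (l, zz, hd u, u)) (Anc ?v m \<times> Anc ?v m')"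
      proof (rule inj_onI)
        fix r1 r2 assume r: "r1 \<in> Anc ?v m \<times> Anc ?v m'" "r2 \<in> Anc ?v m \<times> Anc ?v m'"
          and eq: "(\<lambda>(a, b). case pr a b of (l, zz, u) \<Rightarrow> (l, zz, hd u, u)) r1 = (\<lambda>(a, b). case pr a b of (l, zz, u) \<Rightarrow> (l, zz, hd u, u)) r2"
        obtain a b where ab: "r1 = (a, b)" "a \<in> Anc ?v m" "b \<in> Anc ?v m'" using r(1) by auto
        obtain a2 b2 where ab2: "r2 = (a2, b2)" "a2 \<in> Anc ?v m" "b2 \<in> Anc ?v m'" using r(2) by auto
        obtain l z e z1 q where 1: "pr a b = (l, (z, e, z1), rev a @ q @ map (place z e z1 ?v) b)" "length q = l" "place z e z1 ?v \<in> Gam"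
          using dec[OF ab(2,3)] by (elim exE conjE) (rule that)
        obtain l2 z2 e2 z12 q2 where 2: "pr a2 b2 = (l2, (z2, e2, z12), rev a2 @ q2 @ map (place z2 e2 z12 ?v) b2)" "length q2 = l2"
          using dec[OF ab2(2,3)] by (elim exE conjE) (rule that)
        have e: "l = l2" "z = z2" "e = e2" "z1 = z12" "rev a @ q @ map (place z e z1 ?v) b = rev a2 @ q2 @ map (place z2 e2 z12 ?v) b2"
          using eq unfolding ab(1) ab2(1) prod.case 1(1) 2(1) prod.inject by blast+
        have "length (rev a) = length (rev a2)" using ab(2) ab2(2) by (simp add: Anc_def SW_def)
        then have "rev a = rev a2" "q @ map (place z e z1 ?v) b = q2 @ map (place z2 e2 z12 ?v) b2" using e(5) by auto
        moreover have "length q = length q2" using 1 2 e by simp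
        ultimately have "a = a2" "map (place z e z1 ?v) b = map (place z e z1 ?v) b2" using e by auto
        moreover have "inj (place z e z1 ?v)" using 1(3) by (simp add: Gam_def bij_is_inj)
        ultimately show "r1 = r2" using ab ab2 by (simp add: inj_map_eq_map)
      qed
      show "(\<lambda>(a, b). case pr a b of (l, zz, u) \<Rightarrow> (l, zz, hd u, u)) ` (Anc ?v m \<times> Anc ?v m') \<subseteq> ?T"
      proof
        fix r assume "r \<in> (\<lambda>(a, b). case pr a b of (l, zz, u) \<Rightarrow> (l, zz, hd u, u)) ` (Anc ?v m \<times> Anc ?v m')"
        then obtain a b where ab: "a \<in> Anc ?v m" "b \<in> Anc ?v m'" "r = (case pr a b of (l, zz, u) \<Rightarrow> (l, zz, hd u, u))" by auto
        obtain l z e z1 q where 1: "pr a b = (l, (z, e, z1), rev a @ q @ map (place z e z1 ?v) b)" "l \<le> Cq" "(z, e, z1) \<in> Zb ?v"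
          "length q = l" "saw (rev a @ q @ map (place z e z1 ?v) b)"
          using dec[OF ab(1,2)] by (elim exE conjE) (rule that)
        let ?u = "rev a @ q @ map (place z e z1 ?v) b"
        have la: "length a = Suc m" "length b = Suc m'" "hd a = ?v" "a \<noteq> []" using ab by (auto simp: Anc_def SW_def saw_def)
        have us: "?u \<in> SW (hd ?u) (?N l)" using 1 la by (simp add: SW_def)
        have um: "?u ! m = ?v" using la by (simp add: nth_append rev_nth hd_conv_nth)
        have "hd ?u \<in> B ?v (?N l)"
        proof -
          have "?v \<in> set ?u" using la(3,4) hd_in_set[of a] by auto
          moreover have "set ?u \<subseteq> B (hd ?u) (?N l)" using us SW_sub by blast
          ultimately have "d (hd ?u) ?v \<le> ?N l" by auto
          then show ?thesis using d_sym[of ?v "hd ?u"] by simp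
        qed
        then show "r \<in> ?T" using us um 1 ab(3) by auto
      qed
      fix r assume "r \<in> Anc ?v m \<times> Anc ?v m'"
      then obtain a b where ab: "a \<in> Anc ?v m" "b \<in> Anc ?v m'" "r = (a, b)" by auto
      obtain l z e z1 q where 1: "pr a b = (l, (z, e, z1), rev a @ q @ map (place z e z1 ?v) b)"
          "saw (rev a @ q @ map (place z e z1 ?v) b)" "place z e z1 ?v \<in> Gam"
          using dec[OF ab(1,2)] by (elim exE conjE) (rule that)
      let ?g = "place z e z1 ?v"
      have ne: "rev a \<noteq> []" "map ?g b \<noteq> []" using ab by (auto simp: Anc_def SW_def saw_def)
      have "apath (rev a @ q @ map ?g b)" using 1(2) by (simp add: saw_def)
      then have "apath (last (rev a) # q @ [hd (map ?g b)])"
      proof -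
        have "rev a @ q @ map ?g b = butlast (rev a) @ (last (rev a) # q @ [hd (map ?g b)]) @ tl (map ?g b)"
          using append_butlast_last_id[OF ne(1)] list.collapse[OF ne(2)] by (metis append.assoc append_Cons append_Nil)
        then show ?thesis using \<open>apath (rev a @ q @ map ?g b)\<close> by (metis successively_append_iff)
      qed
      then have "1 \<le> wt (last (rev a) # q @ [hd (map ?g b)])" by (rule wt_ge1)
      moreover have "wt (rev a @ q @ map ?g b) = wt (rev a) * wt (last (rev a) # q @ [hd (map ?g b)]) * wt (map ?g b)"
        using W_join[OF ne, of 1 q] by (simp add: W_def)
      moreover have "0 \<le> wt a * wt b" by simp
      ultimately have "wt a * wt b \<le> wt (rev a @ q @ map ?g b)"
        using 1(3) mult_left_mono[of 1 "wt (last (rev a) # q @ [hd (map ?g b)])" "wt a * wt b"] by (simp add: mult_ac)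
      then show "(case r of (a, b) \<Rightarrow> wt a * wt b) \<le> (case (\<lambda>(a, b). case pr a b of (l, zz, u) \<Rightarrow> (l, zz, hd u, u)) r of (l, zz, y, u) \<Rightarrow> wt u)"
        using 1(1) by (simp add: ab(3))
    qed (auto simp: case_prod_beta)
    also have "\<dots> = (\<Sum>l\<le>Cq. \<Sum>(zz, y, u)\<in>Zb ?v \<times> (SIGMA y : B ?v (?N l). {w\<in>SW y (?N l). w ! m = ?v}). wt u)"
      by (rule sum.Sigma[symmetric]) (use fZ in \<open>auto simp: finite_SW finite_B simp del: in_B\<close>)
    also have "\<dots> = (\<Sum>l\<le>Cq. real (card (Zb ?v)) * c (?N l))"
    proof (rule sum.cong[OF refl])
      fix l assume "l \<in> {..Cq}"
      have "(\<Sum>(zz, y, u)\<in>Zb ?v \<times> (SIGMA y : B ?v (?N l). {w\<in>SW y (?N l). w ! m = ?v}). wt u)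
         = (\<Sum>zz\<in>Zb ?v. \<Sum>(y, u)\<in>(SIGMA y : B ?v (?N l). {w\<in>SW y (?N l). w ! m = ?v}). wt u)"
        by (rule sum.cartesian_product[symmetric])
      also have "(\<Sum>(y, u)\<in>(SIGMA y : B ?v (?N l). {w\<in>SW y (?N l). w ! m = ?v}). wt u)
          = (\<Sum>y\<in>B ?v (?N l). \<Sum>u\<in>{w\<in>SW y (?N l). w ! m = ?v}. wt u)"
        by (rule sum.Sigma[symmetric]) (auto simp: finite_SW finite_B simp del: in_B)
      also have "\<dots> = c (?N l)" by (rule sum_marked) simp
      finally show "(\<Sum>(zz, y, u)\<in>Zb ?v \<times> (SIGMA y : B ?v (?N l). {w\<in>SW y (?N l). w ! m = ?v}). wt u) = real (card (Zb ?v)) * c (?N l)"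
        by simp
    qed
    finally show ?thesis by (simp add: sum_distrib_left)
  qed
  then show ?thesis by blast
qed

theorem c_upper_uni: "\<exists>C>0. \<forall>n. c n \<le> C * mu ^ n"
proof -
  obtain K \<nu> where K: "K > 0" "0 < \<nu>" "\<nu> < mu" "\<And>n v x. cx n v x \<le> K * \<nu> ^ n" using endpoint_decay by blast
  obtain Dp where Dp: "\<And>m m'. Aw m * Aw m' \<le> Dp * (\<Sum>l\<le>Cq. c (m + m' + l + 1))" using anchored_product by blast
  \<comment> \<open>Submultiplicativity absorbs the bounded length of the connector into a
    constant.\<close>
  define D6 where "D6 = max 0 Dp * (\<Sum>l\<le>Cq. c (l + 1))"
  have cs: "0 \<le> (\<Sum>l\<le>Cq. c (l + 1))" by (intro sum_nonneg c_nonneg)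
  have D6: "0 \<le> D6" "Aw m * Aw m' \<le> D6 * c (m + m')" for m m'
  proof -
    show "0 \<le> D6" using cs by (simp add: D6_def)
    have "Aw m * Aw m' \<le> max 0 Dp * (\<Sum>l\<le>Cq. c (m + m' + l + 1))"
      by (rule order_trans[OF Dp]) (intro mult_right_mono sum_nonneg c_nonneg, simp)
    also have "\<dots> \<le> max 0 Dp * (\<Sum>l\<le>Cq. c (m + m') * c (l + 1))"
    proof (intro mult_left_mono sum_mono)
      fix l show "c (m + m' + l + 1) \<le> c (m + m') * c (l + 1)" using c_submult[of "m + m'" "l + 1"] by (simp only: add.assoc)
    qed simp
    finally show "Aw m * Aw m' \<le> D6 * c (m + m')" by (simp add: D6_def sum_distrib_left sum_distrib_right mult_ac)
  qed
  have mp: "mu > 0" by (rule mu_pos)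
  define \<theta> where "\<theta> = \<nu> / mu"
  have th: "0 < \<theta>" "\<theta> < 1" using K mp by (auto simp: \<theta>_def)
  define a where "a n = Aw n / mu ^ n" for n
  have a0: "0 \<le> a n" for n using Aw_nonneg mp by (simp add: a_def)
  \<comment> \<open>With the running maximum in place of \<open>a\<close>, the convolution against
    the summable weights \<open>\<theta> ^ j\<close> becomes a constant factor.\<close>
  define S where "S n = Max (a ` {..n})" for n
  have aS: "a k \<le> S n" if "k \<le> n" for k n unfolding S_def using that by (intro Max_ge) auto
  have Sin: "\<exists>k\<le>n. S n = a k" for n
  proof -
    have "S n \<in> a ` {..n}" unfolding S_def by (intro Max_in) auto
    then show ?thesis by auto
  qed
  have S0: "0 \<le> S n" for n using aS[of 0 n] a0[of 0] by simp
  define E where "E = K * real (NB (Suc R)) / (1 - \<theta>)"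
  have E: "0 \<le> E" using K th by (simp add: E_def)
  have gam: "c n / mu ^ n \<le> E * S n" for n
  proof -
    have "c n \<le> (\<Sum>j\<le>n. \<Sum>x\<in>B undefined (Suc R). (K * \<nu> ^ j) * Aw (n - j))"
      by (rule order_trans[OF c_le_Aw]) (intro sum_mono mult_right_mono K(4) Aw_nonneg)
    also have "\<dots> = (\<Sum>j\<le>n. K * real (NB (Suc R)) * (\<nu> ^ j * Aw (n - j)))" by (simp add: card_B mult_ac)
    finally have "c n / mu ^ n \<le> (\<Sum>j\<le>n. K * real (NB (Suc R)) * (\<nu> ^ j * Aw (n - j))) / mu ^ n"
      using mp by (intro divide_right_mono) auto
    also have "\<dots> = (\<Sum>j\<le>n. K * real (NB (Suc R)) * (\<theta> ^ j * a (n - j)))"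
      unfolding sum_divide_distrib
    proof (rule sum.cong[OF refl])
      fix j assume "j \<in> {..n}"
      then have "mu ^ n = mu ^ j * mu ^ (n - j)" by (simp add: power_add[symmetric])
      then show "K * real (NB (Suc R)) * (\<nu> ^ j * Aw (n - j)) / mu ^ n = K * real (NB (Suc R)) * (\<theta> ^ j * a (n - j))"
        by (simp add: \<theta>_def a_def power_divide)
    qed
    also have "\<dots> \<le> (\<Sum>j\<le>n. K * real (NB (Suc R)) * (\<theta> ^ j * S n))"
      using K th aS by (intro sum_mono mult_left_mono) auto
    also have "\<dots> = K * real (NB (Suc R)) * S n * (\<Sum>j<Suc n. \<theta> ^ j)" by (simp add: sum_distrib_left sum_distrib_right lessThan_Suc_atMost mult_ac)
    also have "\<dots> \<le> K * real (NB (Suc R)) * S n * (1 / (1 - \<theta>))"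
    proof (rule mult_left_mono)
      have "(\<Sum>j<Suc n. \<theta> ^ j) = (1 - \<theta> ^ Suc n) / (1 - \<theta>)"
        using th sum_gp_strict[of \<theta> "Suc n"] by (simp del: sum.lessThan_Suc power_Suc)
      also have "\<dots> \<le> 1 / (1 - \<theta>)" using th by (intro divide_right_mono) auto
      finally show "(\<Sum>j<Suc n. \<theta> ^ j) \<le> 1 / (1 - \<theta>)" .
    qed (use K S0 in auto)
    finally show ?thesis by (simp add: E_def mult_ac)
  qed
  define D7 where "D7 = D6 * E + 1"
  have D7: "D7 > 0" using D6(1) E by (simp add: D7_def add_nonneg_pos)
  have "S m \<le> D7" for m
  proof (rule square_doubling_bounded[OF D7 S0])
    fix m obtain k where k: "k \<le> m" "S m = a k" using Sin by blast
    have "a k ^ 2 = Aw k * Aw k / mu ^ (k + k)" by (simp add: a_def power2_eq_square power_add)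
    also have "\<dots> \<le> D6 * c (k + k) / mu ^ (k + k)" using D6(2)[of k k] mp by (intro divide_right_mono) auto
    also have "\<dots> = D6 * (c (k + k) / mu ^ (k + k))" by simp
    also have "\<dots> \<le> D6 * (E * S (k + k))" by (rule mult_left_mono[OF gam D6(1)])
    also have "\<dots> \<le> D6 * (E * S (2 * m))"
    proof -
      have "S (k + k) \<le> S (2 * m)" using Sin[of "k + k"] aS[of _ "2 * m"] k(1) by (metis add_mono mult_2 order_trans)
      then show ?thesis using D6(1) E by (intro mult_left_mono) auto
    qed
    also have "\<dots> \<le> D7 * S (2 * m)" using S0[of "2 * m"] by (simp add: D7_def algebra_simps)
    finally show "S m ^ 2 \<le> D7 * S (2 * m)" using k by simp
  next
    fix y :: real assume y: "y > 1"
    then have "y * mu > mu" using mp by simp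
    then obtain K2 where K2: "K2 > 0" "\<forall>n. c n \<le> K2 * (y * mu) ^ n" using c_subexp by blast
    have "S n \<le> K2 * y ^ n" for n
    proof -
      obtain k where k: "k \<le> n" "S n = a k" using Sin by blast
      have "Aw k \<le> K2 * (y * mu) ^ k" using Aw_le[of k] K2(2) order_trans by blast
      then have "a k \<le> K2 * y ^ k" using mp by (simp add: a_def power_mult_distrib field_simps)
      also have "\<dots> \<le> K2 * y ^ n" using k y K2 by (intro mult_left_mono power_increasing) auto
      finally show ?thesis using k by simp
    qed
    then show "\<exists>K. \<forall>n. S n \<le> K * y ^ n" by blast
  qed
  have "c n \<le> (E * D7 + 1) * mu ^ n" for n
  proof -
    have "c n / mu ^ n \<le> E * D7" using gam[of n] mult_left_mono[OF \<open>S n \<le> D7\<close> E] by linarith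
    then have "c n \<le> E * D7 * mu ^ n" using mp by (simp add: field_simps)
    also have "\<dots> \<le> (E * D7 + 1) * mu ^ n" using mp by (intro mult_right_mono) auto
    finally show ?thesis .
  qed
  moreover have "E * D7 + 1 > 0" using E D7 by (simp add: add_nonneg_pos)
  ultimately show ?thesis by blast
qed

end

section \<open>The nonunimodular case\<close>

context tgraph begin

text \<open>The variant of \<open>sum_SW_split\<close> in which the index of the cut depends on the
  walk. Both parts keep the cut vertex, so the walk can be recovered from them.\<close>

lemma split_sum:
  fixes f f1 f2 :: "'a list \<Rightarrow> real"
  assumes A: "finite A" "\<And>w. w \<in> A \<Longrightarrow> saw w \<and> J w < length w \<and> take (Suc (J w)) w \<in> P1 \<and> drop (J w) w \<in> P2 (w ! J w) \<and>
      f w \<le> f1 (take (Suc (J w)) w) * f2 (drop (J w) w)"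
    and P1: "finite P1" and P2: "\<And>x. finite (P2 x)" and nn: "\<And>p. 0 \<le> f1 p" "\<And>p. 0 \<le> f2 p"
    and K: "\<And>x. (\<Sum>q\<in>P2 x. f2 q) \<le> K"
  shows "(\<Sum>w\<in>A. f w) \<le> (\<Sum>p\<in>P1. f1 p) * K"
proof -
  have "(\<Sum>w\<in>A. f w) \<le> (\<Sum>(p, q)\<in>(SIGMA p:P1. P2 (last p)). f1 p * f2 q)"
  proof (rule sum_le_inj[where h = "\<lambda>w. (take (Suc (J w)) w, drop (J w) w)"])
    show "inj_on (\<lambda>w. (take (Suc (J w)) w, drop (J w) w)) A"
      by (rule inj_onI) (metis append_take_drop_id drop_Suc tl_drop prod.inject)
    show "(\<lambda>w. (take (Suc (J w)) w, drop (J w) w)) ` A \<subseteq> (SIGMA p:P1. P2 (last p))"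
    proof
      fix r assume "r \<in> (\<lambda>w. (take (Suc (J w)) w, drop (J w) w)) ` A"
      then obtain w where w: "w \<in> A" "r = (take (Suc (J w)) w, drop (J w) w)" by blast
      have "last (take (Suc (J w)) w) = w ! J w" using A(2)[OF w(1)] slice_last[of 0 "J w" w] by (simp add: slice_take)
      then show "r \<in> (SIGMA p:P1. P2 (last p))" using A(2)[OF w(1)] w(2) by simp
    qed
  qed (use A P1 P2 nn in \<open>auto simp: finite_SigmaI\<close>)
  also have "\<dots> = (\<Sum>p\<in>P1. \<Sum>q\<in>P2 (last p). f1 p * f2 q)" by (rule sum.Sigma[symmetric]) (use P1 P2 in auto)
  also have "\<dots> = (\<Sum>p\<in>P1. f1 p * (\<Sum>q\<in>P2 (last p). f2 q))" by (simp add: sum_distrib_left)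
  also have "\<dots> \<le> (\<Sum>p\<in>P1. f1 p * K)" using K nn by (intro sum_mono mult_left_mono) auto
  finally show ?thesis by (simp add: sum_distrib_right)
qed

lemma take_drop_walk: assumes "saw w" "i < length w"
  shows "saw (take (Suc i) w)" "saw (drop i w)" "hd (take (Suc i) w) = hd w" "last (take (Suc i) w) = w ! i"
    "hd (drop i w) = w ! i" "last (drop i w) = last w" "length (take (Suc i) w) = Suc i" "length (drop i w) = length w - i"
    "take (Suc i) w \<noteq> []" "drop i w \<noteq> []" "w = take (Suc i) w @ tl (drop i w)"
proof -
  show "saw (take (Suc i) w)" using slice_saw[OF assms(1), of 0 i] assms(2) by (simp add: slice_take)
  have "i \<le> length w - 1" "length w - 1 < length w" using assms(2) by auto
  then show "saw (drop i w)" using slice_saw[OF assms(1), of i "length w - 1"] slice_drop[of i "length w - 1" w] by metis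
  show "last (take (Suc i) w) = w ! i" using assms(2) slice_last[of 0 i w] by (simp add: slice_take)
  show "w = take (Suc i) w @ tl (drop i w)" by (metis append_take_drop_id drop_Suc tl_drop)
qed (use assms(2) in \<open>auto simp: hd_drop_conv_nth\<close>)

end

context tgraph_inf begin

text \<open>Truncation at length \<open>N\<close> keeps the sums finite; the bounds derived for them
  are uniform in \<open>N\<close>.\<close>

definition WS :: "nat \<Rightarrow> 'a \<Rightarrow> 'a list set" where "WS N v = {w. saw w \<and> hd w = v \<and> length w \<le> Suc N}"

lemma WS_eq: "WS N v = (\<Union>n\<le>N. SW v n)"
proof
  show "WS N v \<subseteq> (\<Union>n\<le>N. SW v n)"
  proof
    fix w assume w: "w \<in> WS N v"
    then have "w \<in> SW v (length w - 1)" "length w - 1 \<le> N" by (cases w; auto simp: WS_def SW_def saw_def)+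
    then show "w \<in> (\<Union>n\<le>N. SW v n)" by blast
  qed
qed (auto simp: WS_def SW_def)
lemma finite_WS: "finite (WS N v)" "finite {w\<in>WS N v. P w}" by (simp_all add: WS_eq finite_SW)

end

section \<open>The height function and the tilt\<close>

locale tgraph_nonuni = tgraph_inf +
  assumes nonuni: "\<exists>x y. Del x y \<noteq> 1"
begin

definition H :: "'a \<Rightarrow> 'a \<Rightarrow> real" where "H x y = ln (Del x y)"
lemma H_add: "H x y + H y z = H x z"
  unfolding H_def using Del_cocycle[of x y z] ln_mult[of "Del x y" "Del y z"] Del_pos[of x y] Del_pos[of y z] by simp
lemma H_self [simp]: "H x x = 0" by (simp add: H_def)
lemma H_neg: "H y x = - H x y" using H_add[of x y x] by simp
lemma H_Gam: "g \<in> Gam \<Longrightarrow> H (g x) (g y) = H x y" by (simp add: H_def Del_Gam)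
lemma exp_H: "exp (H x y) = Del x y" by (simp add: H_def Del_pos)

definition HV :: "real set" where "HV = H undefined ` {y. adj undefined y}"
text \<open>The largest change of height along an edge. As the changes form a symmetric set, every
  vertex has neighbours exactly \<open>h0\<close> above and exactly \<open>h0\<close> below it;
  positivity of \<open>h0\<close> is where the nontrivial modular function enters.\<close>

definition h0 :: real where "h0 = Max HV"

lemma HV_mem: assumes "adj x y" shows "H x y \<in> HV"
proof -
  obtain g where g: "g \<in> Gam" "g x = undefined" using Gam_trans by blast
  have "adj undefined (g y)" using assms Gam_m[OF g(1), of x y] g(2) by (simp add: adj_def)
  moreover have "H x y = H undefined (g y)" using H_Gam[OF g(1), of x y] g(2) by simp
  ultimately show ?thesis by (auto simp: HV_def)
qed
lemma HV_step: assumes "h \<in> HV" shows "\<exists>y. adj x y \<and> H x y = h"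
proof -
  obtain z where z: "adj undefined z" "h = H undefined z" using assms by (auto simp: HV_def)
  obtain g where g: "g \<in> Gam" "g undefined = x" using Gam_trans by blast
  show ?thesis using z Gam_m[OF g(1), of undefined z] H_Gam[OF g(1), of undefined z] g(2)
    by (intro exI[of _ "g z"]) (simp add: adj_def)
qed
lemma HV_neg: assumes "h \<in> HV" shows "- h \<in> HV"
proof -
  obtain y where y: "adj undefined y" "H undefined y = h" using HV_step[OF assms] by blast
  show ?thesis using HV_mem[OF adj_sym[THEN iffD1, OF y(1)]] H_neg[of y undefined] y(2) by simp
qed
lemma HV_props: "finite HV" "HV \<noteq> {}"
proof -
  have "{y. adj undefined y} \<subseteq> B undefined 1" by (auto simp: d_adj)
  then show "finite HV" unfolding HV_def using finite_B finite_subset by blast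
  obtain y where "d undefined y = 1" using ex_far by blast
  then have "adj undefined y" using d_1 by blast
  then show "HV \<noteq> {}" by (auto simp: HV_def)
qed
lemma h0_mem: "h0 \<in> HV" "- h0 \<in> HV" unfolding h0_def using Max_in[OF HV_props] HV_neg by auto
lemma adj_H: assumes "adj x y" shows "H x y \<le> h0" "- h0 \<le> H x y"
proof -
  have 1: "H x y \<le> h0" if "adj x y" for x y unfolding h0_def using HV_mem[OF that] HV_props by simp
  show "H x y \<le> h0" by (rule 1[OF assms])
  show "- h0 \<le> H x y" using 1[OF adj_sym[THEN iffD1, OF assms]] H_neg[of y x] by simp
qed
lemma h0_nonneg: "0 \<le> h0"
proof -
  obtain y where "adj undefined y" using h0_mem HV_step by blast
  from adj_H[OF this] show ?thesis by linarith
qed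
lemma H_bound: "H x y \<le> h0 * real (d x y)"
proof (induction "d x y" arbitrary: y)
  case (Suc n)
  obtain w where w: "d x w = n" "d w y = 1" using d_split[of n x y] Suc(2) by auto
  have "adj w y" using w(2) by (simp add: d_1)
  then have "H w y \<le> h0" by (rule adj_H)
  moreover have "H x w \<le> h0 * real n" using Suc(1)[of w] w by simp
  ultimately show ?case using H_add[of x w y] Suc(2)[symmetric] by (simp add: algebra_simps)
qed simp
lemma h0_pos: "0 < h0"
proof (rule ccontr)
  assume "\<not> 0 < h0"
  then have "h0 = 0" using h0_nonneg by simp
  then have le: "H x y \<le> 0" for x y using H_bound[of x y] by simp
  obtain x y where xy: "Del x y \<noteq> 1" using nonuni by blast
  have "H x y = 0" using le[of x y] le[of y x] H_neg[of x y] by linarith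
  then show False using exp_H[of x y] xy by simp
qed

definition up :: "'a \<Rightarrow> 'a" where "up x = (SOME y. adj x y \<and> H x y = h0)"
definition dn :: "'a \<Rightarrow> 'a" where "dn x = (SOME y. adj x y \<and> H x y = - h0)"
lemma up: "adj x (up x)" "H x (up x) = h0" unfolding up_def using someI_ex[OF HV_step[OF h0_mem(1), of x]] by auto
lemma dn: "adj x (dn x)" "H x (dn x) = - h0" unfolding dn_def using someI_ex[OF HV_step[OF h0_mem(2), of x]] by auto

definition tau :: "real \<Rightarrow> 'a list \<Rightarrow> real" where "tau \<zeta> w = W \<zeta> w * exp (H (hd w) (last w) / 2)"

lemma tau_nonneg: "0 \<le> \<zeta> \<Longrightarrow> 0 \<le> tau \<zeta> w" by (simp add: tau_def)
lemma tau_map: "g \<in> Gam \<Longrightarrow> w \<noteq> [] \<Longrightarrow> tau \<zeta> (map g w) = tau \<zeta> w"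
  by (simp add: tau_def hd_map last_map H_Gam)
lemma tau_glue: assumes "xs \<noteq> []" "ys \<noteq> []" "hd ys = last xs" shows "tau \<zeta> (xs @ tl ys) = tau \<zeta> xs * tau \<zeta> ys"
proof -
  have "last (xs @ tl ys) = last ys" using assms by (cases ys; cases "tl ys") auto
  moreover have "exp (H (hd xs) (last ys) / 2) = exp (H (hd xs) (last xs) / 2) * exp (H (last xs) (last ys) / 2)"
    using H_add[of "hd xs" "last xs" "last ys"] by (simp add: exp_add[symmetric] add_divide_distrib[symmetric])
  ultimately show ?thesis using W_glue[OF assms] assms by (simp add: tau_def)
qed
lemma tau_split: assumes "saw w" "i < length w" shows "tau \<zeta> w = tau \<zeta> (take (Suc i) w) * tau \<zeta> (drop i w)"
proof -
  note T = take_drop_walk[OF assms]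
  have "hd (drop i w) = last (take (Suc i) w)" using T(4,5) by simp
  then show ?thesis using tau_glue[OF T(9,10), of \<zeta>] T(11) by simp
qed

lemma sum_WS_map: assumes g: "g \<in> Gam" and P: "\<And>g w. g \<in> Gam \<Longrightarrow> saw w \<Longrightarrow> P (map g w) = P w"
  and f: "\<And>g w. g \<in> Gam \<Longrightarrow> saw w \<Longrightarrow> f (map g w) = f w"
  shows "(\<Sum>w\<in>{w\<in>WS N (g v). P w}. f w) = (\<Sum>w\<in>{w\<in>WS N v. P w}. f w)"
proof (rule sum.reindex_bij_witness[where i = "map g" and j = "map (inv g)"])
  have gi: "inv g \<in> Gam" by (rule Gam_inv[OF g])
  fix w assume w: "w \<in> {w\<in>WS N (g v). P w}"
  then have sw: "saw w" "w \<noteq> []" by (auto simp: WS_def saw_def)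
  show "map g (map (inv g) w) = w" using g by (simp add: comp_def)
  show "map (inv g) w \<in> {w\<in>WS N v. P w}"
    using w sw gi P g by (auto simp: WS_def saw_map hd_map)
  show "f (map (inv g) w) = f w" by (rule f[OF gi sw(1)])
next
  fix w assume w: "w \<in> {w\<in>WS N v. P w}"
  then have sw: "saw w" "w \<noteq> []" by (auto simp: WS_def saw_def)
  show "map (inv g) (map g w) = w" using g by (simp add: comp_def)
  show "map g w \<in> {w\<in>WS N (g v). P w}" using w sw P g by (auto simp: WS_def saw_map hd_map)
qed

text \<open>The exponent \<open>1/2\<close> in the tilt is the one for which mass transport absorbs the reversal.\<close>
lemma tau_reversal: assumes P: "\<And>g w. g \<in> Gam \<Longrightarrow> saw w \<Longrightarrow> P (map g w) = P w"
  shows "(\<Sum>w\<in>{w\<in>WS N v. P w}. tau \<zeta> w) = (\<Sum>w\<in>{w\<in>WS N v. P (rev w)}. tau \<zeta> w)"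
proof -
  define F where "F x y = (\<Sum>w\<in>{w\<in>WS N x. last w = y \<and> P w}. tau \<zeta> w)" for x y
  have inv: "F (g x) (g y) = F x y" if g: "g \<in> Gam" for g x y
    unfolding F_def
  proof (rule sum.reindex_bij_witness[where i = "map g" and j = "map (inv g)"])
    have gi: "inv g \<in> Gam" by (rule Gam_inv[OF g])
    fix w assume w: "w \<in> {w\<in>WS N (g x). last w = g y \<and> P w}"
    then have sw: "saw w" "w \<noteq> []" by (auto simp: WS_def saw_def)
    show "map g (map (inv g) w) = w" using g by (simp add: comp_def)
    show "map (inv g) w \<in> {w\<in>WS N x. last w = y \<and> P w}"
      using w sw gi P g by (auto simp: WS_def saw_map hd_map last_map)
    show "tau \<zeta> (map (inv g) w) = tau \<zeta> w" by (rule tau_map[OF gi sw(2)])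
  next
    fix w assume w: "w \<in> {w\<in>WS N x. last w = y \<and> P w}"
    then have sw: "saw w" "w \<noteq> []" by (auto simp: WS_def saw_def)
    show "map (inv g) (map g w) = w" using g by (simp add: comp_def)
    show "map g w \<in> {w\<in>WS N (g x). last w = g y \<and> P w}" using w sw P g by (auto simp: WS_def saw_map hd_map last_map)
  qed
  have lastB: "last w \<in> B v N" if w: "w \<in> WS N v" for w
  proof -
    have s: "apath w" "w \<noteq> []" "hd w = v" "length w \<le> Suc N" using w by (auto simp: WS_def saw_def)
    have "d (hd w) (last w) < length w" by (rule path_dist[OF s(1,2)]) (use s(2) in simp)
    then show ?thesis using s by simp
  qed
  have "(\<Sum>w\<in>{w\<in>WS N v. P w}. tau \<zeta> w) = (\<Sum>y\<in>B v N. \<Sum>w\<in>{w\<in>{w\<in>WS N v. P w}. last w = y}. tau \<zeta> w)"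
    by (rule sum.group[symmetric]) (use finite_WS finite_B lastB in auto)
  also have "\<dots> = (\<Sum>y\<in>B v N. F v y)" unfolding F_def by (intro sum.cong) auto
  also have "\<dots> = (\<Sum>y\<in>B v N. F y v * Del v y)" by (rule mass_transport[of F v N]) (rule inv)
  also have "\<dots> = (\<Sum>y\<in>B v N. \<Sum>w\<in>{w\<in>{w\<in>WS N v. P (rev w)}. last w = y}. tau \<zeta> w)"
  proof (rule sum.cong[OF refl])
    fix y
    show "F y v * Del v y = (\<Sum>w\<in>{w\<in>{w\<in>WS N v. P (rev w)}. last w = y}. tau \<zeta> w)"
      unfolding F_def sum_distrib_right
    proof (rule sum.reindex_bij_witness[where i = rev and j = rev])
      fix w assume w: "w \<in> {w\<in>WS N y. last w = v \<and> P w}"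
      then have sw: "saw w" "w \<noteq> []" "hd w = y" "last w = v" by (auto simp: WS_def saw_def)
      show "rev w \<in> {w\<in>{w\<in>WS N v. P (rev w)}. last w = y}" using w sw by (auto simp: WS_def saw_rev hd_rev last_rev)
      \<comment> \<open>Reversing the walk changes its tilt by the factor \<open>Del v y\<close>,
        which is the factor supplied by mass transport.\<close>
      have "exp (H v y / 2) = exp (H y v / 2) * exp (H v y)" using H_neg[of v y] by (simp add: exp_add[symmetric])
      then show "tau \<zeta> (rev w) = tau \<zeta> w * Del v y" using sw by (simp add: tau_def hd_rev last_rev exp_H)
    next
      fix w assume w: "w \<in> {w\<in>{w\<in>WS N v. P (rev w)}. last w = y}"
      then have sw: "saw w" "w \<noteq> []" "hd w = v" by (auto simp: WS_def saw_def)
      then show "rev w \<in> {w\<in>WS N y. last w = v \<and> P w}" using w by (auto simp: WS_def saw_rev hd_rev last_rev)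
    qed auto
  qed
  also have "\<dots> = (\<Sum>w\<in>{w\<in>WS N v. P (rev w)}. tau \<zeta> w)"
    by (rule sum.group) (use finite_WS finite_B lastB in auto)
  finally show ?thesis .
qed

text \<open>Descending pieces can be concatenated freely, so if the decomposition is unique then the
  powers of their generating function are bounded by that of all walks.\<close>
lemma descending_sum:
  assumes P: "\<And>g w. g \<in> Gam \<Longrightarrow> saw w \<Longrightarrow> P (map g w) = P w"
    and desc: "\<And>w y. saw w \<Longrightarrow> P w \<Longrightarrow> y \<in> set w \<Longrightarrow> H (hd w) y \<le> 0"
      "\<And>w y. saw w \<Longrightarrow> P w \<Longrightarrow> y \<in> set (butlast w) \<Longrightarrow> H y (last w) < 0"
    and pf: "\<And>p p'. saw p \<Longrightarrow> saw p' \<Longrightarrow> P p \<Longrightarrow> P p' \<Longrightarrow> p = take (length p) p' \<Longrightarrow> p = p'"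
    and z: "0 < \<zeta>" "\<zeta> * mu < 1"
  shows "(\<Sum>w\<in>{w\<in>WS N v. P w}. W \<zeta> w) \<le> 1"
proof -
  let ?P = "\<lambda>v. {w\<in>WS N v. P w}"
  define f where "f = (\<Sum>w\<in>?P v. W \<zeta> w)"
  have fv: "(\<Sum>w\<in>?P u. W \<zeta> w) = f" for u
  proof -
    obtain g where g: "g \<in> Gam" "g v = u" using Gam_trans by blast
    show ?thesis using sum_WS_map[OF g(1) P, of "W \<zeta>" N v] g by (simp add: f_def)
  qed
  \<comment> \<open>The \<open>k\<close>-fold concatenations of pieces. They are self-avoiding
    because a piece ends strictly below its other vertices, while everything after it stays at or
    below that end.\<close>
  define Ch where "Ch = rec_nat (\<lambda>v. {[v]}) (\<lambda>_ C v. \<Union>p\<in>?P v. (\<lambda>q. p @ tl q) ` C (last p))"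
  have Ch: "Ch 0 u = {[u]}" "Ch (Suc k) u = (\<Union>p\<in>?P u. (\<lambda>q. p @ tl q) ` Ch k (last p))" for k u by (simp_all add: Ch_def)
  have main: "finite (Ch k u) \<and> (\<forall>w\<in>Ch k u. saw w \<and> hd w = u \<and> (\<forall>y\<in>set w. H u y \<le> 0)) \<and> (\<Sum>w\<in>Ch k u. W \<zeta> w) = f ^ k" for k u
  proof (induction k arbitrary: u)
    case 0 then show ?case by (simp add: Ch saw_def)
  next
    case (Suc k)
    have fin: "finite (Ch k x)" and sw: "\<And>w. w \<in> Ch k x \<Longrightarrow> saw w \<and> hd w = x \<and> (\<forall>y\<in>set w. H x y \<le> 0)"
      and sm: "(\<Sum>w\<in>Ch k x. W \<zeta> w) = f ^ k" for x using Suc.IH[of x] by auto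
    let ?S = "SIGMA p:?P u. Ch k (last p)"
    have im: "Ch (Suc k) u = (\<lambda>(p, q). p @ tl q) ` ?S" unfolding Ch by auto
    have fS: "finite ?S" using fin finite_WS by (intro finite_SigmaI) auto
    have ne: "p \<noteq> []" "q \<noteq> []" "hd q = last p" if "(p, q) \<in> ?S" for p q
      using that sw[of q "last p"] by (auto simp: WS_def saw_def)
    have inj: "inj_on (\<lambda>(p, q). p @ tl q) ?S"
    proof (rule inj_onI)
      fix r r' assume r: "r \<in> ?S" "r' \<in> ?S" and eq: "(\<lambda>(p, q). p @ tl q) r = (\<lambda>(p, q). p @ tl q) r'"
      obtain p q where pq: "r = (p, q)" by (metis prod.exhaust)
      obtain p' q' where pq': "r' = (p', q')" by (metis prod.exhaust)
      have e: "p @ tl q = p' @ tl q'" using eq by (simp add: pq pq')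
      have pp: "saw p" "P p" "saw p'" "P p'" using r by (auto simp: pq pq' WS_def)
      have "p = p'"
      proof (cases "length p \<le> length p'")
        case True
        have "take (length p) (p @ tl q) = take (length p) (p' @ tl q')" using e by simp
        then have "p = take (length p) p'" using True by simp
        then show ?thesis using pf pp by blast
      next
        case False
        have "take (length p') (p @ tl q) = take (length p') (p' @ tl q')" using e by simp
        then have "p' = take (length p') p" using False by simp
        then show ?thesis using pf pp by blast
      qed
      moreover have "q = q'" using e calculation ne[OF r(1)[unfolded pq]] ne[OF r(2)[unfolded pq']] by (metis list.collapse same_append_eq)
      ultimately show "r = r'" by (simp add: pq pq')
    qed
    have "(\<Sum>w\<in>Ch (Suc k) u. W \<zeta> w) = (\<Sum>(p, q)\<in>?S. W \<zeta> (p @ tl q))"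
      unfolding im sum.reindex[OF inj] by (simp add: case_prod_beta)
    also have "\<dots> = (\<Sum>(p, q)\<in>?S. W \<zeta> p * W \<zeta> q)"
      by (rule sum.cong[OF refl]) (use W_glue ne in \<open>auto simp: case_prod_beta\<close>)
    also have "\<dots> = (\<Sum>p\<in>?P u. \<Sum>q\<in>Ch k (last p). W \<zeta> p * W \<zeta> q)"
      by (rule sum.Sigma[symmetric]) (use fin finite_WS in auto)
    also have "\<dots> = f ^ Suc k" using sm fv[of u] by (simp add: sum_distrib_left[symmetric] sum_distrib_right[symmetric])
    finally have s: "(\<Sum>w\<in>Ch (Suc k) u. W \<zeta> w) = f ^ Suc k" .
    have "saw (p @ tl q) \<and> hd (p @ tl q) = u \<and> (\<forall>y\<in>set (p @ tl q). H u y \<le> 0)" if pq: "(p, q) \<in> ?S" for p q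
    proof -
      have pp: "saw p" "P p" "hd p = u" using pq by (auto simp: WS_def)
      have qq: "saw q" "hd q = last p" "\<And>y. y \<in> set q \<Longrightarrow> H (last p) y \<le> 0" using pq sw[of q "last p"] by auto
      obtain q' where q': "q = last p # q'" using ne[OF pq] by (cases q) auto
      have hl: "H u (last p) \<le> 0" using desc(1)[OF pp(1,2), of "last p"] ne[OF pq] pp by simp
      have "set p \<inter> set q' = {}"
      proof (rule ccontr)
        assume "\<not> ?thesis"
        then obtain y where y: "y \<in> set p" "y \<in> set q'" by blast
        have "y \<noteq> last p" using qq(1) y(2) q' by (auto simp: saw_def)
        then have "y \<in> set (butlast p)" using y(1) ne[OF pq] by (metis append_butlast_last_id in_set_conv_decomp rotate1.simps(2) set_ConsD set_rotate1)
        then have "H y (last p) < 0" using desc(2) pp by blast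
        then show False using qq(3)[of y] y(2) q' H_neg[of y "last p"] by simp
      qed
      moreover have "q' = [] \<or> (saw q' \<and> adj (last p) (hd q'))"
        using qq(1) q' by (cases q') (auto simp: saw_def)
      ultimately have "saw (p @ q')" using pp(1) ne[OF pq] saw_append[of p q'] by auto
      moreover have "H u y \<le> 0" if "y \<in> set (p @ q')" for y
        using that desc(1)[OF pp(1,2), of y] pp(3) qq(3)[of y] H_add[of u "last p" y] hl q' by auto
      ultimately show ?thesis using pp q' ne[OF pq] by simp
    qed
    then have "\<forall>w\<in>Ch (Suc k) u. saw w \<and> hd w = u \<and> (\<forall>y\<in>set w. H u y \<le> 0)" unfolding im by auto
    moreover have "finite (Ch (Suc k) u)" unfolding im using fS by simp
    ultimately show ?case using s by blast
  qed
  obtain Kz where Kz: "\<And>N. (\<Sum>k<N. c k * \<zeta> ^ k) \<le> Kz" using generating_bound[OF z] by blast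
  have bd: "f ^ k \<le> Kz" for k
  proof -
    have "(\<Sum>w\<in>Ch k v. W \<zeta> w) \<le> Kz" by (rule sum_saw_length[where v = v, OF _ _ z(1) Kz]) (use main[of k v] in blast)+
    then show ?thesis using main[of k v] by simp
  qed
  have "f \<le> 1"
  proof (rule ccontr)
    assume "\<not> f \<le> 1"
    then obtain k where "Kz < f ^ k" using real_arch_pow[of f Kz] by auto
    then show False using bd[of k] by simp
  qed
  then show ?thesis by (simp add: f_def)
qed

text \<open>A weak bridge in direction \<open>\<sigma>\<close>: start and end are extremal only up
  to less than one unit \<open>h0\<close>, and \<open>e - 1\<close> is the integer part of the
  height in units of \<open>h0\<close>.\<close>

definition WB :: "real \<Rightarrow> nat \<Rightarrow> 'a list \<Rightarrow> bool" where
  "WB \<sigma> e w \<longleftrightarrow> (\<forall>y\<in>set w. - h0 < \<sigma> * H (hd w) y \<and> - h0 < \<sigma> * H y (last w)) \<and>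
     (real e - 1) * h0 \<le> \<sigma> * H (hd w) (last w) \<and> \<sigma> * H (hd w) (last w) < real e * h0"

lemma WB_map: "g \<in> Gam \<Longrightarrow> saw w \<Longrightarrow> WB \<sigma> e (map g w) = WB \<sigma> e w"
  by (auto simp: WB_def saw_def hd_map last_map H_Gam)
lemma WB_rev: "saw w \<Longrightarrow> WB 1 e (rev w) = WB (- 1) e w"
  unfolding WB_def set_rev hd_rev last_rev
  using H_neg[of "last w" "hd w"] H_neg[of _ "last w"] H_neg[of "hd w"] by (auto simp: conj_commute)

definition rho :: real where "rho = exp (- h0 / 2)"
lemma rho: "0 < rho" "rho < 1" using h0_pos by (auto simp: rho_def)

text \<open>A vertex \<open>h0\<close> above in front and two steps down at the end turn a weak
  bridge into a walk that stops when it first reaches depth \<open>L\<close>. Such first-passage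
  walks are prefix-free, so \<open>descending_sum\<close> applies; the three added edges cost
  \<open>\<zeta> ^ 3\<close>.\<close>

lemma weak_bridge_sum0: assumes z: "0 < \<zeta>" "\<zeta> * mu < 1"
  shows "(\<Sum>w\<in>{w\<in>WS N v. WB (- 1) e w}. W \<zeta> w) \<le> (1 / \<zeta>) ^ 3"
proof -
  \<comment> \<open>The added vertices bring the end to depth at least \<open>(e + 2) * h0\<close>,
    while the vertex before it is still above that level.\<close>
  define L where "L = (real e + 2) * h0"
  define P where "P w \<longleftrightarrow> (\<forall>y\<in>set w. H (hd w) y \<le> 0) \<and> (\<forall>y\<in>set (butlast w). - L < H (hd w) y) \<and> H (hd w) (last w) \<le> - L" for w
  have FP: "(\<Sum>w\<in>{w\<in>WS (N + 3) (up v). P w}. W \<zeta> w) \<le> 1"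
  proof (rule descending_sum[OF _ _ _ _ z])
    show "P (map g w) = P w" if "g \<in> Gam" "saw w" for g w
      using that by (auto simp: P_def saw_def hd_map last_map H_Gam map_butlast[symmetric])
    show "H (hd w) y \<le> 0" if "P w" "y \<in> set w" for w y using that by (simp add: P_def)
    show "H y (last w) < 0" if "P w" "y \<in> set (butlast w)" for w y
      using that H_add[of "hd w" y "last w"] by (fastforce simp: P_def)
    fix p p' assume p: "saw p" "saw p'" "P p" "P p'" "p = take (length p) p'"
    show "p = p'"
    proof (rule ccontr)
      assume "p \<noteq> p'"
      then have lt: "length p < length p'" using p(5) by (metis not_le take_all)
      have ne: "p \<noteq> []" using p(1) by (simp add: saw_def)
      have "hd p = hd p'" using p(5) ne by (metis hd_take length_greater_0_conv)
      moreover have "last p \<in> set (butlast p')"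
      proof -
        have "p = take (length p) (butlast p')" using p(5) take_butlast[OF lt] by simp
        then show ?thesis using ne by (metis in_set_takeD last_in_set)
      qed
      ultimately show False using p(3,4) by (fastforce simp: P_def)
    qed
  qed
  have "(\<Sum>w\<in>{w\<in>WS N v. WB (- 1) e w}. W \<zeta> w * \<zeta> ^ 3) \<le> (\<Sum>w\<in>{w\<in>WS (N + 3) (up v). P w}. W \<zeta> w)"
  proof (rule sum_le_inj[where h = "\<lambda>w. up v # w @ [dn (last w), dn (dn (last w))]"])
    show "inj_on (\<lambda>w. up v # w @ [dn (last w), dn (dn (last w))]) {w \<in> WS N v. WB (- 1) e w}" by (auto intro!: inj_onI)
    have all: "up v # w @ [dn (last w), dn (dn (last w))] \<in> {w\<in>WS (N + 3) (up v). P w} \<and> W \<zeta> w * \<zeta> ^ 3 \<le> W \<zeta> (up v # w @ [dn (last w), dn (dn (last w))])"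
      if w: "w \<in> {w \<in> WS N v. WB (- 1) e w}" for w
    proof -
      have sw: "saw w" "hd w = v" "w \<noteq> []" "length w \<le> Suc N" "apath w" "distinct w" using w by (auto simp: WS_def saw_def)
      let ?x = "up v" and ?l = "last w" and ?a = "dn (last w)" and ?b = "dn (dn (last w))"
      have b: "H v y < h0" "H y ?l < h0" if "y \<in> set w" for y using w sw that by (auto simp: WB_def)
      have D: "- (real e * h0) < H v ?l" "H v ?l \<le> - ((real e - 1) * h0)" using w sw by (auto simp: WB_def)
      have xv: "H ?x v = - h0" using up[of v] H_neg[of v ?x] by simp
      have xy: "H ?x y = - h0 + H v y" for y using H_add[of ?x v y] xv by simp
      have la: "H ?l ?a = - h0" "H ?l ?b = - 2 * h0" using dn[of ?l] dn[of ?a] H_add[of ?l ?a ?b] by auto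
      have va: "H v ?a = H v ?l - h0" "H v ?b = H v ?l - 2 * h0" using H_add[of v ?l] la by (metis add_uminus_conv_diff, metis diff_conv_add_uminus mult_minus_left)
      have lw: "v \<in> set w" "?l \<in> set w" using sw by auto
      have vy: "H v ?l - h0 < H v y" if "y \<in> set w" for y using b(2)[OF that] H_add[of v y ?l] by simp
      have d1: "?x \<notin> set w" "?a \<notin> set w" "?b \<notin> set w"
        using b(1)[of ?x] up(2)[of v] vy[of ?a] vy[of ?b] va h0_pos by auto
      have d2: "?x \<noteq> ?a" "?x \<noteq> ?b" "?a \<noteq> ?b"
        using va up(2)[of v] b(1)[OF lw(2)] h0_pos by auto
      have ad: "adj ?x v" using adj_sym[THEN iffD1, OF up(1)] .
      have pa: "apath (?x # w @ [?a, ?b])" using sw ad dn(1)[of ?l] dn(1)[of ?a]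
        by (auto simp: successively_Cons successively_append_iff)
      then have "saw (?x # w @ [?a, ?b])" using sw d1 d2 by (auto simp: saw_def)
      moreover have "P (?x # w @ [?a, ?b])"
      proof -
        have bl: "butlast (?x # w @ [?a, ?b]) = ?x # w @ [?a]" by (simp add: butlast_append)
        have L: "L = real e * h0 + 2 * h0" by (simp add: L_def algebra_simps)
        have en: "0 \<le> real e * h0" using h0_pos by simp
        have D2: "H v ?l \<le> - (real e * h0) + h0" using D(2) by (simp add: algebra_simps)
        have "H ?x y \<le> 0" if "y \<in> set (?x # w @ [?a, ?b])" for y
          using that xy[of y] va b(1)[of y] b(1)[OF lw(2)] h0_pos by auto
        moreover have "- L < H ?x y" if "y \<in> set (?x # w @ [?a])" for y
        proof -
          have "H v y > H v ?l - h0 \<or> y = ?x \<or> H v y = H v ?l - h0" using that vy va by auto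
          then show ?thesis
          proof (elim disjE)
            assume "y = ?x"
            then have "H ?x y = 0" by simp
            then show ?thesis using L en h0_pos by linarith
          qed (use xy[of y] D(1) L in auto)
        qed
        moreover have "H ?x ?b \<le> - L" using xy[of ?b] va(2) D2 L by simp
        ultimately show ?thesis unfolding P_def bl by simp
      qed
      moreover have "W \<zeta> w * \<zeta> ^ 3 \<le> W \<zeta> (?x # w @ [?a, ?b])"
      proof -
        have j: "W \<zeta> (?x # w @ [?a, ?b]) = W \<zeta> [?x, v] * W \<zeta> w * W \<zeta> [?l, ?a, ?b]"
          using W_glue[of "[?x, v]" w \<zeta>] W_glue[of "?x # w" "[?l, ?a, ?b]" \<zeta>] sw by (cases w) auto
        have "\<zeta> ^ 1 \<le> W \<zeta> [?x, v]" using W_ge[of "[?x, v]" \<zeta>] z ad by simp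
        moreover have "\<zeta> ^ 2 \<le> W \<zeta> [?l, ?a, ?b]" using W_ge[of "[?l, ?a, ?b]" \<zeta>] z dn(1) by (simp add: power2_eq_square)
        ultimately have "\<zeta> ^ 1 * W \<zeta> w * \<zeta> ^ 2 \<le> W \<zeta> (?x # w @ [?a, ?b])" unfolding j
          using z by (intro mult_mono mult_nonneg_nonneg) auto
        then show ?thesis by (simp add: power2_eq_square power3_eq_cube mult_ac)
      qed
      ultimately show ?thesis using sw by (auto simp: WS_def)
    qed
    show "(\<lambda>w. up v # w @ [dn (last w), dn (dn (last w))]) ` {w \<in> WS N v. WB (- 1) e w} \<subseteq> {w\<in>WS (N + 3) (up v). P w}"
      using all by blast
    show "W \<zeta> w * \<zeta> ^ 3 \<le> W \<zeta> (up v # w @ [dn (last w), dn (dn (last w))])" if "w \<in> {w \<in> WS N v. WB (- 1) e w}" for w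
      using all[OF that] by blast
  qed (use finite_WS z in auto)
  then have "(\<Sum>w\<in>{w\<in>WS N v. WB (- 1) e w}. W \<zeta> w) * \<zeta> ^ 3 \<le> 1" using FP by (simp add: sum_distrib_right)
  then show ?thesis using z by (simp add: power_one_over pos_le_divide_eq)
qed

text \<open>In descending direction the tilt supplies the decay \<open>rho ^ e\<close>. Ascending
  bridges have the same tilted sum by \<open>tau_reversal\<close>.\<close>

lemma weak_bridge_sum: assumes z: "0 < z0" "z0 \<le> \<zeta>" "\<zeta> * mu < 1" and \<sigma>: "\<sigma> = 1 \<or> \<sigma> = - 1"
  shows "(\<Sum>w\<in>{w\<in>WS N v. WB \<sigma> e w}. tau \<zeta> w) \<le> ((1 / z0) ^ 3 * exp (h0 / 2)) * rho ^ e"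
proof -
  have zp: "0 < \<zeta>" using z by simp
  have dnw: "(\<Sum>w\<in>{w\<in>WS N v. WB (- 1) e w}. tau \<zeta> w) \<le> ((1 / z0) ^ 3 * exp (h0 / 2)) * rho ^ e"
  proof -
    have ex: "exp (h0 / 2) * rho ^ e = exp (- ((real e - 1) * h0) / 2)"
      by (simp add: rho_def exp_of_nat_mult[symmetric] exp_add[symmetric] field_simps)
    have "(\<Sum>w\<in>{w\<in>WS N v. WB (- 1) e w}. tau \<zeta> w) \<le> (\<Sum>w\<in>{w\<in>WS N v. WB (- 1) e w}. W \<zeta> w * (exp (h0 / 2) * rho ^ e))"
      unfolding tau_def ex using zp by (intro sum_mono mult_left_mono) (auto simp: WB_def)
    also have "\<dots> = (\<Sum>w\<in>{w\<in>WS N v. WB (- 1) e w}. W \<zeta> w) * (exp (h0 / 2) * rho ^ e)" by (simp only: sum_distrib_right)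
    also have "\<dots> \<le> (1 / z0) ^ 3 * (exp (h0 / 2) * rho ^ e)"
    proof (rule mult_right_mono)
      have "(1 / \<zeta>) ^ 3 \<le> (1 / z0) ^ 3" using z by (intro power_mono) (auto simp: frac_le)
      then show "(\<Sum>w\<in>{w\<in>WS N v. WB (- 1) e w}. W \<zeta> w) \<le> (1 / z0) ^ 3" using weak_bridge_sum0[OF zp z(3), of N v e] by linarith
    qed (use rho in simp)
    finally show ?thesis by (simp only: mult.assoc)
  qed
  have "(\<Sum>w\<in>{w\<in>WS N v. WB 1 e w}. tau \<zeta> w) = (\<Sum>w\<in>{w\<in>WS N v. WB 1 e (rev w)}. tau \<zeta> w)"
    by (rule tau_reversal) (rule WB_map)
  also have "{w\<in>WS N v. WB 1 e (rev w)} = {w\<in>WS N v. WB (- 1) e w}" using WB_rev by (auto simp: WS_def)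
  finally show ?thesis using dnw \<sigma> by auto
qed

end

text \<open>In the terms with \<open>e < m\<close> the argument of \<open>y\<close> is at most
  \<open>m\<close>, so finitely many values bound them; the terms with \<open>e \<ge> m\<close>
  carry a total coefficient of at most \<open>1 / 2\<close>. The constant \<open>Y\<close> solves
  the resulting equation \<open>Y = a * (1 + k * M0) + a + Y / 2\<close>.\<close>

lemma contraction_bounded:
  fixes y :: "nat \<Rightarrow> real" and b r k :: real
  assumes b: "0 \<le> b" and r: "0 < r" "r < 1" and k: "0 \<le> k" and y0: "y 0 = 0" and y: "\<And>l. 0 \<le> y l"
    and rec: "\<And>l. y (Suc l) = (\<Sum>e\<le>l+2. b * r ^ e * (1 + k * y (min l (e + 1))))"
  shows "\<exists>Y. \<forall>l. y l \<le> Y"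
proof -
  have geo: "(\<Sum>e\<in>I. r ^ (m + e)) \<le> r ^ m / (1 - r)" if fin: "finite I" for I m
  proof -
    obtain n where n: "I \<subseteq> {..<n}" using fin by (auto simp: finite_nat_iff_bounded)
    have "(\<Sum>e\<in>I. r ^ e) \<le> (\<Sum>e<n. r ^ e)" using n r by (intro sum_mono2) auto
    also have "\<dots> = (1 - r ^ n) / (1 - r)" using r sum_gp_strict[of r n] by simp
    also have "\<dots> \<le> 1 / (1 - r)" using r by (intro divide_right_mono) auto
    finally have "r ^ m * (\<Sum>e\<in>I. r ^ e) \<le> r ^ m * (1 / (1 - r))" using r by (intro mult_left_mono) auto
    then show ?thesis by (simp add: power_add sum_distrib_left)
  qed
  have pos: "0 < 1 - r" using r by simp
  obtain m where m: "r ^ m < (1 - r) / (2 * (b * k + 1))"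
    using real_arch_pow_inv[of "(1 - r) / (2 * (b * k + 1))" r] r b k by (auto simp: add_nonneg_pos)
  have bk: "0 \<le> b * k" using b k by simp
  have half: "b * k * (r ^ m / (1 - r)) \<le> 1 / 2"
  proof -
    have "r ^ m / (1 - r) \<le> 1 / (2 * (b * k + 1))" using m pos by (simp add: field_simps)
    then have "b * k * (r ^ m / (1 - r)) \<le> b * k * (1 / (2 * (b * k + 1)))" using bk by (rule mult_left_mono)
    also have "\<dots> \<le> 1 / 2" using bk by (simp add: field_simps)
    finally show ?thesis .
  qed
  define M0 where "M0 = (\<Sum>j\<le>m. y j)"
  have M0: "y j \<le> M0" if "j \<le> m" for j unfolding M0_def using that y by (intro member_le_sum) auto
  have M00: "0 \<le> M0" unfolding M0_def using y by (intro sum_nonneg) auto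
  define a where "a = b * (1 / (1 - r))"
  have a: "0 \<le> a" using b r by (simp add: a_def)
  define Y where "Y = 2 * (a * (1 + k * M0) + a)"
  have Y0: "0 \<le> Y" using a k M00 by (simp add: Y_def)
  have "y l \<le> Y" for l
  proof (induction l rule: less_induct)
    case (less l)
    show ?case
    proof (cases l)
      case 0 then show ?thesis using y0 Y0 by simp
    next
      case (Suc l')
      let ?t = "\<lambda>e. b * r ^ e * (1 + k * y (min l' (e + 1)))"
      have "y l = (\<Sum>e\<in>{..l'+2} \<inter> {..<m}. ?t e) + (\<Sum>e\<in>{..l'+2} - {..<m}. ?t e)"
        unfolding Suc rec using sum.Int_Diff[of "{..l'+2}" ?t "{..<m}"] by simp
      also have "(\<Sum>e\<in>{..l'+2} \<inter> {..<m}. ?t e) \<le> (\<Sum>e\<in>{..l'+2} \<inter> {..<m}. b * (1 + k * M0) * r ^ (0 + e))"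
      proof (rule sum_mono)
        fix e assume "e \<in> {..l'+2} \<inter> {..<m}"
        then have "y (min l' (e + 1)) \<le> M0" by (intro M0) auto
        then have "b * r ^ e * (1 + k * y (min l' (e + 1))) \<le> b * r ^ e * (1 + k * M0)"
          using b r k by (intro mult_left_mono add_left_mono) auto
        then show "?t e \<le> b * (1 + k * M0) * r ^ (0 + e)" by (simp add: mult_ac)
      qed
      also have "\<dots> \<le> b * (1 + k * M0) * (r ^ 0 / (1 - r))" unfolding sum_distrib_left[symmetric]
        using geo[of "{..l'+2} \<inter> {..<m}" 0] b k M00 by (intro mult_left_mono) auto
      also have "(\<Sum>e\<in>{..l'+2} - {..<m}. ?t e) \<le> (\<Sum>e\<in>{..l'+2} - {..<m}. b * (1 + k * Y) * r ^ (m + (e - m)))"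
      proof (rule sum_mono)
        fix e assume e: "e \<in> {..l'+2} - {..<m}"
        have "y (min l' (e + 1)) \<le> Y" by (rule less) (simp add: Suc)
        then have "b * r ^ e * (1 + k * y (min l' (e + 1))) \<le> b * r ^ e * (1 + k * Y)"
          using b r k by (intro mult_left_mono add_left_mono) auto
        then show "?t e \<le> b * (1 + k * Y) * r ^ (m + (e - m))" using e by (simp add: mult_ac)
      qed
      also have "\<dots> = b * (1 + k * Y) * (\<Sum>e\<in>(\<lambda>e. e - m) ` ({..l'+2} - {..<m}). r ^ (m + e))"
        unfolding sum_distrib_left[symmetric] by (subst sum.reindex) (auto simp: inj_on_def)
      also have "\<dots> \<le> b * (1 + k * Y) * (r ^ m / (1 - r))" using geo b k Y0 by (intro mult_left_mono) auto
      also have "\<dots> \<le> a + Y / 2"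
      proof -
        have "r ^ m / (1 - r) \<le> 1 / (1 - r)" using r by (intro divide_right_mono) (auto simp: power_le_one)
        then have "b * (r ^ m / (1 - r)) \<le> a" unfolding a_def using b by (rule mult_left_mono)
        moreover have "b * k * (r ^ m / (1 - r)) * Y \<le> 1 / 2 * Y" using half Y0 by (rule mult_right_mono)
        moreover have "b * (1 + k * Y) * (r ^ m / (1 - r)) = b * (r ^ m / (1 - r)) + b * k * (r ^ m / (1 - r)) * Y"
          by (simp only: distrib_left distrib_right mult_ac mult_1_right mult_1_left)
        ultimately show ?thesis by linarith
      qed
      finally have "y l \<le> b * (1 + k * M0) * (r ^ 0 / (1 - r)) + (a + Y / 2)" by simp
      also have "b * (1 + k * M0) * (r ^ 0 / (1 - r)) = a * (1 + k * M0)" by (simp add: a_def)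
      finally have "y l \<le> a * (1 + k * M0) + (a + Y / 2)" .
      moreover define t where "t = a * (1 + k * M0)"
      ultimately have "y l \<le> t + (a + Y / 2)" by simp
      moreover have "Y = 2 * (t + a)" by (simp add: Y_def t_def)
      then have "t + (a + Y / 2) = Y" by (simp add: field_simps)
      ultimately show ?thesis by (simp only:)
    qed
  qed
  then show ?thesis by blast
qed

context tgraph_nonuni begin

text \<open>After its last visit to the top slab of height \<open>h0\<close>, a walk that starts near the bottom is a walk that
  starts near the top and spans one slab less; hence the alternation of the direction \<open>\<sigma>\<close>.\<close>
definition KC :: "real \<Rightarrow> nat \<Rightarrow> 'a list \<Rightarrow> bool" where
  "KC \<sigma> L w \<longleftrightarrow> (\<forall>y\<in>set w. - h0 < \<sigma> * H (hd w) y) \<and> (\<forall>x\<in>set w. \<forall>y\<in>set w. H x y < real L * h0)"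

lemma KC_map: "g \<in> Gam \<Longrightarrow> saw w \<Longrightarrow> KC \<sigma> L (map g w) = KC \<sigma> L w"
  by (auto simp: KC_def saw_def hd_map H_Gam)

text \<open>The price of one linking edge: the choice of a neighbour, its multiplicity and its
  tilt.\<close>

definition kap :: real where "kap = real (NB 1) * (M * exp (h0 / 2))"
lemma kap_nonneg: "0 \<le> kap" using M_ge1 by (simp add: kap_def)

lemma step_sum: assumes z: "0 < \<zeta>" "\<zeta> \<le> 1" and Y: "\<And>u. (\<Sum>q\<in>{q\<in>WS N u. P q}. tau \<zeta> q) \<le> Y" and Y0: "0 \<le> Y"
  shows "finite (insert [x] ((\<lambda>q. x # q) ` (\<Union>u\<in>{u. adj x u}. {q\<in>WS N u. P q})))"
    "(\<Sum>q\<in>insert [x] ((\<lambda>q. x # q) ` (\<Union>u\<in>{u. adj x u}. {q\<in>WS N u. P q})). tau \<zeta> q) \<le> 1 + kap * Y"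
proof -
  let ?Q = "\<lambda>u. {q\<in>WS N u. P q}" and ?U = "\<Union>u\<in>{u. adj x u}. {q\<in>WS N u. P q}"
  have fU: "finite ?U" using finite_nb finite_WS by auto
  then show "finite (insert [x] ((\<lambda>q. x # q) ` ?U))" by simp
  have "[x] \<notin> (\<lambda>q. x # q) ` ?U" by (auto simp: WS_def saw_def)
  then have "(\<Sum>q\<in>insert [x] ((\<lambda>q. x # q) ` ?U). tau \<zeta> q) = tau \<zeta> [x] + (\<Sum>q\<in>(\<lambda>q. x # q) ` ?U. tau \<zeta> q)"
    using fU by simp
  also have "(\<Sum>q\<in>(\<lambda>q. x # q) ` ?U. tau \<zeta> q) = (\<Sum>q\<in>?U. tau \<zeta> (x # q))" by (subst sum.reindex) auto
  also have "\<dots> = (\<Sum>u\<in>{u. adj x u}. \<Sum>q\<in>?Q u. tau \<zeta> (x # q))"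
    by (rule sum.UNION_disjoint) (use finite_nb finite_WS in \<open>auto simp: WS_def\<close>)
  also have "\<dots> \<le> (\<Sum>u\<in>{u. adj x u}. M * exp (h0 / 2) * Y)"
  proof (rule sum_mono)
    fix u assume u: "u \<in> {u. adj x u}"
    have "(\<Sum>q\<in>?Q u. tau \<zeta> (x # q)) \<le> (\<Sum>q\<in>?Q u. M * exp (h0 / 2) * tau \<zeta> q)"
    proof (rule sum_mono)
      fix q assume "q \<in> ?Q u"
      then have q: "q \<noteq> []" "hd q = u" by (auto simp: WS_def saw_def)
      have e: "tau \<zeta> (x # q) = tau \<zeta> [x, u] * tau \<zeta> q" using tau_glue[of "[x, u]" q \<zeta>] q by (cases q) auto
      have "tau \<zeta> [x, u] = real (m x u) * \<zeta> * exp (H x u / 2)" by (simp add: tau_def W_def)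
      also have "\<dots> \<le> M * 1 * exp (h0 / 2)"
        using m_le_M[of x u] z M_ge1 adj_H(1)[of x u] u by (intro mult_mono) auto
      finally show "tau \<zeta> (x # q) \<le> M * exp (h0 / 2) * tau \<zeta> q" unfolding e
        using z by (intro mult_right_mono tau_nonneg) auto
    qed
    also have "\<dots> = M * exp (h0 / 2) * (\<Sum>q\<in>?Q u. tau \<zeta> q)" by (rule sum_distrib_left[symmetric])
    also have "\<dots> \<le> M * exp (h0 / 2) * Y" using Y M_ge1 by (intro mult_left_mono) auto
    finally show "(\<Sum>q\<in>?Q u. tau \<zeta> (x # q)) \<le> M * exp (h0 / 2) * Y" .
  qed
  also have "\<dots> = real (card {u. adj x u}) * (M * exp (h0 / 2) * Y)" by simp
  also have "\<dots> \<le> real (NB 1) * (M * exp (h0 / 2) * Y)"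
  proof (rule mult_right_mono)
    have "card {u. adj x u} \<le> NB 1" by (rule card_le_NB[of _ x]) (auto simp: d_adj)
    then show "real (card {u. adj x u}) \<le> real (NB 1)" by simp
  qed (use M_ge1 Y0 in auto)
  also have "\<dots> = kap * Y" by (simp only: kap_def mult.assoc)
  also have "tau \<zeta> [x] = 1" by (simp add: tau_def)
  finally show "(\<Sum>q\<in>insert [x] ((\<lambda>q. x # q) ` ?U). tau \<zeta> q) \<le> 1 + kap * Y" by simp
qed

text \<open>With heights in direction \<open>\<sigma>\<close>, cut at the last index
  \<open>i\<close> within \<open>h0\<close> of the maximum. Afterwards the walk stays at least
  \<open>h0\<close> below the maximum, so it spans one unit less. Its span is also below
  \<open>e + 1\<close> units, since the walk never drops a full unit below its start and
  \<open>e\<close> measures the height of the cut vertex.\<close>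

lemma half_space_step:
  assumes w: "saw w" "KC \<sigma> (Suc L) w" and \<sigma>: "\<sigma> = 1 \<or> \<sigma> = - 1"
  shows "\<exists>i e. i < length w \<and> e \<le> L + 2 \<and> WB \<sigma> e (take (Suc i) w) \<and>
    (drop (Suc i) w \<noteq> [] \<longrightarrow> KC (- \<sigma>) (min L (e + 1)) (drop (Suc i) w))"
proof -
  let ?S = "\<lambda>x y. \<sigma> * H x y"
  have S_add: "?S x y + ?S y t = ?S x t" for x y t using H_add[of x y t] by (metis distrib_left)
  have S_neg: "?S y x = - ?S x y" for x y using H_neg[of y x] by simp
  have S_self: "?S x x = 0" for x by simp
  have adjS: "?S x y \<ge> - h0" "?S x y \<le> h0" if "adj x y" for x y using adj_H[OF that] \<sigma> by auto
  have ne: "set w \<noteq> {}" "w \<noteq> []" using w by (auto simp: saw_def)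
  have span: "?S x y < real (Suc L) * h0" if "x \<in> set w" "y \<in> set w" for x y
  proof -
    have "H x y < real (Suc L) * h0" "H y x < real (Suc L) * h0" using w(2) that unfolding KC_def by blast+
    then show ?thesis using \<sigma> H_neg[of y x] by auto
  qed
  obtain T where T: "T \<in> set w" "\<And>t. t \<in> set w \<Longrightarrow> ?S (hd w) t \<le> ?S (hd w) T"
  proof -
    have "Max (?S (hd w) ` set w) \<in> ?S (hd w) ` set w" using ne by (intro Max_in) auto
    then obtain T where "T \<in> set w" "Max (?S (hd w) ` set w) = ?S (hd w) T" by auto
    moreover have "?S (hd w) t \<le> Max (?S (hd w) ` set w)" if "t \<in> set w" for t using that by (intro Max_ge) auto
    ultimately show ?thesis using that by metis
  qed
  have Tt: "0 \<le> ?S t T" if "t \<in> set w" for t using T(2)[OF that] S_add[of "hd w" t T] by linarith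
  define I where "I = {i. i < length w \<and> (\<forall>y\<in>set w. - h0 < ?S y (w ! i))}"
  have fI: "finite I" by (simp add: I_def)
  obtain iT where iT: "iT < length w" "w ! iT = T" using T(1) by (auto simp: in_set_conv_nth)
  have "- h0 < ?S y T" if "y \<in> set w" for y using Tt[OF that] h0_pos by linarith
  then have "iT \<in> I" using iT by (simp add: I_def)
  then have Mi: "Max I \<in> I" "\<And>k. k \<in> I \<Longrightarrow> k \<le> Max I" using fI by (auto intro: Max_in)
  define i where "i = Max I"
  have i: "i < length w" "\<And>y. y \<in> set w \<Longrightarrow> - h0 < ?S y (w ! i)" using Mi(1) by (auto simp: I_def i_def)
  note TD = take_drop_walk[OF w(1) i(1)]
  have wi: "w ! i \<in> set w" using i(1) by simp
  define g where "g = ?S (hd w) (w ! i)"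
  have gl: "- h0 < g" using i(2)[of "hd w"] ne by (simp add: g_def)
  have gu: "g < real (Suc L) * h0" unfolding g_def by (rule span) (use ne wi in auto)
  \<comment> \<open>The height of the cut vertex lies above \<open>- h0\<close>, so the floor is at
    least \<open>- 1\<close> and \<open>nat\<close> truncates nothing.\<close>
  define e where "e = nat (\<lfloor>g / h0\<rfloor> + 1)"
  have fl: "- 1 \<le> \<lfloor>g / h0\<rfloor>" using gl h0_pos by (simp add: le_floor_iff field_simps)
  have fu: "\<lfloor>g / h0\<rfloor> < int (Suc L)" using gu h0_pos by (simp add: floor_less_iff field_simps)
  have re: "real e = of_int \<lfloor>g / h0\<rfloor> + 1" using fl by (simp add: e_def)
  have e1: "(real e - 1) * h0 \<le> g" "g < real e * h0"
  proof -
    have "of_int \<lfloor>g / h0\<rfloor> \<le> g / h0" "g / h0 < of_int \<lfloor>g / h0\<rfloor> + 1" by linarith+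
    then have "of_int \<lfloor>g / h0\<rfloor> * h0 \<le> g" "g < (of_int \<lfloor>g / h0\<rfloor> + 1) * h0"
      unfolding pos_le_divide_eq[OF h0_pos] pos_divide_less_eq[OF h0_pos] .
    then show "(real e - 1) * h0 \<le> g" "g < real e * h0" unfolding re by simp_all
  qed
  have eL: "e \<le> L + 2" using fu by (simp add: e_def)
  have sub: "set (take (Suc i) w) \<subseteq> set w" "set (drop (Suc i) w) \<subseteq> set w" by (auto dest: in_set_takeD in_set_dropD)
  have wb: "WB \<sigma> e (take (Suc i) w)" unfolding WB_def TD(3,4)
    using sub(1) i(2) e1 w(2) by (auto simp: KC_def g_def)
  have kc: "KC (- \<sigma>) (min L (e + 1)) (drop (Suc i) w)" if nd: "drop (Suc i) w \<noteq> []"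
  proof -
    let ?q = "drop (Suc i) w"
    have li: "Suc i < length w" using nd by simp
    have hq: "hd ?q = w ! Suc i" using li by (simp add: hd_drop_conv_nth)
    have low: "?S T y \<le> - h0" if y: "y \<in> set ?q" for y
    proof -
      obtain k where k: "k < length ?q" "y = ?q ! k" using y by (auto simp: in_set_conv_nth)
      then have yk: "y = w ! (Suc i + k)" "Suc i + k < length w" by auto
      have "Suc i + k \<notin> I" using Mi(2)[of "Suc i + k"] by (auto simp: i_def)
      then obtain t where t: "t \<in> set w" "?S t y \<le> - h0" using yk by (auto simp: I_def not_less)
      then show ?thesis using S_add[of T t y] Tt[OF t(1)] S_neg[of T t] by linarith
    qed
    have ad: "adj (w ! i) (w ! Suc i)" using w(1) li by (auto simp: saw_def successively_conv_nth)
    have start: "- h0 < (- \<sigma>) * H (hd ?q) y" if y: "y \<in> set ?q" for y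
    proof -
      have "?S (w ! Suc i) y = ?S (w ! Suc i) (w ! i) + ?S (w ! i) T + ?S T y"
        using S_add[of "w ! Suc i" "w ! i" T] S_add[of "w ! Suc i" T y] by simp
      moreover have "?S (w ! Suc i) (w ! i) \<le> h0" using adjS(1)[OF ad] S_neg[of "w ! Suc i" "w ! i"] by linarith
      moreover have "?S (w ! i) T < h0" using i(2)[OF T(1)] S_neg[of T "w ! i"] by linarith
      ultimately have "?S (w ! Suc i) y < h0" using low[OF y] by linarith
      then show ?thesis unfolding hq by simp
    qed
    have sp: "?S x y < real (min L (e + 1)) * h0" if xy: "x \<in> set ?q" "y \<in> set ?q" for x y
    proof -
      have xw: "x \<in> set w" using xy sub by blast
      have s: "?S x y \<le> ?S x T - h0" using S_add[of x T y] low[OF xy(2)] by linarith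
      have "?S x T < real (Suc L) * h0" by (rule span[OF xw T(1)])
      then have 1: "?S x y < real L * h0" using s by (simp add: algebra_simps)
      have "- h0 < ?S (hd w) x" using w(2) xw by (auto simp: KC_def)
      then have "?S x (hd w) < h0" using S_neg[of x "hd w"] by linarith
      moreover have "?S (w ! i) T < h0" using i(2)[OF T(1)] S_neg[of T "w ! i"] by linarith
      moreover have "?S x T = ?S x (hd w) + g + ?S (w ! i) T" unfolding g_def
        using S_add[of x "hd w" "w ! i"] S_add[of x "w ! i" T] by simp
      ultimately have "?S x y < real (e + 1) * h0" using s e1(2) by (simp add: algebra_simps)
      then show ?thesis using 1 by (simp add: min_def)
    qed
    have "H x y < real (min L (e + 1)) * h0" if "x \<in> set ?q" "y \<in> set ?q" for x y
      using sp[OF that] sp[OF that(2,1)] \<sigma> H_neg[of y x] by auto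
    then show ?thesis unfolding KC_def using start by blast
  qed
  show ?thesis using i(1) eL wb kc by blast
qed

lemma half_space_sum:
  assumes z: "0 < z0" "z0 \<le> \<zeta>" "\<zeta> * mu < 1"
    and y0: "0 \<le> y 0" and rec: "\<And>l. y (Suc l) = (\<Sum>e\<le>l+2. ((1 / z0) ^ 3 * exp (h0 / 2)) * rho ^ e * (1 + kap * y (min l (e + 1))))"
    and yn: "\<And>l. 0 \<le> y l"
  shows "\<sigma> = 1 \<or> \<sigma> = - 1 \<Longrightarrow> (\<Sum>w\<in>{w\<in>WS N v. KC \<sigma> L w}. tau \<zeta> w) \<le> y L"
proof (induction L arbitrary: v \<sigma> rule: less_induct)
  case (less L)
  have zp: "0 < \<zeta>" using z by simp
  have z1: "\<zeta> \<le> 1"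
  proof -
    have "\<zeta> * 1 \<le> \<zeta> * mu" using mu_ge1 zp by (intro mult_left_mono) auto
    then have "\<zeta> * 1 < 1" using z(3) by (rule le_less_trans)
    then show ?thesis by simp
  qed
  show ?case
  proof (cases L)
    case 0
    have "\<not> KC \<sigma> L w" if "w \<in> WS N v" for w
    proof -
      have "hd w \<in> set w" using that by (auto simp: WS_def saw_def)
      then show ?thesis using 0 by (auto simp: KC_def intro!: bexI[of _ "hd w"])
    qed
    then have "{w\<in>WS N v. KC \<sigma> L w} = {}" by blast
    then show ?thesis using y0 0 by (metis sum.empty)
  next
    case (Suc L')
    let ?A = "{w\<in>WS N v. KC \<sigma> (Suc L') w}"
    let ?ok = "\<lambda>w r. fst r < length w \<and> snd r \<le> L' + 2 \<and> WB \<sigma> (snd r) (take (Suc (fst r)) w) \<and>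
      (drop (Suc (fst r)) w \<noteq> [] \<longrightarrow> KC (- \<sigma>) (min L' (snd r + 1)) (drop (Suc (fst r)) w))"
    define ie where "ie w = (SOME r. ?ok w r)" for w
    have ie: "?ok w (ie w)" if "w \<in> ?A" for w
    proof -
      have "\<exists>r. ?ok w r" using half_space_step[of w \<sigma> L'] that less.prems by (auto simp: WS_def)
      then show ?thesis unfolding ie_def by (rule someI_ex)
    qed
    have "(\<Sum>w\<in>?A. tau \<zeta> w) = (\<Sum>e\<le>L'+2. \<Sum>w\<in>{w\<in>?A. snd (ie w) = e}. tau \<zeta> w)"
      by (rule sum.group[symmetric]) (use finite_WS ie in auto)
    also have "\<dots> \<le> (\<Sum>e\<le>L'+2. ((1 / z0) ^ 3 * exp (h0 / 2)) * rho ^ e * (1 + kap * y (min L' (e + 1))))"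
    proof (rule sum_mono)
      fix e assume "e \<in> {..L'+2}"
      let ?M = "min L' (e + 1)"
      have IH: "(\<Sum>q\<in>{q\<in>WS N u. KC (- \<sigma>) ?M q}. tau \<zeta> q) \<le> y ?M" for u
        by (rule less.IH) (use Suc less.prems in auto)
      let ?P2 = "\<lambda>x. insert [x] ((\<lambda>q. x # q) ` (\<Union>u\<in>{u. adj x u}. {q\<in>WS N u. KC (- \<sigma>) ?M q}))"
      note st = step_sum[OF zp z1 IH yn]
      have "(\<Sum>w\<in>{w\<in>?A. snd (ie w) = e}. tau \<zeta> w) \<le> (\<Sum>p\<in>{p\<in>WS N v. WB \<sigma> e p}. tau \<zeta> p) * (1 + kap * y ?M)"
      proof (rule split_sum[where J = "\<lambda>w. fst (ie w)" and ?P2.0 = ?P2])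
        fix w assume w: "w \<in> {w\<in>?A. snd (ie w) = e}"
        have sw: "saw w" "hd w = v" "length w \<le> Suc N" using w by (auto simp: WS_def)
        have k: "?ok w (ie w)" "snd (ie w) = e" using ie w by auto
        let ?i = "fst (ie w)"
        have il: "?i < length w" using k by blast
        note TD = take_drop_walk[OF sw(1) il]
        have "take (Suc ?i) w \<in> {p\<in>WS N v. WB \<sigma> e p}" using TD sw k il by (simp add: WS_def)
        moreover have "drop ?i w \<in> ?P2 (w ! ?i)"
        proof (cases "drop (Suc ?i) w = []")
          case True
          then have "drop ?i w = [w ! ?i]" using il by (metis Cons_nth_drop_Suc)
          then show ?thesis by simp
        next
          case False
          have dw: "drop ?i w = w ! ?i # drop (Suc ?i) w" using il by (simp add: Cons_nth_drop_Suc)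
          have li: "Suc ?i < length w" using False by simp
          note TD2 = take_drop_walk[OF sw(1) li]
          have "adj (w ! ?i) (w ! Suc ?i)" using sw(1) li by (auto simp: saw_def successively_conv_nth)
          moreover have "drop (Suc ?i) w \<in> {q\<in>WS N (w ! Suc ?i). KC (- \<sigma>) ?M q}" using TD2 k False sw by (simp add: WS_def)
          ultimately show ?thesis unfolding dw by blast
        qed
        ultimately show "saw w \<and> ?i < length w \<and> take (Suc ?i) w \<in> {p\<in>WS N v. WB \<sigma> e p} \<and> drop ?i w \<in> ?P2 (w ! ?i) \<and>
          tau \<zeta> w \<le> tau \<zeta> (take (Suc ?i) w) * tau \<zeta> (drop ?i w)"
          using sw(1) il tau_split[OF sw(1) il, of \<zeta>] by (intro conjI) auto
      qed (use finite_WS st tau_nonneg zp in \<open>auto simp: less_imp_le\<close>)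
      also have "\<dots> \<le> (((1 / z0) ^ 3 * exp (h0 / 2)) * rho ^ e) * (1 + kap * y ?M)"
        using weak_bridge_sum[OF z less.prems, of N v e] kap_nonneg yn by (intro mult_right_mono) auto
      finally show "(\<Sum>w\<in>{w\<in>?A. snd (ie w) = e}. tau \<zeta> w) \<le> ((1 / z0) ^ 3 * exp (h0 / 2)) * rho ^ e * (1 + kap * y ?M)" .
    qed
    also have "\<dots> = y L" by (simp only: rec Suc)
    finally show ?thesis by (simp only: Suc)
  qed
qed

text \<open>The bound depends on \<open>z0\<close> alone, which later allows \<open>\<zeta>\<close>
  to approach \<open>1 / mu\<close>.\<close>

lemma half_space_bounded: assumes z: "0 < z0"
  shows "\<exists>Y\<ge>0. \<forall>\<zeta> N v L \<sigma>. z0 \<le> \<zeta> \<longrightarrow> \<zeta> * mu < 1 \<longrightarrow> (\<sigma> = 1 \<or> \<sigma> = - 1) \<longrightarrow> (\<Sum>w\<in>{w\<in>WS N v. KC \<sigma> L w}. tau \<zeta> w) \<le> Y"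
proof -
  let ?b = "(1 / z0) ^ 3 * exp (h0 / 2)"
  \<comment> \<open>Course-of-values recursion: the list \<open>Ys l\<close> stores the values of
    \<open>y\<close> from \<open>0\<close> to \<open>l\<close>.\<close>
  define Ys where "Ys = rec_nat [0 :: real] (\<lambda>l ys. ys @ [(\<Sum>e\<le>l+2. ?b * rho ^ e * (1 + kap * ys ! (min l (e + 1))))])"
  have Ys0: "Ys 0 = [0]" and YsS: "Ys (Suc l) = Ys l @ [(\<Sum>e\<le>l+2. ?b * rho ^ e * (1 + kap * Ys l ! (min l (e + 1))))]" for l
    by (simp_all add: Ys_def)
  have len: "length (Ys l) = Suc l" for l by (induction l) (simp_all add: Ys0 YsS)
  define y where "y l = Ys l ! l" for l
  have stable: "Ys l ! j = y j" if "j \<le> l" for j l using that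
  proof (induction l)
    case (Suc l)
    show ?case
    proof (cases "j = Suc l")
      case False
      then have "j \<le> l" using Suc.prems by simp
      then show ?thesis using Suc.IH len[of l] by (simp add: YsS nth_append)
    qed (simp add: y_def)
  qed (simp add: y_def)
  have rec: "y (Suc l) = (\<Sum>e\<le>l+2. ?b * rho ^ e * (1 + kap * y (min l (e + 1))))" for l
  proof -
    have "y (Suc l) = (\<Sum>e\<le>l+2. ?b * rho ^ e * (1 + kap * Ys l ! (min l (e + 1))))"
      using len[of l] by (simp add: y_def YsS nth_append)
    also have "\<dots> = (\<Sum>e\<le>l+2. ?b * rho ^ e * (1 + kap * y (min l (e + 1))))"
      by (rule sum.cong[OF refl]) (simp add: stable)
    finally show ?thesis .
  qed
  have y0: "y 0 = 0" by (simp add: y_def Ys0)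
  have bn: "0 \<le> ?b" using z by simp
  have yn: "0 \<le> y l" for l
  proof (induction l rule: less_induct)
    case (less l)
    show ?case
    proof (cases l)
      case (Suc l')
      show ?thesis unfolding Suc rec
      proof (rule sum_nonneg)
        fix e
        have "0 \<le> y (min l' (e + 1))" by (rule less) (simp add: Suc)
        then show "0 \<le> ?b * rho ^ e * (1 + kap * y (min l' (e + 1)))"
          by (intro mult_nonneg_nonneg[OF mult_nonneg_nonneg[OF bn zero_le_power[OF less_imp_le[OF rho(1)]]]]
            add_nonneg_nonneg mult_nonneg_nonneg[OF kap_nonneg]) auto
      qed
    qed (simp add: y0)
  qed
  obtain Y where Y: "\<And>l. y l \<le> Y" using contraction_bounded[OF bn rho kap_nonneg y0 yn rec] by blast
  have "(\<Sum>w\<in>{w\<in>WS N v. KC \<sigma> L w}. tau \<zeta> w) \<le> Y" if "z0 \<le> \<zeta>" "\<zeta> * mu < 1" "\<sigma> = 1 \<or> \<sigma> = - 1" for \<zeta> N v L \<sigma>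
    using half_space_sum[OF z that(1,2) _ rec yn that(3), of N v L] y0 Y[of L] by linarith
  moreover have "0 \<le> Y" using yn[of 0] Y[of 0] by linarith
  ultimately show ?thesis by blast
qed

section \<open>Decay of the tilted counts\<close>

definition tc :: "nat \<Rightarrow> real" where "tc n = (\<Sum>w\<in>SW undefined n. tau 1 w)"

lemma tc_eq: "(\<Sum>w\<in>SW v n. tau 1 w) = tc n"
proof -
  obtain g where g: "g \<in> Gam" "g undefined = v" using Gam_trans by blast
  have "(\<Sum>w\<in>SW v n. tau 1 w) = (\<Sum>w\<in>SW undefined n. tau 1 (map g w))"
    using sum_SW_map[OF g(1), of "tau 1" undefined n] g(2) by simp
  also have "\<dots> = tc n" unfolding tc_def
    by (rule sum.cong[OF refl]) (auto simp: SW_def intro!: tau_map[OF g(1)])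
  finally show ?thesis .
qed

lemma tc_nonneg: "0 \<le> tc n" unfolding tc_def by (intro sum_nonneg tau_nonneg) simp

lemma tc_submult: "tc (k + l) \<le> tc k * tc l"
  unfolding tc_def[of "k + l"] tc_def[of k]
proof (rule sum_SW_split[where ?f2.0 = "tau 1"])
  fix xs ys assume "saw xs" "saw ys" "hd ys = last xs"
  then show "tau 1 (xs @ tl ys) \<le> tau 1 xs * tau 1 ys" using tau_glue[of xs ys 1] by (simp add: saw_def)
qed (auto simp: tau_nonneg tc_eq)

lemma tau_WS: "(\<Sum>w\<in>WS N v. tau \<zeta> w) = (\<Sum>n\<le>N. tc n * \<zeta> ^ n)"
proof -
  have "(\<Sum>w\<in>WS N v. tau \<zeta> w) = (\<Sum>n\<le>N. \<Sum>w\<in>SW v n. tau \<zeta> w)" unfolding WS_eq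
    by (rule sum.UNION_disjoint, simp, simp add: finite_SW, auto simp: SW_def)
  also have "\<dots> = (\<Sum>n\<le>N. tc n * \<zeta> ^ n)"
  proof (rule sum.cong[OF refl])
    fix n show "(\<Sum>w\<in>SW v n. tau \<zeta> w) = tc n * \<zeta> ^ n"
      unfolding tc_eq[of v n, symmetric] sum_distrib_right by (rule sum.cong) (auto simp: tau_def W_def SW_def)
  qed
  finally show ?thesis .
qed

text \<open>Cut at a highest vertex: the reversed first part and the second part both start at their
  top, so both are half-space walks in direction \<open>- 1\<close>. Undoing the reversal costs
  nothing by \<open>tau_reversal\<close>.\<close>

lemma tilted_bounded: assumes z: "0 < z0"
  shows "\<exists>Y. \<forall>\<zeta> N. z0 \<le> \<zeta> \<longrightarrow> \<zeta> * mu < 1 \<longrightarrow> (\<Sum>n\<le>N. tc n * \<zeta> ^ n) \<le> Y"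
proof -
  obtain Y where Y: "Y \<ge> 0" "\<And>\<zeta> N v L \<sigma>. z0 \<le> \<zeta> \<Longrightarrow> \<zeta> * mu < 1 \<Longrightarrow> \<sigma> = 1 \<or> \<sigma> = - 1 \<Longrightarrow> (\<Sum>w\<in>{w\<in>WS N v. KC \<sigma> L w}. tau \<zeta> w) \<le> Y"
    using half_space_bounded[OF z] by blast
  have "(\<Sum>n\<le>N. tc n * \<zeta> ^ n) \<le> Y * Y" if zz: "z0 \<le> \<zeta>" "\<zeta> * mu < 1" for \<zeta> N
  proof -
    have zp: "0 \<le> \<zeta>" using z zz by simp
    let ?v = "undefined :: 'a"
    \<comment> \<open>A span so large that it excludes no walk of length at most
      \<open>N\<close>.\<close>
    define L where "L = 2 * N + 1"
    have span: "H x y < real L * h0" if w: "w \<in> WS N v" and xy: "x \<in> set w" "y \<in> set w" for w v x y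
    proof -
      have s: "apath w" "w \<noteq> []" "length w \<le> Suc N" using w by (auto simp: WS_def saw_def)
      have "d (hd w) x < length w" "d (hd w) y < length w" using path_dist[OF s(1,2)] xy by auto
      then have "d x y \<le> 2 * N" using d_tri[of x y "hd w"] d_sym[of x "hd w"] s(3) by linarith
      then have "h0 * real (d x y) \<le> h0 * real (2 * N)" using h0_pos by (intro mult_left_mono) auto
      with H_bound[of x y] have "H x y \<le> h0 * real (2 * N)" by (rule order_trans)
      moreover have "real L * h0 = h0 * real (2 * N) + h0" by (simp add: L_def algebra_simps)
      ultimately show ?thesis using h0_pos by linarith
    qed
    define J where "J w = (SOME i. i < length w \<and> (\<forall>y\<in>set w. H y (w ! i) \<ge> 0))" for w :: "'a list"
    have J: "J w < length w \<and> (\<forall>y\<in>set w. H y (w ! J w) \<ge> 0)" if "saw w" for w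
    proof -
      have ne: "set w \<noteq> {}" using that by (simp add: saw_def)
      have "Max (H (hd w) ` set w) \<in> H (hd w) ` set w" using ne by (intro Max_in) auto
      then obtain T where T: "T \<in> set w" "Max (H (hd w) ` set w) = H (hd w) T" by auto
      have "H y T \<ge> 0" if "y \<in> set w" for y
      proof -
        have "H (hd w) y \<le> H (hd w) T" unfolding T(2)[symmetric] using that by (intro Max_ge) auto
        then show ?thesis using H_add[of "hd w" y T] by linarith
      qed
      moreover obtain i where "i < length w" "w ! i = T" using T(1) by (auto simp: in_set_conv_nth)
      ultimately have "\<exists>i. i < length w \<and> (\<forall>y\<in>set w. H y (w ! i) \<ge> 0)" by blast
      then show ?thesis unfolding J_def by (rule someI_ex)
    qed
    have "(\<Sum>w\<in>WS N ?v. tau \<zeta> w) \<le> (\<Sum>p\<in>{p\<in>WS N ?v. KC (- 1) L (rev p)}. tau \<zeta> p) * Y"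
    proof (rule split_sum[where J = J and ?P2.0 = "\<lambda>x. {q\<in>WS N x. KC (- 1) L q}"])
      fix w assume w: "w \<in> WS N ?v"
      then have sw: "saw w" "hd w = ?v" "length w \<le> Suc N" by (auto simp: WS_def)
      have j: "J w < length w" "\<forall>y\<in>set w. H y (w ! J w) \<ge> 0" using J[OF sw(1)] by auto
      note TD = take_drop_walk[OF sw(1) j(1)]
      have sub: "set (take (Suc (J w)) w) \<subseteq> set w" "set (drop (J w) w) \<subseteq> set w" by (auto dest: in_set_takeD in_set_dropD)
      have lo: "- h0 < - 1 * H (w ! J w) y" if "y \<in> set w" for y
        using j(2) that H_neg[of "w ! J w" y] h0_pos by fastforce
      have "take (Suc (J w)) w \<in> {p\<in>WS N ?v. KC (- 1) L (rev p)}"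
      proof -
        have "KC (- 1) L (rev (take (Suc (J w)) w))" unfolding KC_def set_rev hd_rev TD(4)
          using sub(1) lo span[OF w] by blast
        then show ?thesis using TD sw j by (simp add: WS_def)
      qed
      moreover have "drop (J w) w \<in> {q\<in>WS N (w ! J w). KC (- 1) L q}"
      proof -
        have "KC (- 1) L (drop (J w) w)" unfolding KC_def TD(5) using sub(2) lo span[OF w] by blast
        then show ?thesis using TD sw by (simp add: WS_def)
      qed
      ultimately show "saw w \<and> J w < length w \<and> take (Suc (J w)) w \<in> {p\<in>WS N ?v. KC (- 1) L (rev p)} \<and>
        drop (J w) w \<in> {q\<in>WS N (w ! J w). KC (- 1) L q} \<and> tau \<zeta> w \<le> tau \<zeta> (take (Suc (J w)) w) * tau \<zeta> (drop (J w) w)"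
        using sw(1) j(1) tau_split[OF sw(1) j(1), of \<zeta>] by (intro conjI) auto
    qed (use finite_WS tau_nonneg[OF zp] Y(2)[OF zz] in auto)
    also have "(\<Sum>p\<in>{p\<in>WS N ?v. KC (- 1) L (rev p)}. tau \<zeta> p) = (\<Sum>p\<in>{p\<in>WS N ?v. KC (- 1) L p}. tau \<zeta> p)"
      by (rule tau_reversal[symmetric]) (rule KC_map)
    also have "\<dots> * Y \<le> Y * Y" using Y(2)[OF zz] Y(1) by (intro mult_right_mono) auto
    finally show ?thesis by (simp add: tau_WS)
  qed
  then show ?thesis by blast
qed

text \<open>If \<open>mu ^ n \<le> tc n\<close> for all \<open>n \<ge> 1\<close>, the tilted
  generating function would be unbounded near \<open>1 / mu\<close>, against
  \<open>tilted_bounded\<close>. Submultiplicativity turns a single \<open>tc N < mu ^ N\<close>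
  into a smaller rate.\<close>

lemma tc_decay: "\<exists>\<nu> K. 0 < \<nu> \<and> \<nu> < mu \<and> (\<forall>n. tc n \<le> K * \<nu> ^ n)"
proof -
  have "\<exists>N\<ge>1. tc N < mu ^ N"
  proof (rule ccontr)
    assume "\<not> ?thesis"
    then have ge: "mu ^ n \<le> tc n" if "n \<ge> 1" for n using that by (meson not_le)
    have mp: "0 < mu" by (rule mu_pos)
    define z0 where "z0 = 1 / (2 * mu)"
    have z0: "0 < z0" using mp by (simp add: z0_def)
    obtain Y where Y: "\<And>\<zeta> N. z0 \<le> \<zeta> \<Longrightarrow> \<zeta> * mu < 1 \<Longrightarrow> (\<Sum>n\<le>N. tc n * \<zeta> ^ n) \<le> Y" using tilted_bounded[OF z0] by blast
    obtain N0 where N0: "2 * Y < real N0" using reals_Archimedean2 by blast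
    define N where "N = Suc N0"
    \<comment> \<open>With \<open>\<zeta> = x / mu\<close> each of the terms from \<open>1\<close>
      to \<open>N\<close> is at least \<open>1 / 2\<close>, while \<open>\<zeta>\<close> stays
      between \<open>z0\<close> and \<open>1 / mu\<close>.\<close>
    define x where "x = root N (1 / 2)"
    have x: "0 < x" "x < 1" by (auto simp: x_def N_def real_root_lt_1_iff)
    have xN: "x ^ N = 1 / 2" unfolding x_def by (rule real_root_pow_pos2) (auto simp: N_def)
    have x2: "1 / 2 \<le> x"
    proof -
      have "x ^ N \<le> x ^ 1" using x by (intro power_decreasing) (auto simp: N_def)
      then show ?thesis using xN by simp
    qed
    define \<zeta> where "\<zeta> = x / mu"
    have zz: "z0 \<le> \<zeta>" "\<zeta> * mu < 1" using x x2 mp by (auto simp: \<zeta>_def z0_def field_simps)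
    have "real N / 2 = (\<Sum>n=1..N. x ^ N)" using xN by simp
    also have "\<dots> \<le> (\<Sum>n=1..N. tc n * \<zeta> ^ n)"
    proof (rule sum_mono)
      fix n assume n: "n \<in> {1..N}"
      have "x ^ N \<le> x ^ n" using n x by (intro power_decreasing) auto
      also have "\<dots> = mu ^ n * \<zeta> ^ n" using mp by (simp add: \<zeta>_def power_divide)
      also have "\<dots> \<le> tc n * \<zeta> ^ n" using ge n z0 zz by (intro mult_right_mono) auto
      finally show "x ^ N \<le> tc n * \<zeta> ^ n" .
    qed
    also have "\<dots> \<le> (\<Sum>n\<le>N. tc n * \<zeta> ^ n)" using tc_nonneg z0 zz by (intro sum_mono2) auto
    also have "\<dots> \<le> Y" by (rule Y[OF zz])
    finally show False using N0 by (simp add: N_def)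
  qed
  then obtain N where N: "N \<ge> 1" "tc N < mu ^ N" by blast
  show ?thesis using submultiplicative_growth[of tc N mu, OF tc_nonneg tc_submult N(2,1) mu_pos] by blast
qed

text \<open>The tilt depends on the end points only, so removing it costs a factor exponential in
  their distance. This is the reason for \<open>A ^ d v x\<close> in
  \<open>ballistic\<close>.\<close>

theorem endpoint_decay_nonuni: "\<exists>K \<nu> A. K > 0 \<and> 0 < \<nu> \<and> \<nu> < mu \<and> 1 \<le> A \<and> (\<forall>n v x. cx n v x \<le> K * A ^ d v x * \<nu> ^ n)"
proof -
  obtain \<nu> K where nu: "0 < \<nu>" "\<nu> < mu" "\<And>n. tc n \<le> K * \<nu> ^ n" using tc_decay by blast
  have K: "0 \<le> K" using nu(3)[of 0] tc_nonneg[of 0] by simp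
  have "cx n v x \<le> (K + 1) * exp (h0 / 2) ^ d v x * \<nu> ^ n" for n v x
  proof -
    have e: "exp (- H v x / 2) \<le> exp (h0 / 2) ^ d v x"
    proof -
      have "- H v x \<le> h0 * real (d v x)" using H_bound[of x v] H_neg[of x v] d_sym[of x v] by simp
      then have "- H v x / 2 \<le> real (d v x) * (h0 / 2)" by (simp add: mult.commute)
      then have "exp (- H v x / 2) \<le> exp (real (d v x) * (h0 / 2))" by (simp only: exp_le_cancel_iff)
      then show ?thesis by (simp only: exp_of_nat_mult)
    qed
    have "cx n v x = (\<Sum>w\<in>{w\<in>SW v n. last w = x}. tau 1 w) * exp (- H v x / 2)"
      unfolding cx_def sum_distrib_right
      by (rule sum.cong[OF refl]) (auto simp: tau_def W_def SW_def exp_add[symmetric])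
    also have "\<dots> \<le> tc n * exp (h0 / 2) ^ d v x"
    proof (rule mult_mono)
      show "(\<Sum>w\<in>{w\<in>SW v n. last w = x}. tau 1 w) \<le> tc n" unfolding tc_eq[of v n, symmetric]
        by (rule sum_mono2) (auto simp: finite_SW tau_nonneg)
    qed (use e tc_nonneg in auto)
    also have "\<dots> \<le> ((K + 1) * \<nu> ^ n) * exp (h0 / 2) ^ d v x"
      using nu(3)[of n] nu(1) by (intro mult_right_mono) (auto simp: distrib_right intro: order_trans)
    finally show ?thesis by (simp add: mult_ac)
  qed
  moreover have "1 \<le> exp (h0 / 2)" using h0_pos by simp
  moreover have "0 < K + 1" using K by simp
  ultimately show ?thesis using nu(1,2) by blast
qed

section \<open>Bridges and the upper bound\<close>

definition SB :: "'a list \<Rightarrow> bool" where "SB p \<longleftrightarrow> (\<forall>y\<in>set p. H (hd p) y \<le> 0 \<and> H y (last p) \<le> 0)"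

text \<open>One more step down makes the last vertex strictly lowest, and walks of equal length are
  prefix-free. So \<open>descending_sum\<close> bounds the sum by \<open>t ^ (b + 1)\<close> for
  \<open>t\<close> slightly above \<open>mu\<close>; the exponent \<open>b + 1\<close> comes from
  the added step.\<close>

lemma bridge_bound: "(\<Sum>p\<in>{p\<in>SW x b. SB p}. wt p) \<le> mu ^ (b + 1)"
proof (rule ccontr)
  let ?s = "\<Sum>p\<in>{p\<in>SW x b. SB p}. wt p"
  assume "\<not> ?s \<le> mu ^ (b + 1)"
  then have s: "mu ^ (b + 1) < ?s" by simp
  have mp: "0 < mu" by (rule mu_pos)
  have s0: "0 < ?s" using s mp by (meson less_trans zero_less_power)
  define r where "r = root (b + 1) ?s"
  have r: "mu < r" "r ^ (b + 1) = ?s"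
  proof -
    show "r ^ (b + 1) = ?s" unfolding r_def using s0 by (intro real_root_pow_pos2) auto
    then show "mu < r" using s s0 mp by (metis not_le power_mono real_root_ge_zero less_imp_le r_def)
  qed
  define t where "t = (mu + r) / 2"
  have t: "mu < t" "t < r" "0 < t" using r(1) mp by (auto simp: t_def)
  define \<zeta> where "\<zeta> = 1 / t"
  have z: "0 < \<zeta>" "\<zeta> * mu < 1" using t by (auto simp: \<zeta>_def)
  define P where "P w \<longleftrightarrow> length w = b + 2 \<and> (\<forall>y\<in>set w. H (hd w) y \<le> 0) \<and> (\<forall>y\<in>set (butlast w). H y (last w) < 0)" for w
  have FP: "(\<Sum>w\<in>{w\<in>WS (b + 1) x. P w}. W \<zeta> w) \<le> 1"
  proof (rule descending_sum[OF _ _ _ _ z])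
    show "P (map g w) = P w" if "g \<in> Gam" "saw w" for g w
      using that by (auto simp: P_def saw_def hd_map last_map H_Gam map_butlast[symmetric])
    show "H (hd w) y \<le> 0" if "P w" "y \<in> set w" for w y using that by (simp add: P_def)
    show "H y (last w) < 0" if "P w" "y \<in> set (butlast w)" for w y using that by (simp add: P_def)
    show "p = p'" if "P p" "P p'" "p = take (length p) p'" for p p' using that by (simp add: P_def)
  qed
  have "(\<Sum>w\<in>{p\<in>SW x b. SB p}. wt w * \<zeta> ^ (b + 1)) \<le> (\<Sum>w\<in>{w\<in>WS (b + 1) x. P w}. W \<zeta> w)"
  proof (rule sum_le_inj[where h = "\<lambda>w. w @ [dn (last w)]"])
    have all: "w @ [dn (last w)] \<in> {w\<in>WS (b + 1) x. P w} \<and> wt w * \<zeta> ^ (b + 1) \<le> W \<zeta> (w @ [dn (last w)])"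
      if w: "w \<in> {p\<in>SW x b. SB p}" for w
    proof -
      have sw: "saw w" "hd w = x" "w \<noteq> []" "length w = Suc b" using w by (auto simp: SW_def saw_def)
      have sb: "H x y \<le> 0" "H y (last w) \<le> 0" if "y \<in> set w" for y using w sw that by (auto simp: SB_def)
      let ?a = "dn (last w)"
      have ya: "H y ?a < 0" if "y \<in> set w" for y using sb(2)[OF that] H_add[of y "last w" ?a] dn(2)[of "last w"] h0_pos by linarith
      have "?a \<notin> set w" using ya[of ?a] by auto
      then have "saw (w @ [?a])" using sw dn(1)[of "last w"] saw_append[of w "[?a]"] by (auto simp: saw_def)
      moreover have "P (w @ [?a])" using sb ya sw by (auto simp: P_def less_imp_le)
      moreover have "wt w * \<zeta> ^ (b + 1) \<le> W \<zeta> (w @ [?a])"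
      proof -
        have "1 \<le> real (m (last w) ?a)" using dn(1)[of "last w"] by (simp add: adj_def)
        then have "wt w * 1 \<le> wt w * real (m (last w) ?a)" by (intro mult_left_mono) auto
        moreover have "wt (w @ [?a]) = wt w * real (m (last w) ?a)" using wt_append[OF sw(3), of "[?a]"] by simp
        ultimately have "wt w \<le> wt (w @ [?a])" by simp
        then show ?thesis using z sw(4) by (simp add: W_def mult_right_mono)
      qed
      ultimately show ?thesis using sw by (auto simp: WS_def)
    qed
    show "(\<lambda>w. w @ [dn (last w)]) ` {p\<in>SW x b. SB p} \<subseteq> {w\<in>WS (b + 1) x. P w}" using all by blast
    show "wt w * \<zeta> ^ (b + 1) \<le> W \<zeta> (w @ [dn (last w)])" if "w \<in> {p\<in>SW x b. SB p}" for w using all[OF that] by blast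
  qed (use finite_WS z in \<open>auto intro!: inj_onI\<close>)
  then have "?s * \<zeta> ^ (b + 1) \<le> 1" using FP by (simp add: sum_distrib_right)
  then have "?s \<le> t ^ (b + 1)" using t(3) by (simp add: \<zeta>_def power_one_over pos_divide_le_eq)
  moreover have "t ^ (b + 1) < r ^ (b + 1)" using t by (intro power_strict_mono) auto
  ultimately show False using r(2) by simp
qed

theorem c_upper_nonuni: "\<exists>C>0. \<forall>n. c n \<le> C * mu ^ n"
proof -
  obtain \<nu> K where nu: "0 < \<nu>" "\<nu> < mu" "\<And>n. tc n \<le> K * \<nu> ^ n" using tc_decay by blast
  have K: "0 \<le> K" using nu(3)[of 0] tc_nonneg[of 0] by simp
  have mp: "0 < mu" by (rule mu_pos)
  \<comment> \<open>A walk that ends at least as high as it starts has a tilt of at least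
    \<open>1\<close>.\<close>
  have ascend: "(\<Sum>p\<in>{p\<in>SW v n. 0 \<le> H (hd p) (last p)}. wt p) \<le> tc n" for v n
  proof -
    have "(\<Sum>p\<in>{p\<in>SW v n. 0 \<le> H (hd p) (last p)}. wt p) \<le> (\<Sum>p\<in>{p\<in>SW v n. 0 \<le> H (hd p) (last p)}. tau 1 p)"
    proof (rule sum_mono)
      fix p assume "p \<in> {p\<in>SW v n. 0 \<le> H (hd p) (last p)}"
      then have "1 \<le> exp (H (hd p) (last p) / 2)" by simp
      then have "wt p * 1 \<le> wt p * exp (H (hd p) (last p) / 2)" by (intro mult_left_mono) auto
      then show "wt p \<le> tau 1 p" by (simp add: tau_def W_def)
    qed
    also have "\<dots> \<le> tc n" unfolding tc_eq[of v n, symmetric] by (rule sum_mono2) (auto simp: finite_SW tau_nonneg)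
    finally show ?thesis .
  qed
  \<comment> \<open>Here \<open>snd r\<close> is the index of a lowest vertex and
    \<open>fst r\<close> the index of a highest one up to there.\<close>
  let ?ok = "\<lambda>n w r. fst r \<le> snd r \<and> snd r \<le> n \<and> (\<forall>y\<in>set w. H y (w ! snd r) \<le> 0) \<and> (\<forall>k\<le>snd r. 0 \<le> H (w ! k) (w ! fst r))"
  define ij where "ij n w = (SOME r. ?ok n w r)" for n and w :: "'a list"
  have ij: "?ok n w (ij n w)" if w: "w \<in> SW v n" for v n w
  proof -
    have sw: "saw w" "length w = Suc n" using w by (auto simp: SW_def)
    have ne: "set w \<noteq> {}" using sw by (simp add: saw_def)
    have "Min (H (hd w) ` set w) \<in> H (hd w) ` set w" using ne by (intro Min_in) auto
    then obtain T where T: "T \<in> set w" "Min (H (hd w) ` set w) = H (hd w) T" by auto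
    have T2: "H y T \<le> 0" if "y \<in> set w" for y
    proof -
      have "H (hd w) T \<le> H (hd w) y" unfolding T(2)[symmetric] using that by (intro Min_le) auto
      then show ?thesis using H_add[of "hd w" y T] by linarith
    qed
    obtain j where j: "j < length w" "w ! j = T" using T(1) by (auto simp: in_set_conv_nth)
    let ?I = "(\<lambda>k. H (hd w) (w ! k)) ` {..j}"
    have "Max ?I \<in> ?I" by (intro Max_in) auto
    then obtain i where i: "i \<le> j" "Max ?I = H (hd w) (w ! i)" unfolding image_iff atMost_iff by blast
    have "0 \<le> H (w ! k) (w ! i)" if "k \<le> j" for k
    proof -
      have "H (hd w) (w ! k) \<le> H (hd w) (w ! i)" unfolding i(2)[symmetric] using that by (intro Max_ge) auto
      then show ?thesis using H_add[of "hd w" "w ! k" "w ! i"] by linarith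
    qed
    then have "\<exists>r. ?ok n w r" using i(1) j T2 sw(2) by (intro exI[of _ "(i, j)"]) auto
    then show ?thesis unfolding ij_def by (rule someI_ex)
  qed
  have main: "c n \<le> (\<Sum>i\<le>n. \<Sum>j\<le>n. if i \<le> j then tc i * (mu ^ (j - i + 1) * tc (n - j)) else 0)" for n
  proof -
    let ?v = "undefined :: 'a"
    have "c n = (\<Sum>w\<in>SW ?v n. wt w)" by (simp add: c_def)
    also have "\<dots> = (\<Sum>r\<in>{..n} \<times> {..n}. \<Sum>w\<in>{w\<in>SW ?v n. ij n w = r}. wt w)"
    proof (rule sum.group[symmetric])
      show "ij n ` SW ?v n \<subseteq> {..n} \<times> {..n}"
      proof
        fix r assume "r \<in> ij n ` SW ?v n"
        then obtain w where "w \<in> SW ?v n" "r = ij n w" by blast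
        then show "r \<in> {..n} \<times> {..n}" using ij[of w ?v n] by (auto simp: mem_Times_iff)
      qed
    qed (auto simp: finite_SW)
    also have "\<dots> \<le> (\<Sum>r\<in>{..n} \<times> {..n}. if fst r \<le> snd r then tc (fst r) * (mu ^ (snd r - fst r + 1) * tc (n - snd r)) else 0)"
    proof (rule sum_mono)
      fix r assume "r \<in> {..n} \<times> {..n}"
      obtain i j where r: "r = (i, j)" by (metis prod.exhaust)
      show "(\<Sum>w\<in>{w\<in>SW ?v n. ij n w = r}. wt w) \<le> (if fst r \<le> snd r then tc (fst r) * (mu ^ (snd r - fst r + 1) * tc (n - snd r)) else 0)"
      proof (cases "i \<le> j \<and> j \<le> n")
        case False
        have "{w\<in>SW ?v n. ij n w = r} = {}" using ij[of _ ?v n] False r by fastforce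
        then have "(\<Sum>w\<in>{w\<in>SW ?v n. ij n w = r}. wt w) = 0" by (simp only: sum.empty)
        moreover have "0 \<le> tc (fst r) * (mu ^ (snd r - fst r + 1) * tc (n - snd r))"
          using tc_nonneg mp by (intro mult_nonneg_nonneg) auto
        ultimately show ?thesis by auto
      next
        case True
        define P2 where "P2 x = {u\<in>SW x (n - i). SB (take (Suc (j - i)) u) \<and> 0 \<le> H (u ! (j - i)) (last u)}" for x
        have in2: "(\<Sum>u\<in>P2 x. wt u) \<le> mu ^ (j - i + 1) * tc (n - j)" for x
        proof -
          have "(\<Sum>u\<in>P2 x. wt u) \<le> (\<Sum>p\<in>{p\<in>SW x (j - i). SB p}. wt p) * tc (n - j)"
          proof (rule split_sum[where J = "\<lambda>_. j - i" and ?P2.0 = "\<lambda>y. {q\<in>SW y (n - j). 0 \<le> H (hd q) (last q)}"])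
            fix u assume u: "u \<in> P2 x"
            have su: "saw u" "hd u = x" "length u = Suc (n - i)" using u by (auto simp: P2_def SW_def)
            have jl: "j - i < length u" using su True by (simp add: less_Suc_eq_le diff_le_mono)
            note TD = take_drop_walk[OF su(1) jl]
            have "take (Suc (j - i)) u \<in> {p\<in>SW x (j - i). SB p}" using TD su u by (simp add: P2_def SW_def)
            moreover have "drop (j - i) u \<in> {q\<in>SW (u ! (j - i)) (n - j). 0 \<le> H (hd q) (last q)}"
              using TD su u True by (simp add: P2_def SW_def Suc_diff_le)
            moreover have "wt u = wt (take (Suc (j - i)) u) * wt (drop (j - i) u)"
              using wt_glue[OF TD(9,10)] TD(4,5,11) by simp
            ultimately show "saw u \<and> j - i < length u \<and> take (Suc (j - i)) u \<in> {p\<in>SW x (j - i). SB p} \<and>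
              drop (j - i) u \<in> {q\<in>SW (u ! (j - i)) (n - j). 0 \<le> H (hd q) (last q)} \<and>
              wt u \<le> wt (take (Suc (j - i)) u) * wt (drop (j - i) u)" using su(1) jl by simp
          qed (use ascend in \<open>auto simp: P2_def finite_SW\<close>)
          also have "\<dots> \<le> mu ^ (j - i + 1) * tc (n - j)" using bridge_bound tc_nonneg by (intro mult_right_mono) auto
          finally show ?thesis .
        qed
        have "(\<Sum>w\<in>{w\<in>SW ?v n. ij n w = r}. wt w) \<le> (\<Sum>p\<in>{p\<in>SW ?v i. 0 \<le> H (hd p) (last p)}. wt p) * (mu ^ (j - i + 1) * tc (n - j))"
        proof (rule split_sum[where J = "\<lambda>_. i" and ?P2.0 = P2])
          fix w assume w: "w \<in> {w\<in>SW ?v n. ij n w = r}"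
          have sw: "saw w" "hd w = ?v" "length w = Suc n" using w by (auto simp: SW_def)
          have k: "\<forall>y\<in>set w. H y (w ! j) \<le> 0" "\<forall>k\<le>j. 0 \<le> H (w ! k) (w ! i)" using ij[of w ?v n] w r by auto
          have il: "i < length w" using sw True by simp
          note TD = take_drop_walk[OF sw(1) il]
          have w0: "w ! 0 = hd w" using il by (cases w) auto
          have "take (Suc i) w \<in> {p\<in>SW ?v i. 0 \<le> H (hd p) (last p)}" using TD sw k(2)[rule_format, of 0] w0 by (simp add: SW_def)
          moreover have "drop i w \<in> P2 (w ! i)"
          proof -
            let ?u = "drop i w"
            have "j - i \<le> n - i" using True by (simp add: diff_le_mono)
            then have jl: "j - i < length ?u" using sw(3) True by (simp add: Suc_diff_le)
            note TU = take_drop_walk[OF TD(2) jl]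
            have uj: "?u ! (j - i) = w ! j" using True sw(3) by simp
            have "SB (take (Suc (j - i)) ?u)" unfolding SB_def TU(3,4) uj TD(5)
            proof
              fix y assume "y \<in> set (take (Suc (j - i)) ?u)"
              then obtain l where l: "l < Suc (j - i)" "l < length ?u" "y = ?u ! l" by (auto simp: in_set_conv_nth)
              then have y: "y = w ! (i + l)" "i + l \<le> j" "i + l < length w" using True by auto
              then have "0 \<le> H y (w ! i)" using k(2) by blast
              moreover have "y \<in> set w" using y by simp
              ultimately show "H (w ! i) y \<le> 0 \<and> H y (w ! j) \<le> 0" using k(1) H_neg[of "w ! i" y] by simp
            qed
            moreover have "0 \<le> H (w ! j) (last w)" using k(1) H_neg[of "w ! j" "last w"] TD(9) il
              by (metis last_in_set length_greater_0_conv neg_0_le_iff_le order_le_less_trans zero_le)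
            ultimately show ?thesis using TD sw uj by (simp add: P2_def SW_def Suc_diff_le True)
          qed
          moreover have "wt w = wt (take (Suc i) w) * wt (drop i w)" using wt_glue[OF TD(9,10)] TD(4,5,11) by simp
          ultimately show "saw w \<and> i < length w \<and> take (Suc i) w \<in> {p\<in>SW ?v i. 0 \<le> H (hd p) (last p)} \<and>
            drop i w \<in> P2 (w ! i) \<and> wt w \<le> wt (take (Suc i) w) * wt (drop i w)" using sw(1) il by simp
        qed (use in2 in \<open>auto simp: P2_def finite_SW\<close>)
        also have "\<dots> \<le> tc i * (mu ^ (j - i + 1) * tc (n - j))"
          using ascend tc_nonneg mp by (intro mult_right_mono) auto
        finally show ?thesis using True r by simp
      qed
    qed
    also have "\<dots> = (\<Sum>i\<le>n. \<Sum>j\<le>n. if i \<le> j then tc i * (mu ^ (j - i + 1) * tc (n - j)) else 0)"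
      by (simp add: sum.cartesian_product case_prod_beta)
    finally show ?thesis .
  qed
  define \<theta> where "\<theta> = \<nu> / mu"
  have th: "0 < \<theta>" "\<theta> < 1" using nu mp by (auto simp: \<theta>_def)
  have nth: "\<nu> ^ k = \<theta> ^ k * mu ^ k" for k using mp by (simp add: \<theta>_def power_divide)
  have geo: "(\<Sum>i\<le>n. \<theta> ^ i) \<le> 1 / (1 - \<theta>)" for n
  proof -
    have "(\<Sum>i\<le>n. \<theta> ^ i) = (1 - \<theta> ^ Suc n) / (1 - \<theta>)" using th sum_gp0[of \<theta> n] by simp
    also have "\<dots> \<le> 1 / (1 - \<theta>)" using th by (intro divide_right_mono) auto
    finally show ?thesis .
  qed
  have "c n \<le> (K * K * mu * (1 / (1 - \<theta>)) * (1 / (1 - \<theta>)) + 1) * mu ^ n" for n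
  proof -
    have "(\<Sum>i\<le>n. \<Sum>j\<le>n. if i \<le> j then tc i * (mu ^ (j - i + 1) * tc (n - j)) else 0)
      \<le> (\<Sum>i\<le>n. \<Sum>j\<le>n. (K * K * mu * mu ^ n) * (\<theta> ^ i * \<theta> ^ (n - j)))"
    proof (intro sum_mono)
      fix i j assume ij': "i \<in> {..n}" "j \<in> {..n}"
      show "(if i \<le> j then tc i * (mu ^ (j - i + 1) * tc (n - j)) else 0) \<le> (K * K * mu * mu ^ n) * (\<theta> ^ i * \<theta> ^ (n - j))"
      proof (cases "i \<le> j")
        case True
        have "tc i * (mu ^ (j - i + 1) * tc (n - j)) \<le> (K * \<nu> ^ i) * (mu ^ (j - i + 1) * (K * \<nu> ^ (n - j)))"
          using nu tc_nonneg mp K by (intro mult_mono mult_nonneg_nonneg) auto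
        also have "\<dots> = K * K * (mu ^ i * mu ^ (j - i + 1) * mu ^ (n - j)) * (\<theta> ^ i * \<theta> ^ (n - j))" by (simp only: nth mult_ac)
        also have "mu ^ i * mu ^ (j - i + 1) * mu ^ (n - j) = mu * mu ^ n"
        proof -
          have "i + (j - i + 1) + (n - j) = Suc n" using True ij' by simp
          then show ?thesis by (metis power_Suc power_add)
        qed
        finally show ?thesis using True by (simp add: mult_ac)
      qed (use K mp th in auto)
    qed
    also have "\<dots> = (K * K * mu * mu ^ n) * ((\<Sum>i\<le>n. \<theta> ^ i) * (\<Sum>j\<le>n. \<theta> ^ (n - j)))"
      by (subst sum_product) (simp only: sum_distrib_left)
    also have "(\<Sum>j\<le>n. \<theta> ^ (n - j)) = (\<Sum>j\<le>n. \<theta> ^ j)"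
      using sum.nat_diff_reindex[of "\<lambda>j. \<theta> ^ j" "Suc n"] by (simp add: lessThan_Suc_atMost)
    also have "(K * K * mu * mu ^ n) * ((\<Sum>i\<le>n. \<theta> ^ i) * (\<Sum>j\<le>n. \<theta> ^ j)) \<le> (K * K * mu * mu ^ n) * ((1 / (1 - \<theta>)) * (1 / (1 - \<theta>)))"
      using geo[of n] th K mp by (intro mult_left_mono mult_mono) (auto intro: sum_nonneg)
    also have "\<dots> \<le> (K * K * mu * (1 / (1 - \<theta>)) * (1 / (1 - \<theta>)) + 1) * mu ^ n" using mp by (simp add: algebra_simps)
    finally show ?thesis using main[of n] by linarith
  qed
  moreover have "0 < K * K * mu * (1 / (1 - \<theta>)) * (1 / (1 - \<theta>)) + 1" using K mp th by (intro add_nonneg_pos) auto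
  ultimately show ?thesis by blast
qed

end

section \<open>Multigraphs\<close>

context tgraph_ends begin

theorem asymptotics:
  "\<exists>C>0. \<forall>n. c n \<le> C * mu ^ n"
  "\<exists>b t. b > 0 \<and> t > 0 \<and> (\<forall>n\<ge>1. (\<Sum>xs\<in>{xs\<in>SW v n. real (d v (last xs)) < b * real n}. wt xs) \<le> exp (- t * real n) * c n)"
proof -
  have "(\<exists>C>0. \<forall>n. c n \<le> C * mu ^ n) \<and> (\<exists>K \<nu> A. K > 0 \<and> 0 < \<nu> \<and> \<nu> < mu \<and> 1 \<le> A \<and> (\<forall>n v x. cx n v x \<le> K * A ^ d v x * \<nu> ^ n))"
  proof (cases "\<forall>x y. Del x y = 1")
    case True
    interpret U: tgraph_uni m by unfold_locales (use True in blast)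
    obtain K \<nu> where "K > 0" "0 < \<nu>" "\<nu> < mu" "\<forall>n v x. cx n v x \<le> K * \<nu> ^ n" using U.endpoint_decay by blast
    then have "K > 0 \<and> 0 < \<nu> \<and> \<nu> < mu \<and> 1 \<le> (1 :: real) \<and> (\<forall>n v x. cx n v x \<le> K * 1 ^ d v x * \<nu> ^ n)" by simp
    then show ?thesis using U.c_upper_uni by blast
  next
    case False
    interpret N: tgraph_nonuni m by unfold_locales (use False in blast)
    show ?thesis using N.endpoint_decay_nonuni N.c_upper_nonuni by blast
  qed
  then obtain K \<nu> A where C: "\<exists>C>0. \<forall>n. c n \<le> C * mu ^ n"
    and K: "K > 0" "0 < \<nu>" "\<nu> < mu" "1 \<le> A" "\<And>n v x. cx n v x \<le> K * A ^ d v x * \<nu> ^ n" by blast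
  show "\<exists>C>0. \<forall>n. c n \<le> C * mu ^ n" by (rule C)
  show "\<exists>b t. b > 0 \<and> t > 0 \<and> (\<forall>n\<ge>1. (\<Sum>xs\<in>{xs\<in>SW v n. real (d v (last xs)) < b * real n}. wt xs) \<le> exp (- t * real n) * c n)"
    by (rule ballistic[OF K(2,3,4,1,5)])
qed

end

section \<open>Adjacency, walks and components of the multigraph\<close>

definition madj :: "('v, 'e) multigraph \<Rightarrow> 'v \<Rightarrow> 'v \<Rightarrow> bool" where
  "madj G x y \<longleftrightarrow> (\<exists>e\<in>edges G. endpoints G e = {x, y})"

lemma madj_sym: "madj G x y \<longleftrightarrow> madj G y x" by (simp add: madj_def insert_commute)

lemma walk_relpow:
  assumes "wf_multigraph G" "u \<in> verts G"
  shows "(\<exists>w\<in>walks_between G u v. length (snd w) = n) \<longleftrightarrow> (madj G ^^ n) u v"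
proof
  assume "\<exists>w\<in>walks_between G u v. length (snd w) = n"
  then obtain vs es where w: "is_walk G (vs, es)" "hd vs = u" "last vs = v" "length es = n" by (auto simp: walks_between_def)
  then have l: "length vs = Suc n" "\<And>i. i < n \<Longrightarrow> es ! i \<in> edges G \<and> endpoints G (es ! i) = {vs ! i, vs ! Suc i}"
    by (auto simp: is_walk_def intro: nth_mem subsetD)
  then have "vs ! 0 = u" "vs ! n = v" using w by (cases vs; auto simp: last_conv_nth)+
  then show "(madj G ^^ n) u v" unfolding relpowp_fun_conv using l
    by (intro exI[of _ "\<lambda>i. vs ! i"]) (auto simp: madj_def)
next
  assume "(madj G ^^ n) u v"
  then obtain f where f: "f 0 = u" "f n = v" "\<And>i. i < n \<Longrightarrow> madj G (f i) (f (Suc i))" unfolding relpowp_fun_conv by blast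
  define E where "E i = (SOME e. e \<in> edges G \<and> endpoints G e = {f i, f (Suc i)})" for i
  have E: "E i \<in> edges G \<and> endpoints G (E i) = {f i, f (Suc i)}" if "i < n" for i
  proof -
    have "\<exists>e. e \<in> edges G \<and> endpoints G e = {f i, f (Suc i)}" using f(3)[OF that] by (auto simp: madj_def)
    then show ?thesis unfolding E_def by (rule someI_ex)
  qed
  have fv: "f i \<in> verts G" if "i \<le> n" for i
  proof (cases i)
    case 0 then show ?thesis using f assms by simp
  next
    case (Suc j)
    then have "E j \<in> edges G" "f i \<in> endpoints G (E j)" using E[of j] that by auto
    then show ?thesis using assms(1) by (auto simp: wf_multigraph_def)
  qed
  let ?w = "(map f [0..<Suc n], map E [0..<n])"
  have "is_walk G ?w" unfolding is_walk_def prod.case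
  proof (intro conjI allI impI)
    show "set (map f [0..<Suc n]) \<subseteq> verts G" using fv by auto
    show "set (map E [0..<n]) \<subseteq> edges G" using E by auto
    fix i assume i: "i < length (map E [0..<n])"
    then have "map f [0..<Suc n] ! i = f i" "map f [0..<Suc n] ! Suc i = f (Suc i)" "map E [0..<n] ! i = E i"
      by (simp_all del: upt_Suc)
    then show "endpoints G (map E [0..<n] ! i) = {map f [0..<Suc n] ! i, map f [0..<Suc n] ! Suc i}" using E[of i] i by simp
  qed simp
  moreover have "hd (map f [0..<Suc n]) = u" using f by (simp add: hd_map upt_conv_Cons del: upt_Suc)
  moreover have "last (map f [0..<Suc n]) = v" using f by simp
  ultimately have "?w \<in> walks_between G u v" by (simp add: walks_between_def del: upt_Suc)
  moreover have "length (snd ?w) = n" by simp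
  ultimately show "\<exists>w\<in>walks_between G u v. length (snd w) = n" by blast
qed

lemma walks_rtranclp: assumes "wf_multigraph G" "u \<in> verts G"
  shows "walks_between G u v \<noteq> {} \<longleftrightarrow> (madj G)\<^sup>*\<^sup>* u v"
  unfolding rtranclp_power using walk_relpow[OF assms, of v] by blast

lemma wf_delete: "wf_multigraph G \<Longrightarrow> wf_multigraph (delete_verts G K)"
  by (fastforce simp: wf_multigraph_def delete_verts_def)

lemma madj_delete: "madj (delete_verts G K) x y \<longleftrightarrow> madj G x y \<and> x \<notin> K \<and> y \<notin> K"
  by (auto simp: madj_def delete_verts_def)

lemma madj_verts: assumes "wf_multigraph G" "madj G x y" shows "x \<in> verts G" "y \<in> verts G" "x \<noteq> y"
proof -
  obtain e where e: "e \<in> edges G" "endpoints G e = {x, y}" using assms(2) by (auto simp: madj_def)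
  then have c: "{x, y} \<subseteq> verts G" "card {x, y} = 2" using assms(1) by (auto simp: wf_multigraph_def)
  then show "x \<in> verts G" "y \<in> verts G" by auto
  show "x \<noteq> y" using c(2) by auto
qed

lemma finite_madj: assumes "wf_multigraph G" "locally_finite_graph G" shows "finite {y. madj G x y}"
proof (cases "x \<in> verts G")
  case True
  let ?E = "{e\<in>edges G. x \<in> endpoints G e}"
  have "{y. madj G x y} \<subseteq> (\<Union>e\<in>?E. endpoints G e)"
  proof
    fix y assume "y \<in> {y. madj G x y}"
    then obtain e where "e \<in> edges G" "endpoints G e = {x, y}" by (auto simp: madj_def)
    then show "y \<in> (\<Union>e\<in>?E. endpoints G e)" by auto
  qed
  moreover have "finite (endpoints G e)" if "e \<in> ?E" for e
    using that assms(1) by (intro card_ge_0_finite) (auto simp: wf_multigraph_def)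
  moreover have "finite ?E" using assms(2) True by (simp add: locally_finite_graph_def)
  ultimately show ?thesis by (meson finite_UN_I finite_subset)
next
  case False
  then have "{y. madj G x y} = {}" using madj_verts(1)[OF assms(1)] by blast
  then show ?thesis by (simp only: finite.emptyI)
qed

lemma component_eq:
  assumes wf: "wf_multigraph G" and C: "C \<in> graph_components G" and u: "u \<in> C"
  shows "C = {v. (madj G)\<^sup>*\<^sup>* u v}" "u \<in> verts G"
proof -
  obtain r where r: "r \<in> verts G" "C = {v. walks_between G r v \<noteq> {}}" using C by (auto simp: graph_components_def)
  have Cr: "C = {v. (madj G)\<^sup>*\<^sup>* r v}" unfolding r(2) using walks_rtranclp[OF wf r(1)] by simp
  have sy: "symp (madj G)\<^sup>*\<^sup>*" by (intro symp_rtranclp sympI) (simp add: madj_sym)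
  have ru: "(madj G)\<^sup>*\<^sup>* r u" using u Cr by simp
  then have ur: "(madj G)\<^sup>*\<^sup>* u r" using sy by (meson sympD)
  show "C = {v. (madj G)\<^sup>*\<^sup>* u v}" unfolding Cr using ru ur by (auto intro: rtranclp_trans)
  show "u \<in> verts G" using ru r(1) by (induction rule: rtranclp_induct) (use madj_verts[OF wf] in auto)
qed

lemma component_of: assumes "wf_multigraph G" "u \<in> verts G" shows "{v. (madj G)\<^sup>*\<^sup>* u v} \<in> graph_components G"
  unfolding graph_components_def using walks_rtranclp[OF assms] assms(2) by auto

section \<open>Rays, ends and a finite set separating three of them\<close>

abbreviation "reach G K \<equiv> (madj (delete_verts G K))\<^sup>*\<^sup>*"

text \<open>A ray is injective, so it visits a finite set only finitely often and its tail stays in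
  one component.\<close>

lemma ray_tail: assumes r: "r \<in> rays G" and K: "finite K"
  shows "\<exists>N. \<forall>i\<ge>N. fst r i \<notin> K \<and> reach G K (fst r N) (fst r i)"
proof -
  obtain x y where xy: "r = (x, y)" "inj x" "range y \<subseteq> edges G" "\<And>i. endpoints G (y i) = {x i, x (Suc i)}"
    using r by (auto simp: rays_def)
  have "finite (x -` K)" by (rule finite_vimageI[OF K xy(2)])
  then obtain N where N: "\<And>i. i \<in> x -` K \<Longrightarrow> i < N" by (meson finite_nat_iff_bounded lessThan_iff subsetD)
  have out: "x i \<notin> K" if "i \<ge> N" for i using N[of i] that by auto
  have "reach G K (x N) (x i)" if "i \<ge> N" for i using that
  proof (induction rule: dec_induct)
    case (step n)
    have "madj G (x n) (x (Suc n))" using xy(3,4) unfolding madj_def by (intro bexI[of _ "y n"]) auto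
    then have "madj (delete_verts G K) (x n) (x (Suc n))" unfolding madj_delete using out step by simp
    then show ?case using step.IH by (rule rtranclp.rtrancl_into_rtrancl[rotated])
  qed simp
  then show ?thesis using out xy(1) by (intro exI[of _ N]) auto
qed

lemma ray_verts: "r \<in> rays G \<Longrightarrow> fst r i \<in> verts G" "r \<in> rays G \<Longrightarrow> inj (fst r)" by (auto simp: rays_def)

text \<open>For transitivity, the two components both contain almost all vertices of the infinite
  middle ray, so they meet and coincide. That this is an equivalence makes representatives of
  different ends inequivalent.\<close>

lemma ray_equiv_equiv: assumes wf: "wf_multigraph G" shows "equiv (rays G) (ray_equiv G)"
proof (rule equivI)
  show "ray_equiv G \<subseteq> rays G \<times> rays G" by (auto simp: ray_equiv_def)
  show "refl_on (rays G) (ray_equiv G)"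
  proof (rule refl_onI)
    fix r assume r: "r \<in> rays G"
    have "\<exists>C\<in>graph_components (delete_verts G K). finite (range (fst r) - C)" if K: "finite K" for K
    proof -
      obtain N where N: "\<forall>i\<ge>N. fst r i \<notin> K \<and> reach G K (fst r N) (fst r i)" using ray_tail[OF r K] by blast
      let ?C = "{v. reach G K (fst r N) v}"
      have "?C \<in> graph_components (delete_verts G K)"
        by (rule component_of[OF wf_delete[OF wf]]) (use N ray_verts(1)[OF r] in \<open>simp add: delete_verts_def\<close>)
      moreover have "range (fst r) - ?C \<subseteq> fst r ` {..<N}" using N by (auto simp: not_less[symmetric])
      then have "finite (range (fst r) - ?C)" by (rule finite_subset) simp
      ultimately show ?thesis by blast
    qed
    then show "(r, r) \<in> ray_equiv G" using r unfolding ray_equiv_def by blast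
  qed
  show "sym (ray_equiv G)" by (rule symI) (auto simp: ray_equiv_def)
  show "trans (ray_equiv G)"
  proof (rule transI)
    fix r s t assume rs: "(r, s) \<in> ray_equiv G" and st: "(s, t) \<in> ray_equiv G"
    have "\<exists>C\<in>graph_components (delete_verts G K). finite (range (fst r) - C) \<and> finite (range (fst t) - C)"
      if K: "K \<subseteq> verts G" "finite K" for K
    proof -
      obtain C where C: "C \<in> graph_components (delete_verts G K)" "finite (range (fst r) - C)" "finite (range (fst s) - C)"
        using rs K unfolding ray_equiv_def by blast
      obtain D where D: "D \<in> graph_components (delete_verts G K)" "finite (range (fst s) - D)" "finite (range (fst t) - D)"
        using st K unfolding ray_equiv_def by blast
      have "infinite (range (fst s))" using rs ray_verts(2)[of s G] by (auto simp: ray_equiv_def dest: range_inj_infinite)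
      then have "\<not> range (fst s) \<subseteq> (range (fst s) - C) \<union> (range (fst s) - D)" using C(3) D(2) by (meson finite_UnI finite_subset)
      then obtain u where "u \<in> C" "u \<in> D" by blast
      then have "C = D" using component_eq(1)[OF wf_delete[OF wf] C(1)] component_eq(1)[OF wf_delete[OF wf] D(1)] by blast
      then show ?thesis using C D by blast
    qed
    then show "(r, t) \<in> ray_equiv G" using rs st unfolding ray_equiv_def by blast
  qed
qed

lemma three_rays: assumes wf: "wf_multigraph G" and inf: "infinite (graph_ends G)"
  shows "\<exists>r1\<in>rays G. \<exists>r2\<in>rays G. \<exists>r3\<in>rays G. (r1, r2) \<notin> ray_equiv G \<and> (r1, r3) \<notin> ray_equiv G \<and> (r2, r3) \<notin> ray_equiv G"
proof -
  obtain E where E: "E \<subseteq> graph_ends G" "card E = 3" "finite E" using infinite_arbitrarily_large[OF inf] by metis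
  obtain c1 c2 c3 where c: "E = {c1, c2, c3}" "c1 \<noteq> c2" "c1 \<noteq> c3" "c2 \<noteq> c3" using E(2) by (metis card_3_iff)
  have cs: "c1 \<in> rays G // ray_equiv G" "c2 \<in> rays G // ray_equiv G" "c3 \<in> rays G // ray_equiv G"
    using E(1) c(1) by (auto simp: graph_ends_def)
  obtain r1 r2 r3 where r: "r1 \<in> rays G" "c1 = ray_equiv G `` {r1}" "r2 \<in> rays G" "c2 = ray_equiv G `` {r2}"
    "r3 \<in> rays G" "c3 = ray_equiv G `` {r3}" using cs by (elim quotientE) blast
  have "(a, b) \<notin> ray_equiv G" if "ray_equiv G `` {a} \<noteq> ray_equiv G `` {b}" for a b
    using that equiv_class_eq[OF ray_equiv_equiv[OF wf]] by blast
  then show ?thesis using r c by metis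
qed

text \<open>Each pair of rays has its own separating set. The union of the three separates all
  pairs, because deleting more vertices only destroys connections, and the tails lie in infinite
  components.\<close>

lemma separated_tails:
  assumes wf: "wf_multigraph G" and inf: "infinite (graph_ends G)"
  shows "\<exists>K a b c. finite K \<and> a \<in> verts G - K \<and> b \<in> verts G - K \<and> c \<in> verts G - K \<and>
    infinite {v. reach G K a v} \<and> infinite {v. reach G K b v} \<and>
    infinite {v. reach G K c v} \<and> \<not> reach G K a b \<and>
    \<not> reach G K a c \<and> \<not> reach G K b c"
proof -
  obtain r1 r2 r3 where r: "r1 \<in> rays G" "r2 \<in> rays G" "r3 \<in> rays G"
    "(r1, r2) \<notin> ray_equiv G" "(r1, r3) \<notin> ray_equiv G" "(r2, r3) \<notin> ray_equiv G" using three_rays[OF assms] by blast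
  let ?sep = "\<lambda>r s K. \<not> (\<exists>C\<in>graph_components (delete_verts G K). finite (range (fst r) - C) \<and> finite (range (fst s) - C))"
  have ex: "\<exists>K. finite K \<and> ?sep r s K" if "r \<in> rays G" "s \<in> rays G" "(r, s) \<notin> ray_equiv G" for r s
    using that unfolding ray_equiv_def by blast
  obtain K1 where K1: "finite K1" "?sep r1 r2 K1" using ex[OF r(1,2,4)] by blast
  obtain K2 where K2: "finite K2" "?sep r1 r3 K2" using ex[OF r(1,3,5)] by blast
  obtain K3 where K3: "finite K3" "?sep r2 r3 K3" using ex[OF r(2,3,6)] by blast
  define K where "K = K1 \<union> K2 \<union> K3"
  have fK: "finite K" using K1 K2 K3 by (simp add: K_def)
  have mono: "reach G L x y" if "reach G K x y" "L \<subseteq> K" for L x y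
    using that(1) by (rule rtranclp_mono[THEN predicate2D, rotated]) (use that(2) in \<open>auto simp: madj_delete\<close>)
  define tl where "tl r = (SOME N. \<forall>i\<ge>N. fst r i \<notin> K \<and> reach G K (fst r N) (fst r i))" for r :: "(nat \<Rightarrow> 'a) \<times> (nat \<Rightarrow> 'b)"
  have tl: "\<forall>i\<ge>tl r. fst r i \<notin> K \<and> reach G K (fst r (tl r)) (fst r i)" if "r \<in> rays G" for r
    unfolding tl_def by (rule someI_ex[OF ray_tail[OF that fK]])
  define a where "a r = fst r (tl r)" for r :: "(nat \<Rightarrow> 'a) \<times> (nat \<Rightarrow> 'b)"
  have aV: "a r \<in> verts G - K" if "r \<in> rays G" for r using tl[OF that] ray_verts(1)[OF that] by (auto simp: a_def)
  have cof: "finite (range (fst r) - {v. reach G K (a r) v})" if "r \<in> rays G" for r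
  proof (rule finite_subset)
    show "range (fst r) - {v. reach G K (a r) v} \<subseteq> fst r ` {..<tl r}"
      using tl[OF that] by (auto simp: a_def not_less[symmetric])
  qed simp
  have infa: "infinite {v. reach G K (a r) v}" if "r \<in> rays G" for r
  proof
    assume "finite {v. reach G K (a r) v}"
    then have "finite (range (fst r))" using cof[OF that] by (meson finite_Diff2)
    then show False using range_inj_infinite[OF ray_verts(2)[OF that]] by blast
  qed
  have sep: "\<not> reach G K (a r) (a s)" if rs: "r \<in> rays G" "s \<in> rays G" "?sep r s L" "L \<subseteq> K" for r s L
  proof
    assume con: "reach G K (a r) (a s)"
    let ?C = "{v. reach G L (a r) v}"
    have "?C \<in> graph_components (delete_verts G L)"
      by (rule component_of[OF wf_delete[OF wf]]) (use aV[OF rs(1)] rs(4) in \<open>auto simp: delete_verts_def\<close>)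
    moreover have "finite (range (fst r) - ?C)" by (rule finite_subset[OF _ cof[OF rs(1)]]) (use mono rs(4) in blast)
    moreover have "finite (range (fst s) - ?C)"
      by (rule finite_subset[OF _ cof[OF rs(2)]]) (use mono rs(4) con in \<open>blast intro: rtranclp_trans\<close>)
    ultimately show False using rs(3) by blast
  qed
  have s: "\<not> reach G K (a r1) (a r2)" "\<not> reach G K (a r1) (a r3)"
    "\<not> reach G K (a r2) (a r3)"
    using sep[OF r(1,2) K1(2)] sep[OF r(1,3) K2(2)] sep[OF r(2,3) K3(2)] by (auto simp: K_def)
  show ?thesis
    by (intro exI[of _ K] exI[of _ "a r1"] exI[of _ "a r2"] exI[of _ "a r3"] conjI fK aV infa r s)
qed

text \<open>The weighted setting has a whole type as vertex set, so the vertices are enumerated by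
  natural numbers. Such an \<open>f\<close> exists because the vertex set is countable and
  infinite.\<close>

locale end_graph =
  fixes G :: "('v, 'e) multigraph" and f :: "nat \<Rightarrow> 'v"
  assumes wf: "wf_multigraph G" and conn: "connected_graph G" and lf: "locally_finite_graph G"
    and trans: "transitive_graph G" and ends: "infinite (graph_ends G)" and f: "bij_betw f UNIV (verts G)"
begin

definition mult :: "nat \<Rightarrow> nat \<Rightarrow> nat" where
  "mult i j = card {e\<in>edges G. endpoints G e = {f i, f j}}"

lemma f_V: "f i \<in> verts G" using f by (auto simp: bij_betw_def)
lemma f_inj: "f i = f j \<longleftrightarrow> i = j" using f by (auto simp: bij_betw_def inj_def)
lemma f_surj: "x \<in> verts G \<Longrightarrow> \<exists>i. f i = x" using f unfolding bij_betw_def by (metis imageE)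

lemma finite_par: "finite {e\<in>edges G. endpoints G e = {f i, f j}}"
  by (rule finite_subset[of _ "{e\<in>edges G. f i \<in> endpoints G e}"]) (use lf f_V in \<open>auto simp: locally_finite_graph_def\<close>)

lemma mult_madj: "mult i j > 0 \<longleftrightarrow> madj G (f i) (f j)"
  using finite_par[of i j] by (auto simp: mult_def card_gt_0_iff madj_def)

lemma vertex_automorphism: assumes "u \<in> verts G" "v \<in> verts G" shows "\<exists>\<phi> \<psi>. is_automorphism G \<phi> \<psi> \<and> \<phi> u = v"
proof -
  obtain O1 where O1: "vertex_orbit G ` verts G = {O1}" using trans by (auto simp: transitive_graph_def card_1_singleton_iff)
  then have "vertex_orbit G u = vertex_orbit G v" using assms by blast
  moreover have "is_automorphism G id id" by (simp add: is_automorphism_def)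
  then have "v \<in> vertex_orbit G v" unfolding vertex_orbit_def by (metis (mono_tags, lifting) id_apply mem_Collect_eq)
  ultimately have "v \<in> vertex_orbit G u" by simp
  then show ?thesis by (auto simp: vertex_orbit_def)
qed

lemma rtranclp_mult: assumes "(madj G)\<^sup>*\<^sup>* (f i) y" shows "\<exists>j. y = f j \<and> (\<lambda>x y. mult x y > 0)\<^sup>*\<^sup>* i j"
  using assms
proof (induction rule: rtranclp_induct)
  case (step y z)
  then obtain j where j: "y = f j" "(\<lambda>x y. mult x y > 0)\<^sup>*\<^sup>* i j" by blast
  obtain k where k: "f k = z" using f_surj[OF madj_verts(2)[OF wf step(2)]] by blast
  have "mult j k > 0" using step(2) j k by (simp add: mult_madj)
  then show ?case using j k by (intro exI[of _ k]) (auto intro: rtranclp.rtrancl_into_rtrancl)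
qed auto

text \<open>The edge part of an automorphism restricts to bijections between parallel classes, so
  the vertex part preserves multiplicities.\<close>

lemma mult_trans: "\<exists>g. bij g \<and> (\<forall>x y. mult (g x) (g y) = mult x y) \<and> g u = v"
proof -
  obtain \<phi> \<psi> where a: "is_automorphism G \<phi> \<psi>" "\<phi> (f u) = f v" using vertex_automorphism[OF f_V f_V] by blast
  have \<phi>: "bij_betw \<phi> (verts G) (verts G)" and \<psi>: "bij_betw \<psi> (edges G) (edges G)"
    and inc: "\<And>e. e \<in> edges G \<Longrightarrow> endpoints G (\<psi> e) = \<phi> ` endpoints G e" using a(1) by (auto simp: is_automorphism_def)
  define g where "g = inv_into UNIV f \<circ> (\<phi> \<circ> f)"
  have "bij_betw (inv_into UNIV f) (verts G) UNIV" by (rule bij_betw_inv_into[OF f])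
  then have bg: "bij g" unfolding g_def using bij_betw_trans[OF bij_betw_trans[OF f \<phi>]] by blast
  have fg: "f (g x) = \<phi> (f x)" for x
  proof -
    have "\<phi> (f x) \<in> verts G" using \<phi> f_V by (auto simp: bij_betw_def)
    then show ?thesis unfolding g_def comp_def by (rule bij_betw_inv_into_right[OF f])
  qed
  have "mult (g x) (g y) = mult x y" for x y
  proof -
    have "{e\<in>edges G. endpoints G e = {\<phi> (f x), \<phi> (f y)}} = \<psi> ` {e\<in>edges G. endpoints G e = {f x, f y}}" (is "?L = \<psi> ` ?R")
    proof
      show "?L \<subseteq> \<psi> ` ?R"
      proof
        fix e assume e: "e \<in> ?L"
        then obtain e' where e': "e' \<in> edges G" "e = \<psi> e'" using \<psi> by (auto simp: bij_betw_def)
        have "\<phi> ` endpoints G e' = \<phi> ` {f x, f y}" using e e' inc[OF e'(1)] by simp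
        moreover have "endpoints G e' \<subseteq> verts G" "{f x, f y} \<subseteq> verts G" using e' wf f_V by (auto simp: wf_multigraph_def)
        moreover have "inj_on \<phi> (verts G)" using \<phi> by (simp add: bij_betw_def)
        ultimately have "endpoints G e' = {f x, f y}" by (metis inj_on_image_eq_iff)
        then show "e \<in> \<psi> ` ?R" using e' by blast
      qed
      show "\<psi> ` ?R \<subseteq> ?L" using \<psi> inc by (auto simp: bij_betw_def)
    qed
    moreover have "inj_on \<psi> ?R" using \<psi> by (auto simp: bij_betw_def inj_on_def)
    ultimately show ?thesis unfolding mult_def fg by (simp add: card_image)
  qed
  moreover have "g u = v"
  proof -
    have "f (g u) = f v" using fg a(2) by simp
    then show ?thesis by (simp add: f_inj)
  qed
  ultimately show ?thesis using bg by blast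
qed

lemma mult_sym: "mult x y = mult y x" by (simp add: mult_def insert_commute)
lemma mult_irrefl: "mult x x = 0"
proof (rule ccontr)
  assume "mult x x \<noteq> 0"
  then show False using madj_verts(3)[OF wf, of "f x" "f x"] mult_madj[of x x] by simp
qed

sublocale tgraph mult
proof
  show "finite {y. mult x y > 0}" for x
  proof -
    have "finite (f -` {y. madj G (f x) y})"
      by (rule finite_vimageI[OF finite_madj[OF wf lf]]) (simp add: inj_def f_inj)
    then show ?thesis by (simp add: mult_madj vimage_def)
  qed
  show "(\<lambda>x y. mult x y > 0)\<^sup>*\<^sup>* x y" for x y
  proof -
    have "walks_between G (f x) (f y) \<noteq> {}" using conn f_V by (simp add: connected_graph_def)
    then have "(madj G)\<^sup>*\<^sup>* (f x) (f y)" using walks_rtranclp[OF wf f_V] by blast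
    then show ?thesis using rtranclp_mult f_inj by metis
  qed
qed (rule mult_sym mult_irrefl mult_trans)+

lemma adj_madj: "adj i j \<longleftrightarrow> madj G (f i) (f j)" by (simp add: adj_def mult_madj)

lemma con_delete: "con (f -` K) i j \<longleftrightarrow> reach G K (f i) (f j)"
proof
  assume "con (f -` K) i j"
  then show "reach G K (f i) (f j)" unfolding con_def
  proof (induction rule: rtranclp_induct)
    case (step y z)
    then have "madj (delete_verts G K) (f y) (f z)" by (simp add: madj_delete adj_madj)
    then show ?case using step.IH by (rule rtranclp.rtrancl_into_rtrancl[rotated])
  qed simp
next
  assume "reach G K (f i) (f j)"
  then have "\<exists>k. f j = f k \<and> con (f -` K) i k"
  proof (induction rule: rtranclp_induct)
    case (step y z)
    then obtain k where k: "y = f k" "con (f -` K) i k" by blast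
    have yz: "madj G y z" "y \<notin> K" "z \<notin> K" using step(2) by (auto simp: madj_delete)
    obtain l where l: "f l = z" using f_surj[OF madj_verts(2)[OF wf yz(1)]] by blast
    have "con (f -` K) i l" by (rule con_into[OF k(2)]) (use yz k l in \<open>auto simp: adj_madj\<close>)
    then show ?case using l by blast
  qed (auto simp: con_def)
  then show "con (f -` K) i j" by (simp add: f_inj)
qed

lemma component_image: assumes "f i \<notin> K" shows "{v. reach G K (f i) v} = f ` {j. con (f -` K) i j}"
proof -
  have "v \<in> verts G" if "reach G K (f i) v" for v
    using that f_V[of i] by (induction rule: rtranclp_induct) (use madj_verts(2)[OF wf] in \<open>auto simp: madj_delete\<close>)
  then show ?thesis using f_surj by (fastforce simp: con_delete)
qed

sublocale tgraph_ends mult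
proof
  show "infinite (UNIV :: nat set)" by simp
  obtain K a b c where K: "finite K" "a \<in> verts G - K" "b \<in> verts G - K" "c \<in> verts G - K"
    "infinite {v. reach G K a v}" "infinite {v. reach G K b v}"
    "infinite {v. reach G K c v}" "\<not> reach G K a b"
    "\<not> reach G K a c" "\<not> reach G K b c"
    using separated_tails[OF wf ends] by blast
  obtain i j k where ijk: "f i = a" "f j = b" "f k = c" using K f_surj by (metis DiffD1)
  have "finite (f -` K)" by (rule finite_vimageI[OF K(1)]) (simp add: inj_def f_inj)
  moreover have "infinite {y. con (f -` K) l y}" if "f l \<notin> K" "infinite {v. reach G K (f l) v}" for l
    using that component_image[OF that(1)] by auto
  ultimately show "\<exists>K x1 x2 x3. finite K \<and> x1 \<notin> K \<and> x2 \<notin> K \<and> x3 \<notin> K \<and>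
    infinite {y. con K x1 y} \<and> infinite {y. con K x2 y} \<and> infinite {y. con K x3 y} \<and>
    \<not> con K x1 x2 \<and> \<not> con K x1 x3 \<and> \<not> con K x2 x3"
    using K unfolding ijk[symmetric]
    by (intro exI[of _ "f -` K"] exI[of _ i] exI[of _ j] exI[of _ k]) (auto simp: con_delete)
qed

lemma graph_dist_d: "graph_dist G (f i) (f j) = d i j"
proof -
  have "(madj G ^^ n) (f i) y \<longleftrightarrow> (\<exists>j. y = f j \<and> (adj ^^ n) i j)" for n y
  proof (induction n arbitrary: y)
    case (Suc n)
    show ?case
    proof
      assume "(madj G ^^ Suc n) (f i) y"
      then obtain k where k: "(adj ^^ n) i k" "madj G (f k) y" using Suc.IH by (auto simp: OO_def)
      then obtain l where "y = f l" using f_surj[OF madj_verts(2)[OF wf k(2)]] by blast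
      then show "\<exists>j. y = f j \<and> (adj ^^ Suc n) i j" using k by (auto simp: adj_madj OO_def)
    next
      assume "\<exists>j. y = f j \<and> (adj ^^ Suc n) i j"
      then obtain j k where jk: "y = f j" "(adj ^^ n) i k" "adj k j" by (auto simp: OO_def)
      have "(madj G ^^ n) (f i) (f k)" using Suc.IH jk(2) by blast
      moreover have "madj G (f k) y" using jk by (simp add: adj_madj)
      ultimately show "(madj G ^^ Suc n) (f i) y" by (rule relpowp_Suc_I)
    qed
  qed auto
  then have "(madj G ^^ n) (f i) (f j) \<longleftrightarrow> (adj ^^ n) i j" for n by (auto simp: f_inj)
  then show ?thesis unfolding graph_dist_def d_def using walk_relpow[OF wf f_V, of i "f j"] by simp
qed

section \<open>Walks with edges as lifts of vertex lists\<close>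

definition edge_lists :: "nat list \<Rightarrow> 'e list set" where
  "edge_lists xs = {es. length es = length xs - 1 \<and>
     (\<forall>i<length es. es ! i \<in> edges G \<and> endpoints G (es ! i) = {f (xs ! i), f (xs ! Suc i)})}"

text \<open>The edge of the first step can be chosen independently of the later ones, so the number
  of lifts is the product that defines \<open>wt\<close>.\<close>

lemma edge_lists: "finite (edge_lists xs) \<and> real (card (edge_lists xs)) = wt xs"
proof (induction xs rule: induct_list012)
  case 1
  have "edge_lists [] = {[]}" by (auto simp: edge_lists_def)
  then show ?case by simp
next
  case (2 x)
  have "edge_lists [x] = {[]}" by (auto simp: edge_lists_def)
  then show ?case by simp
next
  case (3 x y zs)
  let ?E = "{e\<in>edges G. endpoints G e = {f x, f y}}"
  have "edge_lists (x # y # zs) = (\<lambda>(e, es). e # es) ` (?E \<times> edge_lists (y # zs))"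
  proof
    show "edge_lists (x # y # zs) \<subseteq> (\<lambda>(e, es). e # es) ` (?E \<times> edge_lists (y # zs))"
    proof
      fix es assume es: "es \<in> edge_lists (x # y # zs)"
      then obtain e es' where e: "es = e # es'" by (cases es) (auto simp: edge_lists_def)
      have "e \<in> ?E" using es e by (auto simp: edge_lists_def dest: spec[of _ 0])
      moreover have "es' \<in> edge_lists (y # zs)" unfolding edge_lists_def
      proof (intro CollectI conjI allI impI)
        show "length es' = length (y # zs) - 1" using es e by (simp add: edge_lists_def)
        fix i assume "i < length es'"
        then have "Suc i < length es" using e by simp
        then have "es ! Suc i \<in> edges G \<and> endpoints G (es ! Suc i) = {f ((x # y # zs) ! Suc i), f ((x # y # zs) ! Suc (Suc i))}"
          using es by (simp only: edge_lists_def mem_Collect_eq)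
        then show "es' ! i \<in> edges G" "endpoints G (es' ! i) = {f ((y # zs) ! i), f ((y # zs) ! Suc i)}" using e by auto
      qed
      ultimately show "es \<in> (\<lambda>(e, es). e # es) ` (?E \<times> edge_lists (y # zs))" using e by force
    qed
    show "(\<lambda>(e, es). e # es) ` (?E \<times> edge_lists (y # zs)) \<subseteq> edge_lists (x # y # zs)"
      by (auto simp: edge_lists_def nth_Cons split: nat.splits)
  qed
  moreover have "inj_on (\<lambda>(e, es). e # es) (?E \<times> edge_lists (y # zs))" by (auto simp: inj_on_def)
  ultimately show ?case using 3 finite_par[of x y] by (simp add: card_image card_cartesian_product mult_def[symmetric])
qed

lemma saws_decompose: "{w\<in>saws G (f i) n. P (fst w)} =
    (\<lambda>(xs, es). (map f xs, es)) ` (SIGMA xs:{xs\<in>SW i n. P (map f xs)}. edge_lists xs)"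
proof
  show "{w\<in>saws G (f i) n. P (fst w)} \<subseteq> (\<lambda>(xs, es). (map f xs, es)) ` (SIGMA xs:{xs\<in>SW i n. P (map f xs)}. edge_lists xs)"
  proof
    fix w assume w: "w \<in> {w\<in>saws G (f i) n. P (fst w)}"
    obtain vs es where ve: "w = (vs, es)" by (metis prod.exhaust)
    have vs: "length vs = Suc n" "length es = n" "set vs \<subseteq> verts G" "hd vs = f i" "distinct vs" "P vs"
      "\<And>k. k < n \<Longrightarrow> es ! k \<in> edges G \<and> endpoints G (es ! k) = {vs ! k, vs ! Suc k}"
      using w by (auto simp: ve saws_def is_walk_def intro: nth_mem subsetD)
    define xs where "xs = map (inv_into UNIV f) vs"
    have fx: "map f xs = vs" unfolding xs_def map_map
      using vs(3) bij_betw_inv_into_right[OF f] by (intro map_idI) auto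
    have lx: "length xs = Suc n" using vs(1) by (simp add: xs_def)
    have nx: "f (xs ! k) = vs ! k" if "k \<le> n" for k using that lx fx by (metis le_imp_less_Suc nth_map)
    have "xs \<noteq> []" using lx by auto
    moreover have "distinct xs" using vs(5) fx distinct_map by metis
    moreover have "adj (xs ! k) (xs ! Suc k)" if "Suc k < length xs" for k
      using vs(7)[of k] that lx nx[of k] nx[of "Suc k"] by (auto simp: adj_madj madj_def)
    then have "apath xs" by (simp add: successively_conv_nth)
    moreover have "f (hd xs) = f i" using vs(4) fx \<open>xs \<noteq> []\<close> by (metis list.map_sel(1))
    ultimately have "xs \<in> SW i n" using lx by (simp add: SW_def saw_def f_inj)
    moreover have "es \<in> edge_lists xs" unfolding edge_lists_def
    proof (intro CollectI conjI allI impI)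
      fix k assume k: "k < length es"
      then show "es ! k \<in> edges G" "endpoints G (es ! k) = {f (xs ! k), f (xs ! Suc k)}"
        using vs(7)[of k] vs(2) nx[of k] nx[of "Suc k"] by auto
    qed (use vs lx in simp)
    ultimately have "(xs, es) \<in> (SIGMA xs:{xs\<in>SW i n. P (map f xs)}. edge_lists xs)" using vs(6) fx by simp
    then show "w \<in> (\<lambda>(xs, es). (map f xs, es)) ` (SIGMA xs:{xs\<in>SW i n. P (map f xs)}. edge_lists xs)"
      by (rule rev_image_eqI) (simp add: ve fx)
  qed
  show "(\<lambda>(xs, es). (map f xs, es)) ` (SIGMA xs:{xs\<in>SW i n. P (map f xs)}. edge_lists xs) \<subseteq> {w\<in>saws G (f i) n. P (fst w)}"
  proof
    fix w assume "w \<in> (\<lambda>(xs, es). (map f xs, es)) ` (SIGMA xs:{xs\<in>SW i n. P (map f xs)}. edge_lists xs)"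
    then obtain xs es where w: "w = (map f xs, es)" "xs \<in> SW i n" "P (map f xs)" "es \<in> edge_lists xs" by auto
    have x: "length xs = Suc n" "hd xs = i" "distinct xs" "xs \<noteq> []" using w(2) by (auto simp: SW_def saw_def)
    have le: "length es = n" using w(4) x(1) by (simp add: edge_lists_def)
    have e: "es ! k \<in> edges G" "endpoints G (es ! k) = {f (xs ! k), f (xs ! Suc k)}" if "k < n" for k
      using w(4) that le unfolding edge_lists_def by blast+
    have "is_walk G w" unfolding w(1) is_walk_def prod.case
    proof (intro conjI allI impI)
      show "set (map f xs) \<subseteq> verts G" using f_V by auto
      show "set es \<subseteq> edges G" using e(1) le by (auto simp: in_set_conv_nth)
      fix k assume "k < length es"
      then show "endpoints G (es ! k) = {map f xs ! k, map f xs ! Suc k}" using e(2)[of k] le x(1) by simp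
    qed (use le x in simp)
    moreover have "distinct (map f xs)" using x(3) f_inj by (simp add: distinct_map inj_on_def)
    ultimately show "w \<in> {w\<in>saws G (f i) n. P (fst w)}" using w x le by (simp add: saws_def hd_map)
  qed
qed

lemma card_saws: "finite {w\<in>saws G (f i) n. P (fst w)}"
    "real (card {w\<in>saws G (f i) n. P (fst w)}) = (\<Sum>xs\<in>{xs\<in>SW i n. P (map f xs)}. wt xs)"
proof -
  let ?S = "SIGMA xs:{xs\<in>SW i n. P (map f xs)}. edge_lists xs"
  have fS: "finite {xs\<in>SW i n. P (map f xs)}" using finite_SW by simp
  have "inj_on (\<lambda>(xs, es). (map f xs, es)) ?S" using inj_map_eq_map[of f] by (auto simp: inj_on_def inj_def f_inj)
  moreover have "finite ?S" using fS edge_lists by (intro finite_SigmaI) auto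
  ultimately show "finite {w\<in>saws G (f i) n. P (fst w)}"
    "real (card {w\<in>saws G (f i) n. P (fst w)}) = (\<Sum>xs\<in>{xs\<in>SW i n. P (map f xs)}. wt xs)"
    unfolding saws_decompose using fS edge_lists by (auto simp: card_image)
qed

lemma saw_count_c: "real (saw_count G (f i) n) = c n" "finite (saws G (f i) n)"
  using card_saws[of i n "\<lambda>_. True"] by (simp_all add: saw_count_def c_eq)

lemma connective_constant_mu: "connective_constant G (f i) = mu"
  unfolding connective_constant_def mu_def saw_count_c ..

lemma conclusion:
  "(\<exists>C::real. C > 0 \<and> (\<forall>n\<ge>1. connective_constant G (f i) ^ n \<le> real (saw_count G (f i) n) \<and>
      real (saw_count G (f i) n) \<le> C * connective_constant G (f i) ^ n)) \<and>
   (\<exists>c t :: real. c > 0 \<and> t > 0 \<and> (\<forall>n\<ge>1. measure_pmf.prob (saw_pmf G (f i) n)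
      {w. real (graph_dist G (fst w ! 0) (fst w ! n)) \<ge> c * real n} \<ge> 1 - exp (- t * real n)))"
proof
  show "\<exists>C::real. C > 0 \<and> (\<forall>n\<ge>1. connective_constant G (f i) ^ n \<le> real (saw_count G (f i) n) \<and>
      real (saw_count G (f i) n) \<le> C * connective_constant G (f i) ^ n)"
    unfolding connective_constant_mu saw_count_c using asymptotics(1) mu_le by blast
  obtain b t where bt: "b > 0" "t > 0"
    "\<And>n. n \<ge> 1 \<Longrightarrow> (\<Sum>xs\<in>{xs\<in>SW i n. real (d i (last xs)) < b * real n}. wt xs) \<le> exp (- t * real n) * c n"
    using asymptotics(2)[of i] by blast
  have "measure_pmf.prob (saw_pmf G (f i) n) {w. real (graph_dist G (fst w ! 0) (fst w ! n)) \<ge> b * real n} \<ge> 1 - exp (- t * real n)"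
    if n: "n \<ge> 1" for n
  proof -
    let ?A = "saws G (f i) n"
    let ?P = "\<lambda>vs. real (graph_dist G (vs ! 0) (vs ! n)) < b * real n"
    have cA: "real (card ?A) = c n" using saw_count_c(1)[of i n] by (simp add: saw_count_def)
    have c1: "1 \<le> c n" by (rule c_ge1)
    have ne: "?A \<noteq> {}" using cA c1 by (metis card.empty not_one_le_zero of_nat_0)
    have "{xs\<in>SW i n. ?P (map f xs)} = {xs\<in>SW i n. real (d i (last xs)) < b * real n}"
    proof -
      have "graph_dist G (map f xs ! 0) (map f xs ! n) = d i (last xs)" if "xs \<in> SW i n" for xs
      proof -
        have x: "length xs = Suc n" "hd xs = i" "xs \<noteq> []" using that by (auto simp: SW_def)
        have "map f xs ! 0 = f i" "map f xs ! n = f (last xs)" using x by (auto simp: hd_conv_nth last_conv_nth)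
        then show ?thesis by (simp add: graph_dist_d)
      qed
      then show ?thesis by auto
    qed
    then have bad: "real (card {w\<in>?A. ?P (fst w)}) \<le> exp (- t * real n) * c n" using bt(3)[OF n] card_saws(2)[of i n ?P] by simp
    let ?S = "{w. real (graph_dist G (fst w ! 0) (fst w ! n)) \<ge> b * real n}"
    have fin: "finite ?A" by (rule saw_count_c(2))
    have split: "?A = (?A \<inter> ?S) \<union> {w\<in>?A. ?P (fst w)}" "(?A \<inter> ?S) \<inter> {w\<in>?A. ?P (fst w)} = {}" by auto
    have "card ?A = card (?A \<inter> ?S) + card {w\<in>?A. ?P (fst w)}"
      by (subst split(1), rule card_Un_disjoint) (use fin in auto)
    then have "c n \<le> real (card (?A \<inter> ?S)) + exp (- t * real n) * c n" using bad cA by simp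
    then have "(1 - exp (- t * real n)) * c n \<le> real (card (?A \<inter> ?S))" by (simp add: algebra_simps)
    moreover have "measure_pmf.prob (saw_pmf G (f i) n) ?S = real (card (?A \<inter> ?S)) / c n"
      unfolding saw_pmf_def using measure_pmf_of_set[OF ne fin] cA by simp
    ultimately show ?thesis using c1 by (simp add: pos_le_divide_eq)
  qed
  then show "\<exists>c t :: real. c > 0 \<and> t > 0 \<and> (\<forall>n\<ge>1. measure_pmf.prob (saw_pmf G (f i) n)
      {w. real (graph_dist G (fst w ! 0) (fst w ! n)) \<ge> c * real n} \<ge> 1 - exp (- t * real n))"
    using bt(1,2) by blast
qed

end

text \<open>Local finiteness makes the set of vertices reached in \<open>n\<close> steps finite, and
  by connectedness these sets exhaust the graph.\<close>

lemma countable_verts: assumes wf: "wf_multigraph G" and conn: "connected_graph G" and lf: "locally_finite_graph G"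
  shows "countable (verts G)"
proof (cases "verts G = {}")
  case False
  then obtain o1 where o1: "o1 \<in> verts G" by blast
  have "finite {y. (madj G ^^ n) o1 y}" for n
  proof (induction n)
    case (Suc n)
    have "{y. (madj G ^^ Suc n) o1 y} \<subseteq> (\<Union>x\<in>{y. (madj G ^^ n) o1 y}. {y. madj G x y})" by auto
    then show ?case using Suc finite_madj[OF wf lf] by (meson finite_UN_I finite_subset)
  qed simp
  then have "countable (\<Union>n. {y. (madj G ^^ n) o1 y})" by (intro countable_UN) (auto intro: countable_finite)
  moreover have "verts G \<subseteq> (\<Union>n. {y. (madj G ^^ n) o1 y})"
  proof
    fix v assume "v \<in> verts G"
    then have "walks_between G o1 v \<noteq> {}" using conn o1 by (simp add: connected_graph_def)
    then have "(madj G)\<^sup>*\<^sup>* o1 v" using walks_rtranclp[OF wf o1] by blast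
    then show "v \<in> (\<Union>n. {y. (madj G ^^ n) o1 y})" by (simp add: rtranclp_power)
  qed
  ultimately show ?thesis by (rule countable_subset[rotated])
qed simp

lemma infinite_verts: assumes "infinite (graph_ends G)" shows "infinite (verts G)"
proof
  assume fin: "finite (verts G)"
  have "rays G \<noteq> {}" using assms by (auto simp: graph_ends_def)
  then obtain r where r: "r \<in> rays G" by blast
  have "range (fst r) \<subseteq> verts G" using ray_verts(1)[OF r] by auto
  then have "finite (range (fst r))" using fin finite_subset by blast
  then show False using range_inj_infinite[OF ray_verts(2)[OF r]] by blast
qed

theorem theorem1p3:
  fixes G :: "('v, 'e) multigraph" and v :: 'v
  assumes "wf_multigraph G"
    and "connected_graph G"
    and "locally_finite_graph G"
    and "transitive_graph G"
    and "infinite (graph_ends G)"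
    and "v \<in> verts G"
  shows "(\<exists>C::real. C > 0 \<and> (\<forall>n\<ge>1.
            connective_constant G v ^ n \<le> real (saw_count G v n) \<and>
            real (saw_count G v n) \<le> C * connective_constant G v ^ n)) \<and>
         (\<exists>c t :: real. c > 0 \<and> t > 0 \<and> (\<forall>n\<ge>1.
            measure_pmf.prob (saw_pmf G v n)
              {w. real (graph_dist G (fst w ! 0) (fst w ! n)) \<ge> c * real n}
            \<ge> 1 - exp (- t * real n)))"
proof -
  have f: "bij_betw (from_nat_into (verts G)) UNIV (verts G)"
    by (rule bij_betw_from_nat_into[OF countable_verts[OF assms(1-3)] infinite_verts[OF assms(5)]])
  interpret end_graph G "from_nat_into (verts G)"
    by (rule end_graph.intro[OF assms(1-5) f])
  obtain i where "from_nat_into (verts G) i = v" using f_surj[OF assms(6)] by blast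
  then show ?thesis using conclusion[of i] by simp
qed

end
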